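(* Fix constants $\alpha,K,M_0,M>0$. For each $\mathcal J\in\{\mathcal G,\mathcal H\}$, along sequences $(n,d,\rho)$ in the asymptotic regime described in the context, $$ \inf_{\hat\Sigma\in\mathcal M_\rho}\ \sup_{P\in\mathcal P_\alpha^{\mathcal J}}\frac1d\,\mathbb E_P\|\hat\Sigma-\Sigma(P)\|_F^2 \;\asymp_{\log}\; \Bigl(n^{-\frac{2\alpha+1}{2\alpha+2}}\wedge\frac dn\Bigr)+\Bigl(\bigl(\tfrac{d}{\rho n^2}\bigr)^{\frac{2\alpha+1}{2\alpha+3}}\wedge\frac{d^3}{\rho n^2}\Bigr). $$ For $\mathcal J=\mathcal H$, the relation $\asymp_{\log}$ can be strengthened to $\asymp$.
   Context: Norms: $\|\cdot\|_F$ is the Frobenius norm; $a\wedge b=\min(a,b)$. For a random variable $\xi$, $\|\xi\|_{\psi_2}=\inf\{t>0:\mathbb E e^{\xi^2/t^2}\le2\}$; for a random vector $X$, $\|X\|_{\psi_2}=\sup_{\|v\|_2=1}\|\langle X,v\rangle\|_{\psi_2}$. Privacy. Two datasets of $n$ points of $\mathbb R^d$ are adjacent if they differ in one observation. For $\lambda>1$ the R\'enyi divergence of laws $P,Q$ is $D_\lambda(P\|Q)=\frac1{\lambda-1}\log\int(\frac{dP}{dQ})^\lambda dQ$ ($=\infty$ if $P\not\ll Q$). A randomized algorithm $A$ is $\rho$-zCDP if $D_\lambda(A(S)\|A(S'))\le\rho\lambda$ for all adjacent $S,S'$ and all $\lambda\in(1,\infty)$ (divergence over the internal randomness of $A$ only).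 $\mathcal M_\rho$ is the set of all $\rho$-zCDP estimators (random $d\times d$ matrices) based on $n$ observations. Covariance classes. The pointwise-decay class $\mathcal H_\alpha(M_0,M)$ is the set of $d\times d$ covariance matrices with $0\preceq\Sigma\preceq M_0I_d$ and $|\Sigma_{ij}|\le M|i-j|^{-(\alpha+1)}$ for $i\ne j$. The row-tail class $\mathcal G_\alpha(M_0,M)$ is the set of $d\times d$ covariance matrices with $0\preceq\Sigma\preceq M_0I_d$ and $\max_{j}\sum_{i:|i-j|>k}|\Sigma_{ij}|\le Mk^{-\alpha}$ for all $k\ge1$. Model. For $\mathcal J\in\{\mathcal G,\mathcal H\}$, $\mathcal P_\alpha^{\mathcal J}=\mathcal P_\alpha^{\mathcal J}(K,M_0,M)$ is the set of distributions $P$ on $\mathbb R^d$ such that $X\sim P$ with mean $\mu$ and covariance $\Sigma(P)$ satisfies $\|X-\mu\|_{\psi_2}\le K$ and $\Sigma(P)\in\mathcal J_\alpha(M_0,M)$. $\mathbb E_P$ is expectation over $n$ i.i.d. observations from $P$ and over the randomness of the estimator. Asymptotic regime. Statements are along sequences $(n,d,\rho)=(n,d_n,\rho_n)$, $n\to\infty$, with $d\gtrsim\log n$, $0<\rho\lesssim1$ (a fixed upper bound), and $d/(\rho n^2)\to0$. $a\lesssim b$ (equivalently $b\gtrsim a$) means $a\le Cb$ for all sufficiently large $n$, and $a\lesssim_{\log}b$ means $a\le C\log^A(edn/\rho)\,b$ for all sufficiently large $n$, with $C,A>0$ not depending on $n,d,\rho$ (they may depend on $\alpha,K,M_0,M$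 and on the fixed constants in the regime conditions). $\asymp$ and $\asymp_{\log}$ denote the corresponding two-sided relations. *)

theory Defs
  imports "HOL-Probability.Probability"
begin

text \<open>
  The dimension varies along the sequences considered, so R^d and the space of d by d matrices are
  rendered as finite product spaces: a vector is an (extensional) function on the index set
  {..<d}, a matrix an (extensional) function on {..<d} x {..<d}.  Indices start at 0, which does
  not affect any expression in i - j.
\<close>

definition vec_space :: "nat \<Rightarrow> (nat \<Rightarrow> real) measure" where
  "vec_space d = PiM {..<d} (\<lambda>_. borel)"

definition mat_space :: "nat \<Rightarrow> (nat \<times> nat \<Rightarrow> real) measure" where
  "mat_space d = PiM ({..<d} \<times> {..<d}) (\<lambda>_. borel)"

definition data_space :: "nat \<Rightarrow> nat \<Rightarrow> (nat \<Rightarrow> nat \<Rightarrow> real) measure" where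
  "data_space n d = PiM {..<n} (\<lambda>_. vec_space d)"

definition frobenius_norm :: "nat \<Rightarrow> (nat \<times> nat \<Rightarrow> real) \<Rightarrow> real" where
  "frobenius_norm d A = L2_set A ({..<d} \<times> {..<d})"

subsection \<open>Privacy\<close>

text \<open>
  \<open>RN_deriv Q P\<close> is finite Q-almost everywhere for finite P, so passing through
  \<open>enn2real\<close> inside the integral loses nothing.  For probability measures the integral is at
  least 1 by Jensen's inequality, so the real logarithm is applied to a positive number.
\<close>

definition renyi_divergence :: "real \<Rightarrow> 'a measure \<Rightarrow> 'a measure \<Rightarrow> ereal" where
  "renyi_divergence lam P Q =
     (if absolutely_continuous Q P
      then (let I = \<integral>\<^sup>+x. ennreal (enn2real (RN_deriv Q P x) powr lam) \<partial>Q
            in if I = \<infinity> then \<infinity> else ereal (1 / (lam - 1) * ln (enn2real I)))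
      else \<infinity>)"

definition adjacent :: "nat \<Rightarrow> (nat \<Rightarrow> nat \<Rightarrow> real) \<Rightarrow> (nat \<Rightarrow> nat \<Rightarrow> real) \<Rightarrow> bool" where
  "adjacent n S S' \<longleftrightarrow> (\<exists>i<n. S i \<noteq> S' i \<and> (\<forall>j<n. j \<noteq> i \<longrightarrow> S j = S' j))"

text \<open>
  A randomized algorithm is a Markov kernel: it maps a data set to the law of its output, the
  randomness of that law being the internal randomness of the algorithm.
\<close>

definition zCDP ::
    "real \<Rightarrow> nat \<Rightarrow> nat \<Rightarrow> ((nat \<Rightarrow> nat \<Rightarrow> real) \<Rightarrow> 'b measure) \<Rightarrow> bool" where
  "zCDP \<rho> n d A \<longleftrightarrow>
     (\<forall>S\<in>space (data_space n d). \<forall>S'\<in>space (data_space n d). adjacent n S S' \<longrightarrow>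
        (\<forall>lam>1. renyi_divergence lam (A S) (A S') \<le> ereal (\<rho> * lam)))"

definition zCDP_estimators ::
    "nat \<Rightarrow> nat \<Rightarrow> real \<Rightarrow> ((nat \<Rightarrow> nat \<Rightarrow> real) \<Rightarrow> (nat \<times> nat \<Rightarrow> real) measure) set" where
  "zCDP_estimators n d \<rho> =
     {A \<in> data_space n d \<rightarrow>\<^sub>M prob_algebra (mat_space d). zCDP \<rho> n d A}"

subsection \<open>Covariance classes\<close>

definition psd :: "nat \<Rightarrow> (nat \<times> nat \<Rightarrow> real) \<Rightarrow> bool" where
  "psd d A \<longleftrightarrow> (\<forall>i<d. \<forall>j<d. A (i, j) = A (j, i)) \<and>
     (\<forall>v :: nat \<Rightarrow> real. 0 \<le> (\<Sum>i<d. \<Sum>j<d. v i * A (i, j) * v j))"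

definition loewner_le :: "nat \<Rightarrow> (nat \<times> nat \<Rightarrow> real) \<Rightarrow> (nat \<times> nat \<Rightarrow> real) \<Rightarrow> bool" where
  "loewner_le d A B \<longleftrightarrow> psd d (\<lambda>p. B p - A p)"

text \<open>
  The d by d covariance matrices are exactly the symmetric positive semidefinite ones; the
  comparison with 0 below includes symmetry.
\<close>

definition bounded_covariances :: "real \<Rightarrow> nat \<Rightarrow> (nat \<times> nat \<Rightarrow> real) set" where
  "bounded_covariances M0 d = {\<Sigma> \<in> space (mat_space d).
     loewner_le d (\<lambda>_. 0) \<Sigma> \<and> loewner_le d \<Sigma> (\<lambda>(i, j). if i = j then M0 else 0)}"

definition pointwise_class ::
    "real \<Rightarrow> real \<Rightarrow> real \<Rightarrow> nat \<Rightarrow> (nat \<times> nat \<Rightarrow> real) set" where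
  "pointwise_class \<alpha> M0 M d = {\<Sigma> \<in> bounded_covariances M0 d.
     \<forall>i<d. \<forall>j<d. i \<noteq> j \<longrightarrow>
       \<bar>\<Sigma> (i, j)\<bar> \<le> M * \<bar>real i - real j\<bar> powr (- (\<alpha> + 1))}"

definition row_tail_class ::
    "real \<Rightarrow> real \<Rightarrow> real \<Rightarrow> nat \<Rightarrow> (nat \<times> nat \<Rightarrow> real) set" where
  "row_tail_class \<alpha> M0 M d = {\<Sigma> \<in> bounded_covariances M0 d.
     \<forall>k::nat. k \<ge> 1 \<longrightarrow> (\<forall>j<d.
       (\<Sum>i | i < d \<and> \<bar>real i - real j\<bar> > real k. \<bar>\<Sigma> (i, j)\<bar>) \<le> M * real k powr (- \<alpha>))}"

subsection \<open>Model\<close>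

text \<open>The infimum is taken in the extended nonnegative reals; it is \<open>\<infinity>\<close> if no t qualifies.\<close>

definition psi2_norm :: "'a measure \<Rightarrow> ('a \<Rightarrow> real) \<Rightarrow> ennreal" where
  "psi2_norm P \<xi> =
     Inf {ennreal t | t. t > 0 \<and> (\<integral>\<^sup>+x. ennreal (exp ((\<xi> x)\<^sup>2 / t\<^sup>2)) \<partial>P) \<le> 2}"

definition psi2_norm_vec :: "nat \<Rightarrow> 'a measure \<Rightarrow> ('a \<Rightarrow> nat \<Rightarrow> real) \<Rightarrow> ennreal" where
  "psi2_norm_vec d P X =
     (SUP v\<in>{v. L2_set v {..<d} = 1}. psi2_norm P (\<lambda>x. \<Sum>i<d. X x i * v i))"

definition mean_vec :: "(nat \<Rightarrow> real) measure \<Rightarrow> nat \<Rightarrow> real" where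
  "mean_vec P i = (\<integral>x. x i \<partial>P)"

definition cov_mat :: "nat \<Rightarrow> (nat \<Rightarrow> real) measure \<Rightarrow> nat \<times> nat \<Rightarrow> real" where
  "cov_mat d P = (\<lambda>(i, j)\<in>{..<d} \<times> {..<d}.
     \<integral>x. (x i - mean_vec P i) * (x j - mean_vec P j) \<partial>P)"

text \<open>
  Integrability of the squared coordinates makes the mean and the covariance meaningful.  (It is
  implied by the bound on the psi_2 norm.)
\<close>

definition dist_class ::
    "(real \<Rightarrow> real \<Rightarrow> real \<Rightarrow> nat \<Rightarrow> (nat \<times> nat \<Rightarrow> real) set) \<Rightarrow>
     real \<Rightarrow> real \<Rightarrow> real \<Rightarrow> real \<Rightarrow> nat \<Rightarrow> (nat \<Rightarrow> real) measure set" where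
  "dist_class \<J> \<alpha> K M0 M d = {P \<in> space (prob_algebra (vec_space d)).
     (\<forall>i<d. integrable P (\<lambda>x. (x i)\<^sup>2)) \<and>
     psi2_norm_vec d P (\<lambda>x i. x i - mean_vec P i) \<le> ennreal K \<and>
     cov_mat d P \<in> \<J> \<alpha> M0 M d}"

definition frobenius_risk ::
    "nat \<Rightarrow> nat \<Rightarrow> ((nat \<Rightarrow> nat \<Rightarrow> real) \<Rightarrow> (nat \<times> nat \<Rightarrow> real) measure) \<Rightarrow>
     (nat \<Rightarrow> real) measure \<Rightarrow> ennreal" where
  "frobenius_risk n d A P =
     (\<integral>\<^sup>+S. (\<integral>\<^sup>+T. ennreal ((frobenius_norm d (\<lambda>p. T p - cov_mat d P p))\<^sup>2) \<partial>A S)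
        \<partial>PiM {..<n} (\<lambda>_. P))"

definition minimax_risk ::
    "(real \<Rightarrow> real \<Rightarrow> real \<Rightarrow> nat \<Rightarrow> (nat \<times> nat \<Rightarrow> real) set) \<Rightarrow>
     real \<Rightarrow> real \<Rightarrow> real \<Rightarrow> real \<Rightarrow> nat \<Rightarrow> nat \<Rightarrow> real \<Rightarrow> ennreal" where
  "minimax_risk \<J> \<alpha> K M0 M n d \<rho> =
     (INF A\<in>zCDP_estimators n d \<rho>. SUP P\<in>dist_class \<J> \<alpha> K M0 M d.
        ennreal (1 / real d) * frobenius_risk n d A P)"

subsection \<open>Asymptotic regime\<close>

text \<open>The parameters c and R are the fixed constants in d >= c log n and rho <= R.\<close>

definition regime :: "real \<Rightarrow> real \<Rightarrow> (nat \<Rightarrow> nat) \<Rightarrow> (nat \<Rightarrow> real) \<Rightarrow> bool" where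
  "regime c R d \<rho> \<longleftrightarrow>
     (\<forall>\<^sub>F n in sequentially. c * ln (real n) \<le> real (d n)) \<and>
     (\<forall>\<^sub>F n in sequentially. 0 < \<rho> n \<and> \<rho> n \<le> R) \<and>
     (\<lambda>n. real (d n) / (\<rho> n * (real n)\<^sup>2)) \<longlonglongrightarrow> 0"

text \<open>
  The constants are chosen before the sequences, so they depend on c and R (and on the parameters
  hidden in a and b) only; the threshold on n may depend on the sequences.
\<close>

definition lesssim ::
    "real \<Rightarrow> real \<Rightarrow> (nat \<Rightarrow> nat \<Rightarrow> real \<Rightarrow> ennreal) \<Rightarrow> (nat \<Rightarrow> nat \<Rightarrow> real \<Rightarrow> ennreal) \<Rightarrow> bool" where
  "lesssim c R a b \<longleftrightarrow>
     (\<exists>C>0. \<forall>d \<rho>. regime c R d \<rho> \<longrightarrow>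
        (\<forall>\<^sub>F n in sequentially. a n (d n) (\<rho> n) \<le> ennreal C * b n (d n) (\<rho> n)))"

definition lesssim_log ::
    "real \<Rightarrow> real \<Rightarrow> (nat \<Rightarrow> nat \<Rightarrow> real \<Rightarrow> ennreal) \<Rightarrow> (nat \<Rightarrow> nat \<Rightarrow> real \<Rightarrow> ennreal) \<Rightarrow> bool" where
  "lesssim_log c R a b \<longleftrightarrow>
     (\<exists>C>0. \<exists>A>0. \<forall>d \<rho>. regime c R d \<rho> \<longrightarrow>
        (\<forall>\<^sub>F n in sequentially. a n (d n) (\<rho> n) \<le>
           ennreal (C * ln (exp 1 * real (d n) * real n / \<rho> n) powr A) * b n (d n) (\<rho> n)))"

definition asymp_eq ::
    "real \<Rightarrow> real \<Rightarrow> (nat \<Rightarrow> nat \<Rightarrow> real \<Rightarrow> ennreal) \<Rightarrow> (nat \<Rightarrow> nat \<Rightarrow> real \<Rightarrow> ennreal) \<Rightarrow> bool" where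
  "asymp_eq c R a b \<longleftrightarrow> lesssim c R a b \<and> lesssim c R b a"

definition asymp_eq_log ::
    "real \<Rightarrow> real \<Rightarrow> (nat \<Rightarrow> nat \<Rightarrow> real \<Rightarrow> ennreal) \<Rightarrow> (nat \<Rightarrow> nat \<Rightarrow> real \<Rightarrow> ennreal) \<Rightarrow> bool" where
  "asymp_eq_log c R a b \<longleftrightarrow> lesssim_log c R a b \<and> lesssim_log c R b a"

definition minimax_rate :: "real \<Rightarrow> nat \<Rightarrow> nat \<Rightarrow> real \<Rightarrow> ennreal" where
  "minimax_rate \<alpha> n d \<rho> = ennreal (
     min (real n powr (- ((2 * \<alpha> + 1) / (2 * \<alpha> + 2)))) (real d / real n) +
     min ((real d / (\<rho> * (real n)\<^sup>2)) powr ((2 * \<alpha> + 1) / (2 * \<alpha> + 3)))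
         (real d ^ 3 / (\<rho> * (real n)\<^sup>2)))"

end

theory Submission
 imports Defs "HOL-Probability.Probability"
begin

text \<open>
 \<^bold>\<open>Lower bound.\<close> Split the coordinates into blocks of length \<open>2 * k\<close>, one half of each block being a set of
 free coordinates and the other half a set of driven ones.  In a vector of signs the free
 coordinates are independent and uniform, and a driven coordinate has conditional mean
 \<open>\<delta> * (\<Sum>c. \<theta> (a, c) * x c)\<close> over the free coordinates of its block.  The covariance of a driven and a free coordinate
 of the same block is then \<open>\<delta> * \<theta> (a, c)\<close>, all the covariances are at most \<open>\<delta>\<close> and vanish
 outside the blocks, so a multiple of \<open>k powr (- (\<alpha> + 1))\<close> is admissible for \<open>\<delta>\<close> in both
 classes.  An estimator of the covariance matrix therefore has to estimate about \<open>d * k\<close> parameters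
 \<open>\<theta> j\<close> in \<open>{-1..1}\<close>.  Let these be independent with a smooth prior.  The van Trees identity
 (\<open>exists_hard_parameter\<close>) says that an accurate estimator is correlated with the score of the
 sample, and this correlation is limited in two ways.  By the Fisher information it is at most
 of order \<open>sqrt (n * \<delta>^2 * loss)\<close> per parameter (\<open>statistical_lower_bound\<close>), which forces a constant loss
 when \<open>k\<close> is of order \<open>n powr (1 / (2 * \<alpha> + 2))\<close>.  By privacy, replacing one observation by an independent copy
 makes its score uncorrelated with the output and changes the law of the output little
 (\<open>private_lower_bound\<close>), which forces a constant loss when \<open>k\<close> is of order
 \<open>(\<rho> * n^2 / d) powr (1 / (2 * \<alpha> + 3))\<close>.  Cutting \<open>k\<close> off at \<open>d\<close> gives the two minima of the rate
 (\<open>minimax_lower_bound\<close>).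

 \<^bold>\<open>Upper bound.\<close> Differences of paired observations are centred, independent and subgaussian, and
 their second moments are the covariances.  Cut the coordinates into blocks of length \<open>k\<close>.  On the
 block tridiagonal band, truncate an observation wherever a block is longer than a multiple of
 \<open>sqrt k\<close>, average the products, and add Gaussian noise.  The truncated products have
 squared length of order \<open>k * d\<close> on the band, so the noise has variance of order \<open>k * d / (\<rho> * n^2)\<close> per
 entry, and the band costs \<open>k / n + k^2 * d / (\<rho> * n^2)\<close> per row.  For the pointwise class zero is good enough off
 the band: the squares of the entries of a row sum to a multiple of \<open>k powr (- (2 * \<alpha> + 1))\<close>, and the best \<open>k\<close> gives
 the rate without logarithms.  For the row-tail class such a sum may be of order \<open>k powr (- 2 * \<alpha>)\<close>, which is too
 much.  But the off-band part of a row lies in an \<open>l1\<close> ball of radius of order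
 \<open>r = k powr (- \<alpha>)\<close>, and \<open>k\<close> steps of the Frank-Wolfe algorithm, the vertex in each step being drawn by the
 exponential mechanism, reach a squared error of order \<open>r^2 / k + r * e\<close>, where \<open>e\<close> is the uniform error of
 the estimated row plus the loss of the exponential mechanism (\<open>frank_wolfe_risk\<close>).  With the same \<open>k\<close>
 this is \<open>k powr (- (2 * \<alpha> + 1))\<close> up to two logarithms.  The privacy of the whole estimator is seen on
 the joint law of the noise and of the chosen vertices, which has an explicit density; the matrix is a function
 of these, and applying a function does not increase a Renyi divergence
 (\<open>renyi_divergence_le_of_moment\<close>).
\<close>

section \<open>Renyi divergences\<close>

text \<open>
 Young's inequality for the exponents \<open>lam / (lam - 1)\<close> and \<open>lam\<close>, tilted by the density \<open>q\<close>.  Integrated, it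
 bounds a mixed moment of \<open>u\<close> and \<open>p\<close> by the moments of order \<open>lam\<close>, which replaces a
 conditional Jensen inequality in the next lemma.
\<close>

lemma young_tilt:
 fixes u p q lam :: real
 assumes "lam > 1" "u \<ge> 0" "p > 0" "q > 0"
 shows "u powr (lam - 1) * p \<le> (1 - 1 / lam) * (u powr lam * q) + (1 / lam) * (p powr lam * q powr (1 - lam))"
proof -
 have "u powr (lam - 1) * (p / q) \<le> (1 - 1 / lam) * (u powr lam) + (1 / lam) * ((p / q) powr lam)"
 proof (cases "u = 0")
  case True
  then show ?thesis using assms by simp
 next
  case False
  then have "(u powr lam) powr (1 - 1 / lam) * ((p / q) powr lam) powr (1 / lam)
    \<le> (1 - 1 / lam) * (u powr lam) + (1 / lam) * ((p / q) powr lam)"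
   using assms by (intro Youngs_inequality_0) auto
  moreover have "lam * (1 - 1 / lam) = lam - 1" using assms by (simp add: field_simps)
  ultimately show ?thesis using assms by (simp add: powr_powr)
 qed
 from mult_right_mono[OF this, of q]
 have "u powr (lam - 1) * p \<le> ((1 - 1 / lam) * (u powr lam) + (1 / lam) * ((p / q) powr lam)) * q"
  using assms by simp
 also have "(p / q) powr lam * q = p powr lam * q powr (1 - lam)"
  using assms by (simp add: powr_divide powr_diff)
 then have "((1 - 1 / lam) * (u powr lam) + (1 / lam) * ((p / q) powr lam)) * q
   = (1 - 1 / lam) * (u powr lam * q) + (1 / lam) * (p powr lam * q powr (1 - lam))"
  by (simp add: algebra_simps)
 finally show ?thesis .
qed

text \<open>
 The integral in the Renyi divergence of order \<open>lam\<close> of the laws with densities \<open>p\<close> and \<open>q\<close> with respect to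
 \<open>\<mu>\<close>; its logarithm is \<open>lam - 1\<close> times the divergence.
\<close>

definition renyi_moment :: "'a measure => real => ('a => real) => ('a => real) => ennreal" where
 "renyi_moment \<mu> lam p q = (\<integral>\<^sup>+x. ennreal (p x powr lam * q x powr (1 - lam)) \<partial>\<mu>)"

text \<open>
 With \<open>t\<close> the truncated density ratio, the moment \<open>X\<close> on the left is at most the integral of
 \<open>t powr (lam - 1)\<close> with respect to \<open>P\<close>, which Young's inequality on the source space bounds by
 \<open>(1 - 1 / lam) * X\<close> plus \<open>1 / lam\<close> times the moment on the right.  The truncation
 makes \<open>X\<close> finite, so that \<open>X\<close> can be absorbed.
\<close>

lemma truncated_moment_postprocess:
 assumes [measurable]: "p \<in> borel_measurable \<mu>" "q \<in> borel_measurable \<mu>" "f \<in> \<mu> \<rightarrow>\<^sub>M M'"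
  and pos: "\<And>x. x \<in> space \<mu> ==> 0 < p x" "\<And>x. x \<in> space \<mu> ==> 0 < q x"
  and lam: "lam > 1"
  and P: "P = distr (density \<mu> p) M' f" and Q: "Q = distr (density \<mu> q) M' f"
  and prob: "prob_space P" "prob_space Q"
  and r[measurable]: "r \<in> borel_measurable M'" and r0: "\<And>x. r x \<ge> 0"
  and dens: "density Q (\<lambda>x. ennreal (r x)) = P"
  and N: "N \<ge> 0"
 shows "(\<integral>\<^sup>+x. ennreal (min (r x) N powr lam) \<partial>Q) \<le> renyi_moment \<mu> lam p q"
proof -
 define t where "t x = min (r x) N" for x
 have [measurable]: "t \<in> borel_measurable M'" unfolding t_def by measurable
 have t: "0 \<le> t x" "t x \<le> r x" "t x \<le> N" for x using r0[of x] N by (auto simp: t_def)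
 have sQ[measurable_cong]: "sets Q = sets M'" and sP: "sets P = sets M'" by (auto simp: P Q)
 have lam1: "0 \<le> 1 - 1 / lam" using lam by simp
 interpret Q: prob_space Q by fact
 define X where "X = (\<integral>\<^sup>+x. ennreal (t x powr lam) \<partial>Q)"
 have Xq: "X = (\<integral>\<^sup>+x. ennreal (t (f x) powr lam * q x) \<partial>\<mu>)"
  unfolding X_def Q using pos
  by (subst nn_integral_distr) (auto simp: nn_integral_density ennreal_mult' less_imp_le mult.commute intro!: nn_integral_cong)
 have "X \<le> (\<integral>\<^sup>+x. ennreal (N powr lam) \<partial>Q)" unfolding X_def
  using t lam by (intro nn_integral_mono ennreal_leI powr_mono2) auto
 also have "... < \<infinity>" by (simp add: Q.emeasure_space_1 )
 finally have Xfin: "X < \<infinity>" .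
 have "X \<le> (\<integral>\<^sup>+x. ennreal (r x) * ennreal (t x powr (lam - 1)) \<partial>Q)"
 proof (unfold X_def, rule nn_integral_mono)
  fix x
  have "t x powr lam = t x powr (lam - 1) * t x"
   using t(1)[of x] by (cases "t x = 0") (auto simp: powr_diff)
  also have "... \<le> t x powr (lam - 1) * r x" using t by (intro mult_left_mono) auto
  finally show "ennreal (t x powr lam) \<le> ennreal (r x) * ennreal (t x powr (lam - 1))"
   using r0 by (subst ennreal_mult[symmetric]) (auto intro!: ennreal_leI simp: mult.commute)
 qed
 also have "... = (\<integral>\<^sup>+x. ennreal (t x powr (lam - 1)) \<partial>P)"
  unfolding dens[symmetric] by (subst nn_integral_density) auto
 also have "... = (\<integral>\<^sup>+x. ennreal (p x) * ennreal (t (f x) powr (lam - 1)) \<partial>\<mu>)"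
  unfolding P by (subst nn_integral_distr, measurable, subst nn_integral_density) auto
 also have "... \<le> (\<integral>\<^sup>+x. ennreal (1 - 1 / lam) * ennreal (t (f x) powr lam * q x)
   + ennreal (1 / lam) * ennreal (p x powr lam * q x powr (1 - lam)) \<partial>\<mu>)"
 proof (rule nn_integral_mono)
  fix x assume x: "x \<in> space \<mu>"
  have "ennreal (p x) * ennreal (t (f x) powr (lam - 1)) = ennreal (t (f x) powr (lam - 1) * p x)"
   using pos(1)[OF x] by (subst ennreal_mult[symmetric]) (auto simp: mult.commute)
  also have "... \<le> ennreal ((1 - 1 / lam) * (t (f x) powr lam * q x) + (1 / lam) * (p x powr lam * q x powr (1 - lam)))"
   using young_tilt[OF lam t(1) pos(1)[OF x] pos(2)[OF x]] by (rule ennreal_leI)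
  also have "... = ennreal (1 - 1 / lam) * ennreal (t (f x) powr lam * q x)
   + ennreal (1 / lam) * ennreal (p x powr lam * q x powr (1 - lam))"
  proof -
   have "0 \<le> (1 - 1 / lam) * (t (f x) powr lam * q x)" "0 \<le> 1 / lam * (p x powr lam * q x powr (1 - lam))"
    using lam pos(2)[OF x] lam1 by (auto intro!: mult_nonneg_nonneg)
   moreover have "0 \<le> 1 / lam" using lam by simp
   ultimately show ?thesis by (simp only: ennreal_plus ennreal_mult'[OF lam1] ennreal_mult'[OF \<open>0 \<le> 1 / lam\<close>])
  qed
  finally show "ennreal (p x) * ennreal (t (f x) powr (lam - 1)) \<le> ..." .
 qed
 also have "... = ennreal (1 - 1 / lam) * X + ennreal (1 / lam) * renyi_moment \<mu> lam p q"
  unfolding Xq renyi_moment_def by (subst nn_integral_add) (auto simp: nn_integral_cmult)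
 finally have main: "X \<le> ennreal (1 - 1 / lam) * X + ennreal (1 / lam) * renyi_moment \<mu> lam p q" .
 show ?thesis
 proof (cases "renyi_moment \<mu> lam p q = \<infinity>")
  case False
  obtain x where x: "X = ennreal x" "x \<ge> 0" using Xfin by (cases X) auto
  obtain m where m: "renyi_moment \<mu> lam p q = ennreal m" "m \<ge> 0" using False by (cases "renyi_moment \<mu> lam p q") auto
  have "ennreal x \<le> ennreal ((1 - 1 / lam) * x + (1 / lam) * m)"
  proof -
   have l: "0 \<le> 1 / lam" using lam by simp
   show ?thesis
    using main lam1 l x(2) m(2)
    by (subst ennreal_plus) (auto simp only: x(1) m(1) ennreal_mult'[OF lam1] ennreal_mult'[OF l] mult_nonneg_nonneg)
  qed
  then have "x \<le> (1 - 1 / lam) * x + (1 / lam) * m"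
   using x m lam by (subst (asm) ennreal_le_iff) (auto intro!: add_nonneg_nonneg mult_nonneg_nonneg)
  then have "x \<le> m" using lam by (simp add: field_simps)
  then show ?thesis using x m by (simp add: X_def[symmetric] t_def[symmetric] ennreal_leI)
 qed auto
qed

text \<open>
 Post-processing: the divergence of the images under \<open>f\<close> is controlled by the densities before \<open>f\<close>
 is applied.  This form of the data processing inequality suits mechanisms whose internal randomness has an
 explicit density.
\<close>

lemma renyi_divergence_le_of_moment:
 assumes [measurable]: "p \<in> borel_measurable \<mu>" "q \<in> borel_measurable \<mu>" "f \<in> \<mu> \<rightarrow>\<^sub>M M'"
  and pos: "\<And>x. x \<in> space \<mu> ==> 0 < p x" "\<And>x. x \<in> space \<mu> ==> 0 < q x"
  and lam: "lam > 1" and c: "c \<ge> 0"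
  and P: "P = distr (density \<mu> p) M' f" and Q: "Q = distr (density \<mu> q) M' f"
  and prob: "prob_space P" "prob_space Q"
  and mom: "renyi_moment \<mu> lam p q \<le> ennreal (exp ((lam - 1) * c))"
 shows "renyi_divergence lam P Q \<le> ereal c"
proof -
 have sQ[measurable_cong]: "sets Q = sets M'" and sP[measurable_cong]: "sets P = sets M'" by (auto simp: P Q)
 interpret P: prob_space P by fact
 interpret Q: prob_space Q by fact
 have ac: "absolutely_continuous Q P"
  unfolding absolutely_continuous_def
 proof safe
  fix A assume A: "A \<in> null_sets Q"
  then have [measurable]: "A \<in> sets M'" by (auto simp: null_sets_def sQ)
  have "0 = (\<integral>\<^sup>+x. ennreal (q x) * indicator (f -` A \<inter> space \<mu>) x \<partial>\<mu>)"
   using A by (auto simp: null_sets_def Q emeasure_distr emeasure_density)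
  then have "AE x in \<mu>. ennreal (q x) * indicator (f -` A \<inter> space \<mu>) x = 0"
   by (subst (asm) eq_commute, subst (asm) nn_integral_0_iff_AE) auto
  then have "AE x in \<mu>. ennreal (p x) * indicator (f -` A \<inter> space \<mu>) x = 0"
   using AE_space by eventually_elim (use pos in \<open>force simp: indicator_def split: if_splits\<close>)
  then have "(\<integral>\<^sup>+x. ennreal (p x) * indicator (f -` A \<inter> space \<mu>) x \<partial>\<mu>) = 0"
   by (subst nn_integral_0_iff_AE) auto
  then show "A \<in> null_sets P"
   by (auto simp: null_sets_def P emeasure_distr emeasure_density)
 qed
 have sets_eq: "sets P = sets Q" by (simp add: sP sQ)
 define r where "r x = enn2real (RN_deriv Q P x)" for x
 have [measurable]: "r \<in> borel_measurable M'"
  unfolding r_def using borel_measurable_RN_deriv[of Q P] by (measurable)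
 have r0: "r x \<ge> 0" for x by (simp add: r_def)
 have fin: "AE x in Q. RN_deriv Q P x \<noteq> \<infinity>"
  using Q.RN_deriv_finite[OF _ ac sets_eq] P.sigma_finite_measure_axioms by simp
 have dens: "density Q (\<lambda>x. ennreal (r x)) = P"
 proof -
  have "density Q (\<lambda>x. ennreal (r x)) = density Q (RN_deriv Q P)"
  proof (rule density_cong)
   show "AE x in Q. ennreal (r x) = RN_deriv Q P x"
    using fin by eventually_elim (auto simp: r_def less_top)
  qed auto
  then show ?thesis using Q.density_RN_deriv[OF ac sets_eq] by simp
 qed
 define I where "I = (\<integral>\<^sup>+x. ennreal (r x powr lam) \<partial>Q)"
 have "I = (\<integral>\<^sup>+x. liminf (\<lambda>N. ennreal (min (r x) (real N) powr lam)) \<partial>Q)"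
  unfolding I_def
 proof (rule nn_integral_cong)
  fix x
  obtain N0 :: nat where N0: "r x \<le> real N0" using real_arch_simple by blast
  have "(\<lambda>N. ennreal (min (r x) (real N) powr lam)) \<longlonglongrightarrow> ennreal (r x powr lam)"
   by (rule tendsto_eventually, rule eventually_sequentiallyI[of N0]) (use N0 in \<open>auto simp: min_def\<close>)
  then show "ennreal (r x powr lam) = liminf (\<lambda>N. ennreal (min (r x) (real N) powr lam))"
   by (rule lim_imp_Liminf[symmetric, OF trivial_limit_sequentially])
 qed
 also have "... \<le> liminf (\<lambda>N. \<integral>\<^sup>+x. ennreal (min (r x) (real N) powr lam) \<partial>Q)"
  by (rule nn_integral_liminf) auto
 also have "... \<le> liminf (\<lambda>N::nat. renyi_moment \<mu> lam p q)"
  by (intro Liminf_mono always_eventually allI truncated_moment_postprocess[OF _ _ _ pos lam P Q prob _ r0 dens]) auto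
 also have "... \<le> ennreal (exp ((lam - 1) * c))" using mom by (simp add: Liminf_const)
 finally have I: "I \<le> ennreal (exp ((lam - 1) * c))" .
 then have Ifin: "I \<noteq> \<infinity>" by (auto simp: top_unique)
 then obtain y where y: "I = ennreal y" "y \<ge> 0" by (cases I) auto
 have "1 / (lam - 1) * ln y \<le> c"
 proof (cases "y = 0")
  case False
  then have "ln y \<le> (lam - 1) * c"
   using I y ln_le_cancel_iff[of y "exp ((lam - 1) * c)"] by simp
  then show ?thesis using lam by (simp add: field_simps)
 qed (use c in simp)
 then show ?thesis
  unfolding renyi_divergence_def Let_def using ac Ifin y by (simp add: r_def[symmetric] I_def[symmetric])
qed

text \<open>
 With \<open>r\<close> the density of \<open>P\<close>, the left side is the integral of \<open>(r - 1) * f\<close> under \<open>Q\<close>, and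
 \<open>(r - 1) * f \<le> \<beta> / 2 * (r - 1)^2 + f^2 / (2 * \<beta>)\<close>; the divergence of order 2 bounds the
 chi-square distance, which is the integral of \<open>(r - 1)^2\<close>.
\<close>

lemma renyi2_expectation_diff:
 assumes prob: "prob_space P" "prob_space Q" and sets_eq: "sets P = sets Q"
  and div: "renyi_divergence 2 P Q \<le> ereal c"
  and f[measurable]: "f \<in> borel_measurable Q" and bnd: "\<And>x. \<bar>f x\<bar> \<le> B" and b: "\<beta> > 0"
 shows "(\<integral>x. f x \<partial>P) - (\<integral>x. f x \<partial>Q) \<le> (exp c - 1) * \<beta> / 2 + (\<integral>x. (f x)^2 \<partial>Q) / (2 * \<beta>)"
proof -
 interpret P: prob_space P by fact
 interpret Q: prob_space Q by fact
 have ac: "absolutely_continuous Q P"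
  using div by (auto simp: renyi_divergence_def split: if_splits)
 define r where "r x = enn2real (RN_deriv Q P x)" for x
 have [measurable]: "r \<in> borel_measurable Q" unfolding r_def by measurable
 have r0: "r x \<ge> 0" for x by (simp add: r_def)
 have sfP: "sigma_finite_measure P" by (simp add: P.sigma_finite_measure_axioms)
 note RN = Q.RN_deriv_integrable[OF sfP ac sets_eq, folded r_def] Q.RN_deriv_integral[OF sfP ac sets_eq, folded r_def]
 define I where "I = (\<integral>\<^sup>+x. ennreal ((r x)^2) \<partial>Q)"
 have pw: "r x powr 2 = (r x)^2" for x using r0[of x] by (cases "r x = 0") auto
 have Ifin: "I \<noteq> \<infinity>" and lnI: "ln (enn2real I) \<le> c"
  using div ac by (auto simp: renyi_divergence_def Let_def r_def[symmetric] pw I_def split: if_splits)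
 obtain y where y: "I = ennreal y" "y \<ge> 0" using Ifin by (cases I) auto
 have yc: "y \<le> exp c"
 proof (cases "y = 0")
  case False
  then show ?thesis using lnI y ln_le_cancel_iff[of y "exp c"] by simp
 qed auto
 have int_r2: "integrable Q (\<lambda>x. (r x)^2)"
  by (rule integrableI_bounded) (use y in \<open>auto simp: I_def\<close>)
 have "integrable P (\<lambda>x. 1::real)" by simp
 then have int_r: "integrable Q r" using RN(1)[of "\<lambda>x. 1"] by simp
 have r1: "(\<integral>x. r x \<partial>Q) = 1" using RN(2)[of "\<lambda>x. 1"] by (simp add: P.prob_space)
 have r2: "(\<integral>x. (r x)^2 \<partial>Q) \<le> exp c"
  using yc y integral_eq_nn_integral[of "\<lambda>x. (r x)^2" Q] by (simp add: I_def)
 have int_f: "integrable Q f"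
  by (rule Q.integrable_const_bound[where B=B]) (use bnd in auto)
 have int_f2: "integrable Q (\<lambda>x. (f x)^2)"
  by (rule Q.integrable_const_bound[where B="B^2"]) (use bnd in \<open>auto simp: abs_le_square_iff intro!: AE_I2\<close>,
   metis abs_ge_zero bnd order_trans abs_of_nonneg abs_le_square_iff power2_abs)
 have int_fP: "integrable P f"
  by (rule P.integrable_const_bound[where B=B]) (use bnd in \<open>auto simp: measurable_cong_sets[OF sets_eq refl]\<close>)
 have int_rf: "integrable Q (\<lambda>x. r x * f x)" using RN(1)[of f] int_fP by simp
 have "(\<integral>x. f x \<partial>P) - (\<integral>x. f x \<partial>Q) = (\<integral>x. r x * f x - f x \<partial>Q)"
  using RN(2)[of f] int_rf int_f by simp
 also have "... \<le> (\<integral>x. ((r x)^2 - 2 * r x + 1) * (\<beta> / 2) + (f x)^2 * (1 / (2 * \<beta>)) \<partial>Q)"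
 proof (rule integral_mono)
  show "integrable Q (\<lambda>x. r x * f x - f x)" using int_rf int_f by simp
  show "integrable Q (\<lambda>x. ((r x)^2 - 2 * r x + 1) * (\<beta> / 2) + (f x)^2 * (1 / (2 * \<beta>)))"
   using int_r int_r2 int_f2 by simp
  fix x
  have "0 \<le> (\<beta> * (r x - 1) - f x)^2 / (2 * \<beta>)" using b by simp
  also have "... = ((r x)^2 - 2 * r x + 1) * (\<beta> / 2) + (f x)^2 * (1 / (2 * \<beta>)) - (r x * f x - f x)"
   using b by (simp add: power2_eq_square field_simps)
  finally show "r x * f x - f x \<le> ((r x)^2 - 2 * r x + 1) * (\<beta> / 2) + (f x)^2 * (1 / (2 * \<beta>))" by simp
 qed
 also have "... = ((\<integral>x. (r x)^2 \<partial>Q) - 1) * (\<beta> / 2) + (\<integral>x. (f x)^2 \<partial>Q) / (2 * \<beta>)"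
  using int_r int_r2 int_f2 r1 by (simp add: Q.prob_space)
 also have "... \<le> (exp c - 1) * (\<beta> / 2) + (\<integral>x. (f x)^2 \<partial>Q) / (2 * \<beta>)"
  using r2 b by (intro add_mono mult_right_mono) auto
 finally show ?thesis by simp
qed

section \<open>A smooth prior on the interval from -1 to 1\<close>

text \<open>
 The biweight kernel.  It vanishes to second order at the endpoints, so integration by parts leaves no
 boundary terms and the score has a finite second moment.
\<close>

definition prior_density :: "real => real" where
 "prior_density t = indicator {-1..1} t * (15 / 16 * (1 - t^2)^2)"

definition prior :: "real measure" where
 "prior = density lborel (\<lambda>t. ennreal (prior_density t))"

text \<open>
 The logarithmic derivative of the density.
\<close>

definition prior_score :: "real => real" where
 "prior_score t = - 4 * t / (1 - t^2)"

lemma prior_density_measurable [measurable]: "prior_density \<in> borel_measurable borel"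
 unfolding prior_density_def by measurable

lemma prior_score_measurable [measurable]: "prior_score \<in> borel_measurable borel"
 unfolding prior_score_def by measurable

lemma prior_density_nonneg: "prior_density t \<ge> 0"
 by (simp add: prior_density_def indicator_def)

lemma sets_prior [simp, measurable_cong]: "sets prior = sets borel"
 by (simp add: prior_def)

lemma space_prior [simp]: "space prior = UNIV"
 by (simp add: prior_def)

text \<open>
 The fundamental theorem of calculus for integrals against the prior, whose density is a polynomial
 on its support.
\<close>

lemma has_bochner_integral_prior:
 fixes f :: "real => real"
 assumes [measurable]: "f \<in> borel_measurable borel"
  and deriv: "\<And>x. -1 \<le> x ==> x \<le> 1 ==> DERIV F x :> g x"
  and cont: "\<And>x. -1 \<le> x ==> x \<le> 1 ==> isCont g x"
  and eq: "\<And>x. -1 \<le> x ==> x \<le> 1 ==> f x * (15 / 16 * (1 - x^2)^2) = g x"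
 shows "has_bochner_integral prior f (F 1 - F (-1))"
proof -
 have "has_bochner_integral lborel (\<lambda>x. g x * indicator {-1..1} x) (F 1 - F (-1))"
  by (rule has_bochner_integral_FTC_Icc_real[OF _ deriv cont]) auto
 also have "(\<lambda>x. g x * indicator {-1..1} x) = (\<lambda>x. prior_density x *\<^sub>R f x)"
  using eq by (auto simp: prior_density_def indicator_def fun_eq_iff mult.commute)
 finally show ?thesis
  unfolding prior_def
  by (intro has_bochner_integral_density) (auto simp: prior_density_nonneg)
qed

lemma prob_space_prior: "prob_space prior"
proof (rule prob_spaceI)
 let ?F = "\<lambda>t::real. 15 / 16 * (t - 2 * t ^ 3 / 3 + t ^ 5 / 5)"
 have "has_bochner_integral prior (\<lambda>_. 1::real) (?F 1 - ?F (-1))"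
 proof (rule has_bochner_integral_prior[where g = "\<lambda>x. 15 / 16 * (1 - x^2)^2"])
  fix x :: real
  show "DERIV ?F x :> 15 / 16 * (1 - x^2)^2"
   by (rule derivative_eq_intros refl | simp)+ (simp add: power2_eq_square algebra_simps eval_nat_numeral)
 qed (auto intro!: continuous_intros)
 then have hb: "has_bochner_integral prior (\<lambda>_. 1) (1::real)" by simp
 have "emeasure prior (space prior) = (\<integral>\<^sup>+x. ennreal 1 \<partial>prior)" by simp
 also have "... = ennreal (\<integral>x. 1 \<partial>prior)"
  using hb by (intro nn_integral_eq_integral) (auto simp: has_bochner_integral_iff)
 also have "... = 1" using hb by (simp add: has_bochner_integral_iff)
 finally show "emeasure prior (space prior) = 1" .
qed

lemma AE_prior: "AE t in prior. \<bar>t\<bar> < 1"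
proof -
 have "AE t in lborel. t \<noteq> 1 \<and> t \<noteq> (-1::real)"
  using AE_lborel_singleton[of 1] AE_lborel_singleton[of "-1::real"] by eventually_elim auto
 then have "AE t in lborel. 0 < ennreal (prior_density t) \<longrightarrow> \<bar>t\<bar> < 1"
  by eventually_elim (auto simp: prior_density_def indicator_def split: if_splits)
 then show ?thesis unfolding prior_def by (subst AE_density) auto
qed

lemma prior_score_times_density:
 assumes "-1 \<le> t" "t \<le> 1"
 shows "prior_score t * (15 / 16 * (1 - t^2)^2) = 15 / 16 * (2 * (1 - t^2) * (- 2 * t))"
proof (cases "1 - t^2 = 0")
 case False
 then show ?thesis by (simp add: prior_score_def field_simps power2_eq_square)
qed (auto simp: prior_score_def)

lemma prior_fisher: "integrable prior (\<lambda>t. (prior_score t)^2)" "(\<integral>t. (prior_score t)^2 \<partial>prior) = 10"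
proof -
 define f where "f t = (if \<bar>t\<bar> < 1 then (prior_score t)^2 else 0)" for t
 define h where "h t = (if \<bar>t\<bar> < 1 then 15 * t^2 else 0)" for t :: real
 have [measurable]: "f \<in> borel_measurable borel" unfolding f_def by measurable
 have eq: "f t * (15 / 16 * (1 - t^2)^2) = h t" for t
 proof (cases "\<bar>t\<bar> < 1")
  case True
  then have "1 - t^2 \<noteq> 0" by (auto simp: abs_square_less_1[symmetric])
  then show ?thesis using True by (simp add: f_def h_def prior_score_def power_divide power_mult_distrib)
 qed (auto simp: f_def h_def)
 have "has_bochner_integral lborel (\<lambda>x. 15 * x^2 * indicator {-1..1} x) (5 * 1 ^ 3 - 5 * (-1) ^ 3 :: real)"
  by (rule has_bochner_integral_FTC_Icc_real) (auto intro!: derivative_eq_intros simp: power2_eq_square)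
 then have hb: "has_bochner_integral lborel (\<lambda>x. 15 * x^2 * indicator {-1..1} x) (10::real)" by simp
 have "has_bochner_integral lborel (\<lambda>x. prior_density x *\<^sub>R f x) 10"
 proof (rule has_bochner_integral_cong_AE[THEN iffD1, OF _ _ _ hb])
  have "AE t in lborel. t \<noteq> 1 \<and> t \<noteq> (-1::real)"
   using AE_lborel_singleton[of 1] AE_lborel_singleton[of "-1::real"] by eventually_elim auto
  then show "AE x in lborel. 15 * x^2 * indicator {-1..1} x = prior_density x *\<^sub>R f x"
  proof eventually_elim
   case (elim t)
   then show ?case using eq[of t] by (auto simp: prior_density_def h_def indicator_def abs_if mult.commute)
  qed
 qed auto
 then have "has_bochner_integral prior f 10"
  unfolding prior_def by (intro has_bochner_integral_density) (auto simp: prior_density_nonneg)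
 moreover have "AE t in prior. f t = (prior_score t)^2"
  using AE_prior by eventually_elim (auto simp: f_def)
 ultimately have "has_bochner_integral prior (\<lambda>t. (prior_score t)^2) 10"
  by (subst (asm) has_bochner_integral_cong_AE[of _ _ "\<lambda>t. (prior_score t)^2"]) auto
 then show "integrable prior (\<lambda>t. (prior_score t)^2)" "(\<integral>t. (prior_score t)^2 \<partial>prior) = 10"
  by (auto simp: has_bochner_integral_iff)
qed

lemma integrable_prior_score: "integrable prior prior_score"
proof (rule Bochner_Integration.integrable_bound)
 interpret prob_space prior by (rule prob_space_prior)
 show "integrable prior (\<lambda>t. 1 + (prior_score t)^2)" using prior_fisher(1) by simp
 have "\<bar>x\<bar> \<le> 1 + x^2" for x :: real
  using zero_le_power2[of "\<bar>x\<bar> - 1"] by (simp add: power2_eq_square algebra_simps)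
 then show "AE x in prior. norm (prior_score x) \<le> norm (1 + (prior_score x)^2)"
  by (auto simp: abs_of_nonneg)
qed auto

text \<open>
 The integrand times the density is the derivative of \<open>(a - t) * f t * prior_density t\<close>, which is zero at both
 endpoints.
\<close>

lemma prior_integration_by_parts:
 fixes f f' :: "real => real"
 assumes [measurable]: "f \<in> borel_measurable borel" "f' \<in> borel_measurable borel"
  and deriv: "\<And>t. -1 \<le> t ==> t \<le> 1 ==> DERIV f t :> f' t"
  and cont: "\<And>t. -1 \<le> t ==> t \<le> 1 ==> isCont f' t"
 shows "(\<integral>t. (a - t) * (f' t + f t * prior_score t) - f t \<partial>prior) = 0"
proof -
 let ?w = "\<lambda>t::real. 15 / 16 * (1 - t^2)^2"
 let ?w' = "\<lambda>t::real. 15 / 16 * (2 * (1 - t^2) * (- 2 * t))"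
 let ?g = "\<lambda>t. (a - t) * (f' t * ?w t + f t * ?w' t) - f t * ?w t"
 have "has_bochner_integral prior (\<lambda>t. (a - t) * (f' t + f t * prior_score t) - f t)
  ((\<lambda>t. (a - t) * (f t * ?w t)) 1 - (\<lambda>t. (a - t) * (f t * ?w t)) (-1))"
 proof (rule has_bochner_integral_prior[where g = ?g])
  fix x :: real assume x: "-1 \<le> x" "x \<le> 1"
  show "DERIV (\<lambda>t. (a - t) * (f t * ?w t)) x :> ?g x"
   by (rule derivative_eq_intros deriv[OF x] refl | simp)+
  have "isCont f x" using deriv[OF x] by (rule DERIV_isCont)
  then show "isCont ?g x" using cont[OF x] by (intro continuous_intros) auto
  have "((a - x) * (f' x + f x * prior_score x) - f x) * w
   = (a - x) * (f' x * w + f x * (prior_score x * w)) - f x * w" for w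
   by (simp add: algebra_simps)
  from this[of "?w x"] show "((a - x) * (f' x + f x * prior_score x) - f x) * ?w x = ?g x"
   by (simp only: prior_score_times_density[OF x])
 qed measurable
 then show ?thesis by (simp add: has_bochner_integral_iff)
qed

section \<open>Bayesian lower bounds for smooth families\<close>

text \<open>
 A family of probability mass functions on a finite set, smooth in a parameter \<open>\<theta>\<close> that ranges over a cube; \<open>s \<theta> j\<close> is the
 score of the coordinate \<open>j\<close>.  The constant \<open>Q\<close> bounds the largest eigenvalue of the Fisher information matrix.
\<close>

locale score_family =
 fixes J :: "'j set" and \<Omega> :: "'x set"
  and p :: "('j => real) => 'x => real"
  and s :: "('j => real) => 'j => 'x => real"
  and Q B :: real and cube :: "('j => real) set"
 defines "cube \<equiv> {\<theta>. \<forall>j\<in>J. \<bar>\<theta> j\<bar> \<le> 1}"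
 assumes finite_J: "finite J" and finite_\<Omega>: "finite \<Omega>"
  and p_nonneg: "\<And>\<theta> x. \<theta> \<in> cube ==> x \<in> \<Omega> ==> 0 \<le> p \<theta> x"
  and p_sum: "\<And>\<theta>. \<theta> \<in> cube ==> (\<Sum>x\<in>\<Omega>. p \<theta> x) = 1"
  and p_deriv: "\<And>\<theta> j x. \<theta> \<in> cube ==> j \<in> J ==> x \<in> \<Omega> ==>
    DERIV (\<lambda>t. p (\<theta>(j := t)) x) (\<theta> j) :> p \<theta> x * s \<theta> j x"
  and s_cont: "\<And>\<theta> j x. \<theta> \<in> cube ==> j \<in> J ==> x \<in> \<Omega> ==> isCont (\<lambda>t. s (\<theta>(j := t)) j x) (\<theta> j)"
  and s_bound: "\<And>\<theta> j x. \<theta> \<in> cube ==> j \<in> J ==> x \<in> \<Omega> ==> \<bar>s \<theta> j x\<bar> \<le> B"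
  and s_mean: "\<And>\<theta> j. \<theta> \<in> cube ==> j \<in> J ==> (\<Sum>x\<in>\<Omega>. p \<theta> x * s \<theta> j x) = 0"
  and s_fisher: "\<And>\<theta> w. \<theta> \<in> cube ==>
    (\<Sum>x\<in>\<Omega>. p \<theta> x * (\<Sum>j\<in>J. w j * s \<theta> j x)^2) \<le> Q * (\<Sum>j\<in>J. (w j)^2)"
  and p_meas: "\<And>x. (\<lambda>\<theta>. p \<theta> x) \<in> borel_measurable (PiM J (\<lambda>_. borel))"
  and s_meas: "\<And>j x. j \<in> J ==> (\<lambda>\<theta>. s \<theta> j x) \<in> borel_measurable (PiM J (\<lambda>_. borel))"
begin

lemma p_le1: "\<theta> \<in> cube ==> x \<in> \<Omega> ==> p \<theta> x \<le> 1"
 using p_sum[of \<theta>] p_nonneg[of \<theta>] member_le_sum[of x \<Omega> "p \<theta>"] finite_\<Omega> by auto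

subsection \<open>Samples\<close>

definition samples :: "nat => (nat => 'x) set" where
 "samples n = PiE {..<n} (\<lambda>_. \<Omega>)"

definition pn :: "nat => ('j => real) => (nat => 'x) => real" where
 "pn n \<theta> S = (\<Prod>l<n. p \<theta> (S l))"

definition sn :: "nat => ('j => real) => 'j => (nat => 'x) => real" where
 "sn n \<theta> j S = (\<Sum>l<n. s \<theta> j (S l))"

lemma samples_mem: "S \<in> samples n ==> l < n ==> S l \<in> \<Omega>"
 by (auto simp: samples_def)

lemma pn_nonneg: "\<theta> \<in> cube ==> S \<in> samples n ==> 0 \<le> pn n \<theta> S"
 unfolding pn_def by (intro prod_nonneg) (auto simp: p_nonneg samples_mem)

lemma pn_le1: "\<theta> \<in> cube ==> S \<in> samples n ==> pn n \<theta> S \<le> 1"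
 unfolding pn_def by (intro prod_le_1) (auto simp: p_nonneg samples_mem p_le1)

lemma pn_sum: "\<theta> \<in> cube ==> (\<Sum>S\<in>samples n. pn n \<theta> S) = 1"
 unfolding samples_def pn_def using p_sum[of \<theta>]
 by (subst prod_sum_PiE[symmetric]) (auto simp: finite_\<Omega>)

lemma sn_bound: "\<theta> \<in> cube ==> j \<in> J ==> S \<in> samples n ==> \<bar>sn n \<theta> j S\<bar> \<le> real n * B"
 unfolding sn_def
 by (rule order_trans[OF sum_abs])
  (use sum_mono[of "{..<n}" "\<lambda>l. \<bar>s \<theta> j (S l)\<bar>" "\<lambda>_. B"] s_bound samples_mem in auto)

lemma pn_deriv:
 assumes "\<theta> \<in> cube" "j \<in> J" "S \<in> samples n"
 shows "DERIV (\<lambda>t. pn n (\<theta>(j := t)) S) (\<theta> j) :> pn n \<theta> S * sn n \<theta> j S"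
proof -
 have "DERIV (\<lambda>t. \<Prod>l<n. p (\<theta>(j := t)) (S l)) (\<theta> j) :>
  (\<Sum>l<n. (p \<theta> (S l) * s \<theta> j (S l)) * (\<Prod>m\<in>{..<n}-{l}. p (\<theta>(j := \<theta> j)) (S m)))"
  using assms by (intro has_field_derivative_prod p_deriv) (auto simp: samples_mem)
 also have "(\<Sum>l<n. (p \<theta> (S l) * s \<theta> j (S l)) * (\<Prod>m\<in>{..<n}-{l}. p (\<theta>(j := \<theta> j)) (S m)))
  = (\<Sum>l<n. (\<Prod>l<n. p \<theta> (S l)) * s \<theta> j (S l))"
  by (intro sum.cong refl) (auto simp: prod.remove mult_ac)
 finally show ?thesis by (simp only: pn_def sn_def sum_distrib_left)
qed

lemma samples_upd: "S \<in> samples n ==> l < n ==> x \<in> \<Omega> ==> S(l := x) \<in> samples n"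
 unfolding samples_def by (intro PiE_I) (auto simp: PiE_def extensional_def Pi_def)

text \<open>
 Under the joint law of a sample and an independent observation, the observation is exchangeable with each member
 of the sample.
\<close>

lemma resample_swap:
 assumes l: "l < n"
 shows "(\<Sum>S\<in>samples n. \<Sum>x\<in>\<Omega>. pn n \<theta> S * p \<theta> x * \<Phi> S x)
   = (\<Sum>S\<in>samples n. \<Sum>x\<in>\<Omega>. pn n \<theta> S * p \<theta> x * \<Phi> (S(l := x)) (S l))"
proof -
 have w: "pn n \<theta> (S(l := x)) * p \<theta> (S l) = pn n \<theta> S * p \<theta> x" for S x
 proof -
  have "pn n \<theta> S' = p \<theta> (S' l) * (\<Prod>m\<in>{..<n}-{l}. p \<theta> (S' m))" for S'
   unfolding pn_def using l by (subst prod.remove[of _ l]) auto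
  then show ?thesis by simp
 qed
 have "(\<Sum>z\<in>samples n \<times> \<Omega>. pn n \<theta> (fst z) * p \<theta> (snd z) * \<Phi> (fst z) (snd z))
   = (\<Sum>z\<in>samples n \<times> \<Omega>. pn n \<theta> (fst z) * p \<theta> (snd z) * \<Phi> ((fst z)(l := snd z)) (fst z l))"
  by (rule sum.reindex_bij_witness[where i = "\<lambda>z. ((fst z)(l := snd z), fst z l)" and j = "\<lambda>z. ((fst z)(l := snd z), fst z l)"])
   (auto simp: w samples_upd l samples_mem)
 then show ?thesis by (simp add: sum.cartesian_product case_prod_beta)
qed

lemma resample:
 assumes "\<theta> \<in> cube" and l: "l < n"
 shows "(\<Sum>S\<in>samples n. pn n \<theta> S * F S)
   = (\<Sum>S\<in>samples n. pn n \<theta> S * (\<Sum>x\<in>\<Omega>. p \<theta> x * F (S(l := x))))"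
proof -
 have "(\<Sum>S\<in>samples n. pn n \<theta> S * F S) = (\<Sum>S\<in>samples n. \<Sum>x\<in>\<Omega>. pn n \<theta> S * p \<theta> x * F S)"
  using p_sum[OF assms(1)] by (simp flip: sum_distrib_left sum_distrib_right)
 also have "... = (\<Sum>S\<in>samples n. \<Sum>x\<in>\<Omega>. pn n \<theta> S * p \<theta> x * F (S(l := x)))"
  by (rule resample_swap[OF l])
 finally show ?thesis by (simp only: sum_distrib_left mult.assoc)
qed

text \<open>
 The scores of distinct observations are uncorrelated, since the score of one observation has mean zero.
\<close>

lemma sn_second_moment:
 assumes th: "\<theta> \<in> cube" and j: "j \<in> J"
 shows "(\<Sum>S\<in>samples n. pn n \<theta> S * (sn n \<theta> j S)^2) \<le> real n * Q"
proof -
 have off: "(\<Sum>S\<in>samples n. pn n \<theta> S * (s \<theta> j (S l) * s \<theta> j (S m))) = 0" if "l < n" "m < n" "l \<noteq> m" for l m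
  using that s_mean[OF th j]
  by (subst resample[OF th that(1)]) (simp add: mult.assoc[symmetric] flip: sum_distrib_right)
 have diag: "(\<Sum>S\<in>samples n. pn n \<theta> S * (s \<theta> j (S l) * s \<theta> j (S l))) \<le> Q" if "l < n" for l
 proof -
  have "(\<Sum>S\<in>samples n. pn n \<theta> S * (s \<theta> j (S l) * s \<theta> j (S l))) = (\<Sum>x\<in>\<Omega>. p \<theta> x * (s \<theta> j x)^2)"
   using pn_sum[OF th]
   by (subst resample[OF th that]) (simp add: power2_eq_square flip: sum_distrib_right)
  also have "... \<le> Q"
   using s_fisher[OF th, of "\<lambda>i. if i = j then 1 else 0"] j finite_J
   by (simp add: if_distrib[of "\<lambda>x. x * _"] if_distrib[of "\<lambda>x. x ^ _"] cong: if_cong)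
  finally show ?thesis .
 qed
 have "(\<Sum>S\<in>samples n. pn n \<theta> S * (sn n \<theta> j S)^2)
   = (\<Sum>S\<in>samples n. \<Sum>l<n. \<Sum>m<n. pn n \<theta> S * (s \<theta> j (S l) * s \<theta> j (S m)))"
  unfolding sn_def power2_eq_square sum_product by (simp only: sum_distrib_left)
 also have "... = (\<Sum>l<n. \<Sum>m<n. \<Sum>S\<in>samples n. pn n \<theta> S * (s \<theta> j (S l) * s \<theta> j (S m)))"
  by (subst sum.swap, intro sum.cong refl, rule sum.swap)
 also have "... \<le> (\<Sum>l<n. \<Sum>m<n. if m = l then Q else 0)"
  using off diag by (intro sum_mono) auto
 finally show ?thesis by simp
qed

subsection \<open>Averaging over the prior\<close>

abbreviation \<nu> :: "('j => real) measure" where "\<nu> \<equiv> PiM J (\<lambda>_. prior)"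

lemma prob_\<nu>: "prob_space \<nu>"
 by (intro prob_space_PiM prob_space_prior)

lemma sets_\<nu>[measurable_cong]: "sets \<nu> = sets (PiM J (\<lambda>_. borel))"
 by (intro sets_PiM_cong) auto

lemma AE_cube: "AE \<theta> in \<nu>. \<theta> \<in> cube"
proof -
 have "AE \<theta> in \<nu>. \<bar>\<theta> j\<bar> \<le> 1" if "j \<in> J" for j
  using that prob_space_prior by (intro AE_PiM_component) (auto intro: eventually_mono[OF AE_prior])
 then show ?thesis unfolding cube_def using finite_J by (simp add: AE_finite_all)
qed

lemma pn_meas[measurable]: "(\<lambda>\<theta>. pn n \<theta> S) \<in> borel_measurable \<nu>"
 unfolding pn_def using p_meas by measurable

lemma sn_meas: "j \<in> J ==> (\<lambda>\<theta>. sn n \<theta> j S) \<in> borel_measurable \<nu>"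
 unfolding sn_def using s_meas[of j] by measurable

lemma score_component:
 assumes j: "j \<in> J"
 shows "integrable \<nu> (\<lambda>\<theta>. prior_score (\<theta> j))" "integrable \<nu> (\<lambda>\<theta>. (prior_score (\<theta> j))^2)"
  "(\<integral>\<theta>. (prior_score (\<theta> j))^2 \<partial>\<nu>) = 10"
proof -
 have d: "distr \<nu> prior (\<lambda>\<theta>. \<theta> j) = prior"
  by (rule distr_PiM_component) (use j prob_space_prior in auto)
 have m[measurable]: "(\<lambda>\<theta>. \<theta> j) \<in> \<nu> \<rightarrow>\<^sub>M prior" using j by (intro measurable_component_singleton)
 show "integrable \<nu> (\<lambda>\<theta>. prior_score (\<theta> j))"
  using integrable_distr[OF m, of prior_score] integrable_prior_score by (simp add: d)
 show "integrable \<nu> (\<lambda>\<theta>. (prior_score (\<theta> j))^2)"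
  using integrable_distr[OF m, of "\<lambda>t. (prior_score t)^2"] prior_fisher by (simp add: d)
 show "(\<integral>\<theta>. (prior_score (\<theta> j))^2 \<partial>\<nu>) = 10"
  using integral_distr[OF m, of "\<lambda>t. (prior_score t)^2"] prior_fisher by (simp add: d)
qed

text \<open>
 For a fixed sample and fixed values of the other coordinates this is \<open>prior_integration_by_parts\<close> for the likelihood as
 a function of the coordinate \<open>j\<close>.
\<close>

lemma van_trees_coordinate:
 assumes j: "j \<in> J" and S: "S \<in> samples n" and a: "\<bar>a\<bar> \<le> 1"
 defines "G \<equiv> \<lambda>\<theta>. (a - \<theta> j) * (pn n \<theta> S * sn n \<theta> j S + pn n \<theta> S * prior_score (\<theta> j)) - pn n \<theta> S"
 shows "integrable \<nu> G" "(\<integral>\<theta>. G \<theta> \<partial>\<nu>) = 0"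
proof -
 interpret \<nu>: prob_space \<nu> by (rule prob_\<nu>)
 interpret PF: product_sigma_finite "\<lambda>_::'j. prior"
  by (intro product_sigma_finite.intro prob_space_imp_sigma_finite prob_space_prior)
 have sm[measurable]: "(\<lambda>\<theta>. sn n \<theta> j S) \<in> borel_measurable \<nu>" by (rule sn_meas[OF j])
 have jm[measurable]: "(\<lambda>\<theta>. \<theta> j) \<in> borel_measurable \<nu>"
  using measurable_component_singleton[OF j, of "\<lambda>_. prior"] by (simp cong: measurable_cong_sets)
 show int: "integrable \<nu> G"
 proof (rule Bochner_Integration.integrable_bound)
  show "integrable \<nu> (\<lambda>\<theta>. 2 * (real n * B + \<bar>prior_score (\<theta> j)\<bar>) + 1)"
   using score_component(1)[OF j] by auto
  show "G \<in> borel_measurable \<nu>" unfolding G_def by measurable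
  show "AE \<theta> in \<nu>. norm (G \<theta>) \<le> norm (2 * (real n * B + \<bar>prior_score (\<theta> j)\<bar>) + 1)"
   using AE_cube
  proof eventually_elim
   case (elim \<theta>)
   have pn: "0 \<le> pn n \<theta> S" "pn n \<theta> S \<le> 1" using pn_nonneg[OF elim S] pn_le1[OF elim S] by auto
   have t: "\<bar>a - \<theta> j\<bar> \<le> 2" using elim j a by (force simp: cube_def)
   have nB: "\<bar>sn n \<theta> j S\<bar> \<le> real n * B" by (rule sn_bound[OF elim j S])
   have "\<bar>G \<theta>\<bar> \<le> \<bar>a - \<theta> j\<bar> * (pn n \<theta> S * \<bar>sn n \<theta> j S + prior_score (\<theta> j)\<bar>) + pn n \<theta> S"
    unfolding G_def using pn by (simp add: abs_mult distrib_left[symmetric] order_trans[OF abs_triangle_ineq4])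
   also have "... \<le> 2 * (1 * (real n * B + \<bar>prior_score (\<theta> j)\<bar>)) + 1"
    using pn t nB by (intro add_mono mult_mono) auto
   finally show ?case by simp
  qed
 qed
 have J: "J = insert j (J - {j})" using j by auto
 have "(\<integral>\<theta>. G \<theta> \<partial>\<nu>) = (\<integral>\<theta>. G \<theta> \<partial>PiM (insert j (J - {j})) (\<lambda>_. prior))"
  using J by simp
 also have "... = (\<integral>\<theta>. (\<integral>t. G (\<theta>(j := t)) \<partial>prior) \<partial>PiM (J - {j}) (\<lambda>_. prior))"
  using int J finite_J by (intro PF.product_integral_insert) auto
 also have "... = 0"
 proof (rule integral_eq_zero_AE)
  have "AE \<theta> in PiM (J - {j}) (\<lambda>_. prior). \<forall>i\<in>J - {j}. \<bar>\<theta> i\<bar> \<le> 1"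
   using finite_J
   by (intro AE_finite_allI AE_PiM_component) (auto simp: prob_space_prior intro: eventually_mono[OF AE_prior])
  then show "AE \<theta> in PiM (J - {j}) (\<lambda>_. prior). (\<integral>t. G (\<theta>(j := t)) \<partial>prior) = 0"
   using AE_space
  proof eventually_elim
   case (elim \<theta>)
   have c: "\<theta>(j := t) \<in> cube" if "-1 \<le> t" "t \<le> 1" for t using elim that by (auto simp: cube_def)
   have upd[measurable]: "(\<lambda>t. \<theta>(j := t)) \<in> borel \<rightarrow>\<^sub>M \<nu>"
    using measurable_component_update[OF elim(2), of j] J by (simp cong: measurable_cong_sets)
   have dr: "DERIV (\<lambda>t. pn n (\<theta>(j := t)) S) t :> pn n (\<theta>(j := t)) S * sn n (\<theta>(j := t)) j S"
    if "-1 \<le> t" "t \<le> 1" for t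
    using pn_deriv[OF c[OF that] j S] by simp
   show ?case unfolding G_def fun_upd_same
   proof (rule prior_integration_by_parts)
    show "(\<lambda>t. pn n (\<theta>(j := t)) S) \<in> borel_measurable borel"
     by (rule measurable_compose[OF upd pn_meas])
    show "(\<lambda>t. pn n (\<theta>(j := t)) S * sn n (\<theta>(j := t)) j S) \<in> borel_measurable borel"
     by (intro borel_measurable_times measurable_compose[OF upd pn_meas] measurable_compose[OF upd sm])
    fix t :: real assume t: "-1 \<le> t" "t \<le> 1"
    show "DERIV (\<lambda>t. pn n (\<theta>(j := t)) S) t :> pn n (\<theta>(j := t)) S * sn n (\<theta>(j := t)) j S"
     by (rule dr[OF t])
    have "isCont (\<lambda>t. pn n (\<theta>(j := t)) S) t" using dr[OF t] by (rule DERIV_isCont)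
    moreover have "isCont (\<lambda>t. sn n (\<theta>(j := t)) j S) t"
     unfolding sn_def using s_cont[OF c[OF t] j samples_mem[OF S]]
     by (intro continuous_intros) auto
    ultimately show "isCont (\<lambda>t. pn n (\<theta>(j := t)) S * sn n (\<theta>(j := t)) j S) t"
     by (intro continuous_intros)
   qed
  qed
 qed
 finally show "(\<integral>\<theta>. G \<theta> \<partial>\<nu>) = 0" .
qed

text \<open>
 The van Trees identity, summed over samples and coordinates and integrated over the prior, says that
 \<open>(a j S - \<theta> j) * (sn n \<theta> j S + prior_score (\<theta> j))\<close> has mean 1 for every \<open>j\<close>.  The part with
 the prior score is split by the arithmetic-geometric mean inequality, with weights for which the Fisher information 10 of
 the prior uses up half of the mean; some parameter does at least as well as the average.
\<close>

lemma exists_hard_parameter: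
 assumes a: "\<And>j S. j \<in> J ==> S \<in> samples n ==> \<bar>a j S\<bar> \<le> 1"
 shows "\<exists>\<theta>\<in>cube. real (card J) / 2 \<le> (\<Sum>S\<in>samples n. pn n \<theta> S *
   (\<Sum>j\<in>J. (a j S - \<theta> j) * sn n \<theta> j S + 5 * (a j S - \<theta> j)^2))"
proof (rule ccontr)
 assume neg: "\<not> ?thesis"
 interpret \<nu>: prob_space \<nu> by (rule prob_\<nu>)
 define V where "V \<theta> = (\<Sum>S\<in>samples n. pn n \<theta> S *
   (\<Sum>j\<in>J. (a j S - \<theta> j) * sn n \<theta> j S + 5 * (a j S - \<theta> j)^2))" for \<theta>
 define G where "G \<theta> = (\<Sum>S\<in>samples n. \<Sum>j\<in>J. (a j S - \<theta> j) * (pn n \<theta> S * sn n \<theta> j S + pn n \<theta> S * prior_score (\<theta> j)) - pn n \<theta> S)" for \<theta>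
 have G: "integrable \<nu> G" "(\<integral>\<theta>. G \<theta> \<partial>\<nu>) = 0"
  unfolding G_def using van_trees_coordinate a by (auto intro!: Bochner_Integration.integrable_sum)
 define H where "H \<theta> = (\<Sum>j\<in>J. (prior_score (\<theta> j))^2) / 20" for \<theta>
 have H: "integrable \<nu> H" "(\<integral>\<theta>. H \<theta> \<partial>\<nu>) = real (card J) / 2"
  unfolding H_def using score_component by auto
 have key: "G \<theta> - H \<theta> \<le> V \<theta> - real (card J)" if th: "\<theta> \<in> cube" for \<theta>
 proof -
  have "G \<theta> = (\<Sum>S\<in>samples n. pn n \<theta> S * ((\<Sum>j\<in>J. (a j S - \<theta> j) * sn n \<theta> j S + (a j S - \<theta> j) * prior_score (\<theta> j)) - real (card J)))"
   unfolding G_def by (intro sum.cong refl) (simp add: sum_distrib_left algebra_simps sum.distrib sum_subtractf)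
  also have "... \<le> (\<Sum>S\<in>samples n. pn n \<theta> S * ((\<Sum>j\<in>J. (a j S - \<theta> j) * sn n \<theta> j S + 5 * (a j S - \<theta> j)^2) + H \<theta> - real (card J)))"
  proof (intro sum_mono mult_left_mono pn_nonneg th)
   fix S
   \<comment> \<open>the weight 1/20 turns the Fisher information 10 of the prior into 1/2 per coordinate\<close>
   have amgm: "x * y \<le> 5 * x^2 + y^2 / 20" for x y :: real
    using zero_le_power2[of "10 * x - y"] by (simp add: power2_eq_square algebra_simps)
   show "(\<Sum>j\<in>J. (a j S - \<theta> j) * sn n \<theta> j S + (a j S - \<theta> j) * prior_score (\<theta> j)) - real (card J)
    \<le> (\<Sum>j\<in>J. (a j S - \<theta> j) * sn n \<theta> j S + 5 * (a j S - \<theta> j)^2) + H \<theta> - real (card J)"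
    unfolding H_def sum_divide_distrib
    by (simp add: sum.distrib[symmetric]) (intro sum_mono, use amgm in \<open>simp add: add.assoc\<close>)
  qed
  also have "... = V \<theta> + (H \<theta> - real (card J))"
   using pn_sum[OF th, of n] unfolding V_def
   by (simp add: algebra_simps sum.distrib sum_subtractf flip: sum_distrib_left sum_distrib_right)
  finally show ?thesis by simp
 qed
 have "AE \<theta> in \<nu>. G \<theta> - H \<theta> < - real (card J) / 2"
  using AE_cube
 proof eventually_elim
  case (elim \<theta>)
  have "V \<theta> < real (card J) / 2" using neg elim by (auto simp: V_def not_le)
  with key[OF elim] show ?case by simp
 qed
 then have "(\<integral>\<theta>. G \<theta> - H \<theta> \<partial>\<nu>) < - real (card J) / 2"
  using G H by (intro \<nu>.expectation_less) auto
 with G H show False by simp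
qed

subsection \<open>Lower bounds\<close>

text \<open>
 The correlation with the score is split by the arithmetic-geometric mean inequality, with weights for which the
 second moment \<open>n * Q\<close> of the score costs \<open>card J / 8\<close>.
\<close>

lemma statistical_lower_bound:
 assumes a: "\<And>j S. j \<in> J ==> S \<in> samples n ==> \<bar>a j S\<bar> \<le> 1" and pos: "Q > 0" "n > 0"
 shows "\<exists>\<theta>\<in>cube. 3 * real (card J) / 8 \<le> (5 + 2 * real n * Q) *
  (\<Sum>S\<in>samples n. pn n \<theta> S * (\<Sum>j\<in>J. (a j S - \<theta> j)^2))"
proof -
 obtain \<theta> where th: "\<theta> \<in> cube" and V: "real (card J) / 2 \<le> (\<Sum>S\<in>samples n. pn n \<theta> S *
   (\<Sum>j\<in>J. (a j S - \<theta> j) * sn n \<theta> j S + 5 * (a j S - \<theta> j)^2))"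
  using exists_hard_parameter[of n a] a by blast
 define R where "R = (\<Sum>S\<in>samples n. pn n \<theta> S * (\<Sum>j\<in>J. (a j S - \<theta> j)^2))"
 define N where "N = real n * Q"
 have N: "N > 0" using pos by (simp add: N_def)
 have amgm: "x * y \<le> 2 * N * x^2 + y^2 / (8 * N)" for x y :: real
 proof -
  have "0 \<le> (4 * N * x - y)^2 / (8 * N)" using N by simp
  also have "... = 2 * N * x^2 + y^2 / (8 * N) - x * y"
   using N by (simp add: power2_eq_square field_simps)
  finally show ?thesis by simp
 qed
 note V
 also have "(\<Sum>S\<in>samples n. pn n \<theta> S *
   (\<Sum>j\<in>J. (a j S - \<theta> j) * sn n \<theta> j S + 5 * (a j S - \<theta> j)^2))
  \<le> (\<Sum>S\<in>samples n. pn n \<theta> S *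
   (\<Sum>j\<in>J. (5 + 2 * N) * (a j S - \<theta> j)^2 + (sn n \<theta> j S)^2 / (8 * N)))"
 proof (intro sum_mono mult_left_mono pn_nonneg th)
  fix S j
  show "(a j S - \<theta> j) * sn n \<theta> j S + 5 * (a j S - \<theta> j)^2
   \<le> (5 + 2 * N) * (a j S - \<theta> j)^2 + (sn n \<theta> j S)^2 / (8 * N)"
   using amgm[of "a j S - \<theta> j" "sn n \<theta> j S"] by (simp only: distrib_right)
 qed
 also have "... = (5 + 2 * N) * R + (\<Sum>S\<in>samples n. \<Sum>j\<in>J. pn n \<theta> S * (sn n \<theta> j S)^2) / (8 * N)"
  unfolding R_def by (simp add: sum.distrib sum_distrib_left algebra_simps sum_divide_distrib)
 also have "(\<Sum>S\<in>samples n. \<Sum>j\<in>J. pn n \<theta> S * (sn n \<theta> j S)^2) = (\<Sum>j\<in>J. \<Sum>S\<in>samples n. pn n \<theta> S * (sn n \<theta> j S)^2)"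
  by (rule sum.swap)
 also have "... \<le> (\<Sum>j\<in>J. N)"
  unfolding N_def by (intro sum_mono sn_second_moment th)
 finally have "real (card J) / 2 \<le> (5 + 2 * N) * R + real (card J) / 8"
  using N by (simp add: divide_right_mono mult.commute)
 then show ?thesis using th unfolding R_def N_def by (intro bexI[of _ \<theta>]) (auto simp: mult.assoc)
qed

text \<open>
 The score of the sample is the sum of the scores of its \<open>n\<close> observations.  For each of them, the correlation of the
 estimation error with its score vanishes when the estimator is run on a sample in which that observation has been
 resampled.  By \<open>priv\<close> the resampling changes the correlation by at most
 \<open>\<kappa> * b / 2 + Q * R / (2 * b)\<close>, where \<open>R\<close> is the loss: in the second moment all the coordinates share one factor \<open>Q\<close>, which is
 what gains over adding up the coordinates.
\<close>

lemma private_lower_bound: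
 fixes A :: "(nat => 'x) => 'o measure" and \<tau> :: "'j => 'o => real"
 assumes prob: "\<And>S. S \<in> samples n ==> prob_space (A S)"
  and meas: "\<And>S j. S \<in> samples n ==> j \<in> J ==> \<tau> j \<in> borel_measurable (A S)"
  and bound: "\<And>j T. \<bar>\<tau> j T\<bar> \<le> 1"
  and priv: "\<And>S l x f b C. S \<in> samples n ==> l < n ==> x \<in> \<Omega> ==> f \<in> borel_measurable (A S) ==> (\<And>T. \<bar>f T\<bar> \<le> C) ==> b > 0 ==>
   (\<integral>T. f T \<partial>A S) - (\<integral>T. f T \<partial>A (S(l := x))) \<le> \<kappa> * b / 2 + (\<integral>T. (f T)^2 \<partial>A (S(l := x))) / (2 * b)"
  and pos: "Q > 0" "n > 0" "\<kappa> > 0" "J \<noteq> {}"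
 shows "\<exists>\<theta>\<in>cube. 3 * real (card J) / 8 \<le> (5 + 2 * (real n)^2 * Q * \<kappa> / real (card J)) *
  (\<Sum>S\<in>samples n. pn n \<theta> S * (\<integral>T. (\<Sum>j\<in>J. (\<tau> j T - \<theta> j)^2) \<partial>A S))"
proof -
 define a where "a j S = (\<integral>T. \<tau> j T \<partial>A S)" for j S
 have int: "integrable (A S) f" if "S \<in> samples n" "f \<in> borel_measurable (A S)" "\<And>T. \<bar>f T\<bar> \<le> C" for S f and C :: real
 proof -
  interpret prob_space "A S" by (rule prob[OF that(1)])
  show ?thesis by (rule integrable_const_bound[where B=C]) (use that in auto)
 qed
 have a1: "\<bar>a j S\<bar> \<le> 1" if "j \<in> J" "S \<in> samples n" for j S
 proof -
  interpret prob_space "A S" by (rule prob[OF that(2)])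
  have "\<bar>a j S\<bar> \<le> (\<integral>T. \<bar>\<tau> j T\<bar> \<partial>A S)" unfolding a_def by (rule integral_abs_bound)
  also have "... \<le> (\<integral>T. 1 \<partial>A S)"
   using int[OF that(2), of "\<tau> j" 1] meas[OF that(2,1)] bound by (intro integral_mono) auto
  finally show ?thesis by (simp add: prob_space)
 qed
 obtain \<theta> where th: "\<theta> \<in> cube" and V: "real (card J) / 2 \<le> (\<Sum>S\<in>samples n. pn n \<theta> S *
   (\<Sum>j\<in>J. (a j S - \<theta> j) * sn n \<theta> j S + 5 * (a j S - \<theta> j)^2))"
  using exists_hard_parameter[of n a] a1 by blast
 define L where "L T = (\<Sum>j\<in>J. (\<tau> j T - \<theta> j)^2)" for T
 define f where "f x T = (\<Sum>j\<in>J. (\<tau> j T - \<theta> j) * s \<theta> j x)" for x T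
 define R where "R = (\<Sum>S\<in>samples n. pn n \<theta> S * (\<integral>T. L T \<partial>A S))"
 have th1: "\<bar>\<theta> j\<bar> \<le> 1" if "j \<in> J" for j using th that by (auto simp: cube_def)
 have d2: "\<bar>\<tau> j T - \<theta> j\<bar> \<le> 2" if "j \<in> J" for j T using th1[OF that] bound[of j T] by linarith
 have sq2: "(\<tau> j T - \<theta> j)^2 \<le> 4" if "j \<in> J" for j T
  using power_mono[OF d2[OF that, of T], of 2] by simp
 have ti: "integrable (A S) (\<tau> j)" if "S \<in> samples n" "j \<in> J" for S j
  using int[OF that(1) meas[OF that], of 1] bound by auto
 have sqi: "integrable (A S) (\<lambda>T. (\<tau> j T - \<theta> j)^2)" if "S \<in> samples n" "j \<in> J" for S j
  using int[OF that(1), of "\<lambda>T. (\<tau> j T - \<theta> j)^2" 4] meas[OF that] sq2[OF that(2)] by auto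
 have f_meas: "f x \<in> borel_measurable (A S)" if "S \<in> samples n" for S x
  unfolding f_def using meas[OF that] by auto
 define F where "F = (\<Sum>j\<in>J. 2 * B)"
 have f_bound: "\<bar>f x T\<bar> \<le> F" if "x \<in> \<Omega>" for x T
  unfolding f_def F_def
  by (rule order_trans[OF sum_abs], rule sum_mono, unfold abs_mult, rule mult_mono)
   (use d2 s_bound[OF th _ that] in auto)
 have fi: "integrable (A S) (f x)" if "S \<in> samples n" "x \<in> \<Omega>" for S x
  using int[OF that(1) f_meas[OF that(1)]] f_bound[OF that(2)] by blast
 have f2i: "integrable (A S) (\<lambda>T. (f x T)^2)" if "S \<in> samples n" "x \<in> \<Omega>" for S x
 proof (rule int[OF that(1)])
  show "(\<lambda>T. (f x T)^2) \<in> borel_measurable (A S)" using f_meas[OF that(1)] by auto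
  show "\<bar>(f x T)^2\<bar> \<le> F^2" for T
   using power_mono[OF f_bound[OF that(2), of T], of 2] by simp
 qed
 have jensen: "(a j S - \<theta> j)^2 \<le> (\<integral>T. (\<tau> j T - \<theta> j)^2 \<partial>A S)" if "S \<in> samples n" "j \<in> J" for S j
 proof -
  interpret prob_space "A S" by (rule prob[OF that(1)])
  have "0 \<le> (\<integral>T. ((\<tau> j T - \<theta> j) - (a j S - \<theta> j))^2 \<partial>A S)" by simp
  also have "... = (\<integral>T. (\<tau> j T - \<theta> j)^2 - 2 * (a j S - \<theta> j) * \<tau> j T + (2 * \<theta> j * (a j S - \<theta> j) + (a j S - \<theta> j)^2) \<partial>A S)"
   by (intro Bochner_Integration.integral_cong refl) (simp add: power2_eq_square algebra_simps)
  also have "... = (\<integral>T. (\<tau> j T - \<theta> j)^2 \<partial>A S) - 2 * (a j S - \<theta> j) * a j S + (2 * \<theta> j * (a j S - \<theta> j) + (a j S - \<theta> j)^2)"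
   using sqi[OF that] ti[OF that] by (simp add: a_def prob_space)
  also have "... = (\<integral>T. (\<tau> j T - \<theta> j)^2 \<partial>A S) - (a j S - \<theta> j)^2"
   by (simp add: power2_eq_square algebra_simps)
  finally show ?thesis by simp
 qed
 have quad: "(\<Sum>S\<in>samples n. pn n \<theta> S * (\<Sum>j\<in>J. (a j S - \<theta> j)^2)) \<le> R"
  unfolding R_def L_def
 proof (intro sum_mono mult_left_mono pn_nonneg th)
  fix S assume S: "S \<in> samples n"
  then show "(\<Sum>j\<in>J. (a j S - \<theta> j)^2) \<le> (\<integral>T. (\<Sum>j\<in>J. (\<tau> j T - \<theta> j)^2) \<partial>A S)"
   using jensen[OF S] sqi[OF S] by (subst Bochner_Integration.integral_sum) (auto intro!: sum_mono)
 qed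
 \<comment> \<open>the value for which the terms \<open>\<kappa> * b / 2\<close> of all the observations add up to \<open>card J / 8\<close>\<close>
 define b where "b = real (card J) / (4 * real n * \<kappa>)"
 have cJ: "real (card J) > 0" using pos finite_J by (simp add: card_gt_0_iff)
 have b: "b > 0" using pos cJ by (simp add: b_def)
 have score_sum: "(\<Sum>j\<in>J. (a j S - \<theta> j) * sn n \<theta> j S) = (\<Sum>l<n. \<integral>T. f (S l) T \<partial>A S)" if S: "S \<in> samples n" for S
 proof -
  interpret prob_space "A S" by (rule prob[OF S])
  have "(\<integral>T. f (S l) T \<partial>A S) = (\<Sum>j\<in>J. (a j S - \<theta> j) * s \<theta> j (S l))" for l
   unfolding f_def a_def using ti[OF S]
   by (subst Bochner_Integration.integral_sum) (auto simp: prob_space)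
  then show ?thesis by (simp add: sn_def sum_distrib_left sum.swap[of _ J])
 qed
 have lin: "(\<Sum>S\<in>samples n. pn n \<theta> S * (\<integral>T. f (S l) T \<partial>A S)) \<le> \<kappa> * b / 2 + Q * R / (2 * b)" if l: "l < n" for l
 proof -
  have upd: "S(l := x) \<in> samples n" if "S \<in> samples n" "x \<in> \<Omega>" for S x
   using that l by (rule_tac samples_upd)
  have zero: "(\<Sum>S\<in>samples n. \<Sum>x\<in>\<Omega>. pn n \<theta> S * p \<theta> x * (\<integral>T. f (S l) T \<partial>A (S(l := x)))) = 0"
  proof -
   have nul: "(\<Sum>x\<in>\<Omega>. p \<theta> x * f x T) = 0" for T
   proof -
    have "(\<Sum>x\<in>\<Omega>. p \<theta> x * f x T) = (\<Sum>j\<in>J. (\<tau> j T - \<theta> j) * (\<Sum>x\<in>\<Omega>. p \<theta> x * s \<theta> j x))"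
     unfolding f_def sum_distrib_left by (subst sum.swap) (simp add: mult_ac)
    then show ?thesis using s_mean[OF th] by simp
   qed
   have "(\<Sum>S\<in>samples n. \<Sum>x\<in>\<Omega>. pn n \<theta> S * p \<theta> x * (\<integral>T. f (S l) T \<partial>A (S(l := x))))
    = (\<Sum>S\<in>samples n. \<Sum>x\<in>\<Omega>. pn n \<theta> S * p \<theta> x * (\<integral>T. f x T \<partial>A S))"
    by (subst resample_swap[OF l, of \<theta> "\<lambda>S x. \<integral>T. f x T \<partial>A S"]) simp
   also have "... = (\<Sum>S\<in>samples n. pn n \<theta> S * (\<integral>T. (\<Sum>x\<in>\<Omega>. p \<theta> x * f x T) \<partial>A S))"
    using fi by (intro sum.cong refl) (subst Bochner_Integration.integral_sum, auto simp: sum_distrib_left mult.assoc)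
   finally show ?thesis using nul by simp
  qed
  have sq: "(\<Sum>S\<in>samples n. \<Sum>x\<in>\<Omega>. pn n \<theta> S * p \<theta> x * (\<integral>T. (f (S l) T)^2 \<partial>A (S(l := x)))) \<le> Q * R"
  proof -
   have "(\<Sum>S\<in>samples n. \<Sum>x\<in>\<Omega>. pn n \<theta> S * p \<theta> x * (\<integral>T. (f (S l) T)^2 \<partial>A (S(l := x))))
    = (\<Sum>S\<in>samples n. \<Sum>x\<in>\<Omega>. pn n \<theta> S * p \<theta> x * (\<integral>T. (f x T)^2 \<partial>A S))"
    by (subst resample_swap[OF l, of \<theta> "\<lambda>S x. \<integral>T. (f x T)^2 \<partial>A S"]) simp
   also have "... = (\<Sum>S\<in>samples n. pn n \<theta> S * (\<integral>T. (\<Sum>x\<in>\<Omega>. p \<theta> x * (f x T)^2) \<partial>A S))"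
    using f2i by (intro sum.cong refl) (subst Bochner_Integration.integral_sum, auto simp: sum_distrib_left mult.assoc)
   also have "... \<le> (\<Sum>S\<in>samples n. pn n \<theta> S * (\<integral>T. Q * L T \<partial>A S))"
   proof (intro sum_mono mult_left_mono pn_nonneg th integral_mono)
    fix S T assume S: "S \<in> samples n"
    show "integrable (A S) (\<lambda>T. \<Sum>x\<in>\<Omega>. p \<theta> x * (f x T)^2)" using f2i[OF S] by auto
    show "integrable (A S) (\<lambda>T. Q * L T)" unfolding L_def using sqi[OF S] by auto
    show "(\<Sum>x\<in>\<Omega>. p \<theta> x * (f x T)^2) \<le> Q * L T"
     unfolding f_def L_def by (rule s_fisher[OF th])
   qed
   also have "... = Q * R" unfolding R_def sum_distrib_left by (simp add: mult_ac)
   finally show ?thesis .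
  qed
  have one: "(\<Sum>x\<in>\<Omega>. pn n \<theta> S * p \<theta> x * c) = pn n \<theta> S * c" for S and c :: real
   using p_sum[OF th] by (simp flip: sum_distrib_left sum_distrib_right)
  have "(\<Sum>S\<in>samples n. pn n \<theta> S * (\<integral>T. f (S l) T \<partial>A S))
   = (\<Sum>S\<in>samples n. \<Sum>x\<in>\<Omega>. pn n \<theta> S * p \<theta> x * (\<integral>T. f (S l) T \<partial>A S))"
   by (simp only: one)
  also have "... \<le> (\<Sum>S\<in>samples n. \<Sum>x\<in>\<Omega>. pn n \<theta> S * p \<theta> x *
    ((\<integral>T. f (S l) T \<partial>A (S(l := x))) + (\<kappa> * b / 2 + (\<integral>T. (f (S l) T)^2 \<partial>A (S(l := x))) / (2 * b))))"
  proof (intro sum_mono mult_left_mono mult_nonneg_nonneg pn_nonneg p_nonneg th)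
   fix S x assume S: "S \<in> samples n" and x: "x \<in> \<Omega>"
   show "(\<integral>T. f (S l) T \<partial>A S) \<le> (\<integral>T. f (S l) T \<partial>A (S(l := x))) + (\<kappa> * b / 2 + (\<integral>T. (f (S l) T)^2 \<partial>A (S(l := x))) / (2 * b))"
    using priv[OF S l x f_meas[OF S] f_bound[OF samples_mem[OF S l]] b] by simp
  qed
  also have "... = \<kappa> * b / 2 + (\<Sum>S\<in>samples n. \<Sum>x\<in>\<Omega>. pn n \<theta> S * p \<theta> x * (\<integral>T. (f (S l) T)^2 \<partial>A (S(l := x)))) / (2 * b)"
  proof -
   have "(\<Sum>S\<in>samples n. \<Sum>x\<in>\<Omega>. pn n \<theta> S * p \<theta> x * C) = C" for C :: real
    using pn_sum[OF th, of n] by (simp only: one) (simp flip: sum_distrib_right)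
   note C = this[of "\<kappa> * b / 2"]
   show ?thesis
    unfolding distrib_left sum.distrib zero C by (simp add: sum_divide_distrib)
  qed
  also have "... \<le> \<kappa> * b / 2 + Q * R / (2 * b)"
   using sq b by (simp add: divide_right_mono)
  finally show ?thesis .
 qed
 have "(\<Sum>S\<in>samples n. pn n \<theta> S * (\<Sum>j\<in>J. (a j S - \<theta> j) * sn n \<theta> j S)) =
    (\<Sum>l<n. \<Sum>S\<in>samples n. pn n \<theta> S * (\<integral>T. f (S l) T \<partial>A S))"
  by (simp add: score_sum sum_distrib_left sum.swap[of _ "samples n"])
 also have "... \<le> (\<Sum>l<n. \<kappa> * b / 2 + Q * R / (2 * b))" using lin by (intro sum_mono) auto
 also have "... = real (card J) / 8 + 2 * (real n)^2 * Q * \<kappa> / real (card J) * R"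
  using pos cJ by (simp add: b_def field_simps power2_eq_square)
 finally have lin': "(\<Sum>S\<in>samples n. pn n \<theta> S * (\<Sum>j\<in>J. (a j S - \<theta> j) * sn n \<theta> j S))
  \<le> real (card J) / 8 + 2 * (real n)^2 * Q * \<kappa> / real (card J) * R" .
 have "real (card J) / 2 \<le> (\<Sum>S\<in>samples n. pn n \<theta> S * (\<Sum>j\<in>J. (a j S - \<theta> j) * sn n \<theta> j S))
  + 5 * (\<Sum>S\<in>samples n. pn n \<theta> S * (\<Sum>j\<in>J. (a j S - \<theta> j)^2))"
  using V by (simp add: sum.distrib distrib_left sum_distrib_left mult_ac)
 with lin' quad have "3 * real (card J) / 8 \<le> (5 + 2 * (real n)^2 * Q * \<kappa> / real (card J)) * R"
  by (simp add: distrib_right)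
 then show ?thesis using th unfolding R_def L_def by blast
qed

end

section \<open>Exponential moments of signs and Gaussian variables\<close>

text \<open>
 The exponential moment of a sign with mean \<open>m\<close>; Hoeffding's lemma for a variable with values in \<open>{-1, 1}\<close>.
\<close>

lemma two_point_hoeffding:
 fixes m v :: real
 assumes "\<bar>m\<bar> \<le> 1"
 shows "((1 + m) * exp v + (1 - m) * exp (- v)) / 2 \<le> exp (v * m + v^2 / 2)"
proof -
 have *: "((1 + m) * exp v + (1 - m) * exp (- v)) / 2 \<le> exp (v * m + v^2 / 2)"
  if "v \<ge> 0" "\<bar>m\<bar> \<le> 1" for m v :: real
 proof -
  let ?p = "(1 + m) / 2"
  have pos: "0 < 1 + ?p * (exp (2 * v) - 1)" using that by (intro add_pos_nonneg mult_nonneg_nonneg) auto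
  have "- (2 * v) * ?p + ln (1 + ?p * (exp (2 * v) - 1)) \<le> (2 * v)^2 / 8"
   using that by (intro Hoeffdings_lemma_aux) auto
  then have "ln (1 + ?p * (exp (2 * v) - 1)) \<le> v + v * m + v^2 / 2"
   by (simp add: field_simps power2_eq_square)
  then have "1 + ?p * (exp (2 * v) - 1) \<le> exp (v + v * m + v^2 / 2)"
   using pos by (metis exp_le_cancel_iff exp_ln)
  then have "exp (- v) * (1 + ?p * (exp (2 * v) - 1)) \<le> exp (- v) * exp (v + v * m + v^2 / 2)"
   by (intro mult_left_mono) auto
  also have "exp (- v) * exp (v + v * m + v^2 / 2) = exp (v * m + v^2 / 2)"
   by (simp add: exp_add[symmetric])
  also have "exp (- v) * (1 + ?p * (exp (2 * v) - 1)) = ((1 + m) * exp v + (1 - m) * exp (- v)) / 2"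
  proof -
   have e: "exp (2 * v) = exp v * exp v" by (simp add: exp_add[symmetric])
   have e2: "exp (- v) * exp v = 1" by (simp add: exp_add[symmetric])
   have "x * (1 + q * (y * y - 1)) = x * (1 - q) + q * ((x * y) * y)" for x y q :: real
    by (simp add: algebra_simps)
   then have "exp (- v) * (1 + ?p * (exp (2 * v) - 1)) = exp (- v) * (1 - ?p) + ?p * ((exp (- v) * exp v) * exp v)"
    unfolding e .
   then show ?thesis unfolding e2 by (simp add: field_simps)
  qed
  finally show ?thesis .
 qed
 show ?thesis
 proof (cases "v \<ge> 0")
  case False
  then show ?thesis using *[of "- v" "- m"] assms by (simp add: add.commute)
 qed (use * assms in auto)
qed

abbreviation std_normal :: "real measure" where
 "std_normal \<equiv> density lborel (\<lambda>x. ennreal (normal_density 0 1 x))"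

lemma prob_space_std_normal: "prob_space std_normal"
 by (rule prob_space_normal_density) simp

text \<open>
 Read from right to left, this turns the exponential of a square into an average of exponentials of linear
 forms.  With \<open>std_normal_exp_square\<close> it converts bounds on moment generating functions into bounds on
 exponential moments of squares.
\<close>

lemma std_normal_exp_linear: "(\<integral>\<^sup>+g. ennreal (exp (a * g)) \<partial>std_normal) = ennreal (exp (a^2 / 2))"
proof -
 have "(\<integral>\<^sup>+g. ennreal (exp (a * g)) \<partial>std_normal) = (\<integral>\<^sup>+g. ennreal (exp (a^2 / 2)) * ennreal (normal_density a 1 g) \<partial>lborel)"
 proof (subst nn_integral_density, simp, simp, rule nn_integral_cong)
  fix g :: real
  have "normal_density 0 1 g * exp (a * g) = exp (a^2 / 2) * normal_density a 1 g"
   by (simp add: normal_density_def exp_add[symmetric] power2_eq_square algebra_simps add_divide_distrib diff_divide_distrib)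
  then show "ennreal (normal_density 0 1 g) * ennreal (exp (a * g)) = ennreal (exp (a^2 / 2)) * ennreal (normal_density a 1 g)"
   by (metis ennreal_mult' exp_ge_zero normal_density_nonneg)
 qed
 also have "... = ennreal (exp (a^2 / 2)) * emeasure (density lborel (\<lambda>x. ennreal (normal_density a 1 x))) UNIV"
  by (subst nn_integral_cmult) (auto simp: emeasure_density)
 also have "... = ennreal (exp (a^2 / 2))"
  using prob_space.emeasure_space_1[OF prob_space_normal_density[of 1 a]] by simp
 finally show ?thesis .
qed

lemma std_normal_exp_square:
 assumes "b < 1 / 2"
 shows "(\<integral>\<^sup>+g. ennreal (exp (b * g^2)) \<partial>std_normal) = ennreal (1 / sqrt (1 - 2 * b))"
proof -
 define \<sigma> where "\<sigma> = 1 / sqrt (1 - 2 * b)"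
 have s: "\<sigma> > 0" using assms by (simp add: \<sigma>_def)
 have s2: "\<sigma>^2 * (1 - 2 * b) = 1" using assms by (simp add: \<sigma>_def power_divide)
 have "(\<integral>\<^sup>+g. ennreal (exp (b * g^2)) \<partial>std_normal) = (\<integral>\<^sup>+g. ennreal \<sigma> * ennreal (normal_density 0 \<sigma> g) \<partial>lborel)"
 proof (subst nn_integral_density, simp, simp, rule nn_integral_cong)
  fix g :: real
  have "g^2 / (2 * \<sigma>^2) = (\<sigma>^2 * (1 - 2 * b)) * g^2 / (2 * \<sigma>^2)" by (simp add: s2)
  also have "... = g^2 / 2 - b * g^2" using s by (simp add: field_simps)
  finally have e: "exp (- (g^2 / (2 * \<sigma>^2))) = exp (- (g^2 / 2)) * exp (b * g^2)"
   by (simp add: exp_add[symmetric])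
  have "sqrt (2 * pi * \<sigma>^2) = \<sigma> * sqrt (2 * pi)" using s by (simp add: real_sqrt_mult)
  then have "normal_density 0 1 g * exp (b * g^2) = \<sigma> * normal_density 0 \<sigma> g"
   using s by (simp add: normal_density_def e)
  then show "ennreal (normal_density 0 1 g) * ennreal (exp (b * g^2)) = ennreal \<sigma> * ennreal (normal_density 0 \<sigma> g)"
   using s by (metis ennreal_mult' exp_ge_zero normal_density_nonneg less_imp_le)
 qed
 also have "... = ennreal \<sigma> * emeasure (density lborel (\<lambda>x. ennreal (normal_density 0 \<sigma> x))) UNIV"
  by (subst nn_integral_cmult) (auto simp: emeasure_density)
 also have "... = ennreal \<sigma>"
  using prob_space.emeasure_space_1[OF prob_space_normal_density[of \<sigma> 0]] s by simp
 finally show ?thesis by (simp add: \<sigma>_def)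
qed

section \<open>Sign vectors with planted correlations\<close>

text \<open>
 The set \<open>V\<close> contains the driven coordinates, and \<open>nb a\<close> is the set of free coordinates that drive \<open>a\<close>.  The bound
 on \<open>\<delta> * k\<close> keeps the conditional means away from -1 and 1.
\<close>

locale sign_model =
 fixes d k :: nat and V :: "nat set" and nb :: "nat => nat set" and \<delta> :: real
 assumes V: "V \<subseteq> {..<d}"
  and nb: "\<And>a. a \<in> V ==> nb a \<subseteq> {..<d} - V"
  and card_nb: "\<And>a. a \<in> V ==> card (nb a) \<le> k"
  and card_nb': "\<And>c. card {a\<in>V. c \<in> nb a} \<le> k"
  and \<delta>: "\<delta> \<ge> 0" "\<delta> * real k \<le> 1 / 2"
begin

definition J :: "(nat \<times> nat) set" where "J = Sigma V nb"

definition cube :: "(nat \<times> nat => real) set" where "cube = {\<theta>. \<forall>j\<in>J. \<bar>\<theta> j\<bar> \<le> 1}"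

definition \<Omega> :: "(nat => real) set" where "\<Omega> = PiE {..<d} (\<lambda>_. {-1, 1})"

text \<open>
 The conditional mean of the driven coordinate \<open>a\<close> given the free ones.
\<close>

definition m :: "(nat \<times> nat => real) => nat => (nat => real) => real" where
 "m \<theta> a x = \<delta> * (\<Sum>c\<in>nb a. \<theta> (a, c) * x c)"

text \<open>
 The law in which the coordinates in \<open>W\<close> are driven and all the others are uniform.  The model is \<open>w V\<close>, the uniform law is
 \<open>w {}\<close>, and the intermediate laws allow the driven coordinates to be removed one at a time.
\<close>

definition w :: "nat set => (nat \<times> nat => real) => (nat => real) => real" where
 "w W \<theta> x = (\<Prod>a\<in>W. 1 + x a * m \<theta> a x) / 2 ^ d"

definition z :: "(nat \<times> nat => real) => nat => (nat => real) => real" where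
 "z \<theta> a x = x a / (1 + x a * m \<theta> a x)"

text \<open>
 The derivative of \<open>ln (w V \<theta> x)\<close> with respect to \<open>\<theta> j\<close>.
\<close>

definition s :: "(nat \<times> nat => real) => nat \<times> nat => (nat => real) => real" where
 "s \<theta> j x = \<delta> * x (snd j) * z \<theta> (fst j) x"

definition E :: "nat set => (nat \<times> nat => real) => ((nat => real) => real) => real" where
 "E W \<theta> f = (\<Sum>x\<in>\<Omega>. w W \<theta> x * f x)"

definition flip :: "nat => (nat => real) => nat => real" where
 "flip a x = x(a := - x a)"

lemma finite_V: "finite V" using V by (rule finite_subset) simp

lemma finite_nb: "a \<in> V ==> finite (nb a)" using nb by (rule finite_subset) auto

lemma finite_J: "finite J" unfolding J_def using finite_V finite_nb by auto

lemma finite_\<Omega>: "finite \<Omega>" unfolding \<Omega>_def by (intro finite_PiE) auto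

lemma card_\<Omega>: "card \<Omega> = 2 ^ d" unfolding \<Omega>_def by (subst card_PiE) (auto simp: numeral_2_eq_2)

lemma \<Omega>_sign: "x \<in> \<Omega> ==> i < d ==> x i = 1 \<or> x i = -1"
 by (auto simp: \<Omega>_def PiE_def Pi_def)

lemma \<Omega>_square: "x \<in> \<Omega> ==> i < d ==> x i * x i = 1"
 using \<Omega>_sign[of x i] by auto

lemma \<Omega>_abs: "x \<in> \<Omega> ==> i < d ==> \<bar>x i\<bar> = 1"
 using \<Omega>_sign[of x i] by auto

lemma flip_\<Omega>: "x \<in> \<Omega> ==> a < d ==> flip a x \<in> \<Omega>"
 unfolding \<Omega>_def flip_def by (rule PiE_I) (auto simp: PiE_def Pi_def extensional_def)

lemma flip_flip [simp]: "flip a (flip a x) = x"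
 by (auto simp: flip_def)

lemma flip_same [simp]: "flip a x a = - x a"
 by (simp add: flip_def)

lemma flip_other [simp]: "i \<noteq> a ==> flip a x i = x i"
 by (simp add: flip_def)

lemma sum_flip: "a < d ==> (\<Sum>x\<in>\<Omega>. f (flip a x)) = (\<Sum>x\<in>\<Omega>. f x)"
 by (rule sum.reindex_bij_witness[where i = "flip a" and j = "flip a"]) (auto simp: flip_\<Omega>)

lemma sum_odd:
 assumes "a < d" "\<And>x. x \<in> \<Omega> ==> f (flip a x) = - f x"
 shows "(\<Sum>x\<in>\<Omega>. f x) = (0::real)"
proof -
 have "(\<Sum>x\<in>\<Omega>. f x) = (\<Sum>x\<in>\<Omega>. - f x)"
  using sum_flip[OF assms(1), of f] assms(2) by (metis (no_types, lifting) sum.cong)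
 then show ?thesis by (simp add: sum_negf)
qed

lemma m_flip: "a \<in> V ==> b \<in> V ==> m \<theta> b (flip a x) = m \<theta> b x"
proof -
 assume "a \<in> V" "b \<in> V"
 then have "\<And>c. c \<in> nb b ==> flip a x c = x c" using nb[of b] by (intro flip_other) auto
 then show ?thesis by (simp add: m_def)
qed

lemma z_flip: "a \<in> V ==> b \<in> V ==> a \<noteq> b ==> z \<theta> b (flip a x) = z \<theta> b x"
 by (simp add: z_def m_flip)

lemma w_flip: "a \<in> V ==> W \<subseteq> V ==> a \<notin> W ==> w W \<theta> (flip a x) = w W \<theta> x"
 unfolding w_def
 by (rule arg_cong[where f = "\<lambda>u. u / 2 ^ d"], rule prod.cong) (auto simp: m_flip subset_iff, metis flip_other)

lemma w_insert: "a \<notin> W ==> finite W ==> w (insert a W) \<theta> x = w W \<theta> x * (1 + x a * m \<theta> a x)"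
 by (simp add: w_def)

lemma w_remove: "a \<in> V ==> w V \<theta> x = w (V - {a}) \<theta> x * (1 + x a * m \<theta> a x)"
 using w_insert[of a "V - {a}"] finite_V by (simp add: insert_absorb)

lemma m_bound:
 assumes "\<theta> \<in> cube" "a \<in> V" "x \<in> \<Omega>"
 shows "\<bar>m \<theta> a x\<bar> \<le> 1 / 2"
proof -
 have "\<bar>\<Sum>c\<in>nb a. \<theta> (a, c) * x c\<bar> \<le> (\<Sum>c\<in>nb a. 1)"
 proof (rule order_trans[OF sum_abs], rule sum_mono)
  fix c assume c: "c \<in> nb a"
  then have "\<bar>\<theta> (a, c)\<bar> \<le> 1" "c < d" using assms nb[OF assms(2)] by (auto simp: cube_def J_def)
  then show "\<bar>\<theta> (a, c) * x c\<bar> \<le> 1" using \<Omega>_abs[OF assms(3)] by (simp add: abs_mult)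
 qed
 also have "... \<le> real k" using card_nb[OF assms(2)] by simp
 finally have "\<delta> * \<bar>\<Sum>c\<in>nb a. \<theta> (a, c) * x c\<bar> \<le> \<delta> * real k"
  using \<delta> by (intro mult_left_mono) auto
 then show ?thesis using \<delta> by (simp add: m_def abs_mult)
qed

lemma factor_pos:
 assumes "\<theta> \<in> cube" "a \<in> V" "x \<in> \<Omega>"
 shows "1 / 2 \<le> 1 + x a * m \<theta> a x"
proof -
 have "\<bar>x a * m \<theta> a x\<bar> \<le> 1 / 2"
  using m_bound[OF assms] \<Omega>_abs[OF assms(3), of a] V assms(2) by (auto simp: abs_mult)
 then show ?thesis by linarith
qed

lemma w_nonneg: "\<theta> \<in> cube ==> W \<subseteq> V ==> x \<in> \<Omega> ==> 0 \<le> w W \<theta> x"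
 unfolding w_def by (intro divide_nonneg_nonneg prod_nonneg) (auto dest!: factor_pos[of \<theta> _ x] subsetD)

lemma z_bound:
 assumes "\<theta> \<in> cube" "a \<in> V" "x \<in> \<Omega>"
 shows "\<bar>z \<theta> a x\<bar> \<le> 2"
 using factor_pos[OF assms] \<Omega>_abs[OF assms(3), of a] V assms(2) by (auto simp: z_def field_simps subset_iff)

text \<open>
 The two values of the driven coordinate \<open>a\<close> have total mass that does not depend on \<open>\<theta>\<close>, so a function that ignores
 this coordinate has the same mean whether or not \<open>a\<close> is driven.
\<close>

lemma E_insert:
 assumes "a \<in> V" "W \<subseteq> V" "a \<notin> W" "\<And>x. x \<in> \<Omega> ==> f (flip a x) = f x"
 shows "E (insert a W) \<theta> f = E W \<theta> f"
proof -
 have fW: "finite W" using assms finite_V by (auto intro: finite_subset)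
 have "E (insert a W) \<theta> f - E W \<theta> f = (\<Sum>x\<in>\<Omega>. w W \<theta> x * (x a * m \<theta> a x) * f x)"
  unfolding E_def using w_insert[OF assms(3) fW]
  by (simp add: sum_subtractf[symmetric] algebra_simps)
 also have "... = 0"
  using assms V by (intro sum_odd[of a]) (auto simp: w_flip m_flip)
 finally show ?thesis by simp
qed

lemma E_invariant:
 assumes "\<And>a x. a \<in> V ==> x \<in> \<Omega> ==> f (flip a x) = f x"
 shows "E V \<theta> f = E {} \<theta> f"
proof -
 have "E W \<theta> f = E {} \<theta> f" if "W \<subseteq> V" for W
  using finite_subset[OF that finite_V] that
 proof (induction W rule: finite_induct)
  case (insert a W)
  then have "a \<in> V" "W \<subseteq> V" by auto
  then have "E (insert a W) \<theta> f = E W \<theta> f"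
  proof (rule E_insert)
   show "a \<notin> W" by fact
   show "\<And>x. x \<in> \<Omega> ==> f (flip a x) = f x" by (rule assms[OF \<open>a \<in> V\<close>])
  qed
  with insert(3)[OF \<open>W \<subseteq> V\<close>] show ?case by (rule trans[rotated])
 qed (rule refl)
 from this[OF subset_refl] show ?thesis .
qed

lemma E_linear:
 "E W \<theta> (\<lambda>x. f x + g x) = E W \<theta> f + E W \<theta> g"
 "E W \<theta> (\<lambda>x. c * f x) = c * E W \<theta> f"
 "E W \<theta> (\<lambda>x. \<Sum>i\<in>I. h i x) = (\<Sum>i\<in>I. E W \<theta> (h i))"
proof -
 show "E W \<theta> (\<lambda>x. \<Sum>i\<in>I. h i x) = (\<Sum>i\<in>I. E W \<theta> (h i))"
  unfolding E_def sum_distrib_left by (rule sum.swap)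
qed (simp_all add: E_def algebra_simps sum.distrib sum_distrib_left)

lemma E_cong: "(\<And>x. x \<in> \<Omega> ==> f x = g x) ==> E W \<theta> f = E W \<theta> g"
 by (simp add: E_def)

lemma E_mono: "\<theta> \<in> cube ==> W \<subseteq> V ==> (\<And>x. x \<in> \<Omega> ==> f x \<le> g x) ==> E W \<theta> f \<le> E W \<theta> g"
 unfolding E_def by (intro sum_mono mult_left_mono w_nonneg)

text \<open>
 The coordinate \<open>x a\<close> may be replaced by its conditional mean.
\<close>

lemma E_mult_sign:
 assumes a: "a \<in> V" and g: "\<And>x. x \<in> \<Omega> ==> g (flip a x) = g x"
 shows "E V \<theta> (\<lambda>x. x a * g x) = E V \<theta> (\<lambda>x. m \<theta> a x * g x)"
proof -
 have ad: "a < d" using a V by auto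
 have "E V \<theta> (\<lambda>x. x a * g x) - E V \<theta> (\<lambda>x. m \<theta> a x * g x)
  = (\<Sum>x\<in>\<Omega>. w (V - {a}) \<theta> x * (x a * (1 - (m \<theta> a x)^2)) * g x)"
  unfolding E_def sum_subtractf[symmetric]
 proof (rule sum.cong[OF refl])
  fix x assume x: "x \<in> \<Omega>"
  have "(1 + x a * m \<theta> a x) * (x a - m \<theta> a x) = x a + (x a * x a - 1) * m \<theta> a x - x a * (m \<theta> a x)^2"
   by (simp add: algebra_simps power2_eq_square)
  also have "... = x a * (1 - (m \<theta> a x)^2)" using \<Omega>_square[OF x ad] by (simp add: algebra_simps)
  finally have "w (V - {a}) \<theta> x * ((1 + x a * m \<theta> a x) * (x a - m \<theta> a x)) * g x = w (V - {a}) \<theta> x * (x a * (1 - (m \<theta> a x)^2)) * g x"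
   by simp
  then show "w V \<theta> x * (x a * g x) - w V \<theta> x * (m \<theta> a x * g x) = w (V - {a}) \<theta> x * (x a * (1 - (m \<theta> a x)^2)) * g x"
   unfolding w_remove[OF a] by (simp add: algebra_simps)
 qed
 also have "... = 0"
  using a g ad by (intro sum_odd[of a]) (auto simp: w_flip m_flip)
 finally show ?thesis by simp
qed

text \<open>
 In \<open>z \<theta> a x\<close> the denominator cancels the factor of \<open>a\<close> in the density, and what is left is odd in \<open>x a\<close>.
\<close>

lemma E_z_zero:
 assumes th: "\<theta> \<in> cube" and a: "a \<in> V" and g: "\<And>x. x \<in> \<Omega> ==> g (flip a x) = g x"
 shows "E V \<theta> (\<lambda>x. z \<theta> a x * g x) = 0"
proof -
 have ad: "a < d" using a V by auto
 have "E V \<theta> (\<lambda>x. z \<theta> a x * g x) = (\<Sum>x\<in>\<Omega>. w (V - {a}) \<theta> x * x a * g x)"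
  unfolding E_def
 proof (rule sum.cong[OF refl])
  fix x assume x: "x \<in> \<Omega>"
  show "w V \<theta> x * (z \<theta> a x * g x) = w (V - {a}) \<theta> x * x a * g x"
   using factor_pos[OF th a x] unfolding w_remove[OF a] z_def by simp
 qed
 also have "... = 0"
  using a g ad by (intro sum_odd[of a]) (auto simp: w_flip)
 finally show ?thesis .
qed

lemma E_empty: "E {} \<theta> f = (\<Sum>x\<in>\<Omega>. f x) / 2 ^ d"
 by (simp add: E_def w_def sum_divide_distrib)

lemma E_empty_one: "E {} \<theta> (\<lambda>_. 1) = 1"
 by (simp add: E_empty card_\<Omega>)

lemma E_one: "E V \<theta> (\<lambda>_. 1) = 1"
 by (subst E_invariant) (auto simp: E_empty_one)

lemma E_empty_sign: "i < d ==> E {} \<theta> (\<lambda>x. x i) = 0"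
 unfolding E_empty by (subst sum_odd[of i]) auto

lemma E_empty_sign2:
 assumes "i < d" "j < d"
 shows "E {} \<theta> (\<lambda>x. x i * x j) = (if i = j then 1 else 0)"
proof (cases "i = j")
 case True
 have "E {} \<theta> (\<lambda>x. x i * x j) = E {} \<theta> (\<lambda>_. 1)" using assms True by (intro E_cong) (simp add: \<Omega>_square)
 then show ?thesis using True by (simp add: E_empty_one)
next
 case False
 then show ?thesis unfolding E_empty using assms by (subst sum_odd[of i]) auto
qed

subsection \<open>The family is a score family\<close>

lemma s_mean:
 assumes "\<theta> \<in> cube" "j \<in> J"
 shows "E V \<theta> (s \<theta> j) = 0"
proof -
 obtain a c where j: "j = (a, c)" "a \<in> V" "c \<in> nb a" using assms(2) by (auto simp: J_def)
 then have "c \<noteq> a" using nb by auto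
 have "E V \<theta> (s \<theta> j) = E V \<theta> (\<lambda>x. z \<theta> a x * (\<delta> * x c))"
  by (simp add: j s_def[abs_def] mult_ac)
 also have "... = 0" using assms(1) j \<open>c \<noteq> a\<close> by (intro E_z_zero) auto
 finally show ?thesis .
qed

lemma s_bound:
 assumes "\<theta> \<in> cube" "j \<in> J" "x \<in> \<Omega>"
 shows "\<bar>s \<theta> j x\<bar> \<le> 2 * \<delta>"
proof -
 obtain a c where j: "j = (a, c)" "a \<in> V" "c \<in> nb a" using assms(2) by (auto simp: J_def)
 then have "c < d" using nb by auto
 then have "\<bar>s \<theta> j x\<bar> = \<delta> * \<bar>z \<theta> a x\<bar>"
  using \<Omega>_abs[OF assms(3)] \<delta> by (simp add: s_def j abs_mult)
 also have "... \<le> \<delta> * 2" by (rule mult_left_mono[OF z_bound[OF assms(1) j(2) assms(3)] \<delta>(1)])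
 finally show ?thesis by simp
qed

text \<open>
 The square is a double sum over pairs of driven coordinates; the terms of distinct coordinates vanish by
 \<open>E_z_zero\<close>, and in the diagonal terms \<open>z\<close> is bounded by 2 and the free coordinates are orthonormal.
\<close>

lemma s_fisher:
 assumes th: "\<theta> \<in> cube"
 shows "E V \<theta> (\<lambda>x. (\<Sum>j\<in>J. u j * s \<theta> j x)^2) \<le> 4 * \<delta>^2 * (\<Sum>j\<in>J. (u j)^2)"
proof -
 define r where "r a x = (\<Sum>c\<in>nb a. u (a, c) * x c)" for a and x :: "nat => real"
 have r_flip: "r b (flip a x) = r b x" if "a \<in> V" "b \<in> V" for a b x
 proof -
  have "\<And>c. c \<in> nb b ==> flip a x c = x c" using nb[OF that(2)] that by (intro flip_other) auto
  then show ?thesis by (simp add: r_def)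
 qed
 have expand: "(\<Sum>j\<in>J. u j * s \<theta> j x) = \<delta> * (\<Sum>a\<in>V. z \<theta> a x * r a x)" for x
 proof -
  have "(\<Sum>j\<in>J. u j * s \<theta> j x) = (\<Sum>a\<in>V. \<Sum>c\<in>nb a. u (a, c) * s \<theta> (a, c) x)"
   using sum.Sigma[of V nb "\<lambda>a c. u (a, c) * s \<theta> (a, c) x"] finite_V finite_nb
   by (simp add: J_def case_prod_beta)
  then show ?thesis by (simp add: s_def r_def sum_distrib_left mult_ac)
 qed
 have cross: "E V \<theta> (\<lambda>x. z \<theta> a x * r a x * (z \<theta> b x * r b x)) = 0" if "a \<in> V" "b \<in> V" "a \<noteq> b" for a b
  using E_z_zero[OF th that(1), of "\<lambda>x. r a x * (z \<theta> b x * r b x)"] that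
  by (simp add: r_flip z_flip mult.assoc)
 have diag: "E V \<theta> (\<lambda>x. z \<theta> a x * r a x * (z \<theta> a x * r a x)) \<le> 4 * (\<Sum>c\<in>nb a. (u (a, c))^2)" if a: "a \<in> V" for a
 proof -
  have "E V \<theta> (\<lambda>x. z \<theta> a x * r a x * (z \<theta> a x * r a x)) \<le> E V \<theta> (\<lambda>x. 4 * (r a x)^2)"
  proof (rule E_mono[OF th subset_refl])
   fix x assume x: "x \<in> \<Omega>"
   have "(z \<theta> a x)^2 \<le> 4" using power_mono[OF z_bound[OF th a x], of 2] by simp
   then have "(z \<theta> a x)^2 * (r a x)^2 \<le> 4 * (r a x)^2" by (intro mult_right_mono) auto
   then show "z \<theta> a x * r a x * (z \<theta> a x * r a x) \<le> 4 * (r a x)^2" by (simp add: power2_eq_square mult_ac)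
  qed
  also have "... = 4 * E {} \<theta> (\<lambda>x. (r a x)^2)"
   using E_invariant[of "\<lambda>x. (r a x)^2"] a by (simp add: E_linear r_flip)
  also have "E {} \<theta> (\<lambda>x. (r a x)^2) = (\<Sum>c\<in>nb a. \<Sum>c'\<in>nb a. u (a, c) * u (a, c') * E {} \<theta> (\<lambda>x. x c * x c'))"
  proof -
   have "E {} \<theta> (\<lambda>x. (r a x)^2) = E {} \<theta> (\<lambda>x. \<Sum>c\<in>nb a. \<Sum>c'\<in>nb a. (u (a, c) * u (a, c')) * (x c * x c'))"
    unfolding r_def power2_eq_square sum_product by (intro E_cong sum.cong refl) (simp add: mult_ac)
   then show ?thesis by (simp only: E_linear)
  qed
  also have "... = (\<Sum>c\<in>nb a. \<Sum>c'\<in>nb a. if c' = c then u (a, c) * u (a, c') else 0)"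
   using nb[OF a] by (intro sum.cong refl) (auto simp: E_empty_sign2 subset_iff)
  also have "... = (\<Sum>c\<in>nb a. (u (a, c))^2)"
   using finite_nb[OF a] by (simp add: power2_eq_square)
  finally show ?thesis .
 qed
 have "E V \<theta> (\<lambda>x. (\<Sum>j\<in>J. u j * s \<theta> j x)^2)
  = E V \<theta> (\<lambda>x. \<delta>^2 * (\<Sum>a\<in>V. \<Sum>b\<in>V. z \<theta> a x * r a x * (z \<theta> b x * r b x)))"
  unfolding expand by (rule E_cong) (simp only: power_mult_distrib power2_eq_square[of "sum _ _"] sum_product)
 also have "... = \<delta>^2 * (\<Sum>a\<in>V. \<Sum>b\<in>V. E V \<theta> (\<lambda>x. z \<theta> a x * r a x * (z \<theta> b x * r b x)))"
  by (simp only: E_linear)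
 also have "... \<le> \<delta>^2 * (\<Sum>a\<in>V. \<Sum>b\<in>V. if b = a then 4 * (\<Sum>c\<in>nb a. (u (a, c))^2) else 0)"
  using cross diag by (intro mult_left_mono sum_mono) auto
 also have "... = 4 * \<delta>^2 * (\<Sum>a\<in>V. \<Sum>c\<in>nb a. (u (a, c))^2)"
  using finite_V by (simp add: sum_distrib_left mult_ac)
 also have "(\<Sum>a\<in>V. \<Sum>c\<in>nb a. (u (a, c))^2) = (\<Sum>j\<in>J. (u j)^2)"
  unfolding J_def using finite_V finite_nb by (subst sum.Sigma) (auto simp: case_prod_beta)
 finally show ?thesis .
qed

lemma w_deriv:
 assumes th: "\<theta> \<in> cube" and j: "j \<in> J" and x: "x \<in> \<Omega>"
 shows "DERIV (\<lambda>t. w V (\<theta>(j := t)) x) (\<theta> j) :> w V \<theta> x * s \<theta> j x"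
proof -
 obtain a c where jj: "j = (a, c)" "a \<in> V" "c \<in> nb a" using j by (auto simp: J_def)
 have other: "m (\<theta>(j := t)) b x = m \<theta> b x" if "b \<noteq> a" for b t
  using that by (simp add: m_def jj)
 have mt: "m (\<theta>(j := t)) a x = m \<theta> a x + \<delta> * (t - \<theta> j) * x c" for t
 proof -
  have "(\<Sum>c'\<in>nb a. (\<theta>(j := t)) (a, c') * x c') = (\<Sum>c'\<in>nb a. \<theta> (a, c') * x c' + (if c' = c then (t - \<theta> j) * x c else 0))"
   using jj by (intro sum.cong) (auto simp: algebra_simps)
  also have "... = (\<Sum>c'\<in>nb a. \<theta> (a, c') * x c') + (t - \<theta> j) * x c"
   using jj finite_nb by (simp add: sum.distrib)
  finally show ?thesis by (simp add: m_def distrib_left mult.assoc del: fun_upd_apply)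
 qed
 have wt: "w V (\<theta>(j := t)) x = w (V - {a}) \<theta> x * (1 + x a * (m \<theta> a x + \<delta> * (t - \<theta> j) * x c))" for t
 proof -
  have "w (V - {a}) (\<theta>(j := t)) x = w (V - {a}) \<theta> x"
   unfolding w_def using other by (intro arg_cong[where f = "\<lambda>u. u / 2 ^ d"] prod.cong) auto
  then show ?thesis using w_remove[OF jj(2), of "\<theta>(j := t)" x] by (simp only: mt)
 qed
 have "DERIV (\<lambda>t. w (V - {a}) \<theta> x * (1 + x a * (m \<theta> a x + \<delta> * (t - \<theta> j) * x c))) (\<theta> j) :>
   w (V - {a}) \<theta> x * (x a * (\<delta> * x c))"
  by (auto intro!: derivative_eq_intros)
 moreover have "w (V - {a}) \<theta> x * (x a * (\<delta> * x c)) = w V \<theta> x * s \<theta> j x"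
  using factor_pos[OF th jj(2) x] by (simp add: w_remove[OF jj(2)] s_def z_def jj)
 ultimately show ?thesis by (simp only: wt)
qed

lemma s_cont:
 assumes th: "\<theta> \<in> cube" and j: "j \<in> J" and x: "x \<in> \<Omega>"
 shows "isCont (\<lambda>t. s (\<theta>(j := t)) j x) (\<theta> j)"
proof -
 obtain a c where jj: "j = (a, c)" "a \<in> V" "c \<in> nb a" using j by (auto simp: J_def)
 have "isCont (\<lambda>t. m (\<theta>(j := t)) a x) (\<theta> j)"
 proof -
  have "isCont (\<lambda>t. (\<theta>(j := t)) (a, c)) (\<theta> j)" for c by (cases "(a, c) = j") auto
  then show ?thesis unfolding m_def by (intro continuous_intros)
 qed
 moreover have "1 + x a * m (\<theta>(j := \<theta> j)) a x \<noteq> 0"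
  using factor_pos[OF th jj(2) x] by simp
 ultimately show ?thesis unfolding s_def z_def jj(1) fst_conv snd_conv
  by (intro continuous_intros) (auto simp: jj)
qed

subsection \<open>Moments\<close>

lemma E_sign: "i < d ==> E V \<theta> (\<lambda>x. x i) = 0"
proof (cases "i \<in> V")
 case True
 assume i: "i < d"
 have "E V \<theta> (\<lambda>x. x i) = E V \<theta> (\<lambda>x. m \<theta> i x)"
  using E_mult_sign[OF True, of "\<lambda>_. 1"] by simp
 also have "... = E {} \<theta> (\<lambda>x. m \<theta> i x)"
  by (intro E_invariant m_flip True)
 also have "... = \<delta> * (\<Sum>c\<in>nb i. \<theta> (i, c) * E {} \<theta> (\<lambda>x. x c))"
  unfolding m_def E_linear ..
 also have "... = 0" using nb[OF True] by (simp add: E_empty_sign subset_iff)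
 finally show ?thesis .
next
 case False
 assume i: "i < d"
 have "E V \<theta> (\<lambda>x. x i) = E {} \<theta> (\<lambda>x. x i)"
  using False by (intro E_invariant) (metis flip_other)
 then show ?thesis using i by (simp add: E_empty_sign)
qed

lemma E_sign2_VU:
 assumes i: "i \<in> V" and j: "j < d" "j \<notin> V"
 shows "E V \<theta> (\<lambda>x. x i * x j) = (if j \<in> nb i then \<delta> * \<theta> (i, j) else 0)"
proof -
 have "i \<noteq> j" using i j by auto
 then have "E V \<theta> (\<lambda>x. x i * x j) = E V \<theta> (\<lambda>x. m \<theta> i x * x j)"
  using i by (intro E_mult_sign) auto
 also have "... = E {} \<theta> (\<lambda>x. m \<theta> i x * x j)"
  using j i by (intro E_invariant) (auto simp: m_flip, metis flip_other)
 also have "... = E {} \<theta> (\<lambda>x. \<delta> * (\<Sum>c\<in>nb i. \<theta> (i, c) * (x c * x j)))"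
  unfolding m_def by (simp add: sum_distrib_right mult.assoc)
 also have "... = \<delta> * (\<Sum>c\<in>nb i. \<theta> (i, c) * E {} \<theta> (\<lambda>x. x c * x j))"
  unfolding E_linear ..
 also have "... = \<delta> * (\<Sum>c\<in>nb i. if c = j then \<theta> (i, c) else 0)"
  using nb[OF i] j by (intro arg_cong[where f = "(*) \<delta>"] sum.cong refl) (auto simp: E_empty_sign2 subset_iff)
 also have "... = (if j \<in> nb i then \<delta> * \<theta> (i, j) else 0)"
  using finite_nb[OF i] by auto
 finally show ?thesis .
qed

text \<open>
 The product of two conditional means is a quadratic form in the free coordinates, in which only those that
 drive both coordinates survive; there are at most \<open>k\<close> of them.
\<close>

lemma E_sign2_VV:
 assumes th: "\<theta> \<in> cube" and i: "i \<in> V" and j: "j \<in> V" and ij: "i \<noteq> j"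
 shows "\<bar>E V \<theta> (\<lambda>x. x i * x j)\<bar> \<le> \<delta>"
  and "nb i \<inter> nb j = {} ==> E V \<theta> (\<lambda>x. x i * x j) = 0"
proof -
 have "E V \<theta> (\<lambda>x. x i * x j) = E V \<theta> (\<lambda>x. m \<theta> i x * x j)"
  using i ij by (intro E_mult_sign) auto
 also have "... = E V \<theta> (\<lambda>x. x j * m \<theta> i x)" by (simp add: mult.commute)
 also have "... = E V \<theta> (\<lambda>x. m \<theta> j x * m \<theta> i x)"
  using i j by (intro E_mult_sign) (auto simp: m_flip)
 also have "... = E {} \<theta> (\<lambda>x. m \<theta> j x * m \<theta> i x)"
  using i j by (intro E_invariant) (auto simp: m_flip)
 also have "... = E {} \<theta> (\<lambda>x. \<delta>^2 * (\<Sum>c\<in>nb j. \<Sum>c'\<in>nb i. (\<theta> (j, c) * \<theta> (i, c')) * (x c * x c')))"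
 proof (rule E_cong)
  fix x
  have "m \<theta> j x * m \<theta> i x = \<delta>^2 * ((\<Sum>c\<in>nb j. \<theta> (j, c) * x c) * (\<Sum>c\<in>nb i. \<theta> (i, c) * x c))"
   by (simp add: m_def power2_eq_square)
  also have "(\<Sum>c\<in>nb j. \<theta> (j, c) * x c) * (\<Sum>c\<in>nb i. \<theta> (i, c) * x c)
   = (\<Sum>c\<in>nb j. \<Sum>c'\<in>nb i. (\<theta> (j, c) * \<theta> (i, c')) * (x c * x c'))"
   unfolding sum_product by (intro sum.cong refl) (simp add: mult_ac)
  finally show "m \<theta> j x * m \<theta> i x = \<delta>^2 * (\<Sum>c\<in>nb j. \<Sum>c'\<in>nb i. (\<theta> (j, c) * \<theta> (i, c')) * (x c * x c'))" .
 qed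
 also have "... = \<delta>^2 * (\<Sum>c\<in>nb j. \<Sum>c'\<in>nb i. (\<theta> (j, c) * \<theta> (i, c')) * E {} \<theta> (\<lambda>x. x c * x c'))"
  by (simp only: E_linear)
 also have "(\<Sum>c\<in>nb j. \<Sum>c'\<in>nb i. (\<theta> (j, c) * \<theta> (i, c')) * E {} \<theta> (\<lambda>x. x c * x c'))
  = (\<Sum>c\<in>nb j. \<Sum>c'\<in>nb i. if c' = c then \<theta> (j, c) * \<theta> (i, c') else 0)"
  using nb[OF i] nb[OF j] by (intro sum.cong refl) (auto simp: E_empty_sign2 subset_iff)
 also have "... = (\<Sum>c\<in>nb j. if c \<in> nb i then \<theta> (j, c) * \<theta> (i, c) else 0)"
  using finite_nb[OF i] by (simp cong: if_cong)
 finally have eq: "E V \<theta> (\<lambda>x. x i * x j) = \<delta>^2 * (\<Sum>c\<in>nb j. if c \<in> nb i then \<theta> (j, c) * \<theta> (i, c) else 0)" .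
 have "\<bar>\<Sum>c\<in>nb j. if c \<in> nb i then \<theta> (j, c) * \<theta> (i, c) else 0\<bar> \<le> (\<Sum>c\<in>nb j. 1)"
 proof (rule order_trans[OF sum_abs], rule sum_mono)
  fix c assume c: "c \<in> nb j"
  show "\<bar>if c \<in> nb i then \<theta> (j, c) * \<theta> (i, c) else 0\<bar> \<le> 1"
   using c th i j by (auto simp: cube_def J_def abs_mult intro!: mult_le_one)
 qed
 also have "... \<le> real k" using card_nb[OF j] by simp
 finally have "\<bar>E V \<theta> (\<lambda>x. x i * x j)\<bar> \<le> \<delta>^2 * real k"
  unfolding eq by (simp add: abs_mult mult_left_mono)
 also have "... = \<delta> * (\<delta> * real k)" by (simp add: power2_eq_square)
 also have "... \<le> \<delta> * 1" using \<delta> by (intro mult_left_mono) auto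
 finally show "\<bar>E V \<theta> (\<lambda>x. x i * x j)\<bar> \<le> \<delta>" by simp
 show "nb i \<inter> nb j = {} ==> E V \<theta> (\<lambda>x. x i * x j) = 0"
  unfolding eq by (auto intro!: sum.neutral)
qed

lemma E_sign2_UU:
 assumes "i < d" "i \<notin> V" "j < d" "j \<notin> V"
 shows "E V \<theta> (\<lambda>x. x i * x j) = (if i = j then 1 else 0)"
proof -
 have "E V \<theta> (\<lambda>x. x i * x j) = E {} \<theta> (\<lambda>x. x i * x j)"
  using assms by (intro E_invariant) (metis flip_other)
 then show ?thesis using assms by (simp add: E_empty_sign2)
qed

lemma E_sign2_offdiag:
 assumes th: "\<theta> \<in> cube" and ij: "i < d" "j < d" "i \<noteq> j"
 shows "\<bar>E V \<theta> (\<lambda>x. x i * x j)\<bar> \<le> \<delta>"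
  and "\<not> (i \<in> V \<and> j \<in> nb i) ==> \<not> (j \<in> V \<and> i \<in> nb j) ==> \<not> (i \<in> V \<and> j \<in> V \<and> nb i \<inter> nb j \<noteq> {})
   ==> E V \<theta> (\<lambda>x. x i * x j) = 0"
proof -
 have b: "\<bar>\<delta> * \<theta> (a, c)\<bar> \<le> \<delta>" if "a \<in> V" "c \<in> nb a" for a c
 proof -
  have "\<bar>\<theta> (a, c)\<bar> \<le> 1" using th that by (auto simp: cube_def J_def)
  then show ?thesis using \<delta> by (simp add: abs_mult mult_left_le)
 qed
 have comm: "E V \<theta> (\<lambda>x. x i * x j) = E V \<theta> (\<lambda>x. x j * x i)" by (simp add: mult.commute)
 show "\<bar>E V \<theta> (\<lambda>x. x i * x j)\<bar> \<le> \<delta>"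
 proof (cases "i \<in> V"; cases "j \<in> V")
  assume "i \<notin> V" "j \<in> V"
  then show ?thesis unfolding comm using E_sign2_VU[of j i \<theta>] b \<delta> ij by auto
 qed (use E_sign2_VV(1)[OF th _ _ ij(3)] E_sign2_VU[of i j \<theta>] E_sign2_UU[of i j \<theta>] b \<delta> ij in auto)
 show "E V \<theta> (\<lambda>x. x i * x j) = 0"
  if "\<not> (i \<in> V \<and> j \<in> nb i)" "\<not> (j \<in> V \<and> i \<in> nb j)" "\<not> (i \<in> V \<and> j \<in> V \<and> nb i \<inter> nb j \<noteq> {})"
 proof (cases "i \<in> V"; cases "j \<in> V")
  assume "i \<notin> V" "j \<in> V"
  then show ?thesis unfolding comm using E_sign2_VU[of j i \<theta>] that ij by auto
 qed (use E_sign2_VV(2)[OF th _ _ ij(3)] E_sign2_VU[of i j \<theta>] E_sign2_UU[of i j \<theta>] that ij in auto)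
qed

subsection \<open>Exponential moments\<close>

lemma E_empty_exp_le: "E {} \<theta> (\<lambda>x. exp (\<Sum>i<d. u i * x i)) \<le> exp ((\<Sum>i<d. (u i)^2) / 2)"
proof -
 have "E {} \<theta> (\<lambda>x. exp (\<Sum>i<d. u i * x i)) = (\<Sum>x\<in>\<Omega>. \<Prod>i<d. exp (u i * x i) / 2)"
  by (simp add: E_empty exp_sum prod_dividef sum_divide_distrib)
 also have "... = (\<Prod>i<d. \<Sum>y\<in>{-1, 1}. exp (u i * y) / 2)"
  unfolding \<Omega>_def by (subst prod_sum_PiE) auto
 also have "... \<le> (\<Prod>i<d. exp ((u i)^2 / 2))"
 proof (intro prod_mono conjI)
  fix i
  show "0 \<le> (\<Sum>y\<in>{-1, 1::real}. exp (u i * y) / 2)" by (intro sum_nonneg) auto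
  show "(\<Sum>y\<in>{-1, 1}. exp (u i * y) / 2) \<le> exp ((u i)^2 / 2)"
   using two_point_hoeffding[of 0 "u i"] by (simp add: add_divide_distrib add.commute)
 qed
 also have "... = exp ((\<Sum>i<d. (u i)^2) / 2)" by (simp add: exp_sum sum_divide_distrib)
 finally show ?thesis .
qed

text \<open>
 Averaging over the two values of the coordinate \<open>a\<close> replaces \<open>exp (v a * x a)\<close> by the exponential moment of a sign with
 mean \<open>m \<theta> a x\<close>, which \<open>two_point_hoeffding\<close> bounds.
\<close>

lemma E_exp_remove:
 fixes v :: "nat => real"
 assumes th: "\<theta> \<in> cube" and W: "W \<subseteq> V" and a: "a \<in> V" "a \<notin> W"
  and H: "\<And>x. x \<in> \<Omega> ==> H (flip a x) = H x" "\<And>x. x \<in> \<Omega> ==> 0 \<le> H x"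
 shows "E (insert a W) \<theta> (\<lambda>x. H x * exp (v a * x a)) \<le> E W \<theta> (\<lambda>x. H x * exp (v a * m \<theta> a x + (v a)^2 / 2))"
proof -
 have ad: "a < d" using a V by auto
 have fW: "finite W" using W finite_V by (rule finite_subset)
 let ?f = "\<lambda>x. w W \<theta> x * (1 + x a * m \<theta> a x) * (H x * exp (v a * x a))"
 have "E (insert a W) \<theta> (\<lambda>x. H x * exp (v a * x a)) = (\<Sum>x\<in>\<Omega>. ?f x)"
  unfolding E_def using w_insert[OF a(2) fW] by simp
 also have "... = ((\<Sum>x\<in>\<Omega>. ?f x) + (\<Sum>x\<in>\<Omega>. ?f (flip a x))) / 2"
  using sum_flip[OF ad, of ?f] by simp
 also have "... = (\<Sum>x\<in>\<Omega>. (?f x + ?f (flip a x)) / 2)"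
  by (simp only: sum.distrib[symmetric] sum_divide_distrib[symmetric])
 also have "... \<le> (\<Sum>x\<in>\<Omega>. w W \<theta> x * (H x * exp (v a * m \<theta> a x + (v a)^2 / 2)))"
 proof (rule sum_mono)
  fix x assume x: "x \<in> \<Omega>"
  have m1: "\<bar>m \<theta> a x\<bar> \<le> 1" using m_bound[OF th a(1) x] by simp
  have G: "0 \<le> w W \<theta> x * H x" using w_nonneg[OF th W x] H(2)[OF x] by simp
  have "?f x + ?f (flip a x) = (w W \<theta> x * H x) * ((1 + x a * m \<theta> a x) * exp (v a * x a) + (1 - x a * m \<theta> a x) * exp (- (v a * x a)))"
   using x a W by (simp add: w_flip m_flip H algebra_simps)
  also have "(1 + x a * m \<theta> a x) * exp (v a * x a) + (1 - x a * m \<theta> a x) * exp (- (v a * x a))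
   = (1 + m \<theta> a x) * exp (v a) + (1 - m \<theta> a x) * exp (- v a)"
   using \<Omega>_sign[OF x ad] by auto
  also have "(w W \<theta> x * H x) * ... \<le> (w W \<theta> x * H x) * (2 * exp (v a * m \<theta> a x + (v a)^2 / 2))"
   using two_point_hoeffding[OF m1, of "v a"] by (intro mult_left_mono G) simp
  finally show "(?f x + ?f (flip a x)) / 2 \<le> w W \<theta> x * (H x * exp (v a * m \<theta> a x + (v a)^2 / 2))"
   by (simp add: mult_ac)
 qed
 finally show ?thesis by (simp add: E_def)
qed

text \<open>
 All the driven coordinates are removed one after another.  What remains is the exponential moment of a linear form
 under the uniform law, with coefficients \<open>u\<close> that collect the conditional means, and \<open>\<delta> * k \<le> 1 / 2\<close> makes the squared length of
 \<open>u\<close> comparable to that of \<open>v\<close>.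
\<close>

lemma E_exp_le:
 assumes th: "\<theta> \<in> cube"
 shows "E V \<theta> (\<lambda>x. exp (\<Sum>i<d. v i * x i)) \<le> exp (\<Sum>i<d. (v i)^2)"
proof -
 \<comment> \<open>the integrand when the coordinates in \<open>W\<close> are still driven and those in \<open>V - W\<close> have been removed\<close>
 define F where "F W x = exp ((\<Sum>a\<in>V - W. v a * m \<theta> a x + (v a)^2 / 2) + (\<Sum>i\<in>{..<d} - (V - W). v i * x i))" for W x
 have step: "E W \<theta> (F W) \<le> E {} \<theta> (F {})" if "W \<subseteq> V" for W
  using finite_subset[OF that finite_V] that
 proof (induction W rule: finite_induct)
  case (insert a W)
  then have a: "a \<in> V" "a \<notin> W" "W \<subseteq> V" "a < d" using V by auto
  define H where "H x = exp ((\<Sum>b\<in>V - insert a W. v b * m \<theta> b x + (v b)^2 / 2) + (\<Sum>i\<in>{..<d} - (V - W). v i * x i))" for x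
  have s1: "{..<d} - (V - insert a W) = insert a ({..<d} - (V - W))" "a \<notin> {..<d} - (V - W)"
   using a by auto
  have s2: "V - W = insert a (V - insert a W)" "a \<notin> V - insert a W" using a by auto
  have "E (insert a W) \<theta> (F (insert a W)) = E (insert a W) \<theta> (\<lambda>x. H x * exp (v a * x a))"
   unfolding F_def H_def s1(1) using s1(2) by (simp add: exp_add mult_ac)
  also have "... \<le> E W \<theta> (\<lambda>x. H x * exp (v a * m \<theta> a x + (v a)^2 / 2))"
  proof (rule E_exp_remove[OF th a(3) a(1) a(2)])
   fix x assume "x \<in> \<Omega>"
   have "(\<Sum>b\<in>V - insert a W. v b * m \<theta> b (flip a x) + (v b)^2 / 2) = (\<Sum>b\<in>V - insert a W. v b * m \<theta> b x + (v b)^2 / 2)"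
    using a by (intro sum.cong refl) (auto simp: m_flip)
   moreover have "(\<Sum>i\<in>{..<d} - (V - W). v i * flip a x i) = (\<Sum>i\<in>{..<d} - (V - W). v i * x i)"
    using s1(2) by (intro sum.cong refl) (metis flip_other)
   ultimately show "H (flip a x) = H x" by (simp add: H_def)
   show "0 \<le> H x" by (simp add: H_def)
  qed
  also have "... = E W \<theta> (F W)"
  proof (rule E_cong)
   fix x
   have "(\<Sum>a\<in>V - W. v a * m \<theta> a x + (v a)^2 / 2) = v a * m \<theta> a x + (v a)^2 / 2 + (\<Sum>b\<in>V - insert a W. v b * m \<theta> b x + (v b)^2 / 2)"
    by (subst s2(1), subst sum.insert) (use finite_V s2(2) in auto)
   then show "H x * exp (v a * m \<theta> a x + (v a)^2 / 2) = F W x"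
    by (simp add: F_def H_def exp_add[symmetric] add_ac)
  qed
  also have "... \<le> E {} \<theta> (F {})" using insert a by auto
  finally show ?case .
 qed simp
 \<comment> \<open>the linear form in the free coordinates that is left when all the driven ones are removed\<close>
 define u where "u i = (if i \<in> V then 0 else v i + \<delta> * (\<Sum>a | a \<in> V \<and> i \<in> nb a. v a * \<theta> (a, i)))" for i
 have vm: "(\<Sum>a\<in>V. v a * m \<theta> a x) = (\<Sum>i\<in>{..<d} - V. \<delta> * (\<Sum>a | a \<in> V \<and> i \<in> nb a. v a * \<theta> (a, i)) * x i)" for x
 proof -
  have "(\<Sum>a\<in>V. v a * m \<theta> a x) = (\<Sum>a\<in>V. \<Sum>i\<in>nb a. \<delta> * v a * \<theta> (a, i) * x i)"
   by (simp add: m_def sum_distrib_left mult_ac)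
  also have "... = (\<Sum>a\<in>V. \<Sum>i\<in>{..<d} - V. if i \<in> nb a then \<delta> * v a * \<theta> (a, i) * x i else 0)"
   by (intro sum.cong refl sum.mono_neutral_cong_left) (use nb in auto)
  also have "... = (\<Sum>i\<in>{..<d} - V. \<Sum>a\<in>V. if i \<in> nb a then \<delta> * v a * \<theta> (a, i) * x i else 0)"
   by (rule sum.swap)
  also have "... = (\<Sum>i\<in>{..<d} - V. \<Sum>a | a \<in> V \<and> i \<in> nb a. \<delta> * v a * \<theta> (a, i) * x i)"
   using finite_V by (intro sum.cong refl sum.inter_filter[symmetric])
  finally show ?thesis by (simp add: sum_distrib_left sum_distrib_right mult_ac)
 qed
 have u_sum: "(\<Sum>i<d. u i * x i) = (\<Sum>a\<in>V. v a * m \<theta> a x) + (\<Sum>i\<in>{..<d} - V. v i * x i)" for x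
 proof -
  have "(\<Sum>i<d. u i * x i) = (\<Sum>i\<in>{..<d} - V. u i * x i)"
   by (rule sum.mono_neutral_right) (auto simp: u_def)
  then show ?thesis unfolding vm by (simp add: u_def sum.distrib[symmetric] algebra_simps)
 qed
 have "E V \<theta> (\<lambda>x. exp (\<Sum>i<d. v i * x i)) = E V \<theta> (F V)" by (rule E_cong) (simp add: F_def)
 also have "... \<le> E {} \<theta> (F {})" by (rule step) simp
 also have "... = exp ((\<Sum>a\<in>V. (v a)^2) / 2) * E {} \<theta> (\<lambda>x. exp (\<Sum>i<d. u i * x i))"
  unfolding F_def u_sum E_linear(2)[symmetric]
  by (intro E_cong) (simp add: exp_add[symmetric] sum.distrib sum_divide_distrib add_ac)
 also have "... \<le> exp ((\<Sum>a\<in>V. (v a)^2) / 2) * exp ((\<Sum>i<d. (u i)^2) / 2)"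
  by (intro mult_left_mono E_empty_exp_le) simp
 also have "... = exp ((\<Sum>a\<in>V. (v a)^2) / 2 + (\<Sum>i<d. (u i)^2) / 2)" by (simp add: exp_add)
 also have "... \<le> exp (\<Sum>i<d. (v i)^2)"
 proof -
  have "(\<Sum>i<d. (u i)^2) = (\<Sum>i\<in>{..<d} - V. (v i + \<delta> * (\<Sum>a | a \<in> V \<and> i \<in> nb a. v a * \<theta> (a, i)))^2)"
   by (rule sum.mono_neutral_cong_right) (auto simp: u_def)
  also have "... \<le> (\<Sum>i\<in>{..<d} - V. 2 * (v i)^2 + 2 * \<delta>^2 * real k * (\<Sum>a | a \<in> V \<and> i \<in> nb a. (v a)^2))"
  proof (rule sum_mono)
   fix i
   let ?A = "{a. a \<in> V \<and> i \<in> nb a}" let ?S = "\<Sum>a\<in>?A. v a * \<theta> (a, i)"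
   have "?S^2 \<le> (\<Sum>a\<in>?A. (v a)^2) * (\<Sum>a\<in>?A. (\<theta> (a, i))^2)" by (rule Cauchy_Schwarz_ineq_sum)
   also have "... \<le> (\<Sum>a\<in>?A. (v a)^2) * (\<Sum>a\<in>?A. 1)"
    using th by (intro mult_left_mono sum_mono sum_nonneg) (auto simp: cube_def J_def abs_square_le_1)
   also have "... \<le> (\<Sum>a\<in>?A. (v a)^2) * real k"
    using card_nb'[of i] by (intro mult_left_mono sum_nonneg) auto
   finally have S: "?S^2 \<le> real k * (\<Sum>a\<in>?A. (v a)^2)" by (simp add: mult.commute)
   have "(v i + \<delta> * ?S)^2 \<le> 2 * (v i)^2 + 2 * \<delta>^2 * ?S^2"
    using zero_le_power2[of "v i - \<delta> * ?S"] by (simp add: power2_eq_square algebra_simps)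
   also have "... \<le> 2 * (v i)^2 + 2 * \<delta>^2 * (real k * (\<Sum>a\<in>?A. (v a)^2))"
    using S by (intro add_left_mono mult_left_mono) auto
   finally show "(v i + \<delta> * ?S)^2 \<le> 2 * (v i)^2 + 2 * \<delta>^2 * real k * (\<Sum>a\<in>?A. (v a)^2)"
    by (simp add: mult.assoc)
  qed
  also have "... = 2 * (\<Sum>i\<in>{..<d} - V. (v i)^2) + 2 * \<delta>^2 * real k * (\<Sum>i\<in>{..<d} - V. \<Sum>a | a \<in> V \<and> i \<in> nb a. (v a)^2)"
   by (simp add: sum.distrib sum_distrib_left)
  also have "(\<Sum>i\<in>{..<d} - V. \<Sum>a | a \<in> V \<and> i \<in> nb a. (v a)^2) = (\<Sum>i\<in>{..<d} - V. \<Sum>a\<in>V. if i \<in> nb a then (v a)^2 else 0)"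
   using finite_V by (intro sum.cong refl sum.inter_filter)
  also have "... = (\<Sum>a\<in>V. \<Sum>i\<in>{..<d} - V. if i \<in> nb a then (v a)^2 else 0)" by (rule sum.swap)
  also have "... = (\<Sum>a\<in>V. real (card (nb a)) * (v a)^2)"
  proof (intro sum.cong refl)
   fix a assume "a \<in> V"
   have "(\<Sum>i\<in>{..<d} - V. if i \<in> nb a then (v a)^2 else 0) = (\<Sum>i\<in>({..<d} - V) \<inter> nb a. (v a)^2)"
    by (rule sum.inter_restrict[symmetric]) simp
   also have "({..<d} - V) \<inter> nb a = nb a" using nb[OF \<open>a \<in> V\<close>] by auto
   finally show "(\<Sum>i\<in>{..<d} - V. if i \<in> nb a then (v a)^2 else 0) = real (card (nb a)) * (v a)^2" by simp
  qed
  also have "2 * (\<Sum>i\<in>{..<d} - V. (v i)^2) + 2 * \<delta>^2 * real k * (\<Sum>a\<in>V. real (card (nb a)) * (v a)^2)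
   \<le> 2 * (\<Sum>i\<in>{..<d} - V. (v i)^2) + 2 * \<delta>^2 * real k * (\<Sum>a\<in>V. real k * (v a)^2)"
   using card_nb \<delta> by (intro add_left_mono mult_left_mono sum_mono mult_right_mono) auto
  also have "2 * \<delta>^2 * real k * (\<Sum>a\<in>V. real k * (v a)^2) = 2 * (\<delta> * real k)^2 * (\<Sum>a\<in>V. (v a)^2)"
   by (simp add: power2_eq_square sum_distrib_left mult_ac)
  also have "... \<le> 2 * (1 / 2)^2 * (\<Sum>a\<in>V. (v a)^2)"
   using \<delta> by (intro mult_right_mono mult_left_mono power_mono sum_nonneg) auto
  finally have "(\<Sum>i<d. (u i)^2) \<le> 2 * (\<Sum>i\<in>{..<d} - V. (v i)^2) + (\<Sum>a\<in>V. (v a)^2) / 2"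
   by (simp add: power2_eq_square)
  moreover have "(\<Sum>i<d. (v i)^2) = (\<Sum>i\<in>{..<d} - V. (v i)^2) + (\<Sum>a\<in>V. (v a)^2)"
   using V by (intro sum.subset_diff) auto
  moreover have "(\<Sum>a\<in>V. (v a)^2) \<ge> 0" by (intro sum_nonneg) simp
  ultimately show ?thesis by simp
 qed
 finally show ?thesis .
qed

text \<open>
 Averaging \<open>E_exp_le\<close> over a Gaussian multiple of \<open>v\<close>.  The constant 3/16 makes the final Gaussian integral
 \<open>1 / sqrt (1 - 3 / 4) = 2\<close>.
\<close>

lemma E_exp_square_le:
 assumes th: "\<theta> \<in> cube" and v: "(\<Sum>i<d. (v i)^2) = 1"
 shows "E V \<theta> (\<lambda>x. exp (3 / 16 * (\<Sum>i<d. v i * x i)^2)) \<le> 2"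
proof -
 let ?t = "\<lambda>x. \<Sum>i<d. v i * x i"
 let ?s = "sqrt (3 / 8)"
 have s2: "?s^2 = 3 / 8" by simp
 have "ennreal (E V \<theta> (\<lambda>x. exp (3 / 16 * (?t x)^2))) = (\<Sum>x\<in>\<Omega>. ennreal (w V \<theta> x) * ennreal (exp ((?s * ?t x)^2 / 2)))"
  unfolding E_def using w_nonneg[OF th subset_refl]
  by (subst sum_ennreal[symmetric]) (auto simp: ennreal_mult power_mult_distrib intro!: sum.cong)
 also have "... = (\<Sum>x\<in>\<Omega>. ennreal (w V \<theta> x) * (\<integral>\<^sup>+g. ennreal (exp (?s * ?t x * g)) \<partial>std_normal))"
  by (simp only: std_normal_exp_linear)
 also have "... = (\<integral>\<^sup>+g. (\<Sum>x\<in>\<Omega>. ennreal (w V \<theta> x) * ennreal (exp (?s * ?t x * g))) \<partial>std_normal)"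
  by (subst nn_integral_sum) (auto simp: nn_integral_cmult)
 also have "... \<le> (\<integral>\<^sup>+g. ennreal (exp (3 / 8 * g^2)) \<partial>std_normal)"
 proof (rule nn_integral_mono)
  fix g :: real
  have "(\<Sum>x\<in>\<Omega>. ennreal (w V \<theta> x) * ennreal (exp (?s * ?t x * g))) = ennreal (E V \<theta> (\<lambda>x. exp (\<Sum>i<d. (?s * g * v i) * x i)))"
   unfolding E_def using w_nonneg[OF th subset_refl]
   by (subst sum_ennreal[symmetric]) (auto simp: ennreal_mult sum_distrib_left sum_distrib_right mult_ac intro!: sum.cong)
  also have "... \<le> ennreal (exp (\<Sum>i<d. (?s * g * v i)^2))"
   by (intro ennreal_leI E_exp_le th)
  also have "(\<Sum>i<d. (?s * g * v i)^2) = ?s^2 * g^2 * (\<Sum>i<d. (v i)^2)"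
   by (simp add: power_mult_distrib sum_distrib_left)
  finally show "(\<Sum>x\<in>\<Omega>. ennreal (w V \<theta> x) * ennreal (exp (?s * ?t x * g))) \<le> ennreal (exp (3 / 8 * g^2))"
   unfolding v s2 by simp
 qed
 also have "... = ennreal (1 / sqrt (1 - 2 * (3 / 8)))" by (rule std_normal_exp_square) simp
 also have "1 / sqrt (1 - 2 * (3 / 8)) = (2::real)" by (simp add: real_sqrt_divide)
 finally show ?thesis by (subst (asm) ennreal_le_iff) auto
qed

end

section \<open>From the planted correlations to the minimax risk\<close>

lemma prod_mono_ennreal:
 fixes f g :: "'a => ennreal"
 shows "(\<And>i. i \<in> I ==> f i \<le> g i) ==> prod f I \<le> prod g I"
 by (induction I rule: infinite_finite_induct) (auto intro!: mult_mono)

context sign_model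
begin

lemma scores: "score_family J \<Omega> (w V) s (4 * \<delta>^2) (2 * \<delta>)"
proof (unfold_locales, unfold cube_def[symmetric])
 fix \<theta> :: "nat \<times> nat => real" and j :: "nat \<times> nat" and x and u :: "nat \<times> nat => real"
 show "finite J" "finite \<Omega>" by (fact finite_J finite_\<Omega>)+
 show "\<theta> \<in> cube ==> x \<in> \<Omega> ==> 0 \<le> w V \<theta> x" by (rule w_nonneg) auto
 show "\<theta> \<in> cube ==> (\<Sum>x\<in>\<Omega>. w V \<theta> x) = 1" using E_one[of \<theta>] by (simp add: E_def)
 show "\<theta> \<in> cube ==> j \<in> J ==> x \<in> \<Omega> ==> DERIV (\<lambda>t. w V (\<theta>(j := t)) x) (\<theta> j) :> w V \<theta> x * s \<theta> j x"
  by (rule w_deriv)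
 show "\<theta> \<in> cube ==> j \<in> J ==> x \<in> \<Omega> ==> isCont (\<lambda>t. s (\<theta>(j := t)) j x) (\<theta> j)" by (rule s_cont)
 show "\<theta> \<in> cube ==> j \<in> J ==> x \<in> \<Omega> ==> \<bar>s \<theta> j x\<bar> \<le> 2 * \<delta>" by (rule s_bound)
 show "\<theta> \<in> cube ==> j \<in> J ==> (\<Sum>x\<in>\<Omega>. w V \<theta> x * s \<theta> j x) = 0" using s_mean[of \<theta> j] by (simp add: E_def)
 show "\<theta> \<in> cube ==> (\<Sum>x\<in>\<Omega>. w V \<theta> x * (\<Sum>j\<in>J. u j * s \<theta> j x)^2) \<le> 4 * \<delta>^2 * (\<Sum>j\<in>J. (u j)^2)"
  using s_fisher[of \<theta> u] by (simp add: E_def)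
 have c[measurable]: "(\<lambda>\<theta>. \<theta> j) \<in> borel_measurable (PiM J (\<lambda>_. borel))" if "j \<in> J" for j :: "nat \<times> nat"
  using that by (rule measurable_component_singleton)
 have m: "(\<lambda>\<theta>. m \<theta> a x) \<in> borel_measurable (PiM J (\<lambda>_. borel))" if "a \<in> V" for a x
  unfolding m_def using that by (intro borel_measurable_times borel_measurable_sum c) (auto simp: J_def)
 show "(\<lambda>\<theta>. w V \<theta> x) \<in> borel_measurable (PiM J (\<lambda>_. borel))"
  unfolding w_def by (intro borel_measurable_divide borel_measurable_prod borel_measurable_add borel_measurable_times m) auto
 show "j \<in> J ==> (\<lambda>\<theta>. s \<theta> j x) \<in> borel_measurable (PiM J (\<lambda>_. borel))"
  unfolding s_def z_def
  by (intro borel_measurable_times borel_measurable_divide borel_measurable_add m) (auto simp: J_def)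
qed

text \<open>
 The signs are scaled by \<open>c\<close> to meet the bounds \<open>K\<close> and \<open>M0\<close> of the model.
\<close>

definition sc :: "real => (nat => real) => nat => real" where
 "sc c x = (\<lambda>i\<in>{..<d}. c * x i)"

definition law :: "real => (nat \<times> nat => real) => (nat => real) measure" where
 "law c \<theta> = distr (point_measure \<Omega> (\<lambda>x. ennreal (w V \<theta> x))) (vec_space d) (sc c)"

lemma sc_space: "sc c x \<in> space (vec_space d)"
 by (auto simp: sc_def vec_space_def space_PiM)

lemma sc_measurable: "sc c \<in> point_measure \<Omega> f \<rightarrow>\<^sub>M vec_space d"
 using sc_space by (simp add: measurable_point_measure_eq1)

lemma sc_apply [simp]: "i < d ==> sc c x i = c * x i"
 by (simp add: sc_def)

lemma sets_law [simp]: "sets (law c \<theta>) = sets (vec_space d)"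
 by (simp add: law_def)

lemma nn_integral_law:
 assumes "f \<in> borel_measurable (vec_space d)"
 shows "(\<integral>\<^sup>+x. f x \<partial>law c \<theta>) = (\<Sum>x\<in>\<Omega>. f (sc c x) * ennreal (w V \<theta> x))"
 unfolding law_def using assms
 by (subst nn_integral_distr[OF sc_measurable]) (auto simp: nn_integral_point_measure_finite finite_\<Omega> mult.commute)

lemma integral_law:
 fixes f :: "_ => real"
 assumes th: "\<theta> \<in> cube" and "f \<in> borel_measurable (vec_space d)"
 shows "(\<integral>x. f x \<partial>law c \<theta>) = E V \<theta> (\<lambda>x. f (sc c x))"
 unfolding law_def using assms(2) w_nonneg[OF th subset_refl]
 by (subst integral_distr[OF sc_measurable]) (auto simp: lebesgue_integral_point_measure_finite finite_\<Omega> E_def)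

lemma integrable_law:
 fixes f :: "_ => real"
 assumes th: "\<theta> \<in> cube" and f: "f \<in> borel_measurable (vec_space d)"
 shows "integrable (law c \<theta>) f"
 unfolding law_def using finite_\<Omega> w_nonneg[OF th subset_refl]
 by (subst integrable_distr_eq[OF sc_measurable f]) (auto simp: integrable_point_measure_finite)

lemma prob_law:
 assumes th: "\<theta> \<in> cube"
 shows "prob_space (law c \<theta>)"
proof (rule prob_spaceI)
 have "emeasure (law c \<theta>) (space (law c \<theta>)) = (\<integral>\<^sup>+x. 1 \<partial>law c \<theta>)" by simp
 also have "... = (\<Sum>x\<in>\<Omega>. ennreal (w V \<theta> x))" by (subst nn_integral_law) auto
 also have "... = ennreal (E V \<theta> (\<lambda>_. 1))"
  using w_nonneg[OF th subset_refl] by (simp add: E_def sum_ennreal)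
 finally show "emeasure (law c \<theta>) (space (law c \<theta>)) = 1" by (simp add: E_one)
qed

lemma coord_measurable [measurable]: "i < d ==> (\<lambda>x. x i) \<in> borel_measurable (vec_space d)"
 unfolding vec_space_def by (rule measurable_component_singleton) simp

lemma mean_law: "\<theta> \<in> cube ==> i < d ==> mean_vec (law c \<theta>) i = 0"
 unfolding mean_vec_def by (subst integral_law) (auto simp: E_linear E_sign)

lemma cov_law:
 assumes th: "\<theta> \<in> cube" and ij: "i < d" "j < d"
 shows "cov_mat d (law c \<theta>) (i, j) = c^2 * E V \<theta> (\<lambda>x. x i * x j)"
proof -
 have "cov_mat d (law c \<theta>) (i, j) = (\<integral>x. x i * x j \<partial>law c \<theta>)"
  using ij mean_law[OF th] by (simp add: cov_mat_def)
 also have "... = E V \<theta> (\<lambda>x. c^2 * (x i * x j))"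
  using th ij by (subst integral_law) (auto simp: power2_eq_square mult_ac)
 finally show ?thesis by (simp only: E_linear)
qed

text \<open>
 Linearizing the exponential in \<open>E_exp_square_le\<close>: \<open>1 + 3 / 16 * t \<le> exp (3 / 16 * t)\<close>.
\<close>

lemma second_moment_le:
 assumes th: "\<theta> \<in> cube"
 shows "E V \<theta> (\<lambda>x. (\<Sum>i<d. v i * x i)^2) \<le> 16 / 3 * (\<Sum>i<d. (v i)^2)"
proof (cases "(\<Sum>i<d. (v i)^2) = 0")
 case True
 then have "\<forall>i<d. v i = 0" by (subst (asm) sum_nonneg_eq_0_iff) auto
 then show ?thesis by (simp add: E_def)
next
 case False
 define r where "r = sqrt (\<Sum>i<d. (v i)^2)"
 have r: "r > 0" "r^2 = (\<Sum>i<d. (v i)^2)"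
  using False sum_nonneg[of "{..<d}" "\<lambda>i. (v i)^2"] by (auto simp: r_def less_le)
 have unit: "(\<Sum>i<d. (v i / r)^2) = 1" using r(1) by (simp add: power_divide r(2)[symmetric] flip: sum_divide_distrib)
 have scaled: "(\<Sum>i<d. v i / r * x i)^2 = (\<Sum>i<d. v i * x i)^2 / r^2" for x :: "nat => real"
  by (simp add: power_divide[symmetric] sum_divide_distrib)
 have "1 + E V \<theta> (\<lambda>x. 3 / 16 * (\<Sum>i<d. v i / r * x i)^2) = E V \<theta> (\<lambda>x. 1 + 3 / 16 * (\<Sum>i<d. v i / r * x i)^2)"
  by (simp only: E_linear E_one)
 also have "... \<le> E V \<theta> (\<lambda>x. exp (3 / 16 * (\<Sum>i<d. v i / r * x i)^2))"
  by (intro E_mono th subset_refl exp_ge_add_one_self)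
 also have "... \<le> 2" by (rule E_exp_square_le[OF th unit])
 finally have "3 / (16 * r^2) * E V \<theta> (\<lambda>x. (\<Sum>i<d. v i * x i)^2) \<le> 1"
  unfolding scaled by (subst E_linear(2)[symmetric]) (simp add: mult_ac)
 then have "E V \<theta> (\<lambda>x. (\<Sum>i<d. v i * x i)^2) * 3 \<le> 16 * r^2"
  using r(1) by (simp add: field_simps)
 then show ?thesis unfolding r(2) by simp
qed

text \<open>
 The covariances are at most \<open>c^2 * \<delta>\<close> and vanish at distance \<open>L\<close>.  Hence the pointwise bound is needed at
 distances below \<open>L\<close> only, and a row has at most \<open>2 * L\<close> nonzero entries off the diagonal, which gives the row-tail bound because
 \<open>L * L powr (- (\<alpha> + 1)) = L powr (- \<alpha>)\<close>.
\<close>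

lemma law_in_class:
 assumes th: "\<theta> \<in> cube" and par: "\<alpha> > 0" "K > 0" "M0 > 0" "M > 0"
  and c: "c > 0" "c \<le> K / 3" "c^2 \<le> M0 / 9"
  and near: "\<And>a e. a \<in> V ==> e \<in> nb a ==> \<bar>real a - real e\<bar> < real L"
   "\<And>a b. a \<in> V ==> b \<in> V ==> nb a \<inter> nb b \<noteq> {} ==> \<bar>real a - real b\<bar> < real L"
  and L: "L \<ge> 1" and small: "2 * c^2 * \<delta> \<le> M * real L powr (- (\<alpha> + 1))"
  and \<J>: "\<J> \<in> {row_tail_class, pointwise_class}"
 shows "law c \<theta> \<in> dist_class \<J> \<alpha> K M0 M d"
proof -
 let ?C = "cov_mat d (law c \<theta>)"
 have cov0: "?C (i, j) = 0" if "i < d" "j < d" "i \<noteq> j" "\<bar>real i - real j\<bar> \<ge> real L" for i j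
  using E_sign2_offdiag(2)[OF th that(1-3)] near(1)[of i j] near(1)[of j i] near(2)[of i j] that
  by (auto simp: cov_law[OF th] abs_minus_commute not_less[symmetric])
 have covs: "\<bar>?C (i, j)\<bar> \<le> c^2 * \<delta>" if "i < d" "j < d" "i \<noteq> j" for i j
  using E_sign2_offdiag(1)[OF th that] that by (simp add: cov_law[OF th] abs_mult mult_left_mono)
 have cd: "0 \<le> c^2 * \<delta>" using \<delta> by simp
 have quad: "(\<Sum>i<d. \<Sum>j<d. v i * ?C (i, j) * v j) = c^2 * E V \<theta> (\<lambda>x. (\<Sum>i<d. v i * x i)^2)" for v
 proof -
  have "(\<Sum>i<d. \<Sum>j<d. v i * ?C (i, j) * v j) = c^2 * (\<Sum>i<d. \<Sum>j<d. (v i * v j) * E V \<theta> (\<lambda>x. x i * x j))"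
   by (simp add: cov_law[OF th] sum_distrib_left mult_ac)
  also have "(\<Sum>i<d. \<Sum>j<d. (v i * v j) * E V \<theta> (\<lambda>x. x i * x j)) = E V \<theta> (\<lambda>x. \<Sum>i<d. \<Sum>j<d. (v i * v j) * (x i * x j))"
   by (simp only: E_linear)
  also have "... = E V \<theta> (\<lambda>x. (\<Sum>i<d. v i * x i)^2)"
   by (intro E_cong) (simp add: power2_eq_square sum_product mult_ac)
  finally show ?thesis .
 qed
 have sym: "?C (i, j) = ?C (j, i)" if "i < d" "j < d" for i j
  using that by (simp add: cov_law[OF th] mult.commute)
 have bc: "?C \<in> bounded_covariances M0 d"
  unfolding bounded_covariances_def
 proof (intro CollectI conjI)
  show "?C \<in> space (mat_space d)" by (auto simp: mat_space_def space_PiM cov_mat_def)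
  show "loewner_le d (\<lambda>_. 0) ?C"
   unfolding loewner_le_def psd_def using sym quad E_mono[OF th subset_refl, of "\<lambda>_. 0"]
   by (auto simp: E_def intro!: mult_nonneg_nonneg sum_nonneg w_nonneg[OF th])
  show "loewner_le d ?C (\<lambda>(i, j). if i = j then M0 else 0)"
   unfolding loewner_le_def psd_def
  proof (intro conjI allI impI)
   fix v :: "nat => real"
   have "c^2 * E V \<theta> (\<lambda>x. (\<Sum>i<d. v i * x i)^2) \<le> c^2 * (16 / 3 * (\<Sum>i<d. (v i)^2))"
    by (intro mult_left_mono second_moment_le th) simp
   also have "... \<le> (M0 / 9) * (16 / 3 * (\<Sum>i<d. (v i)^2))"
    using c by (intro mult_right_mono) (auto intro!: sum_nonneg)
   also have "... \<le> M0 * (\<Sum>i<d. (v i)^2)"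
    using par sum_nonneg[of "{..<d}" "\<lambda>i. (v i)^2"] by (simp add: field_simps mult_right_mono)
   finally have "c^2 * E V \<theta> (\<lambda>x. (\<Sum>i<d. v i * x i)^2) \<le> M0 * (\<Sum>i<d. (v i)^2)" .
   moreover have "(\<Sum>i<d. \<Sum>j<d. v i * ((case (i, j) of (i, j) => if i = j then M0 else 0) - ?C (i, j)) * v j)
    = (\<Sum>i<d. \<Sum>j<d. (if j = i then M0 * (v i * v j) else 0)) - (\<Sum>i<d. \<Sum>j<d. v i * ?C (i, j) * v j)"
    unfolding sum_subtractf[symmetric] by (intro sum.cong refl) (auto simp: algebra_simps)
   moreover have "(\<Sum>i<d. \<Sum>j<d. (if j = i then M0 * (v i * v j) else 0)) = M0 * (\<Sum>i<d. (v i)^2)"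
    by (simp add: sum_distrib_left power2_eq_square)
   ultimately show "0 \<le> (\<Sum>i<d. \<Sum>j<d. v i * ((case (i, j) of (i, j) => if i = j then M0 else 0) - ?C (i, j)) * v j)"
    unfolding quad by simp
  qed (use sym in auto)
 qed
 have point: "?C \<in> pointwise_class \<alpha> M0 M d"
  unfolding pointwise_class_def
 proof (intro CollectI conjI bc allI impI)
  fix i j assume ij: "i < d" "j < d" "i \<noteq> j"
  show "\<bar>?C (i, j)\<bar> \<le> M * \<bar>real i - real j\<bar> powr (- (\<alpha> + 1))"
  proof (cases "\<bar>real i - real j\<bar> \<ge> real L")
   case False
   have "\<bar>?C (i, j)\<bar> \<le> M * real L powr (- (\<alpha> + 1))"
    using covs[OF ij] small cd by simp
   also have "... \<le> M * \<bar>real i - real j\<bar> powr (- (\<alpha> + 1))"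
    using par False ij by (intro mult_left_mono powr_mono2') auto
   finally show ?thesis .
  qed (use cov0[OF ij] par in auto)
 qed
 have row: "?C \<in> row_tail_class \<alpha> M0 M d"
  unfolding row_tail_class_def
 proof (intro CollectI conjI bc allI impI)
  fix k' j :: nat assume k': "1 \<le> k'" and j: "j < d"
  let ?I = "{i. i < d \<and> \<bar>real i - real j\<bar> > real k'}"
  let ?N = "{i. i < d \<and> i \<noteq> j \<and> \<bar>real i - real j\<bar> < real L}"
  show "(\<Sum>i\<in>?I. \<bar>?C (i, j)\<bar>) \<le> M * real k' powr (- \<alpha>)"
  proof (cases "k' < L")
   case True
   have "(\<Sum>i\<in>?I. \<bar>?C (i, j)\<bar>) = (\<Sum>i\<in>?I \<inter> ?N. \<bar>?C (i, j)\<bar>)"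
   proof (rule sum.mono_neutral_right)
    have "\<bar>real i - real j\<bar> < real L" if "i < d" "i \<noteq> j" "?C (i, j) \<noteq> 0" for i
     using cov0[OF that(1) j that(2)] that(3) by (rule_tac ccontr) (simp add: not_less)
    then show "\<forall>i\<in>?I - ?I \<inter> ?N. \<bar>?C (i, j)\<bar> = 0" using k' by auto
   qed auto
   also have "... \<le> (\<Sum>i\<in>?I \<inter> ?N. c^2 * \<delta>)"
    using covs j by (intro sum_mono) auto
   also have "... = real (card (?I \<inter> ?N)) * (c^2 * \<delta>)" by simp
   also have "... \<le> (2 * real L) * (c^2 * \<delta>)"
   proof (intro mult_right_mono cd)
    have "?I \<inter> ?N \<subseteq> {j - L..<j} \<union> {j + 1..<j + L}"
     by (auto simp: abs_if split: if_splits)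
    then have "card (?I \<inter> ?N) \<le> card ({j - L..<j} \<union> {j + 1..<j + L})" by (intro card_mono) auto
    also have "... \<le> card {j - L..<j} + card {j + 1..<j + L}" by (rule card_Un_le)
    also have "... \<le> 2 * L" by simp
    finally show "real (card (?I \<inter> ?N)) \<le> 2 * real L" by simp
   qed
   also have "... = (2 * c^2 * \<delta>) * real L" by simp
   also have "... \<le> (M * real L powr (- (\<alpha> + 1))) * real L"
    using small by (intro mult_right_mono) auto
   also have "... = M * real L powr (- \<alpha>)"
    using L by (simp add: powr_diff powr_minus field_simps powr_add)
   also have "... \<le> M * real k' powr (- \<alpha>)"
    using True k' par by (intro mult_left_mono powr_mono2') auto
   finally show ?thesis .
  next
   case False
   have "(\<Sum>i\<in>?I. \<bar>?C (i, j)\<bar>) = 0"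
    using cov0[OF _ j] False by (intro sum.neutral) auto
   then show ?thesis using par by simp
  qed
 qed
 have psi: "psi2_norm_vec d (law c \<theta>) (\<lambda>x i. x i - mean_vec (law c \<theta>) i) \<le> ennreal K"
  unfolding psi2_norm_vec_def
 proof (rule SUP_least, clarify)
  fix v :: "nat => real" assume v: "L2_set v {..<d} = 1"
  then have v1: "(\<Sum>i<d. (v i)^2) = 1" by (simp add: L2_set_def)
  let ?\<xi> = "\<lambda>x. \<Sum>i<d. (x i - mean_vec (law c \<theta>) i) * v i"
  have "(\<integral>\<^sup>+x. ennreal (exp ((?\<xi> x)^2 / K^2)) \<partial>law c \<theta>)
   = (\<Sum>x\<in>\<Omega>. ennreal (exp ((?\<xi> (sc c x))^2 / K^2)) * ennreal (w V \<theta> x))"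
   by (rule nn_integral_law) measurable
  also have "... = ennreal (E V \<theta> (\<lambda>x. exp ((?\<xi> (sc c x))^2 / K^2)))"
   unfolding E_def using w_nonneg[OF th subset_refl]
   by (subst sum_ennreal[symmetric]) (auto simp: ennreal_mult mult.commute intro!: sum.cong)
  also have "... \<le> ennreal (E V \<theta> (\<lambda>x. exp (3 / 16 * (\<Sum>i<d. v i * x i)^2)))"
  proof (intro ennreal_leI E_mono th subset_refl)
   fix x
   have "?\<xi> (sc c x) = c * (\<Sum>i<d. v i * x i)"
    using mean_law[OF th] by (simp add: sum_distrib_left mult_ac)
   moreover have "c^2 / K^2 \<le> 3 / 16"
   proof -
    have "9 * c^2 \<le> K^2" using power_mono[OF c(2), of 2] c by (simp add: power_divide)
    then have "16 * c^2 \<le> 3 * K^2" using zero_le_power2[of K] by linarith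
    then show ?thesis using par by (simp add: field_simps)
   qed
   ultimately show "exp ((?\<xi> (sc c x))^2 / K^2) \<le> exp (3 / 16 * (\<Sum>i<d. v i * x i)^2)"
    using mult_right_mono[of "c^2 / K^2" "3 / 16" "(\<Sum>i<d. v i * x i)^2"]
    by (simp add: power_mult_distrib)
  qed
  also have "... \<le> ennreal 2" by (intro ennreal_leI E_exp_square_le th v1)
  finally show "psi2_norm (law c \<theta>) ?\<xi> \<le> ennreal K"
   unfolding psi2_norm_def using par by (intro Inf_lower) auto
 qed
 have sq: "integrable (law c \<theta>) (\<lambda>x. (x i)^2)" if "i < d" for i
  by (rule integrable_law[OF th]) (use that in measurable)
 have "?C \<in> \<J> \<alpha> M0 M d" using \<J> point row by (elim insertE emptyE) simp_all
 then show ?thesis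
  unfolding dist_class_def using psi prob_law[OF th] sq by (simp add: space_prob_algebra)
qed

definition dataset :: "real => nat => (nat => nat => real) => nat => nat => real" where
 "dataset c n S = (\<lambda>l\<in>{..<n}. sc c (S l))"

lemma dataset_space: "dataset c n S \<in> space (data_space n d)"
 by (auto simp: dataset_def data_space_def space_PiM sc_space)

lemma sc_inj:
 assumes "c \<noteq> 0" "x \<in> \<Omega>" "y \<in> \<Omega>" "sc c x = sc c y"
 shows "x = y"
proof
 fix i
 show "x i = y i"
 proof (cases "i < d")
  case True
  then show ?thesis using fun_cong[OF assms(4), of i] assms(1) by simp
 qed (use assms(2,3) in \<open>auto simp: \<Omega>_def PiE_def extensional_def\<close>)
qed

lemma singleton_vec: "x \<in> space (vec_space d) ==> {x} \<in> sets (vec_space d)"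
proof -
 assume x: "x \<in> space (vec_space d)"
 have "{x} = PiE {..<d} (\<lambda>i. {x i})"
  using x by (intro PiE_singleton[symmetric]) (simp add: vec_space_def space_PiM PiE_def)
 also have "... \<in> sets (vec_space d)" unfolding vec_space_def by (intro sets_PiM_I_finite) auto
 finally show ?thesis .
qed

text \<open>
 The samples are atoms of the product measure.  As an inequality this holds for every \<open>f\<close>, measurable or not, in
 particular for the risk of an estimator.
\<close>

lemma sample_sum_le_integral:
 fixes n :: nat
 assumes th: "\<theta> \<in> cube" and c: "c > 0"
 defines "Sn \<equiv> PiE {..<n} (\<lambda>_. \<Omega>)"
 shows "(\<Sum>S\<in>Sn. ennreal (\<Prod>l<n. w V \<theta> (S l)) * f (dataset c n S)) \<le> (\<integral>\<^sup>+S. f S \<partial>PiM {..<n} (\<lambda>_. law c \<theta>))"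
proof -
 interpret prob_space "law c \<theta>" by (rule prob_law[OF th])
 interpret P: product_sigma_finite "\<lambda>_::nat. law c \<theta>"
  by (intro product_sigma_finite.intro sigma_finite_measure_axioms)
 have fin: "finite Sn" unfolding Sn_def using finite_\<Omega> by (intro finite_PiE) auto
 have mem: "S l \<in> \<Omega>" if "S \<in> Sn" "l < n" for S l using that by (auto simp: Sn_def)
 have inj: "S = S'" if "S \<in> Sn" "S' \<in> Sn" "dataset c n S = dataset c n S'" for S S'
 proof
  fix l
  show "S l = S' l"
  proof (cases "l < n")
   case True
   then have "sc c (S l) = sc c (S' l)" using fun_cong[OF that(3), of l] by (simp add: dataset_def)
   then show ?thesis using sc_inj[of c "S l" "S' l"] c mem that True by auto
  qed (use that in \<open>auto simp: Sn_def PiE_def extensional_def\<close>)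
 qed
 have single: "{dataset c n S} = PiE {..<n} (\<lambda>l. {sc c (S l)})" for S
 proof -
  have "{dataset c n S} = PiE {..<n} (\<lambda>l. {dataset c n S l})"
   by (rule PiE_singleton[symmetric]) (simp add: dataset_def)
  also have "... = PiE {..<n} (\<lambda>l. {sc c (S l)})"
   by (rule PiE_cong) (simp add: dataset_def)
  finally show ?thesis .
 qed
 have sets1: "{dataset c n S} \<in> sets (PiM {..<n} (\<lambda>_. law c \<theta>))" for S
  unfolding single using singleton_vec[OF sc_space] by (intro sets_PiM_I_finite) auto
 have em: "ennreal (\<Prod>l<n. w V \<theta> (S l)) \<le> emeasure (PiM {..<n} (\<lambda>_. law c \<theta>)) {dataset c n S}" if S: "S \<in> Sn" for S
 proof -
  have "ennreal (w V \<theta> x) \<le> emeasure (law c \<theta>) {sc c x}" if x: "x \<in> \<Omega>" for x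
  proof -
   have m: "{sc c x} \<in> sets (vec_space d)" by (rule singleton_vec[OF sc_space])
   have "emeasure (law c \<theta>) {sc c x} = (\<integral>\<^sup>+y. indicator {sc c x} y \<partial>law c \<theta>)" using m by simp
   also have "... = (\<Sum>y\<in>\<Omega>. indicator {sc c x} (sc c y) * ennreal (w V \<theta> y))"
    using m by (intro nn_integral_law) auto
   also have "... \<ge> indicator {sc c x} (sc c x) * ennreal (w V \<theta> x)"
    using x finite_\<Omega> by (intro member_le_sum[where f = "\<lambda>y. indicator {sc c x} (sc c y) * ennreal (w V \<theta> y)"]) auto
   finally show ?thesis by simp
  qed
  then have "(\<Prod>l<n. ennreal (w V \<theta> (S l))) \<le> (\<Prod>l<n. emeasure (law c \<theta>) {sc c (S l)})"
   using mem[OF S] by (intro prod_mono_ennreal) auto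
  also have "... = emeasure (PiM {..<n} (\<lambda>_. law c \<theta>)) {dataset c n S}"
   unfolding single using singleton_vec[OF sc_space] by (intro P.emeasure_PiM[symmetric]) auto
  finally show ?thesis using w_nonneg[OF th subset_refl] mem[OF S] by (subst prod_ennreal[symmetric]) auto
 qed
 have "(\<Sum>S\<in>Sn. ennreal (\<Prod>l<n. w V \<theta> (S l)) * f (dataset c n S))
   \<le> (\<Sum>S\<in>Sn. f (dataset c n S) * emeasure (PiM {..<n} (\<lambda>_. law c \<theta>)) {dataset c n S})"
  using em by (intro sum_mono) (simp add: mult.commute mult_left_mono)
 also have "... = (\<Sum>S\<in>Sn. \<integral>\<^sup>+X. f (dataset c n S) * indicator {dataset c n S} X \<partial>PiM {..<n} (\<lambda>_. law c \<theta>))"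
  using sets1 by (simp add: nn_integral_cmult_indicator)
 also have "... = (\<integral>\<^sup>+X. (\<Sum>S\<in>Sn. f (dataset c n S) * indicator {dataset c n S} X) \<partial>PiM {..<n} (\<lambda>_. law c \<theta>))"
  using sets1 by (intro nn_integral_sum[symmetric]) auto
 also have "... \<le> (\<integral>\<^sup>+X. f X \<partial>PiM {..<n} (\<lambda>_. law c \<theta>))"
 proof (rule nn_integral_mono)
  fix X
  show "(\<Sum>S\<in>Sn. f (dataset c n S) * indicator {dataset c n S} X) \<le> f X"
  proof (cases "\<exists>S\<in>Sn. X = dataset c n S")
   case True
   then obtain S where S: "S \<in> Sn" "X = dataset c n S" by auto
   have "(\<Sum>S'\<in>Sn. f (dataset c n S') * indicator {dataset c n S'} X) = (\<Sum>S'\<in>{S}. f (dataset c n S') * indicator {dataset c n S'} X)"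
    using S fin inj by (intro sum.mono_neutral_right) (auto simp: indicator_def)
   then show ?thesis using S by simp
  qed (auto simp: indicator_def intro: sum.neutral[THEN eq_refl, THEN order_trans])
 qed
 finally show ?thesis .
qed

text \<open>
 The estimate of \<open>\<theta> j\<close> read off from an estimate of the covariance matrix.  Clipping only decreases the error, as \<open>\<theta> j\<close>
 lies in \<open>{-1..1}\<close>.
\<close>

definition clipped :: "real => nat \<times> nat => (nat \<times> nat => real) => real" where
 "clipped c j T = max (-1) (min 1 (T j / (c^2 * \<delta>)))"

lemma clipped_bound: "\<bar>clipped c j T\<bar> \<le> 1"
 by (auto simp: clipped_def)

lemma J_bound: "j \<in> J ==> j \<in> {..<d} \<times> {..<d}"
 using V nb by (force simp: J_def)

lemma clipped_measurable: "j \<in> J ==> sets N = sets (mat_space d) ==> clipped c j \<in> borel_measurable N"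
proof -
 assume j: "j \<in> J" and N: "sets N = sets (mat_space d)"
 have "(\<lambda>T. T j) \<in> borel_measurable (mat_space d)"
  unfolding mat_space_def by (rule measurable_component_singleton) (use J_bound[OF j] in auto)
 then have "(\<lambda>T. max (-1) (min 1 (T j / (c^2 * \<delta>)))) \<in> borel_measurable (mat_space d)" by measurable
 then show ?thesis using N by (simp add: clipped_def[abs_def] cong: measurable_cong_sets)
qed

lemma risk_ge:
 assumes A: "A \<in> zCDP_estimators n d \<rho>" and th: "\<theta> \<in> cube" and c: "c > 0" and \<delta>p: "\<delta> > 0"
 shows "ennreal ((c^2 * \<delta>)^2 * (\<Sum>S\<in>PiE {..<n} (\<lambda>_. \<Omega>). (\<Prod>l<n. w V \<theta> (S l)) *
    (\<integral>T. (\<Sum>j\<in>J. (clipped c j T - \<theta> j)^2) \<partial>A (dataset c n S)))) \<le> frobenius_risk n d A (law c \<theta>)"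
proof -
 define g where "g = c^2 * \<delta>"
 have g: "g > 0" using c \<delta>p by (simp add: g_def)
 define C where "C = cov_mat d (law c \<theta>)"
 let ?R = "\<lambda>X. \<integral>\<^sup>+T. ennreal ((frobenius_norm d (\<lambda>p. T p - C p))^2) \<partial>A X"
 have kernel: "sets (A X) = sets (mat_space d)" "prob_space (A X)" if "X \<in> space (data_space n d)" for X
 proof -
  have "A X \<in> space (prob_algebra (mat_space d))"
   using A that unfolding zCDP_estimators_def by (auto dest: measurable_space)
  then show "sets (A X) = sets (mat_space d)" "prob_space (A X)" by (auto simp: space_prob_algebra)
 qed
 have Cj: "C j = g * \<theta> j" if "j \<in> J" for j
 proof -
  obtain a e where j: "j = (a, e)" "a \<in> V" "e \<in> nb a" using \<open>j \<in> J\<close> by (auto simp: J_def)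
  then have "a < d" "e < d" "e \<notin> V" using V nb by auto
  then show ?thesis using E_sign2_VU[of a e \<theta>] j by (simp add: C_def g_def j cov_law[OF th])
 qed
 have pointw: "g^2 * (\<Sum>j\<in>J. (clipped c j T - \<theta> j)^2) \<le> (frobenius_norm d (\<lambda>p. T p - C p))^2" for T
 proof -
  have "g^2 * (clipped c j T - \<theta> j)^2 \<le> (T j - C j)^2" if j: "j \<in> J" for j
  proof -
   have "\<bar>\<theta> j\<bar> \<le> 1" using th j by (auto simp: cube_def)
   then have "\<bar>clipped c j T - \<theta> j\<bar> \<le> \<bar>T j / g - \<theta> j\<bar>"
    by (auto simp: clipped_def g_def[symmetric] max_def min_def)
   then have "(clipped c j T - \<theta> j)^2 \<le> (T j / g - \<theta> j)^2" by (simp add: abs_le_square_iff)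
   then have "g^2 * (clipped c j T - \<theta> j)^2 \<le> g^2 * (T j / g - \<theta> j)^2" by (intro mult_left_mono) auto
   also have "... = (g * (T j / g - \<theta> j))^2" by (simp add: power_mult_distrib)
   also have "g * (T j / g - \<theta> j) = T j - C j" using g Cj[OF j] by (simp add: right_diff_distrib)
   finally show ?thesis .
  qed
  then have "g^2 * (\<Sum>j\<in>J. (clipped c j T - \<theta> j)^2) \<le> (\<Sum>j\<in>J. (T j - C j)^2)"
   unfolding sum_distrib_left by (rule sum_mono)
  also have "... \<le> (\<Sum>j\<in>{..<d} \<times> {..<d}. (T j - C j)^2)"
   using J_bound by (intro sum_mono2) auto
  also have "... = (frobenius_norm d (\<lambda>p. T p - C p))^2"
   by (simp add: frobenius_norm_def L2_set_def sum_nonneg)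
  finally show ?thesis .
 qed
 have inner: "ennreal (g^2 * (\<integral>T. (\<Sum>j\<in>J. (clipped c j T - \<theta> j)^2) \<partial>A X)) \<le> ?R X" if X: "X \<in> space (data_space n d)" for X
 proof -
  interpret prob_space "A X" by (rule kernel[OF X])
  have m: "clipped c j \<in> borel_measurable (A X)" if "j \<in> J" for j
   using clipped_measurable[OF that kernel(1)[OF X]] .
  have i: "integrable (A X) (\<lambda>T. g^2 * (\<Sum>j\<in>J. (clipped c j T - \<theta> j)^2))"
  proof (intro integrable_mult_right Bochner_Integration.integrable_sum)
   fix j assume j: "j \<in> J"
   show "integrable (A X) (\<lambda>T. (clipped c j T - \<theta> j)^2)"
   proof (rule integrable_const_bound[where B = 4])
    have "\<bar>\<theta> j\<bar> \<le> 1" using th j by (auto simp: cube_def)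
    then have "\<bar>clipped c j T - \<theta> j\<bar> \<le> 2" for T using clipped_bound[of c j T] by linarith
    then show "AE T in A X. norm ((clipped c j T - \<theta> j)^2) \<le> 4"
     using power_mono[of "\<bar>clipped c j _ - \<theta> j\<bar>" 2 2] by (auto intro!: AE_I2)
    show "(\<lambda>T. (clipped c j T - \<theta> j)^2) \<in> borel_measurable (A X)" using m[OF j] by measurable
   qed
  qed
  have "ennreal (g^2 * (\<integral>T. (\<Sum>j\<in>J. (clipped c j T - \<theta> j)^2) \<partial>A X)) = (\<integral>\<^sup>+T. ennreal (g^2 * (\<Sum>j\<in>J. (clipped c j T - \<theta> j)^2)) \<partial>A X)"
   using nn_integral_eq_integral[OF i] by (simp add: sum_nonneg)
  also have "... \<le> ?R X" using pointw by (intro nn_integral_mono ennreal_leI)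
  finally show ?thesis .
 qed
 let ?Sn = "PiE {..<n} (\<lambda>_. \<Omega>)"
 let ?I = "\<lambda>S. \<integral>T. (\<Sum>j\<in>J. (clipped c j T - \<theta> j)^2) \<partial>A (dataset c n S)"
 have I0: "0 \<le> ?I S" for S by (intro integral_nonneg_AE AE_I2 sum_nonneg) auto
 have W0: "0 \<le> (\<Prod>l<n. w V \<theta> (S l))" if "S \<in> ?Sn" for S
  using w_nonneg[OF th subset_refl] that by (intro prod_nonneg) (auto dest!: PiE_mem)
 have "ennreal (g^2 * (\<Sum>S\<in>?Sn. (\<Prod>l<n. w V \<theta> (S l)) * ?I S)) = (\<Sum>S\<in>?Sn. ennreal (\<Prod>l<n. w V \<theta> (S l)) * ennreal (g^2 * ?I S))"
  using W0 I0 by (subst sum_distrib_left, subst sum_ennreal[symmetric]) (auto simp: ennreal_mult mult_ac intro!: sum.cong)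
 also have "... \<le> (\<Sum>S\<in>?Sn. ennreal (\<Prod>l<n. w V \<theta> (S l)) * ?R (dataset c n S))"
  by (intro sum_mono mult_left_mono inner dataset_space) auto
 also have "... \<le> (\<integral>\<^sup>+X. ?R X \<partial>PiM {..<n} (\<lambda>_. law c \<theta>))"
  by (rule sample_sum_le_integral[OF th c])
 finally show ?thesis unfolding frobenius_risk_def C_def g_def .
qed

end

context sign_model
begin

text \<open>
 The means of the clipped estimates serve in the statistical bound, where Jensen's inequality compares their error
 with that of the randomized estimate.  In the private bound, the hypothesis on resampling is \<open>renyi2_expectation_diff\<close>, as zCDP gives a
 divergence of order 2 of at most \<open>2 * \<rho>\<close> when one observation is replaced.
\<close>

lemma minimax_ge:
 assumes par: "\<alpha> > 0" "K > 0" "M0 > 0" "M > 0"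
  and c: "c > 0" "c \<le> K / 3" "c^2 \<le> M0 / 9"
  and near: "\<And>a e. a \<in> V ==> e \<in> nb a ==> \<bar>real a - real e\<bar> < real L"
   "\<And>a b. a \<in> V ==> b \<in> V ==> nb a \<inter> nb b \<noteq> {} ==> \<bar>real a - real b\<bar> < real L"
  and L: "L \<ge> 1" and small: "2 * c^2 * \<delta> \<le> M * real L powr (- (\<alpha> + 1))"
  and \<J>: "\<J> \<in> {row_tail_class, pointwise_class}"
  and \<delta>p: "\<delta> > 0" and n: "n > 0" and \<rho>: "\<rho> > 0" and Jne: "J \<noteq> {}"
 shows "ennreal ((c^2 * \<delta>)^2 / real d * (3 * real (card J) / 8 / (5 + 8 * real n * \<delta>^2)))
     \<le> minimax_risk \<J> \<alpha> K M0 M n d \<rho>" (is "ennreal ?s \<le> _")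
  and "ennreal ((c^2 * \<delta>)^2 / real d * (3 * real (card J) / 8 / (5 + 8 * (real n)^2 * \<delta>^2 * (exp (2 * \<rho>) - 1) / real (card J))))
     \<le> minimax_risk \<J> \<alpha> K M0 M n d \<rho>" (is "ennreal ?p \<le> _")
proof -
 interpret SF: score_family J \<Omega> "w V" s "4 * \<delta>^2" "2 * \<delta>" "{\<theta>. \<forall>j\<in>J. \<bar>\<theta> j\<bar> \<le> 1}"
  by (rule scores)
 note cube_eq = cube_def[symmetric]
 have d: "d > 0" using Jne J_bound by (cases d) auto
 let ?Sn = "PiE {..<n} (\<lambda>_. \<Omega>)"
 define R where "R A \<theta> = (\<Sum>S\<in>?Sn. (\<Prod>l<n. w V \<theta> (S l)) *
    (\<integral>T. (\<Sum>j\<in>J. (clipped c j T - \<theta> j)^2) \<partial>A (dataset c n S)))" for A \<theta>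
 have sup_ge: "ennreal ((c^2 * \<delta>)^2 / real d * B) \<le> (SUP P\<in>dist_class \<J> \<alpha> K M0 M d. ennreal (1 / real d) * frobenius_risk n d A P)"
  if A: "A \<in> zCDP_estimators n d \<rho>" and th: "\<theta> \<in> cube" and B: "B \<le> R A \<theta>" for A \<theta> B
 proof -
  have "ennreal ((c^2 * \<delta>)^2 / real d * B) \<le> ennreal ((c^2 * \<delta>)^2 / real d * R A \<theta>)"
   using B by (intro ennreal_leI mult_left_mono) auto
  also have "... = ennreal (1 / real d) * ennreal ((c^2 * \<delta>)^2 * R A \<theta>)"
   by (simp add: ennreal_mult'[symmetric])
  also have "... \<le> ennreal (1 / real d) * frobenius_risk n d A (law c \<theta>)"
   using risk_ge[OF A th c(1) \<delta>p] unfolding R_def by (intro mult_left_mono) auto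
  also have "... \<le> (SUP P\<in>dist_class \<J> \<alpha> K M0 M d. ennreal (1 / real d) * frobenius_risk n d A P)"
   by (intro SUP_upper law_in_class[OF th par c near L small \<J>])
  finally show ?thesis .
 qed
 have kernel: "sets (A X) = sets (mat_space d)" "prob_space (A X)"
  if "A \<in> zCDP_estimators n d \<rho>" "X \<in> space (data_space n d)" for A X
 proof -
  have "A X \<in> space (prob_algebra (mat_space d))"
   using that unfolding zCDP_estimators_def by (auto dest: measurable_space)
  then show "sets (A X) = sets (mat_space d)" "prob_space (A X)" by (auto simp: space_prob_algebra)
 qed
 have stat: "\<exists>\<theta>\<in>cube. 3 * real (card J) / 8 / (5 + 8 * real n * \<delta>^2) \<le> R A \<theta>"
  and priv: "\<exists>\<theta>\<in>cube. 3 * real (card J) / 8 / (5 + 8 * (real n)^2 * \<delta>^2 * (exp (2 * \<rho>) - 1) / real (card J)) \<le> R A \<theta>"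
  if A: "A \<in> zCDP_estimators n d \<rho>" for A
 proof -
  note k = kernel[OF A dataset_space]
  have meas: "clipped c j \<in> borel_measurable (A (dataset c n S))" if "j \<in> J" for S j
   by (rule clipped_measurable[OF that k(1)])
  define a where "a j S = (\<integral>T. clipped c j T \<partial>A (dataset c n S))" for j S
  have int: "integrable (A (dataset c n S)) (clipped c j)" if "j \<in> J" for S j
  proof -
   interpret prob_space "A (dataset c n S)" by (rule k(2))
   show ?thesis by (rule integrable_const_bound[where B=1]) (use clipped_bound meas[OF that] in auto)
  qed
  have sqi: "integrable (A (dataset c n S)) (\<lambda>T. (clipped c j T - t)^2)" if "j \<in> J" "\<bar>t\<bar> \<le> 1" for S j t
  proof -
   interpret prob_space "A (dataset c n S)" by (rule k(2))
   have "\<bar>clipped c j T - t\<bar> \<le> 2" for T using clipped_bound[of c j T] that by linarith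
   then have "(clipped c j T - t)^2 \<le> 4" for T using power_mono[of "\<bar>clipped c j T - t\<bar>" 2 2] by simp
   then show ?thesis by (intro integrable_const_bound[where B=4]) (use meas[OF that(1)] in auto)
  qed
  have a1: "\<bar>a j S\<bar> \<le> 1" if "j \<in> J" for j S
  proof -
   interpret prob_space "A (dataset c n S)" by (rule k(2))
   have "\<bar>a j S\<bar> \<le> (\<integral>T. \<bar>clipped c j T\<bar> \<partial>A (dataset c n S))" unfolding a_def by (rule integral_abs_bound)
   also have "... \<le> (\<integral>T. 1 \<partial>A (dataset c n S))"
    using int[OF that] clipped_bound by (intro integral_mono) auto
   finally show ?thesis by (simp add: prob_space)
  qed
  obtain \<theta> where th: "\<theta> \<in> cube" and lb: "3 * real (card J) / 8 \<le> (5 + 2 * real n * (4 * \<delta>^2)) *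
   (\<Sum>S\<in>?Sn. (\<Prod>l<n. w V \<theta> (S l)) * (\<Sum>j\<in>J. (a j S - \<theta> j)^2))"
   using SF.statistical_lower_bound[of n a] a1 \<delta>p n unfolding SF.pn_def SF.samples_def cube_eq by auto
  have "(\<Sum>S\<in>?Sn. (\<Prod>l<n. w V \<theta> (S l)) * (\<Sum>j\<in>J. (a j S - \<theta> j)^2)) \<le> R A \<theta>"
   unfolding R_def
  proof (intro sum_mono mult_left_mono prod_nonneg ballI)
   fix S assume S: "S \<in> ?Sn"
   show "\<And>l. l \<in> {..<n} ==> 0 \<le> w V \<theta> (S l)" using w_nonneg[OF th subset_refl] S by (auto dest!: PiE_mem)
   interpret prob_space "A (dataset c n S)" by (rule k(2))
   have "(a j S - \<theta> j)^2 \<le> (\<integral>T. (clipped c j T - \<theta> j)^2 \<partial>A (dataset c n S))" if j: "j \<in> J" for j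
   proof -
    have t: "\<bar>\<theta> j\<bar> \<le> 1" using th j by (auto simp: cube_def)
    have e: "(x - a j S)^2 = (x - \<theta> j)^2 - 2 * (a j S - \<theta> j) * x + ((a j S)^2 - (\<theta> j)^2)" for x
     by (simp add: power2_eq_square algebra_simps)
    have "0 \<le> (\<integral>T. (clipped c j T - a j S)^2 \<partial>A (dataset c n S))" by simp
    also have "... = (\<integral>T. (clipped c j T - \<theta> j)^2 \<partial>A (dataset c n S)) - 2 * (a j S - \<theta> j) * a j S + ((a j S)^2 - (\<theta> j)^2)"
     unfolding e using sqi[OF j t] int[OF j] by (simp add: prob_space a_def)
    also have "... = (\<integral>T. (clipped c j T - \<theta> j)^2 \<partial>A (dataset c n S)) - (a j S - \<theta> j)^2"
     by (simp add: power2_eq_square algebra_simps)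
    finally show ?thesis by simp
   qed
   then show "(\<Sum>j\<in>J. (a j S - \<theta> j)^2) \<le> (\<integral>T. (\<Sum>j\<in>J. (clipped c j T - \<theta> j)^2) \<partial>A (dataset c n S))"
    using sqi th by (subst Bochner_Integration.integral_sum) (auto simp: cube_def intro!: sum_mono)
  qed
  then have "(5 + 2 * real n * (4 * \<delta>^2)) * (\<Sum>S\<in>?Sn. (\<Prod>l<n. w V \<theta> (S l)) * (\<Sum>j\<in>J. (a j S - \<theta> j)^2))
   \<le> (5 + 2 * real n * (4 * \<delta>^2)) * R A \<theta>"
   by (rule mult_left_mono) simp
  from order_trans[OF lb this]
  have "3 * real (card J) / 8 \<le> (5 + 8 * real n * \<delta>^2) * R A \<theta>" by (simp add: mult.assoc)
  moreover have "0 < 5 + 8 * real n * \<delta>^2" by (intro add_pos_nonneg) auto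
  ultimately show "\<exists>\<theta>\<in>cube. 3 * real (card J) / 8 / (5 + 8 * real n * \<delta>^2) \<le> R A \<theta>"
   using th by (intro bexI[of _ \<theta>]) (simp_all only: pos_divide_le_eq mult.commute)
  have priv_step: "(\<integral>T. f T \<partial>A (dataset c n S)) - (\<integral>T. f T \<partial>A (dataset c n (S(l := x))))
    \<le> (exp (2 * \<rho>) - 1) * b / 2 + (\<integral>T. (f T)^2 \<partial>A (dataset c n (S(l := x)))) / (2 * b)"
   if S: "S \<in> SF.samples n" and l: "l < n" and x: "x \<in> \<Omega>" and f: "f \<in> borel_measurable (A (dataset c n S))"
    and fb: "\<And>T. \<bar>f T\<bar> \<le> C" and b: "b > 0" for S l x f b C
  proof (cases "S l = x")
   case True
   then have "S(l := x) = S" by auto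
   moreover have "0 \<le> (\<integral>T. (f T)^2 \<partial>A (dataset c n S)) / (2 * b)" using b by (intro divide_nonneg_pos) auto
   moreover have "0 \<le> (exp (2 * \<rho>) - 1) * b / 2" using \<rho> b by simp
   ultimately show ?thesis by simp
  next
   case False
   have Sl: "S l \<in> \<Omega>" using S l by (auto simp: SF.samples_def)
   have "adjacent n (dataset c n S) (dataset c n (S(l := x)))"
    unfolding adjacent_def
   proof (intro exI[of _ l] conjI allI impI l)
    show "dataset c n S l \<noteq> dataset c n (S(l := x)) l"
     using sc_inj[of c "S l" x] c False Sl x l by (auto simp: dataset_def)
   qed (auto simp: dataset_def)
   then have "renyi_divergence 2 (A (dataset c n S)) (A (dataset c n (S(l := x)))) \<le> ereal (\<rho> * 2)"
    using A dataset_space unfolding zCDP_estimators_def zCDP_def by auto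
   then show ?thesis
    using k fb b f
    by (intro renyi2_expectation_diff[where B = C]) (auto simp: mult.commute cong: measurable_cong_sets)
  qed
  have "\<exists>\<theta>\<in>cube. 3 * real (card J) / 8 \<le> (5 + 2 * (real n)^2 * (4 * \<delta>^2) * (exp (2 * \<rho>) - 1) / real (card J)) *
   (\<Sum>S\<in>?Sn. (\<Prod>l<n. w V \<theta> (S l)) * (\<integral>T. (\<Sum>j\<in>J. (clipped c j T - \<theta> j)^2) \<partial>A (dataset c n S)))"
   unfolding SF.pn_def[symmetric] SF.samples_def[symmetric] cube_def
  proof (rule SF.private_lower_bound[where A = "\<lambda>S. A (dataset c n S)" and \<tau> = "clipped c"])
   show "\<And>S l x f b C. S \<in> SF.samples n ==> l < n ==> x \<in> \<Omega> ==> f \<in> borel_measurable (A (dataset c n S)) ==>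
    (\<And>T. \<bar>f T\<bar> \<le> C) ==> b > 0 ==>
   (\<integral>T. f T \<partial>A (dataset c n S)) - (\<integral>T. f T \<partial>A (dataset c n (S(l := x))))
   \<le> (exp (2 * \<rho>) - 1) * b / 2 + (\<integral>T. (f T)^2 \<partial>A (dataset c n (S(l := x)))) / (2 * b)"
    by (rule priv_step)
  qed (use k meas clipped_bound \<delta>p n \<rho> Jne in auto)
  then obtain \<theta> where th: "\<theta> \<in> cube" and lb: "3 * real (card J) / 8 \<le> (5 + 2 * (real n)^2 * (4 * \<delta>^2) * (exp (2 * \<rho>) - 1) / real (card J)) * R A \<theta>"
   unfolding R_def by blast
  have "0 < 5 + 8 * (real n)^2 * \<delta>^2 * (exp (2 * \<rho>) - 1) / real (card J)"
   using \<rho> by (intro add_pos_nonneg divide_nonneg_nonneg mult_nonneg_nonneg) auto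
  note D = this
  show "\<exists>\<theta>\<in>cube. 3 * real (card J) / 8 / (5 + 8 * (real n)^2 * \<delta>^2 * (exp (2 * \<rho>) - 1) / real (card J)) \<le> R A \<theta>"
  proof -
   have "5 + 2 * (real n)^2 * (4 * \<delta>^2) * (exp (2 * \<rho>) - 1) / real (card J)
    = 5 + 8 * (real n)^2 * \<delta>^2 * (exp (2 * \<rho>) - 1) / real (card J)" by simp
   with lb have "3 * real (card J) / 8 \<le> R A \<theta> * (5 + 8 * (real n)^2 * \<delta>^2 * (exp (2 * \<rho>) - 1) / real (card J))"
    by (simp only: mult.commute)
   then show ?thesis using th D by (intro bexI[of _ \<theta>]) (simp_all only: pos_divide_le_eq)
  qed
 qed
 show "ennreal ?s \<le> minimax_risk \<J> \<alpha> K M0 M n d \<rho>"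
  unfolding minimax_risk_def using stat sup_ge by (intro INF_greatest) blast
 show "ennreal ?p \<le> minimax_risk \<J> \<alpha> K M0 M n d \<rho>"
  unfolding minimax_risk_def using priv sup_ge by (intro INF_greatest) blast
qed

end

section \<open>Block designs\<close>

text \<open>
 Only complete blocks of length \<open>2 * k\<close> are used.  The second half of each is driven by the first half.
\<close>

definition block_V :: "nat => nat => nat set" where
 "block_V d k = {a. a < 2 * k * (d div (2 * k)) \<and> k \<le> a mod (2 * k)}"

definition block_nb :: "nat => nat => nat set" where
 "block_nb k a = {2 * k * (a div (2 * k))..<2 * k * (a div (2 * k)) + k}"

lemma block_nb_mem:
 assumes "e \<in> block_nb k a" "k \<ge> 1"
 shows "e div (2 * k) = a div (2 * k)" "e mod (2 * k) < k"
proof -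
 define q where "q = a div (2 * k)"
 obtain r where e: "e = 2 * k * q + r" and r: "r < k"
  using assms(1) by (auto simp: block_nb_def q_def[symmetric] le_iff_add)
 show "e div (2 * k) = a div (2 * k)"
  unfolding e q_def[symmetric] using r assms(2) by (simp add: div_nat_eqI)
 have "(2 * k * q + r) mod (2 * k) = r" using r by simp
 then show "e mod (2 * k) < k" unfolding e using r by simp
qed

lemma same_block_dist:
 assumes "e div L = a div L" "L \<ge> (1::nat)"
 shows "\<bar>real a - real e\<bar> < real L"
proof -
 have "a = L * (a div L) + a mod L" "e = L * (a div L) + e mod L"
  using assms(1) by (metis mult_div_mod_eq)+
 moreover have "a mod L < L" "e mod L < L" using assms by auto
 ultimately have "a < e + L" "e < a + L" by linarith+
 then show ?thesis by linarith
qed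

lemma block_sign_model:
 assumes k: "k \<ge> 1" and \<delta>: "\<delta> \<ge> 0" "\<delta> * real k \<le> 1 / 2"
 shows "sign_model d k (block_V d k) (block_nb k) \<delta>"
proof
 have le: "2 * k * (d div (2 * k)) \<le> d" by simp
 show "block_V d k \<subseteq> {..<d}"
 proof
  fix a assume "a \<in> block_V d k"
  then have "a < 2 * k * (d div (2 * k))" by (simp add: block_V_def)
  also note le
  finally show "a \<in> {..<d}" by simp
 qed
 show "block_nb k a \<subseteq> {..<d} - block_V d k" if "a \<in> block_V d k" for a
 proof
  fix e assume e: "e \<in> block_nb k a"
  have "a div (2 * k) < d div (2 * k)"
   using that k by (simp add: block_V_def less_mult_imp_div_less mult.commute)
  then have "2 * k * (a div (2 * k) + 1) \<le> 2 * k * (d div (2 * k))" by (intro mult_le_mono2) simp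
  moreover have "e < 2 * k * (a div (2 * k) + 1)" using e k by (simp add: block_nb_def)
  ultimately have "e < d" using le by (meson less_le_trans)
  then show "e \<in> {..<d} - block_V d k" using block_nb_mem(2)[OF e k] by (auto simp: block_V_def)
 qed
 show "card (block_nb k a) \<le> k" for a by (simp add: block_nb_def)
 show "card {a \<in> block_V d k. e \<in> block_nb k a} \<le> k" for e
 proof -
  let ?b = "2 * k * (e div (2 * k))"
  have "{a \<in> block_V d k. e \<in> block_nb k a} \<subseteq> {?b + k..<?b + 2 * k}"
  proof clarify
   fix a assume a: "a \<in> block_V d k" "e \<in> block_nb k a"
   have "a = 2 * k * (e div (2 * k)) + a mod (2 * k)"
    using block_nb_mem(1)[OF a(2) k] by (metis mult_div_mod_eq)
   moreover have "a mod (2 * k) < 2 * k" "k \<le> a mod (2 * k)" using a k by (auto simp: block_V_def)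
   ultimately show "a \<in> {?b + k..<?b + 2 * k}" by auto
  qed
  then have "card {a \<in> block_V d k. e \<in> block_nb k a} \<le> card {?b + k..<?b + 2 * k}" by (intro card_mono) auto
  then show ?thesis by simp
 qed
qed (use \<delta> in auto)

lemma card_block_V:
 assumes k: "k \<ge> 1" and d: "2 * k \<le> d"
 shows "real d / 4 \<le> real (card (block_V d k))"
proof -
 let ?q = "d div (2 * k)"
 have inj: "inj_on (\<lambda>(b, i). 2 * k * b + k + i) ({..<?q} \<times> {..<k})"
 proof (rule inj_onI)
  fix x y assume xy: "x \<in> {..<?q} \<times> {..<k}" "y \<in> {..<?q} \<times> {..<k}"
   "(case x of (b, i) => 2 * k * b + k + i) = (case y of (b, i) => 2 * k * b + k + i)"
  obtain b i b' i' where x: "x = (b, i)" and y: "y = (b', i')" by (cases x; cases y)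
  have i: "i < k" "i' < k" and e: "2 * k * b + i = 2 * k * b' + i'" using xy by (auto simp: x y)
  have "(2 * k * b + i) div (2 * k) = b" "(2 * k * b' + i') div (2 * k) = b'"
   using i by (auto simp: div_nat_eqI)
  then have bb: "b = b'" using e by metis
  then have "i = i'" using e by simp
  with bb show "x = y" unfolding x y by simp
 qed
 have "k * ?q = card ((\<lambda>(b, i). 2 * k * b + k + i) ` ({..<?q} \<times> {..<k}))"
  using card_image[OF inj] by (simp add: mult.commute)
 also have "... \<le> card (block_V d k)"
 proof (rule card_mono)
  show "finite (block_V d k)" unfolding block_V_def by auto
  show "(\<lambda>(b, i). 2 * k * b + k + i) ` ({..<?q} \<times> {..<k}) \<subseteq> block_V d k"
  proof (rule image_subsetI)
   fix x assume "x \<in> {..<?q} \<times> {..<k}"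
   then obtain b i where x: "x = (b, i)" and bi: "b \<in> {..<?q}" "i \<in> {..<k}" by auto
   have "2 * k * b + k + i < 2 * k * (b + 1)" using bi by simp
   also have "... \<le> 2 * k * ?q" using bi by (intro mult_le_mono2) auto
   finally have 1: "2 * k * b + k + i < 2 * k * ?q" .
   have "(2 * k * b + (k + i)) mod (2 * k) = k + i" using bi by simp
   then have "k \<le> (2 * k * b + k + i) mod (2 * k)" by (simp add: add.assoc)
   with 1 show "(case x of (b, i) => 2 * k * b + k + i) \<in> block_V d k" by (simp add: block_V_def x)
  qed
 qed
 finally have "k * ?q \<le> card (block_V d k)" .
 moreover have "d \<le> 4 * (k * ?q)"
 proof -
  have "1 \<le> ?q" using d k by (simp add: div_greater_zero_iff Suc_le_eq)
  then have "2 * k \<le> 2 * k * ?q" by simp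
  moreover have "d = 2 * k * ?q + d mod (2 * k)" by simp
  moreover have "d mod (2 * k) < 2 * k" using k by simp
  ultimately show ?thesis by linarith
 qed
 ultimately have "d \<le> 4 * card (block_V d k)" by linarith
 then show ?thesis by linarith
qed

text \<open>
 There are at least \<open>d * k / 4\<close> parameters, and the factor \<open>2 * k\<close> in \<open>\<delta>\<close> is the length of a block, beyond which all the
 covariances vanish.
\<close>

lemma block_minimax_ge:
 assumes par: "\<alpha> > 0" "K > 0" "M0 > 0" "M > 0"
  and c: "c > 0" "c \<le> K / 3" "c^2 \<le> M0 / 9"
  and \<J>: "\<J> \<in> {row_tail_class, pointwise_class}"
  and \<delta>0: "0 < \<delta>0" "\<delta>0 \<le> 1" "2 * c^2 * \<delta>0 \<le> M"
  and k: "k \<ge> 1" "2 * k \<le> d" and n: "n > 0" and \<rho>: "\<rho> > 0"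
 defines "\<delta> \<equiv> \<delta>0 * real (2 * k) powr (- (\<alpha> + 1))"
 shows "ennreal (c ^ 4 * \<delta>^2 * (3 * real k / 32 / (5 + 8 * real n * \<delta>^2)))
     \<le> minimax_risk \<J> \<alpha> K M0 M n d \<rho>"
  and "ennreal (c ^ 4 * \<delta>^2 * (3 * real k / 32 / (5 + 32 * (real n)^2 * \<delta>^2 * (exp (2 * \<rho>) - 1) / (real d * real k))))
     \<le> minimax_risk \<J> \<alpha> K M0 M n d \<rho>"
proof -
 have \<delta>p: "\<delta> > 0" using \<delta>0 k by (simp add: \<delta>_def)
 have "\<delta> * real k \<le> real (2 * k) powr (- (\<alpha> + 1)) * real k"
  unfolding \<delta>_def using \<delta>0 by (intro mult_right_mono mult_left_le_one_le) auto
 also have "... \<le> real (2 * k) powr (- 1) * real k"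
  using k par by (intro mult_right_mono powr_mono) auto
 also have "... = 1 / 2" using k by (simp add: powr_minus_divide)
 finally have \<delta>k: "\<delta> * real k \<le> 1 / 2" .
 interpret sign_model d k "block_V d k" "block_nb k" \<delta>
  by (rule block_sign_model) (use k \<delta>k \<delta>p in auto)
 have near1: "\<bar>real a - real e\<bar> < real (2 * k)" if "e \<in> block_nb k a" for a e
  by (rule same_block_dist) (use block_nb_mem(1)[OF that k(1)] k in auto)
 have near2: "\<bar>real a - real b\<bar> < real (2 * k)" if ne: "block_nb k a \<inter> block_nb k b \<noteq> {}" for a b
 proof -
  obtain e where e: "e \<in> block_nb k a" "e \<in> block_nb k b" using ne by auto
  have "b div (2 * k) = a div (2 * k)" using block_nb_mem(1)[OF e(1) k(1)] block_nb_mem(1)[OF e(2) k(1)] by simp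
  then show ?thesis by (rule same_block_dist) (use k in auto)
 qed
 have small: "2 * c^2 * \<delta> \<le> M * real (2 * k) powr (- (\<alpha> + 1))"
  using mult_right_mono[OF \<delta>0(3), of "real (2 * k) powr (- (\<alpha> + 1))"] by (simp add: \<delta>_def mult.assoc)
 have cardJ: "real (card J) \<ge> real d * real k / 4"
 proof -
  have "card J = (\<Sum>a\<in>block_V d k. card (block_nb k a))"
   unfolding J_def using finite_V finite_nb by (intro card_SigmaI) auto
  then have "card J = card (block_V d k) * k" by (simp add: block_nb_def)
  then show ?thesis using mult_right_mono[OF card_block_V[OF k], of "real k"] by simp
 qed
 have dk: "real d * real k > 0" using k by simp
 then have Jpos: "real (card J) > 0" using cardJ by linarith
 then have Jne: "J \<noteq> {}" by auto
 note main = minimax_ge[OF par c near1 near2 _ small \<J> \<delta>p n \<rho> Jne]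
 have base: "c ^ 4 * \<delta>^2 * (3 * real k / 32 / X) \<le> (c^2 * \<delta>)^2 / real d * (3 * real (card J) / 8 / X')"
  if X: "0 < X'" "X' \<le> X" for X X'
 proof -
  have "3 * real k / 32 / X \<le> 3 * real k / 32 / X'"
   using X by (intro divide_left_mono) auto
  also have "... = (3 * (real d * real k / 4) / 8 / X') / real d" using k by simp
  also have "... \<le> (3 * real (card J) / 8 / X') / real d"
   using X cardJ by (intro divide_right_mono mult_left_mono) auto
  finally have "c ^ 4 * \<delta>^2 * (3 * real k / 32 / X) \<le> c ^ 4 * \<delta>^2 * ((3 * real (card J) / 8 / X') / real d)"
   by (intro mult_left_mono) auto
  also have "... = (c^2 * \<delta>)^2 / real d * (3 * real (card J) / 8 / X')"
   by (simp add: power_mult_distrib power_mult[symmetric])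
  finally show ?thesis .
 qed
 have L: "2 * k \<ge> 1" using k by simp
 show "ennreal (c ^ 4 * \<delta>^2 * (3 * real k / 32 / (5 + 8 * real n * \<delta>^2))) \<le> minimax_risk \<J> \<alpha> K M0 M n d \<rho>"
  by (rule order_trans[OF ennreal_leI[OF base] main(1)]) (use L in \<open>auto intro!: add_pos_nonneg\<close>)
 let ?Z = "8 * (real n)^2 * \<delta>^2 * (exp (2 * \<rho>) - 1)"
 have Z: "0 \<le> ?Z" using \<rho> by simp
 have "?Z / real (card J) \<le> ?Z / (real d * real k / 4)"
  using cardJ dk Z by (intro divide_left_mono mult_pos_pos) auto
 then have le: "5 + ?Z / real (card J) \<le> 5 + 32 * (real n)^2 * \<delta>^2 * (exp (2 * \<rho>) - 1) / (real d * real k)"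
  by simp
 show "ennreal (c ^ 4 * \<delta>^2 * (3 * real k / 32 / (5 + 32 * (real n)^2 * \<delta>^2 * (exp (2 * \<rho>) - 1) / (real d * real k))))
     \<le> minimax_risk \<J> \<alpha> K M0 M n d \<rho>"
 proof (rule order_trans[OF ennreal_leI[OF base[OF _ le]] main(2)])
  show "0 < 5 + ?Z / real (card J)" using Z by (intro add_pos_nonneg divide_nonneg_nonneg) auto
 qed (use L in auto)
qed

section \<open>The lower rate\<close>

lemma floor_half:
 assumes "x \<ge> (2::real)"
 obtains k :: nat where "k \<ge> 1" "real (2 * k) \<le> x" "x / 4 \<le> real k"
proof
 let ?k = "nat \<lfloor>x / 2\<rfloor>"
 have f: "1 \<le> \<lfloor>x / 2\<rfloor>" using assms by (simp add: le_floor_iff)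
 then have r: "real ?k = of_int \<lfloor>x / 2\<rfloor>" by simp
 show "?k \<ge> 1" using f by linarith
 show "real (2 * ?k) \<le> x" using r of_int_floor_le[of "x / 2"] by simp
 have "x / 2 < of_int \<lfloor>x / 2\<rfloor> + 1" by linarith
 moreover have "1 \<le> (of_int \<lfloor>x / 2\<rfloor> :: real)" using f by simp
 ultimately show "x / 4 \<le> real ?k" unfolding r by linarith
qed

text \<open>
 For \<open>2 * k \<le> n powr (1 / (2 * \<alpha> + 2))\<close> the product \<open>n * \<delta>^2\<close> is bounded below, so that the bound is a constant multiple of
 \<open>k / n\<close>.
\<close>

lemma statistical_rate_bound:
 fixes n k d :: nat and \<alpha> \<delta>0 c :: real
 assumes \<alpha>: "\<alpha> > 0" and \<delta>0: "\<delta>0 > 0" and k: "k \<ge> 1" and n: "n > 0"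
  and k1: "real (2 * k) \<le> real n powr (1 / (2 * \<alpha> + 2))"
  and k2: "min (real n powr (1 / (2 * \<alpha> + 2))) (real d) / 4 \<le> real k"
 defines "\<delta> \<equiv> \<delta>0 * real (2 * k) powr (- (\<alpha> + 1))"
 shows "c ^ 4 * (3 / (128 * (5 / \<delta>0^2 + 8))) * min (real n powr (- ((2 * \<alpha> + 1) / (2 * \<alpha> + 2)))) (real d / real n)
  \<le> c ^ 4 * \<delta>^2 * (3 * real k / 32 / (5 + 8 * real n * \<delta>^2))"
proof -
 let ?A = "5 / \<delta>0^2 + 8"
 have A: "?A > 0" using \<delta>0 by (intro add_nonneg_pos) auto
 have k0: "real (2 * k) > 0" using k by simp
 have d2: "\<delta>^2 = \<delta>0^2 / real (2 * k) powr (2 * \<alpha> + 2)"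
 proof -
  have "(real (2 * k) powr (- (\<alpha> + 1)))^2 = real (2 * k) powr (- (2 * \<alpha> + 2))"
   using k0 by (simp add: power2_eq_square powr_add[symmetric])
  also have "... = 1 / real (2 * k) powr (2 * \<alpha> + 2)" by (rule powr_minus_divide)
  finally show ?thesis by (simp only: \<delta>_def power_mult_distrib times_divide_eq_right mult_1_right)
 qed
 have "real (2 * k) powr (2 * \<alpha> + 2) \<le> (real n powr (1 / (2 * \<alpha> + 2))) powr (2 * \<alpha> + 2)"
  using k1 k0 \<alpha> by (intro powr_mono2) auto
 also have "... = real n" using \<alpha> n by (simp add: powr_powr)
 finally have pn: "real (2 * k) powr (2 * \<alpha> + 2) \<le> real n" .
 have dp: "\<delta>^2 > 0" using \<delta>0 k0 by (simp add: d2)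
 have "\<delta>0^2 * real (2 * k) powr (2 * \<alpha> + 2) \<le> \<delta>0^2 * real n" using pn by (intro mult_left_mono) auto
 then have nd: "\<delta>0^2 \<le> real n * \<delta>^2" using k0 by (simp add: d2 field_simps)
 have "5 + 8 * real n * \<delta>^2 \<le> ?A * (real n * \<delta>^2)"
  using nd \<delta>0 by (simp add: field_simps)
 then have "3 * real k / 32 / (?A * (real n * \<delta>^2)) \<le> 3 * real k / 32 / (5 + 8 * real n * \<delta>^2)"
  using dp n A by (intro divide_left_mono) (auto intro!: mult_pos_pos add_pos_nonneg)
 then have "\<delta>^2 * (3 * real k / 32 / (?A * (real n * \<delta>^2))) \<le> \<delta>^2 * (3 * real k / 32 / (5 + 8 * real n * \<delta>^2))"
  using dp by (intro mult_left_mono) auto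
 also have "\<delta>^2 * (3 * real k / 32 / (?A * (real n * \<delta>^2))) = 3 / (32 * ?A) * (real k / real n)"
  using dp by simp
 finally have 1: "3 / (32 * ?A) * (real k / real n) \<le> \<delta>^2 * (3 * real k / 32 / (5 + 8 * real n * \<delta>^2))" .
 have e: "real n powr (1 / (2 * \<alpha> + 2)) / real n = real n powr (- ((2 * \<alpha> + 1) / (2 * \<alpha> + 2)))"
 proof -
  have "real n powr (1 / (2 * \<alpha> + 2)) / real n = real n powr (1 / (2 * \<alpha> + 2) - 1)"
   using n by (simp add: powr_diff)
  also have "1 / (2 * \<alpha> + 2) - 1 = - ((2 * \<alpha> + 1) / (2 * \<alpha> + 2))" using \<alpha> by (simp add: field_simps)
  finally show ?thesis .
 qed
 have "min (real n powr (- ((2 * \<alpha> + 1) / (2 * \<alpha> + 2)))) (real d / real n) = min (real n powr (1 / (2 * \<alpha> + 2))) (real d) / real n"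
  unfolding e[symmetric] using n by (simp add: min_def divide_right_mono field_simps)
 also have "... \<le> 4 * (real k / real n)" using k2 n by (simp add: field_simps)
 finally have "3 / (128 * ?A) * min (real n powr (- ((2 * \<alpha> + 1) / (2 * \<alpha> + 2)))) (real d / real n) \<le> 3 / (128 * ?A) * (4 * (real k / real n))"
  using A by (intro mult_left_mono) auto
 also have "3 / (128 * X) * (4 * Y) = 3 / (32 * X) * Y" for X Y :: real by simp
 also note 1
 finally have "c ^ 4 * (3 / (128 * ?A) * min (real n powr (- ((2 * \<alpha> + 1) / (2 * \<alpha> + 2)))) (real d / real n))
  \<le> c ^ 4 * (\<delta>^2 * (3 * real k / 32 / (5 + 8 * real n * \<delta>^2)))"
  by (intro mult_left_mono) auto
 then show ?thesis by (simp only: mult.assoc)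
qed

text \<open>
 As before, the second summand of the denominator dominates, now for
 \<open>2 * k \<le> (\<rho> * n^2 / d) powr (1 / (2 * \<alpha> + 3))\<close>; the bound is a constant multiple of \<open>k^2 * d / (\<rho> * n^2)\<close>, because
 \<open>exp (2 * \<rho>) - 1\<close> is at most \<open>2 * \<rho> * exp (2 * R)\<close>.
\<close>

lemma private_rate_bound:
 fixes n k d :: nat and \<alpha> \<delta>0 c \<rho> :: real
 assumes \<alpha>: "\<alpha> > 0" and \<delta>0: "\<delta>0 > 0" and k: "k \<ge> 1" and n: "n > 0" and d: "d > 0"
  and \<rho>: "\<rho> > 0" "\<rho> \<le> R"
  and k1: "real (2 * k) \<le> (\<rho> * (real n)^2 / real d) powr (1 / (2 * \<alpha> + 3))"
  and k2: "min ((\<rho> * (real n)^2 / real d) powr (1 / (2 * \<alpha> + 3))) (real d) / 4 \<le> real k"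
 defines "\<delta> \<equiv> \<delta>0 * real (2 * k) powr (- (\<alpha> + 1))"
 shows "c ^ 4 * (3 / (512 * (5 / (2 * \<delta>0^2) + 64 * exp (2 * R)))) * min ((real d / (\<rho> * (real n)^2)) powr ((2 * \<alpha> + 1) / (2 * \<alpha> + 3)))
    (real d ^ 3 / (\<rho> * (real n)^2))
  \<le> c ^ 4 * \<delta>^2 * (3 * real k / 32 / (5 + 32 * (real n)^2 * \<delta>^2 * (exp (2 * \<rho>) - 1) / (real d * real k)))"
proof -
 define T where "T = \<rho> * (real n)^2 / real d"
 have T: "T > 0" using \<rho> n d by (simp add: T_def)
 let ?A = "5 / (2 * \<delta>0^2) + 64 * exp (2 * R)"
 let ?D = "5 + 32 * (real n)^2 * \<delta>^2 * (exp (2 * \<rho>) - 1) / (real d * real k)"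
 have A: "?A > 0" by (intro add_nonneg_pos) auto
 have k0: "real (2 * k) > 0" "real k > 0" using k by simp_all
 have d2: "\<delta>^2 = \<delta>0^2 / real (2 * k) powr (2 * \<alpha> + 2)"
 proof -
  have "(real (2 * k) powr (- (\<alpha> + 1)))^2 = real (2 * k) powr (- (2 * \<alpha> + 2))"
   using k0 by (simp add: power2_eq_square powr_add[symmetric])
  also have "... = 1 / real (2 * k) powr (2 * \<alpha> + 2)" by (rule powr_minus_divide)
  finally show ?thesis by (simp only: \<delta>_def power_mult_distrib times_divide_eq_right mult_1_right)
 qed
 have dp: "\<delta>^2 > 0" using \<delta>0 k0 by (simp add: d2)
 have "real (2 * k) powr (2 * \<alpha> + 3) \<le> (T powr (1 / (2 * \<alpha> + 3))) powr (2 * \<alpha> + 3)"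
  using k1 k0 \<alpha> unfolding T_def by (intro powr_mono2) auto
 also have "... = T" using \<alpha> T by (simp add: powr_powr)
 finally have pT: "real (2 * k) powr (2 * \<alpha> + 3) \<le> T" .
 have split: "real (2 * k) powr (2 * \<alpha> + 3) = real (2 * k) powr (2 * \<alpha> + 2) * real (2 * k)"
 proof -
  have "2 * \<alpha> + 3 = (2 * \<alpha> + 2) + 1" by simp
  then show ?thesis using k0 by (simp only: powr_add) simp
 qed
 have "\<delta>0^2 * (real (2 * k) powr (2 * \<alpha> + 2) * real (2 * k)) \<le> \<delta>0^2 * T"
  using pT unfolding split by (intro mult_left_mono) auto
 then have nd: "2 * \<delta>0^2 \<le> \<delta>^2 * T / real k" using k0 by (simp add: d2 field_simps)
 have "exp (2 * \<rho>) - 1 \<le> 2 * \<rho> * exp (2 * \<rho>)"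
 proof -
  have "1 + (- (2 * \<rho>)) \<le> exp (- (2 * \<rho>))" by (rule exp_ge_add_one_self)
  then have "(1 - 2 * \<rho>) * exp (2 * \<rho>) \<le> exp (- (2 * \<rho>)) * exp (2 * \<rho>)" by (intro mult_right_mono) auto
  then show ?thesis by (simp add: exp_add[symmetric] algebra_simps)
 qed
 also have "... \<le> 2 * \<rho> * exp (2 * R)" using \<rho> by (intro mult_left_mono) auto
 finally have ex: "exp (2 * \<rho>) - 1 \<le> 2 * \<rho> * exp (2 * R)" .
 have "32 * (real n)^2 * \<delta>^2 * (exp (2 * \<rho>) - 1) / (real d * real k) \<le> 32 * (real n)^2 * \<delta>^2 * (2 * \<rho> * exp (2 * R)) / (real d * real k)"
  using ex by (intro divide_right_mono mult_left_mono) auto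
 also have "... = 64 * exp (2 * R) * (\<delta>^2 * T / real k)" by (simp add: T_def)
 finally have 2: "32 * (real n)^2 * \<delta>^2 * (exp (2 * \<rho>) - 1) / (real d * real k) \<le> 64 * exp (2 * R) * (\<delta>^2 * T / real k)" .
 have "5 = 5 / (2 * \<delta>0^2) * (2 * \<delta>0^2)" using \<delta>0 by simp
 also have "... \<le> 5 / (2 * \<delta>0^2) * (\<delta>^2 * T / real k)" by (rule mult_left_mono[OF nd]) simp
 finally have "5 \<le> 5 / (2 * \<delta>0^2) * (\<delta>^2 * T / real k)" .
 from add_mono[OF this 2] have D: "?D \<le> ?A * (\<delta>^2 * T / real k)" by (simp only: distrib_right)
 have Dp: "0 < ?D" using \<rho> by (intro add_pos_nonneg divide_nonneg_nonneg mult_nonneg_nonneg) auto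
 have "3 * real k / 32 / (?A * (\<delta>^2 * T / real k)) \<le> 3 * real k / 32 / ?D"
  by (rule frac_le[OF _ order_refl Dp D]) simp
 then have "\<delta>^2 * (3 * real k / 32 / (?A * (\<delta>^2 * T / real k))) \<le> \<delta>^2 * (3 * real k / 32 / ?D)"
  using dp by (intro mult_left_mono) auto
 moreover have "\<delta>^2 * (3 * real k / 32 / (?A * (\<delta>^2 * T / real k))) = 3 / (32 * ?A) * ((real k)^2 / T)"
 proof -
  have "y * (3 * x / 32 / (B * (y * t / x))) = 3 / (32 * B) * (x^2 / t)" if "y > 0" "x > 0" "B > 0" for x y t B :: real
   using that by (simp add: field_simps power2_eq_square)
  then show ?thesis using dp k0(2) A by blast
 qed
 ultimately have 1: "3 / (32 * ?A) * ((real k)^2 / T) \<le> \<delta>^2 * (3 * real k / 32 / ?D)" by simp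
 have e: "(T powr (1 / (2 * \<alpha> + 3)))^2 / T = (real d / (\<rho> * (real n)^2)) powr ((2 * \<alpha> + 1) / (2 * \<alpha> + 3))"
 proof -
  have "(T powr (1 / (2 * \<alpha> + 3)))^2 / T = T powr (2 / (2 * \<alpha> + 3) - 1)"
   using T by (simp add: powr_diff power2_eq_square powr_add[symmetric])
  also have "2 / (2 * \<alpha> + 3) - 1 = - ((2 * \<alpha> + 1) / (2 * \<alpha> + 3))" using \<alpha> by (simp add: field_simps)
  also have "T powr ... = (1 / T) powr ((2 * \<alpha> + 1) / (2 * \<alpha> + 3))"
   using T by (simp add: powr_minus_divide powr_divide)
  also have "1 / T = real d / (\<rho> * (real n)^2)" by (simp add: T_def)
  finally show ?thesis .
 qed
 have e2: "real d ^ 3 / (\<rho> * (real n)^2) = (real d)^2 / T" by (simp add: T_def power2_eq_square power3_eq_cube)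
 have "min ((real d / (\<rho> * (real n)^2)) powr ((2 * \<alpha> + 1) / (2 * \<alpha> + 3))) (real d ^ 3 / (\<rho> * (real n)^2))
   \<le> (min (T powr (1 / (2 * \<alpha> + 3))) (real d))^2 / T"
  unfolding e[symmetric] e2 by (auto simp: min_def)
 also have "... \<le> (4 * real k)^2 / T"
  using k2 T unfolding T_def[symmetric] by (intro divide_right_mono power_mono) auto
 also have "... = 16 * ((real k)^2 / T)" by (simp add: power_mult_distrib)
 finally have "3 / (512 * ?A) * min ((real d / (\<rho> * (real n)^2)) powr ((2 * \<alpha> + 1) / (2 * \<alpha> + 3))) (real d ^ 3 / (\<rho> * (real n)^2))
  \<le> 3 / (512 * ?A) * (16 * ((real k)^2 / T))"
  using A by (intro mult_left_mono) auto
 also have "3 / (512 * X) * (16 * Y) = 3 / (32 * X) * Y" for X Y :: real by simp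
 also note 1
 finally have "c ^ 4 * (3 / (512 * ?A) * min ((real d / (\<rho> * (real n)^2)) powr ((2 * \<alpha> + 1) / (2 * \<alpha> + 3))) (real d ^ 3 / (\<rho> * (real n)^2)))
  \<le> c ^ 4 * (\<delta>^2 * (3 * real k / 32 / ?D))"
  by (intro mult_left_mono) auto
 then show ?thesis by (simp only: mult.assoc)
qed

lemma rate_le_minimax_risk:
 assumes par: "\<alpha> > 0" "K > 0" "M0 > 0" "M > 0" and R: "R > 0"
  and \<J>: "\<J> \<in> {row_tail_class, pointwise_class}"
 obtains C where "C > 0"
  "\<And>n d \<rho>. n > 0 ==> d \<ge> 2 ==> 0 < \<rho> ==> \<rho> \<le> R ==> 2 \<le> real n powr (1 / (2 * \<alpha> + 2)) ==>
   2 \<le> (\<rho> * (real n)^2 / real d) powr (1 / (2 * \<alpha> + 3)) ==>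
   minimax_rate \<alpha> n d \<rho> \<le> ennreal C * minimax_risk \<J> \<alpha> K M0 M n d \<rho>"
proof -
 define c where "c = min K (sqrt M0) / 3"
 have c: "c > 0" "c \<le> K / 3" using par by (auto simp: c_def)
 have "c \<le> sqrt M0 / 3" by (simp add: c_def)
 from power_mono[OF this, of 2] c have c2: "c^2 \<le> M0 / 9" using par by (simp add: power_divide)
 define \<delta>0 where "\<delta>0 = min 1 (M / (2 * c^2))"
 have \<delta>0: "0 < \<delta>0" "\<delta>0 \<le> 1" using par c by (auto simp: \<delta>0_def)
 have "\<delta>0 \<le> M / (2 * c^2)" by (simp add: \<delta>0_def)
 then have \<delta>0M: "2 * c^2 * \<delta>0 \<le> M" using c by (simp add: field_simps)
 define A1 where "A1 = c ^ 4 * (3 / (128 * (5 / \<delta>0^2 + 8)))"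
 define A2 where "A2 = c ^ 4 * (3 / (512 * (5 / (2 * \<delta>0^2) + 64 * exp (2 * R))))"
 have A1: "A1 > 0" unfolding A1_def using c \<delta>0 by (intro mult_pos_pos divide_pos_pos add_nonneg_pos) auto
 have A2: "A2 > 0" unfolding A2_def using c \<delta>0 by (intro mult_pos_pos divide_pos_pos add_nonneg_pos) auto
 show thesis
 proof (rule that[of "1 / A1 + 1 / A2"])
  show "1 / A1 + 1 / A2 > 0" using A1 A2 by (simp add: add_pos_pos)
  fix n d :: nat and \<rho> :: real
  assume n: "n > 0" and d: "d \<ge> 2" and \<rho>: "0 < \<rho>" "\<rho> \<le> R" and n2: "2 \<le> real n powr (1 / (2 * \<alpha> + 2))"
   and T2: "2 \<le> (\<rho> * (real n)^2 / real d) powr (1 / (2 * \<alpha> + 3))"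
  let ?r = "minimax_risk \<J> \<alpha> K M0 M n d \<rho>"
  let ?a = "min (real n powr (- ((2 * \<alpha> + 1) / (2 * \<alpha> + 2)))) (real d / real n)"
  let ?b = "min ((real d / (\<rho> * (real n)^2)) powr ((2 * \<alpha> + 1) / (2 * \<alpha> + 3))) (real d ^ 3 / (\<rho> * (real n)^2))"
  have a0: "?a \<ge> 0" by auto
  have b0: "?b \<ge> 0" using \<rho> by auto
  obtain k where k: "k \<ge> 1" "real (2 * k) \<le> min (real n powr (1 / (2 * \<alpha> + 2))) (real d)"
   "min (real n powr (1 / (2 * \<alpha> + 2))) (real d) / 4 \<le> real k"
   using floor_half[of "min (real n powr (1 / (2 * \<alpha> + 2))) (real d)"] n2 d by auto
  have kd: "2 * k \<le> d" using k(2) by simp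
  have "ennreal (A1 * ?a) \<le> ?r"
   unfolding A1_def
   by (rule order_trans[OF ennreal_leI[OF statistical_rate_bound[OF par(1) \<delta>0(1) k(1) n _ k(3)]]
     block_minimax_ge(1)[OF par c c2 \<J> \<delta>0 \<delta>0M k(1) kd n \<rho>(1)]])
    (use k(2) in auto)
  then have "ennreal (1 / A1) * ennreal (A1 * ?a) \<le> ennreal (1 / A1) * ?r" by (rule mult_left_mono) simp
  then have 1: "ennreal ?a \<le> ennreal (1 / A1) * ?r"
   using A1 a0 by (subst (asm) ennreal_mult[symmetric]) auto
  obtain k' where k': "k' \<ge> 1" "real (2 * k') \<le> min ((\<rho> * (real n)^2 / real d) powr (1 / (2 * \<alpha> + 3))) (real d)"
   "min ((\<rho> * (real n)^2 / real d) powr (1 / (2 * \<alpha> + 3))) (real d) / 4 \<le> real k'"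
   using floor_half[of "min ((\<rho> * (real n)^2 / real d) powr (1 / (2 * \<alpha> + 3))) (real d)"] T2 d by auto
  have kd': "2 * k' \<le> d" using k'(2) by simp
  have "ennreal (A2 * ?b) \<le> ?r"
   unfolding A2_def
   by (rule order_trans[OF ennreal_leI[OF private_rate_bound[OF par(1) \<delta>0(1) k'(1) n _ \<rho> _ k'(3)]]
     block_minimax_ge(2)[OF par c c2 \<J> \<delta>0 \<delta>0M k'(1) kd' n \<rho>(1)]])
    (use k'(2) d in auto)
  then have "ennreal (1 / A2) * ennreal (A2 * ?b) \<le> ennreal (1 / A2) * ?r" by (rule mult_left_mono) simp
  then have 2: "ennreal ?b \<le> ennreal (1 / A2) * ?r"
   using A2 b0 by (subst (asm) ennreal_mult[symmetric]) auto
  have "minimax_rate \<alpha> n d \<rho> = ennreal ?a + ennreal ?b"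
   unfolding minimax_rate_def using a0 b0 by (rule ennreal_plus)
  also have "... \<le> ennreal (1 / A1) * ?r + ennreal (1 / A2) * ?r" using 1 2 by (rule add_mono)
  also have "... = ennreal (1 / A1 + 1 / A2) * ?r" using A1 A2 by (simp add: distrib_right ennreal_plus)
  finally show "minimax_rate \<alpha> n d \<rho> \<le> ennreal (1 / A1 + 1 / A2) * ?r" .
 qed
qed

text \<open>
 The regime makes \<open>n\<close>, \<open>d\<close> and \<open>\<rho> * n^2 / d\<close> exceed any given bound, so the bandwidths that balance the rates are at
 least any given constant.
\<close>

lemma regime_eventually_large:
 assumes "regime c R d \<rho>" "c > 0"
 shows "\<forall>\<^sub>F n in sequentially. b \<le> real n" "\<forall>\<^sub>F n in sequentially. b \<le> real (d n)"
  "\<forall>\<^sub>F n in sequentially. 0 < \<rho> n \<and> \<rho> n \<le> R"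
  "\<forall>\<^sub>F n in sequentially. c * ln (real n) \<le> real (d n)"
  "\<forall>\<^sub>F n in sequentially. b \<le> \<rho> n * (real n)^2 / real (d n)"
proof -
 show "\<forall>\<^sub>F n in sequentially. b \<le> real n" for b
  using filterlim_real_sequentially by (simp add: filterlim_at_top)
 note nlarge = this
 show r: "\<forall>\<^sub>F n in sequentially. 0 < \<rho> n \<and> \<rho> n \<le> R"
  and dl: "\<forall>\<^sub>F n in sequentially. c * ln (real n) \<le> real (d n)"
  using assms by (auto simp: regime_def)
 show dlarge: "\<forall>\<^sub>F n in sequentially. b \<le> real (d n)" for b
  using dl nlarge[of "exp (b / c)"]
 proof eventually_elim
  case (elim n)
  then have "b / c \<le> ln (real n)" by (metis exp_gt_zero ln_exp ln_le_cancel_iff less_le_trans)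
  then show ?case using elim(1) assms(2) by (simp add: field_simps)
 qed
 have lim: "(\<lambda>n. real (d n) / (\<rho> n * (real n)^2)) \<longlonglongrightarrow> 0" using assms by (simp add: regime_def)
 have pos: "1 / max b 1 > 0" by simp
 show "\<forall>\<^sub>F n in sequentially. b \<le> \<rho> n * (real n)^2 / real (d n)"
  using order_tendstoD(2)[OF lim pos] r dlarge[of 1] nlarge[of 1]
 proof eventually_elim
  case (elim n)
  then have p: "\<rho> n * (real n)^2 > 0" "real (d n) > 0" by auto
  have "real (d n) * max b 1 < \<rho> n * (real n)^2" using elim(1) p by (simp add: field_simps)
  then have "max b 1 < \<rho> n * (real n)^2 / real (d n)"
   using p(2) by (simp only: pos_less_divide_eq mult.commute)
  then show ?case by simp
 qed
qed

lemma minimax_lower_bound: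
 assumes par: "\<alpha> > 0" "K > 0" "M0 > 0" "M > 0" and c: "c > 0" and R: "R > 0"
  and \<J>: "\<J> \<in> {row_tail_class, pointwise_class}"
 shows "lesssim c R (minimax_rate \<alpha>) (minimax_risk \<J> \<alpha> K M0 M)"
proof -
 obtain C where C: "C > 0"
  "\<And>n d \<rho>. n > 0 ==> d \<ge> 2 ==> 0 < \<rho> ==> \<rho> \<le> R ==> 2 \<le> real n powr (1 / (2 * \<alpha> + 2)) ==>
   2 \<le> (\<rho> * (real n)^2 / real d) powr (1 / (2 * \<alpha> + 3)) ==>
   minimax_rate \<alpha> n d \<rho> \<le> ennreal C * minimax_risk \<J> \<alpha> K M0 M n d \<rho>"
  using rate_le_minimax_risk[OF par R \<J>] by metis
 have root: "2 \<le> x powr (1 / b)" if "2 powr b \<le> x" "b > 0" for x b :: real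
 proof -
  have "(2 powr b) powr (1 / b) \<le> x powr (1 / b)" using that by (intro powr_mono2) auto
  then show ?thesis using that by (simp add: powr_powr)
 qed
 show ?thesis unfolding lesssim_def
 proof (intro exI[of _ C] conjI C(1) allI impI)
  fix d \<rho> assume reg: "regime c R d \<rho>"
  note L = regime_eventually_large[OF reg c]
  show "\<forall>\<^sub>F n in sequentially. minimax_rate \<alpha> n (d n) (\<rho> n) \<le> ennreal C * minimax_risk \<J> \<alpha> K M0 M n (d n) (\<rho> n)"
   using L(1)[of 1] L(1)[of "2 powr (2 * \<alpha> + 2)"] L(2)[of 2] L(3) L(5)[of "2 powr (2 * \<alpha> + 3)"]
  proof eventually_elim
   case (elim n)
   then show ?case using par by (intro C(2) root) auto
  qed
 qed
qed

section \<open>Renyi moments of the noise mechanisms\<close>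

lemma sinh_le_cosh: "x \<ge> 0 ==> sinh x \<le> x * cosh (x::real)"
proof -
 assume x: "x \<ge> 0"
 have "(\<lambda>y. y * cosh y - sinh y) 0 \<le> (\<lambda>y. y * cosh y - sinh y) x"
  by (rule DERIV_nonneg_imp_nondecreasing[OF x])
   (auto intro!: exI derivative_eq_intros)
 then show ?thesis by simp
qed

text \<open>
 The function \<open>cosh x * exp (- x^2 / 2)\<close> decreases for positive \<open>x\<close>.
\<close>

lemma cosh_ratio_le:
 fixes a b :: real
 assumes "0 \<le> b" "b \<le> a"
 shows "cosh a \<le> cosh b * exp ((a^2 - b^2) / 2)"
proof -
 let ?h = "\<lambda>x::real. cosh x * exp (- (x^2 / 2))"
 have "?h a \<le> ?h b"
 proof (rule DERIV_nonpos_imp_nonincreasing[OF assms(2)])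
  fix x assume x: "b \<le> x" "x \<le> a"
  have "DERIV ?h x :> (sinh x - x * cosh x) * exp (- (x^2 / 2))"
   by (auto intro!: derivative_eq_intros simp: algebra_simps)
  moreover have "(sinh x - x * cosh x) * exp (- (x^2 / 2)) \<le> 0"
   using sinh_le_cosh[of x] x assms by (intro mult_nonpos_nonneg) auto
  ultimately show "\<exists>y. DERIV ?h x :> y \<and> y \<le> 0" by blast
 qed
 then have "?h a * exp (a^2 / 2) \<le> ?h b * exp (a^2 / 2)" by (rule mult_right_mono) simp
 then show ?thesis by (simp add: mult.assoc exp_add[symmetric] diff_divide_distrib)
qed

lemma powr_chord:
 fixes r u v lam :: real
 assumes "lam \<ge> 1" "0 < u" "u < v" "u \<le> r" "r \<le> v"
 shows "r powr lam \<le> u powr lam + (r - u) / (v - u) * (v powr lam - u powr lam)"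
proof -
 define t where "t = (r - u) / (v - u)"
 have t: "0 \<le> t" "t \<le> 1" using assms by (auto simp: t_def)
 have r: "r = (1 - t) *\<^sub>R u + t *\<^sub>R v"
 proof -
  have "t * (v - u) = r - u" using assms by (simp add: t_def)
  then show ?thesis by (simp add: algebra_simps)
 qed
 have "r powr lam \<le> (1 - t) * u powr lam + t * v powr lam"
  unfolding r by (rule convex_onD[OF powr_convex[OF assms(1)] t]) (use assms in auto)
 then show ?thesis by (simp add: t_def[symmetric] algebra_simps)
qed

text \<open>
 The likelihood ratio lies between \<open>exp (- \<epsilon>)\<close> and \<open>exp \<epsilon>\<close> and has mean 1, so convexity bounds its moment by that of the law on the two
 extreme values with the same mean.  This moment is the quotient \<open>cosh ((lam - 1 / 2) * \<epsilon>) / cosh (\<epsilon> / 2)\<close>.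
\<close>

lemma pure_dp_renyi:
 fixes p q :: "'a => real"
 assumes fin: "finite A" and pos: "\<And>a. a \<in> A ==> 0 < p a" "\<And>a. a \<in> A ==> 0 < q a"
  and sums: "(\<Sum>a\<in>A. p a) = 1" "(\<Sum>a\<in>A. q a) = 1"
  and dp: "\<And>a. a \<in> A ==> p a \<le> exp \<epsilon> * q a" "\<And>a. a \<in> A ==> q a \<le> exp \<epsilon> * p a"
  and \<epsilon>: "\<epsilon> > 0" and lam: "lam > 1"
 shows "(\<Sum>a\<in>A. p a powr lam * q a powr (1 - lam)) \<le> exp (lam * (lam - 1) * \<epsilon>^2 / 2)"
proof -
 let ?u = "exp (- \<epsilon>)" let ?v = "exp \<epsilon>"
 have uv: "?u < ?v" using \<epsilon> by simp
 define s where "s = (?v powr lam - ?u powr lam) / (?v - ?u)"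
 have "(\<Sum>a\<in>A. p a powr lam * q a powr (1 - lam)) \<le> (\<Sum>a\<in>A. ?u powr lam * q a + s * (p a - ?u * q a))"
 proof (rule sum_mono)
  fix a assume a: "a \<in> A"
  have r: "?u \<le> p a / q a" "p a / q a \<le> ?v"
   using dp[OF a] pos[OF a] by (auto simp: field_simps exp_minus)
  have "p a powr lam * q a powr (1 - lam) = (p a / q a) powr lam * q a"
   using pos[OF a] by (simp add: powr_divide powr_diff)
  also have "... \<le> (?u powr lam + (p a / q a - ?u) / (?v - ?u) * (?v powr lam - ?u powr lam)) * q a"
   using r uv lam pos[OF a] by (intro mult_right_mono powr_chord) auto
  also have "... = ?u powr lam * q a + s * ((p a / q a - ?u) * q a)"
   by (simp add: s_def algebra_simps)
  also have "(p a / q a - ?u) * q a = p a - ?u * q a" using pos[OF a] by (simp add: field_simps)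
  finally show "p a powr lam * q a powr (1 - lam) \<le> ?u powr lam * q a + s * (p a - ?u * q a)" .
 qed
 also have "... = ?u powr lam + s * (1 - ?u)"
  using sums by (simp add: sum.distrib sum_subtractf flip: sum_distrib_left)
 also have "... = cosh ((lam - 1 / 2) * \<epsilon>) / cosh (\<epsilon> / 2)"
 proof -
  define x where "x = exp (\<epsilon> / 2)"
  define y where "y = exp (lam * \<epsilon>)"
  have x1: "x > 1" and y0: "y > 0" using \<epsilon> by (auto simp: x_def y_def)
  have "?u powr lam = exp (- (lam * \<epsilon>))" by (simp add: exp_powr_real mult.commute)
  then have e: "?u powr lam = 1 / y" "?v powr lam = y" "?v = x * x" "?u = 1 / (x * x)"
   by (auto simp: x_def y_def exp_add[symmetric] exp_powr_real exp_minus' mult.commute)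
  have c1: "cosh (\<epsilon> / 2) = (x + 1 / x) / 2" by (simp add: cosh_def x_def exp_minus')
  have c2: "cosh ((lam - 1 / 2) * \<epsilon>) = (y / x + x / y) / 2"
   by (simp add: cosh_def x_def y_def exp_minus' left_diff_distrib exp_diff)
  have x2: "x * x - 1 / (x * x) \<noteq> 0"
   using x1 by (simp add: field_simps) (metis less_1_mult less_irrefl mult.assoc)
  have x3: "x * x > 1" "x * x * (x * x) > 1" using x1 by (simp_all add: less_1_mult)
  have "1 / y + (y - 1 / y) / (x * x - 1 / (x * x)) * (1 - 1 / (x * x)) = 1 / y + (y - 1 / y) / (x * x + 1)"
  proof -
   have "(1 - 1 / (x * x)) * (x * x + 1) = x * x - 1 / (x * x)" using x1 by (simp add: field_simps)
   then have "(1 - 1 / (x * x)) / (x * x - 1 / (x * x)) = 1 / (x * x + 1)"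
    using x2 x3 by (simp add: divide_eq_eq eq_divide_eq)
   then show ?thesis by (simp only: times_divide_eq_left times_divide_eq_right[symmetric] mult_1_right) simp
  qed
  also have "... = (y / x + x / y) / 2 / ((x + 1 / x) / 2)"
  proof -
   have p: "x * x + 1 > 0" "x > 0" using x3 x1 by auto
   have "(x + 1 / x) = (x * x + 1) / x" using p by (simp add: field_simps)
   then have "(y / x + x / y) / 2 / ((x + 1 / x) / 2) = (y / x + x / y) * x / (x * x + 1)" by simp
   also have "(y / x + x / y) * x = y + x * x / y" using p by (simp add: field_simps)
   also have "(y + x * x / y) / (x * x + 1) = 1 / y + (y - 1 / y) / (x * x + 1)"
   proof -
    have "y + x * x / y = (x * x + 1) * (1 / y) + (y - 1 / y)" using y0 by (simp add: field_simps)
    moreover have "((x * x + 1) * (1 / y) + (y - 1 / y)) / (x * x + 1) = 1 / y + (y - 1 / y) / (x * x + 1)"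
     using p by (subst add_divide_distrib) simp
    ultimately show ?thesis by (simp only:)
   qed
   finally show ?thesis by simp
  qed
  finally show ?thesis unfolding s_def e(1,2) unfolding e(3,4) c1 c2 .
 qed
 also have "... \<le> exp ((((lam - 1 / 2) * \<epsilon>)^2 - (\<epsilon> / 2)^2) / 2)"
 proof -
  have "cosh ((lam - 1 / 2) * \<epsilon>) \<le> cosh (\<epsilon> / 2) * exp ((((lam - 1 / 2) * \<epsilon>)^2 - (\<epsilon> / 2)^2) / 2)"
   using \<epsilon> lam by (intro cosh_ratio_le) auto
  then show ?thesis by (simp add: divide_le_eq mult.commute)
 qed
 also have "((lam - 1 / 2) * \<epsilon>)^2 - (\<epsilon> / 2)^2 = lam * (lam - 1) * \<epsilon>^2"
  by (simp add: power2_eq_square algebra_simps)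
 finally show ?thesis .
qed

lemma renyi_moment_normal:
 assumes \<sigma>: "\<sigma> > 0"
 shows "renyi_moment lborel lam (normal_density a \<sigma>) (normal_density b \<sigma>)
  = ennreal (exp (lam * (lam - 1) * (a - b)^2 / (2 * \<sigma>^2)))"
proof -
 define c where "c = lam * a + (1 - lam) * b"
 let ?C = "exp (lam * (lam - 1) * (a - b)^2 / (2 * \<sigma>^2))"
 have eq: "normal_density a \<sigma> x powr lam * normal_density b \<sigma> x powr (1 - lam) = ?C * normal_density c \<sigma> x" for x
 proof -
  define A where "A = 1 / sqrt (2 * pi * \<sigma>^2)"
  have A: "A > 0" using \<sigma> by (simp add: A_def)
  have nd: "normal_density m \<sigma> x = A * exp (- (x - m)\<^sup>2 / (2 * \<sigma>^2))" for m
   by (simp add: normal_density_def A_def)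
  have AA: "A powr lam * A powr (1 - lam) = A" using A by (simp add: powr_add[symmetric])
  have "normal_density a \<sigma> x powr lam * normal_density b \<sigma> x powr (1 - lam)
   = A * exp (lam * (- (x - a)\<^sup>2 / (2 * \<sigma>^2)) + (1 - lam) * (- (x - b)\<^sup>2 / (2 * \<sigma>^2)))"
  proof -
   have "(A * exp y) powr lam * (A * exp y') powr (1 - lam) = (A powr lam * A powr (1 - lam)) * exp (lam * y + (1 - lam) * y')" for y y'
    using A by (simp add: powr_mult exp_powr_real exp_add mult_ac)
   then show ?thesis unfolding nd by (simp only: AA)
  qed
  also have "lam * (- (x - a)\<^sup>2 / (2 * \<sigma>^2)) + (1 - lam) * (- (x - b)\<^sup>2 / (2 * \<sigma>^2))
   = (lam * (lam - 1) * (a - b)^2 - (x - c)^2) / (2 * \<sigma>^2)"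
  proof -
   have "lam * (x - a)^2 + (1 - lam) * (x - b)^2 = (x - c)^2 - lam * (lam - 1) * (a - b)^2"
    by (simp add: c_def power2_eq_square algebra_simps)
   then have "- (lam * (x - a)^2) - (1 - lam) * (x - b)^2 = lam * (lam - 1) * (a - b)^2 - (x - c)^2" by simp
   then have "(- (lam * (x - a)^2) - (1 - lam) * (x - b)^2) / (2 * \<sigma>^2) = (lam * (lam - 1) * (a - b)^2 - (x - c)^2) / (2 * \<sigma>^2)"
    by simp
   then show ?thesis by (simp add: diff_divide_distrib)
  qed
  also have "A * exp ((y - y') / s) = exp (y / s) * (A * exp (- y' / s))" for y y' s
  proof -
   have "exp ((y - y') / s) = exp (y / s) * exp (- y' / s)" by (simp add: exp_add[symmetric] diff_divide_distrib)
   then show ?thesis by simp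
  qed
  finally show ?thesis by (simp only: nd)
 qed
 have "renyi_moment lborel lam (normal_density a \<sigma>) (normal_density b \<sigma>) = (\<integral>\<^sup>+x. ennreal ?C * ennreal (normal_density c \<sigma> x) \<partial>lborel)"
  unfolding renyi_moment_def eq by (simp add: ennreal_mult')
 also have "... = ennreal ?C * emeasure (density lborel (\<lambda>x. ennreal (normal_density c \<sigma> x))) UNIV"
  by (subst nn_integral_cmult) (auto simp: emeasure_density)
 also have "emeasure (density lborel (\<lambda>x. ennreal (normal_density c \<sigma> x))) UNIV = 1"
  using prob_space.emeasure_space_1[OF prob_space_normal_density[OF \<sigma>, of c]] by simp
 finally show ?thesis by simp
qed

lemma renyi_moment_PiM:
 fixes p q :: "'i => 'a => real"
 assumes sf: "\<And>i. sigma_finite_measure (\<mu> i)" and fin: "finite I"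
  and [measurable]: "\<And>i. i \<in> I ==> p i \<in> borel_measurable (\<mu> i)" "\<And>i. i \<in> I ==> q i \<in> borel_measurable (\<mu> i)"
  and nn: "\<And>i x. 0 \<le> p i x" "\<And>i x. 0 \<le> q i x"
 shows "renyi_moment (PiM I \<mu>) lam (\<lambda>x. \<Prod>i\<in>I. p i (x i)) (\<lambda>x. \<Prod>i\<in>I. q i (x i)) = (\<Prod>i\<in>I. renyi_moment (\<mu> i) lam (p i) (q i))"
proof -
 interpret product_sigma_finite \<mu> using sf by (rule product_sigma_finite.intro)
 have "renyi_moment (PiM I \<mu>) lam (\<lambda>x. \<Prod>i\<in>I. p i (x i)) (\<lambda>x. \<Prod>i\<in>I. q i (x i))
  = (\<integral>\<^sup>+x. (\<Prod>i\<in>I. ennreal (p i (x i) powr lam * q i (x i) powr (1 - lam))) \<partial>PiM I \<mu>)"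
  unfolding renyi_moment_def using nn
  by (intro nn_integral_cong) (simp add: prod_powr_distrib prod.distrib[symmetric] prod_ennreal)
 also have "... = (\<Prod>i\<in>I. renyi_moment (\<mu> i) lam (p i) (q i))"
  unfolding renyi_moment_def by (rule product_nn_integral_prod[OF fin]) measurable
 finally show ?thesis .
qed

lemma renyi_moment_pair:
 fixes p q :: "'a => real" and p' q' :: "'b => real"
 assumes "sigma_finite_measure \<mu>" "sigma_finite_measure \<nu>"
  and [measurable]: "p \<in> borel_measurable \<mu>" "q \<in> borel_measurable \<mu>" "p' \<in> borel_measurable \<nu>" "q' \<in> borel_measurable \<nu>"
  and nn: "\<And>x. 0 \<le> p x" "\<And>x. 0 \<le> q x" "\<And>x. 0 \<le> p' x" "\<And>x. 0 \<le> q' x"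
 shows "renyi_moment (\<mu> \<Otimes>\<^sub>M \<nu>) lam (\<lambda>z. p (fst z) * p' (snd z)) (\<lambda>z. q (fst z) * q' (snd z))
  = renyi_moment \<mu> lam p q * renyi_moment \<nu> lam p' q'"
proof -
 interpret \<nu>: sigma_finite_measure \<nu> by fact
 have "renyi_moment (\<mu> \<Otimes>\<^sub>M \<nu>) lam (\<lambda>z. p (fst z) * p' (snd z)) (\<lambda>z. q (fst z) * q' (snd z))
  = (\<integral>\<^sup>+x. \<integral>\<^sup>+y. ennreal (p x powr lam * q x powr (1 - lam)) * ennreal (p' y powr lam * q' y powr (1 - lam)) \<partial>\<nu> \<partial>\<mu>)"
  unfolding renyi_moment_def using nn
  by (subst \<nu>.nn_integral_fst[symmetric]) (auto simp: powr_mult ennreal_mult[symmetric] mult_ac intro!: nn_integral_cong)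
 also have "... = renyi_moment \<mu> lam p q * renyi_moment \<nu> lam p' q'"
  unfolding renyi_moment_def by (simp add: nn_integral_cmult nn_integral_multc)
 finally show ?thesis .
qed

subsection \<open>Adaptive exponential mechanism\<close>

text \<open>
 The law of the exponential mechanism with utilities \<open>u\<close>.
\<close>

definition softmax :: "'a set => ('a => real) => 'a => real" where
 "softmax A u a = exp (u a) / (\<Sum>b\<in>A. exp (u b))"

lemma softmax_pos: "finite A ==> A \<noteq> {} ==> 0 < softmax A u a"
 unfolding softmax_def by (intro divide_pos_pos sum_pos) auto

lemma softmax_sum: "finite A ==> A \<noteq> {} ==> (\<Sum>a\<in>A. softmax A u a) = 1"
proof -
 assume "finite A" "A \<noteq> {}"
 then have "(\<Sum>b\<in>A. exp (u b)) > 0" by (intro sum_pos) auto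
 then show ?thesis by (simp add: softmax_def flip: sum_divide_distrib)
qed

lemma softmax_nonneg: "0 \<le> softmax A u a"
 unfolding softmax_def by (intro divide_nonneg_nonneg sum_nonneg) auto

lemma softmax_ratio:
 assumes A: "finite A" "a \<in> A" and close: "\<And>b. b \<in> A ==> \<bar>u b - u' b\<bar> \<le> \<epsilon> / 2"
 shows "softmax A u a \<le> exp \<epsilon> * softmax A u' a"
proof -
 have Z: "0 < (\<Sum>b\<in>A. exp (u b))" "0 < (\<Sum>b\<in>A. exp (u' b))" using A by (auto intro!: sum_pos)
 have "(\<Sum>b\<in>A. exp (u' b)) \<le> (\<Sum>b\<in>A. exp (\<epsilon> / 2) * exp (u b))"
 proof (rule sum_mono)
  fix b assume "b \<in> A"
  from close[OF this] have "u' b \<le> \<epsilon> / 2 + u b" by linarith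
  then show "exp (u' b) \<le> exp (\<epsilon> / 2) * exp (u b)" by (simp add: exp_add[symmetric])
 qed
 then have 1: "(\<Sum>b\<in>A. exp (u' b)) \<le> exp (\<epsilon> / 2) * (\<Sum>b\<in>A. exp (u b))" by (simp add: sum_distrib_left)
 have 2: "exp (u a) \<le> exp (\<epsilon> / 2) * exp (u' a)"
 proof -
  have "u a \<le> \<epsilon> / 2 + u' a" using close[OF A(2)] by linarith
  then show ?thesis by (simp add: exp_add[symmetric])
 qed
 have "exp (u a) * (\<Sum>b\<in>A. exp (u' b)) \<le> (exp (\<epsilon> / 2) * exp (u' a)) * (exp (\<epsilon> / 2) * (\<Sum>b\<in>A. exp (u b)))"
  using 1 2 Z by (intro mult_mono) auto
 also have "... = (exp (\<epsilon> / 2) * exp (\<epsilon> / 2)) * exp (u' a) * (\<Sum>b\<in>A. exp (u b))" by (simp add: mult_ac)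
 also have "exp (\<epsilon> / 2) * exp (\<epsilon> / 2) = exp \<epsilon>" by (simp add: exp_add[symmetric])
 finally show ?thesis unfolding softmax_def using Z by (simp add: field_simps)
qed

text \<open>
 The utility of \<open>b\<close> is at most the logarithm of the normalizing sum, which equals the mean utility plus the entropy
 of the law, and the entropy is at most \<open>ln (card A)\<close>.
\<close>

lemma softmax_utility:
 assumes A: "finite A" "b \<in> A"
 shows "u b \<le> (\<Sum>a\<in>A. softmax A u a * u a) + ln (real (card A))"
proof -
 define Z where "Z = (\<Sum>a\<in>A. exp (u a))"
 have ne: "A \<noteq> {}" using A by auto
 have Z: "Z > 0" using A unfolding Z_def by (auto intro!: sum_pos)
 have N: "real (card A) > 0" using A by (auto simp: card_gt_0_iff)
 let ?p = "softmax A u"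
 have p: "?p a > 0" for a by (rule softmax_pos[OF A(1) ne])
 have ub: "u b \<le> ln Z"
 proof -
  have "exp (u b) \<le> Z" unfolding Z_def using A by (intro member_le_sum) auto
  then show ?thesis using Z by (simp add: ln_ge_iff)
 qed
 have lnp: "ln (?p a) = u a - ln Z" for a using Z by (simp add: softmax_def Z_def[symmetric] ln_div)
 have "(\<Sum>a\<in>A. ?p a * ln (1 / (real (card A) * ?p a))) \<le> (\<Sum>a\<in>A. ?p a * (1 / (real (card A) * ?p a) - 1))"
  using p N by (intro sum_mono mult_left_mono ln_le_minus_one) (auto intro: less_imp_le)
 also have "... = (\<Sum>a\<in>A. 1 / real (card A) - ?p a)"
  using p N by (intro sum.cong refl) (simp add: field_simps less_imp_neq[symmetric])
 also have "... = 0" using N softmax_sum[OF A(1) ne, of u] by (simp add: sum_subtractf)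
 finally have "(\<Sum>a\<in>A. ?p a * ln (1 / (real (card A) * ?p a))) \<le> 0" .
 moreover have "ln (1 / (real (card A) * ?p a)) = ln Z - u a - ln (real (card A))" for a
  using p[of a] N by (simp add: ln_div ln_mult lnp)
 ultimately have neg: "(\<Sum>a\<in>A. ?p a * (ln Z - u a - ln (real (card A)))) \<le> 0" by simp
 have "(ln Z - ln (real (card A))) * (\<Sum>a\<in>A. ?p a) - (\<Sum>a\<in>A. ?p a * u a) \<le> 0"
 proof -
  have "(\<Sum>a\<in>A. ?p a * (ln Z - u a - ln (real (card A)))) = (\<Sum>a\<in>A. (ln Z - ln (real (card A))) * ?p a - ?p a * u a)"
   by (intro sum.cong refl) (simp add: algebra_simps)
  also have "... = (ln Z - ln (real (card A))) * (\<Sum>a\<in>A. ?p a) - (\<Sum>a\<in>A. ?p a * u a)"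
   by (simp only: sum_subtractf sum_distrib_left)
  finally show ?thesis using neg by simp
 qed
 with ub show ?thesis by (simp add: softmax_sum[OF A(1) ne])
qed

text \<open>
 A trace is the sequence of outputs of an adaptive mechanism, in which the utilities in each step depend on the previous outputs.
 Keeping the whole trace makes the composition of the steps a product of densities.
\<close>

definition traces :: "'a set => nat => 'a list set" where
 "traces A s = {h. set h \<subseteq> A \<and> length h = s}"

definition trace_density :: "'a set => ('a list => 'a => real) => 'a list => real" where
 "trace_density A u h = (\<Prod>t<length h. softmax A (u (take t h)) (h ! t))"

lemma finite_traces: "finite A ==> finite (traces A s)"
 unfolding traces_def by (rule finite_lists_length_eq)

lemma traces_0 [simp]: "traces A 0 = {[]}"
 by (auto simp: traces_def)

lemma trace_density_Nil [simp]: "trace_density A u [] = 1"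
 by (simp add: trace_density_def)

lemma trace_density_snoc: "trace_density A u (h @ [a]) = trace_density A u h * softmax A (u h) a"
 by (simp add: trace_density_def lessThan_Suc nth_append)

lemma trace_density_nonneg: "0 \<le> trace_density A u h"
 unfolding trace_density_def by (intro prod_nonneg) (simp add: softmax_nonneg)

lemma trace_density_pos: "finite A ==> A \<noteq> {} \<or> h = [] ==> 0 < trace_density A u h"
 unfolding trace_density_def by (cases "h = []") (auto intro!: prod_pos softmax_pos)

lemma sum_traces_Suc:
 assumes "finite A"
 shows "(\<Sum>h\<in>traces A (Suc s). f h) = (\<Sum>h\<in>traces A s. \<Sum>a\<in>A. f (h @ [a]))"
proof -
 have "(\<Sum>h\<in>traces A (Suc s). f h) = (\<Sum>(h, a)\<in>traces A s \<times> A. f (h @ [a]))"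
 proof (rule sum.reindex_bij_witness[where i = "\<lambda>(h, a). h @ [a]" and j = "\<lambda>h. (butlast h, last h)"])
  fix h assume h: "h \<in> traces A (Suc s)"
  then have ne: "h \<noteq> []" by (auto simp: traces_def)
  show "(case (butlast h, last h) of (h, a) => h @ [a]) = h" using ne by simp
  show "(butlast h, last h) \<in> traces A s \<times> A"
   using h last_in_set[OF ne] by (auto simp: traces_def dest: in_set_butlastD)
  show "(case (butlast h, last h) of (h, a) => f (h @ [a])) = f h" using ne by simp
 qed (auto simp: traces_def)
 then show ?thesis by (simp add: sum.cartesian_product)
qed

lemma trace_density_sum:
 assumes "finite A" "A \<noteq> {} \<or> s = 0"
 shows "(\<Sum>h\<in>traces A s. trace_density A u h) = 1"
 using assms(2)
proof (induction s)
 case (Suc s)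
 then have "A \<noteq> {}" by simp
 with Suc show ?case
  by (simp add: sum_traces_Suc[OF assms(1)] trace_density_snoc softmax_sum[OF assms(1)] flip: sum_distrib_left)
qed simp

text \<open>
 Adaptive composition: given the past, each step multiplies the moment by that of one exponential mechanism.
\<close>

lemma trace_renyi:
 assumes A: "finite A" "A \<noteq> {} \<or> s = 0" and lam: "lam > 1" and \<epsilon>: "\<epsilon> > 0"
  and close: "\<And>h b. b \<in> A ==> \<bar>u h b - u' h b\<bar> \<le> \<epsilon> / 2"
 shows "(\<Sum>h\<in>traces A s. trace_density A u h powr lam * trace_density A u' h powr (1 - lam))
  \<le> exp (real s * (lam * (lam - 1) * \<epsilon>^2 / 2))"
 using A(2)
proof (induction s)
 case (Suc s)
 then have ne: "A \<noteq> {}" by simp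
 have close': "\<And>h b. b \<in> A ==> \<bar>u' h b - u h b\<bar> \<le> \<epsilon> / 2" using close by (simp add: abs_minus_commute)
 have "(\<Sum>h\<in>traces A (Suc s). trace_density A u h powr lam * trace_density A u' h powr (1 - lam))
  = (\<Sum>h\<in>traces A s. trace_density A u h powr lam * trace_density A u' h powr (1 - lam) *
    (\<Sum>a\<in>A. softmax A (u h) a powr lam * softmax A (u' h) a powr (1 - lam)))"
  by (simp add: sum_traces_Suc[OF A(1)] trace_density_snoc powr_mult trace_density_nonneg softmax_nonneg sum_distrib_left mult_ac)
 also have "... \<le> (\<Sum>h\<in>traces A s. trace_density A u h powr lam * trace_density A u' h powr (1 - lam) * exp (lam * (lam - 1) * \<epsilon>^2 / 2))"
  using A(1) ne \<epsilon> lam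
  by (intro sum_mono mult_left_mono pure_dp_renyi softmax_ratio softmax_pos softmax_sum close close') auto
 also have "... \<le> exp (real s * (lam * (lam - 1) * \<epsilon>^2 / 2)) * exp (lam * (lam - 1) * \<epsilon>^2 / 2)"
  using Suc ne by (simp flip: sum_distrib_right)
 also have "exp (real s * C) * exp C = exp (real (Suc s) * C)" for C :: real
  by (simp add: exp_add[symmetric] distrib_right add.commute)
 finally show ?case .
qed simp

section \<open>Noisy Frank-Wolfe iterations in an l1 ball\<close>

text \<open>
 A pair of a sign and a coordinate stands for a vertex of the \<open>l1\<close> ball.
\<close>

definition atoms :: "nat set => (real \<times> nat) set" where
 "atoms C = {-1, 1} \<times> C"

text \<open>
 The Frank-Wolfe iterate with step size \<open>1 / t\<close> in step \<open>t\<close> is the plain average of the vertices chosen so far.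
\<close>

definition iterate :: "real => (real \<times> nat) list => nat => real" where
 "iterate r h j = r / real (length h) * (\<Sum>x\<leftarrow>h. if snd x = j then fst x else 0)"

text \<open>
 Up to the factor \<open>\<eta>\<close>, minus the inner product of the vertex \<open>x\<close> with the gradient of half the squared distance between the iterate and the target
 \<open>g\<close>.
\<close>

definition fw_score :: "real => real => (nat => real) => (real \<times> nat) list => real \<times> nat => real" where
 "fw_score \<eta> r g h x = \<eta> * (fst x * (g (snd x) - iterate r h (snd x)))"

lemma finite_atoms: "finite C ==> finite (atoms C)"
 by (simp add: atoms_def)

lemma card_atoms: "card (atoms C) = 2 * card C"
 by (simp add: atoms_def card_cartesian_product)

lemma iterate_snoc:
 "iterate r (h @ [x]) j = iterate r h j + (1 / real (Suc (length h))) * ((if snd x = j then r * fst x else 0) - iterate r h j)"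
proof (cases "h = []")
 case True
 then show ?thesis by (simp add: iterate_def)
next
 case False
 define t where "t = real (length h)"
 define c where "c = (\<Sum>x\<leftarrow>h. if snd x = j then fst x else 0)"
 have t: "t > 0" using False by (simp add: t_def)
 have "u * t / (1 + t) * (c + y) = u * c + 1 / (1 + t) * (u * t * y - u * c)" for u y
  using t by (simp add: field_simps)
 from this[of "r / t"] have "r / (1 + t) * (c + y) = r / t * c + 1 / (1 + t) * (r * y - r / t * c)" for y
  using t by simp
 then show ?thesis by (simp add: iterate_def t_def[symmetric] c_def[symmetric])
qed

lemma iterate_l1:
 assumes r: "r \<ge> 0" and C: "finite C" and h: "set h \<subseteq> atoms C"
 shows "(\<Sum>j\<in>C. \<bar>iterate r h j\<bar>) \<le> r"
proof (cases "h = []")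
 case True
 then show ?thesis using r by (simp add: iterate_def)
next
 case False
 have "(\<Sum>j\<in>C. \<bar>\<Sum>x\<leftarrow>h. if snd x = j then fst x else 0\<bar>) \<le> real (length h)"
  using h
 proof (induction h)
  case (Cons x h)
  have "(\<Sum>j\<in>C. \<bar>\<Sum>x\<leftarrow>x # h. if snd x = j then fst x else 0\<bar>)
   \<le> (\<Sum>j\<in>C. (if snd x = j then 1 else 0) + \<bar>\<Sum>x\<leftarrow>h. if snd x = j then fst x else 0\<bar>)"
   using Cons.prems by (intro sum_mono) (auto simp: atoms_def)
  also have "... \<le> 1 + real (length h)"
   using Cons C by (auto simp: sum.distrib)
  finally show ?case by simp
 qed simp
 then have "r / real (length h) * (\<Sum>j\<in>C. \<bar>\<Sum>x\<leftarrow>h. if snd x = j then fst x else 0\<bar>) \<le> r / real (length h) * real (length h)"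
  using r by (intro mult_left_mono) auto
 then show ?thesis using False r by (simp add: iterate_def abs_mult sum_distrib_left)
qed

lemma sum_squares_le_l1:
 fixes f :: "'a => real"
 assumes C: "finite C" and l1: "(\<Sum>j\<in>C. \<bar>f j\<bar>) \<le> b"
 shows "(\<Sum>j\<in>C. (f j)^2) \<le> b^2"
proof -
 have "(\<Sum>j\<in>C. (f j)^2) = (\<Sum>j\<in>C. \<bar>f j\<bar> * \<bar>f j\<bar>)" by (simp add: power2_eq_square)
 also have "... \<le> (\<Sum>j\<in>C. \<bar>f j\<bar> * b)"
 proof (intro sum_mono mult_left_mono)
  fix j assume "j \<in> C"
  then have "\<bar>f j\<bar> \<le> (\<Sum>j\<in>C. \<bar>f j\<bar>)" using C by (intro member_le_sum) auto
  then show "\<bar>f j\<bar> \<le> b" using l1 by simp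
 qed simp
 also have "... = (\<Sum>j\<in>C. \<bar>f j\<bar>) * b" by (simp add: sum_distrib_right)
 also have "... \<le> b * b"
  using l1 order_trans[OF sum_nonneg l1] by (intro mult_right_mono) auto
 finally show ?thesis by (simp add: power2_eq_square)
qed

text \<open>
 Moving from the iterate towards the vertex \<open>v\<close> by the fraction \<open>\<gamma>\<close> changes the squared distance to \<open>\<sigma>\<close> by
 \<open>2 * \<gamma>\<close> times the inner product of \<open>iterate - \<sigma>\<close> with \<open>v - iterate\<close>, plus \<open>\<gamma>^2\<close> times a squared length of at most \<open>(2 * r)^2\<close>.  The best vertex
 makes the inner product at most minus the squared distance, since \<open>\<sigma>\<close> is in the ball; the exponential mechanism
 and the error of \<open>g\<close> lose \<open>r * err\<close>.
\<close>

lemma frank_wolfe_step: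
 assumes C: "finite C" "C \<noteq> {}" and \<eta>: "\<eta> > 0" and r: "r \<ge> 0"
  and \<sigma>: "(\<Sum>j\<in>C. \<bar>\<sigma> j\<bar>) \<le> r" and g: "\<And>j. j \<in> C ==> \<bar>g j - \<sigma> j\<bar> \<le> e"
  and h: "set h \<subseteq> atoms C"
 defines "err \<equiv> 2 * e + ln (real (card (atoms C))) / \<eta>" and "\<gamma> \<equiv> 1 / real (Suc (length h))"
 shows "(\<Sum>a\<in>atoms C. softmax (atoms C) (fw_score \<eta> r g h) a * (\<Sum>j\<in>C. (iterate r (h @ [a]) j - \<sigma> j)^2))
  \<le> (1 - 2 * \<gamma>) * (\<Sum>j\<in>C. (iterate r h j - \<sigma> j)^2) + 2 * \<gamma> * r * err + 4 * \<gamma>^2 * r^2"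
proof -
 let ?A = "atoms C" let ?p = "softmax (atoms C) (fw_score \<eta> r g h)" let ?b = "iterate r h"
 define D where "D = (\<Sum>j\<in>C. (?b j - \<sigma> j)^2)"
 define v where "v a j = (if snd a = j then r * fst a else 0)" for a :: "real \<times> nat" and j
 define L where "L = (\<Sum>a\<in>?A. ?p a * (fst a * (\<sigma> (snd a) - ?b (snd a))))"
 have A: "finite ?A" "?A \<noteq> {}" using C finite_atoms by (auto simp: atoms_def)
 have p0: "0 \<le> ?p a" for a by (rule softmax_nonneg)
 have p1: "(\<Sum>a\<in>?A. ?p a) = 1" by (rule softmax_sum[OF A])
 have \<gamma>: "\<gamma> \<ge> 0" by (simp add: \<gamma>_def)
 have sgn: "\<bar>fst a\<bar> = 1" "snd a \<in> C" if "a \<in> ?A" for a using that by (auto simp: atoms_def)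
 have maxdev: "\<bar>\<sigma> j - ?b j\<bar> \<le> L + err" if j: "j \<in> C" for j
 proof -
  define a where "a = ((if g j - ?b j \<ge> 0 then 1 else -1) :: real, j)"
  have a: "a \<in> ?A" using j by (auto simp: a_def atoms_def)
  have "\<bar>\<sigma> j - ?b j\<bar> \<le> \<bar>g j - ?b j\<bar> + e" using g[OF j] by linarith
  also have "\<bar>g j - ?b j\<bar> = fw_score \<eta> r g h a / \<eta>" using \<eta> by (simp add: fw_score_def a_def)
  also have "... \<le> ((\<Sum>a\<in>?A. ?p a * fw_score \<eta> r g h a) + ln (real (card ?A))) / \<eta>"
   using softmax_utility[OF A(1) a, of "fw_score \<eta> r g h"] \<eta> by (intro divide_right_mono) auto
  also have "... = (\<Sum>a\<in>?A. ?p a * (fst a * (g (snd a) - ?b (snd a)))) + ln (real (card ?A)) / \<eta>"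
   using \<eta> by (simp add: fw_score_def add_divide_distrib sum_divide_distrib)
  also have "(\<Sum>a\<in>?A. ?p a * (fst a * (g (snd a) - ?b (snd a)))) \<le> (\<Sum>a\<in>?A. ?p a * (fst a * (\<sigma> (snd a) - ?b (snd a)) + e))"
  proof (intro sum_mono mult_left_mono p0)
   fix a assume a: "a \<in> ?A"
   have "fst a * (g (snd a) - \<sigma> (snd a)) \<le> \<bar>fst a * (g (snd a) - \<sigma> (snd a))\<bar>" by simp
   also have "... \<le> e" using sgn[OF a] g[OF sgn(2)[OF a]] by (simp add: abs_mult)
   finally show "fst a * (g (snd a) - ?b (snd a)) \<le> fst a * (\<sigma> (snd a) - ?b (snd a)) + e"
    by (simp add: right_diff_distrib)
  qed
  also have "... = L + e"
   unfolding L_def using p1 by (simp add: distrib_left sum.distrib flip: sum_distrib_right)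
  finally show ?thesis by (simp add: err_def)
 qed
 have inner: "(\<Sum>j\<in>C. (?b j - \<sigma> j) * (v a j - ?b j)) = - D + (\<Sum>j\<in>C. \<sigma> j * (\<sigma> j - ?b j)) - r * (fst a * (\<sigma> (snd a) - ?b (snd a)))"
  if a: "a \<in> ?A" for a
 proof -
  have "(\<Sum>j\<in>C. (?b j - \<sigma> j) * v a j) = (\<Sum>j\<in>C. if j = snd a then (?b j - \<sigma> j) * (r * fst a) else 0)"
   unfolding v_def by (intro sum.cong refl) auto
  also have "... = - (r * (fst a * (\<sigma> (snd a) - ?b (snd a))))"
   using C sgn(2)[OF a] by (simp add: algebra_simps)
  finally have 1: "(\<Sum>j\<in>C. (?b j - \<sigma> j) * v a j) = - (r * (fst a * (\<sigma> (snd a) - ?b (snd a))))" .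
  have "(\<Sum>j\<in>C. (?b j - \<sigma> j) * (v a j - ?b j)) = (\<Sum>j\<in>C. (?b j - \<sigma> j) * v a j - (?b j - \<sigma> j)^2 + \<sigma> j * (\<sigma> j - ?b j))"
   by (intro sum.cong refl) (simp add: power2_eq_square algebra_simps)
  also have "... = (\<Sum>j\<in>C. (?b j - \<sigma> j) * v a j) - D + (\<Sum>j\<in>C. \<sigma> j * (\<sigma> j - ?b j))"
   by (simp add: D_def sum.distrib sum_subtractf)
  finally show ?thesis unfolding 1 by simp
 qed
 have vnorm: "(\<Sum>j\<in>C. (v a j - ?b j)^2) \<le> (2 * r)^2" if a: "a \<in> ?A" for a
 proof (rule sum_squares_le_l1[OF C(1)])
  have "(\<Sum>j\<in>C. \<bar>v a j - ?b j\<bar>) \<le> (\<Sum>j\<in>C. (if j = snd a then r else 0) + \<bar>?b j\<bar>)"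
   using sgn[OF a] r by (intro sum_mono order_trans[OF abs_triangle_ineq4]) (auto simp: v_def abs_mult)
  also have "... \<le> r + r"
   using iterate_l1[OF r C(1) h] C sgn[OF a] by (simp add: sum.distrib)
  finally show "(\<Sum>j\<in>C. \<bar>v a j - ?b j\<bar>) \<le> 2 * r" by simp
 qed
 have lin: "(\<Sum>j\<in>C. \<sigma> j * (\<sigma> j - ?b j)) \<le> r * (L + err)"
 proof -
  have "(\<Sum>j\<in>C. \<sigma> j * (\<sigma> j - ?b j)) \<le> (\<Sum>j\<in>C. \<bar>\<sigma> j\<bar> * (L + err))"
  proof (rule sum_mono)
   fix j assume j: "j \<in> C"
   have "\<sigma> j * (\<sigma> j - ?b j) \<le> \<bar>\<sigma> j\<bar> * \<bar>\<sigma> j - ?b j\<bar>" by (metis abs_ge_self abs_mult)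
   also have "... \<le> \<bar>\<sigma> j\<bar> * (L + err)" using maxdev[OF j] by (intro mult_left_mono) auto
   finally show "\<sigma> j * (\<sigma> j - ?b j) \<le> \<bar>\<sigma> j\<bar> * (L + err)" .
  qed
  also have "... = (\<Sum>j\<in>C. \<bar>\<sigma> j\<bar>) * (L + err)" by (simp add: sum_distrib_right)
  also have "... \<le> r * (L + err)"
  proof (rule mult_right_mono[OF \<sigma>])
   obtain j where "j \<in> C" using C by auto
   then show "0 \<le> L + err" using maxdev[of j] by linarith
  qed
  finally show ?thesis .
 qed
 have step: "(\<Sum>j\<in>C. (iterate r (h @ [a]) j - \<sigma> j)^2)
  \<le> D + 2 * \<gamma> * (- D + r * (L + err) - r * (fst a * (\<sigma> (snd a) - ?b (snd a)))) + \<gamma>^2 * (2 * r)^2"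
  if a: "a \<in> ?A" for a
 proof -
  have "(\<Sum>j\<in>C. (iterate r (h @ [a]) j - \<sigma> j)^2) = (\<Sum>j\<in>C. (?b j - \<sigma> j)^2 + 2 * \<gamma> * ((?b j - \<sigma> j) * (v a j - ?b j)) + \<gamma>^2 * (v a j - ?b j)^2)"
   unfolding iterate_snoc v_def[symmetric] \<gamma>_def[symmetric]
   by (intro sum.cong refl) (simp add: power2_eq_square algebra_simps)
  also have "... = D + 2 * \<gamma> * (\<Sum>j\<in>C. (?b j - \<sigma> j) * (v a j - ?b j)) + \<gamma>^2 * (\<Sum>j\<in>C. (v a j - ?b j)^2)"
   by (simp add: D_def sum.distrib sum_distrib_left)
  also have "... \<le> D + 2 * \<gamma> * (- D + r * (L + err) - r * (fst a * (\<sigma> (snd a) - ?b (snd a)))) + \<gamma>^2 * (2 * r)^2"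
   unfolding inner[OF a] using lin vnorm[OF a] \<gamma> by (intro add_mono mult_left_mono) auto
  finally show ?thesis .
 qed
 have "(\<Sum>a\<in>?A. ?p a * (\<Sum>j\<in>C. (iterate r (h @ [a]) j - \<sigma> j)^2))
  \<le> (\<Sum>a\<in>?A. ?p a * (D + 2 * \<gamma> * (- D + r * (L + err)) + \<gamma>^2 * (2 * r)^2) - 2 * \<gamma> * r * (?p a * (fst a * (\<sigma> (snd a) - ?b (snd a)))))"
 proof (rule sum_mono)
  fix a assume a: "a \<in> ?A"
  show "?p a * (\<Sum>j\<in>C. (iterate r (h @ [a]) j - \<sigma> j)^2) \<le> ?p a * (D + 2 * \<gamma> * (- D + r * (L + err)) + \<gamma>^2 * (2 * r)^2) - 2 * \<gamma> * r * (?p a * (fst a * (\<sigma> (snd a) - ?b (snd a))))"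
   using mult_left_mono[OF step[OF a] p0[of a]] by (simp add: algebra_simps)
 qed
 also have "... = (D + 2 * \<gamma> * (- D + r * (L + err)) + \<gamma>^2 * (2 * r)^2) - 2 * \<gamma> * r * L"
  using p1 by (simp add: L_def sum_subtractf flip: sum_distrib_left sum_distrib_right)
 also have "... = (1 - 2 * \<gamma>) * D + 2 * \<gamma> * r * err + 4 * \<gamma>^2 * r^2"
  by (simp add: power_mult_distrib algebra_simps)
 finally show ?thesis by (simp add: D_def)
qed

text \<open>
 Induction with step sizes \<open>\<gamma> = 1 / (s + 2)\<close>; the bound \<open>4 * r^2 / (s + 1)\<close> is reproduced by
 \<open>frank_wolfe_step\<close>, and the fixed point of the remaining recursion is \<open>r * err\<close>.
\<close>

lemma frank_wolfe_risk:
 assumes C: "finite C" "C \<noteq> {}" and \<eta>: "\<eta> > 0" and r: "r \<ge> 0"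
  and \<sigma>: "(\<Sum>j\<in>C. \<bar>\<sigma> j\<bar>) \<le> r" and g: "\<And>j. j \<in> C ==> \<bar>g j - \<sigma> j\<bar> \<le> e"
 defines "err \<equiv> 2 * e + ln (real (card (atoms C))) / \<eta>"
 shows "(\<Sum>h\<in>traces (atoms C) (Suc s). trace_density (atoms C) (fw_score \<eta> r g) h * (\<Sum>j\<in>C. (iterate r h j - \<sigma> j)^2))
  \<le> 4 * r^2 / real (Suc s) + r * err"
proof (induction s)
 let ?A = "atoms C"
 have A: "finite ?A" "?A \<noteq> {}" using C finite_atoms by (auto simp: atoms_def)
 have err0: "err \<ge> 0"
 proof -
  obtain j where "j \<in> C" using C by auto
  then have "e \<ge> 0" using g[of j] by linarith
  moreover have "1 \<le> real (card ?A)" using A by (simp add: Suc_le_eq card_gt_0_iff)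
  ultimately show ?thesis using \<eta> by (simp add: err_def)
 qed
 {
  case 0
  have "(\<Sum>h\<in>traces ?A (Suc 0). trace_density ?A (fw_score \<eta> r g) h * (\<Sum>j\<in>C. (iterate r h j - \<sigma> j)^2))
   = (\<Sum>a\<in>?A. softmax ?A (fw_score \<eta> r g []) a * (\<Sum>j\<in>C. (iterate r ([] @ [a]) j - \<sigma> j)^2))"
   by (simp add: sum_traces_Suc[OF A(1)] trace_density_snoc[of _ _ "[]", simplified])
  also have "... \<le> (\<Sum>a\<in>?A. softmax ?A (fw_score \<eta> r g []) a * (2 * r)^2)"
  proof (intro sum_mono mult_left_mono softmax_nonneg sum_squares_le_l1 C)
   fix a assume a: "a \<in> ?A"
   have "(\<Sum>j\<in>C. \<bar>iterate r ([] @ [a]) j - \<sigma> j\<bar>) \<le> (\<Sum>j\<in>C. \<bar>iterate r ([] @ [a]) j\<bar> + \<bar>\<sigma> j\<bar>)"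
    by (intro sum_mono abs_triangle_ineq4)
   also have "... \<le> r + r"
    unfolding sum.distrib using a by (intro add_mono \<sigma> iterate_l1 r C) auto
   finally show "(\<Sum>j\<in>C. \<bar>iterate r ([] @ [a]) j - \<sigma> j\<bar>) \<le> 2 * r" by simp
  qed
  also have "... = 4 * r^2" using softmax_sum[OF A] by (simp add: power_mult_distrib flip: sum_distrib_right)
  finally show ?case using r err0 by (simp add: add_increasing2)
 next
  case (Suc s)
  let ?\<gamma> = "1 / real (Suc (Suc s))"
  let ?D = "\<lambda>h. \<Sum>j\<in>C. (iterate r h j - \<sigma> j)^2"
  let ?w = "trace_density ?A (fw_score \<eta> r g)"
  have "(\<Sum>h\<in>traces ?A (Suc (Suc s)). ?w h * ?D h)
   = (\<Sum>h\<in>traces ?A (Suc s). ?w h * (\<Sum>a\<in>?A. softmax ?A (fw_score \<eta> r g h) a * ?D (h @ [a])))"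
   by (subst sum_traces_Suc[OF A(1)]) (simp add: trace_density_snoc sum_distrib_left mult.assoc)
  also have "... \<le> (\<Sum>h\<in>traces ?A (Suc s). ?w h * ((1 - 2 * ?\<gamma>) * ?D h + 2 * ?\<gamma> * r * err + 4 * ?\<gamma>^2 * r^2))"
  proof (intro sum_mono mult_left_mono trace_density_nonneg)
   fix h assume "h \<in> traces ?A (Suc s)"
   then have h: "set h \<subseteq> ?A" "length h = Suc s" by (auto simp: traces_def)
   show "(\<Sum>a\<in>?A. softmax ?A (fw_score \<eta> r g h) a * ?D (h @ [a])) \<le> (1 - 2 * ?\<gamma>) * ?D h + 2 * ?\<gamma> * r * err + 4 * ?\<gamma>^2 * r^2"
    using frank_wolfe_step[OF C \<eta> r \<sigma> g h(1)] unfolding h(2) err_def by simp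
  qed
  also have "... = (1 - 2 * ?\<gamma>) * (\<Sum>h\<in>traces ?A (Suc s). ?w h * ?D h) + (2 * ?\<gamma> * r * err + 4 * ?\<gamma>^2 * r^2)"
  proof -
   have "(\<Sum>h\<in>H. ?w h * (a * ?D h + b + c)) = a * (\<Sum>h\<in>H. ?w h * ?D h) + (b + c) * (\<Sum>h\<in>H. ?w h)" for H and a b c :: real
    by (simp add: sum_distrib_left sum.distrib[symmetric] algebra_simps)
   then show ?thesis using trace_density_sum[OF A(1) disjI1[OF A(2)]] by simp
  qed
  also have "... \<le> (1 - 2 * ?\<gamma>) * (4 * r^2 / real (Suc s) + r * err) + (2 * ?\<gamma> * r * err + 4 * ?\<gamma>^2 * r^2)"
   by (intro add_right_mono mult_left_mono Suc) (simp add: field_simps)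
  also have "... = 4 * r^2 * ((1 - 2 * ?\<gamma>) / real (Suc s) + ?\<gamma>^2) + r * err"
   by (simp add: algebra_simps)
  also have "... \<le> 4 * r^2 * ?\<gamma> + r * err"
  proof (intro add_right_mono mult_left_mono)
   have "(1 - 2 / (t + 1)) / t + (1 / (t + 1))^2 \<le> 1 / (t + 1)" if "t > 0" for t :: real
   proof -
    have "1 / (t + 1) - ((1 - 2 / (t + 1)) / t + (1 / (t + 1))^2) = 1 / (t * (t + 1)^2)"
     using that by (simp add: divide_simps power2_eq_square) (simp add: algebra_simps)
    moreover have "0 \<le> 1 / (t * (t + 1)^2)" using that by simp
    ultimately show ?thesis by linarith
   qed
   from this[of "real (Suc s)"] show "(1 - 2 * ?\<gamma>) / real (Suc s) + ?\<gamma>^2 \<le> ?\<gamma>"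
    by (simp add: add.commute)
  qed simp
  finally show ?case by simp
 }
qed

section \<open>Averages over subgaussian samples\<close>

lemma coord_meas: "i < d ==> (\<lambda>x. x i) \<in> borel_measurable (vec_space d)"
 unfolding vec_space_def by (rule measurable_component_singleton) simp

text \<open>
 Independent vectors with common second moments \<open>C\<close>.  The exponential moments of the squares of the unit linear forms are what the
 \<open>psi_2\<close> bound of the model provides.
\<close>

locale subgauss_sample = prob_space M for M :: "'a measure" +
 fixes y :: "nat => 'a => nat => real" and N d :: nat and t0 :: real and C :: "nat \<times> nat => real"
 assumes N: "N > 0" and t0: "t0 > 0"
  and indep: "indep_vars (\<lambda>_. vec_space d) y {..<N}"
  and subgauss: "\<And>l v. l < N ==> (\<Sum>i<d. (v i)^2) = 1 ==>
    (\<integral>\<^sup>+\<xi>. ennreal (exp ((\<Sum>i<d. v i * y l \<xi> i)^2 / t0)) \<partial>M) \<le> 2"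
  and cov: "\<And>l i j. l < N ==> i < d ==> j < d ==> (\<integral>\<xi>. y l \<xi> i * y l \<xi> j \<partial>M) = C (i, j)"
begin

lemma y_meas: "l < N ==> y l \<in> M \<rightarrow>\<^sub>M vec_space d"
 using indep unfolding indep_vars_def by auto

lemma yi_meas [measurable]: "l < N ==> i < d ==> (\<lambda>\<xi>. y l \<xi> i) \<in> borel_measurable M"
 using measurable_compose[OF y_meas coord_meas] by simp

lemma coordinate_exp_moment:
 assumes "l < N" "i < d"
 shows "(\<integral>\<^sup>+\<xi>. ennreal (exp ((y l \<xi> i)^2 / t0)) \<partial>M) \<le> 2"
proof -
 have e: "(\<Sum>j<d. (if j = i then 1 else 0) * y l \<xi> j) = y l \<xi> i" for \<xi>
  using assms by (simp add: if_distrib[of "\<lambda>x. x * _"] cong: if_cong)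
 have "(\<Sum>j<d. (if j = i then 1 else 0::real)^2) = 1"
  using assms by (simp add: if_distrib[of "\<lambda>x. x^2"] cong: if_cong)
 from subgauss[OF assms(1) this] show ?thesis unfolding e .
qed

lemma coordinate_tail:
 assumes l: "l < N" "i < d" and \<tau>: "\<tau> \<ge> 0"
 shows "prob {\<xi>\<in>space M. \<bar>y l \<xi> i\<bar> > \<tau>} \<le> 2 * exp (- (\<tau>^2 / t0))"
proof -
 have [measurable]: "(\<lambda>\<xi>. y l \<xi> i) \<in> borel_measurable M" using l by (rule yi_meas)
 have "emeasure M {\<xi>\<in>space M. \<bar>y l \<xi> i\<bar> > \<tau>} = (\<integral>\<^sup>+\<xi>. indicator {\<xi>\<in>space M. \<bar>y l \<xi> i\<bar> > \<tau>} \<xi> \<partial>M)" by simp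
 also have "... \<le> (\<integral>\<^sup>+\<xi>. ennreal (exp (- (\<tau>^2 / t0))) * ennreal (exp ((y l \<xi> i)^2 / t0)) \<partial>M)"
 proof (rule nn_integral_mono)
  fix \<xi>
  show "indicator {\<xi>\<in>space M. \<bar>y l \<xi> i\<bar> > \<tau>} \<xi> \<le> ennreal (exp (- (\<tau>^2 / t0))) * ennreal (exp ((y l \<xi> i)^2 / t0))"
  proof (cases "\<bar>y l \<xi> i\<bar> > \<tau>")
   case True
   then have "\<tau>^2 \<le> (y l \<xi> i)^2" using \<tau> by (metis abs_le_square_iff abs_of_nonneg less_imp_le)
   then have "1 \<le> exp (- (\<tau>^2 / t0)) * exp ((y l \<xi> i)^2 / t0)" using t0 by (simp add: exp_add[symmetric] divide_right_mono)
   then show ?thesis by (simp add: ennreal_mult[symmetric] indicator_def ennreal_1[symmetric] del: ennreal_1)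
  qed (simp add: indicator_def)
 qed
 also have "... = ennreal (exp (- (\<tau>^2 / t0))) * (\<integral>\<^sup>+\<xi>. ennreal (exp ((y l \<xi> i)^2 / t0)) \<partial>M)"
  by (rule nn_integral_cmult) measurable
 also have "... \<le> ennreal (exp (- (\<tau>^2 / t0))) * 2"
  using coordinate_exp_moment[OF l] by (intro mult_left_mono) auto
 also have "... = ennreal (2 * exp (- (\<tau>^2 / t0)))" by (simp add: ennreal_mult' mult.commute)
 finally show ?thesis by (subst (asm) emeasure_eq_measure) simp
qed

lemma fourth_moment:
 assumes l: "l < N" "i < d"
 shows "integrable M (\<lambda>\<xi>. (y l \<xi> i) ^ 4)" "(\<integral>\<xi>. (y l \<xi> i) ^ 4 \<partial>M) \<le> 4 * t0^2"
proof -
 have [measurable]: "(\<lambda>\<xi>. y l \<xi> i) \<in> borel_measurable M" using l by (rule yi_meas)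
 have pt: "z ^ 4 \<le> 2 * t0^2 * exp (z^2 / t0)" for z :: real
 proof -
  have x: "0 \<le> z^2 / t0" using t0 by simp
  have "(z^2 / t0)^2 / 2 \<le> exp (z^2 / t0)"
   using exp_lower_Taylor_quadratic[OF x] x by linarith
  then have "2 * t0^2 * ((z^2 / t0)^2 / 2) \<le> 2 * t0^2 * exp (z^2 / t0)" by (intro mult_left_mono) auto
  then show ?thesis using t0 by (simp add: power_divide power_mult[symmetric])
 qed
 have nn: "(\<integral>\<^sup>+\<xi>. ennreal ((y l \<xi> i) ^ 4) \<partial>M) \<le> ennreal (4 * t0^2)"
 proof -
  have "(\<integral>\<^sup>+\<xi>. ennreal ((y l \<xi> i) ^ 4) \<partial>M) \<le> (\<integral>\<^sup>+\<xi>. ennreal (2 * t0^2) * ennreal (exp ((y l \<xi> i)^2 / t0)) \<partial>M)"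
   using pt by (intro nn_integral_mono) (auto simp: ennreal_mult[symmetric] intro!: ennreal_leI)
  also have "... = ennreal (2 * t0^2) * (\<integral>\<^sup>+\<xi>. ennreal (exp ((y l \<xi> i)^2 / t0)) \<partial>M)"
   by (rule nn_integral_cmult) measurable
  also have "... \<le> ennreal (2 * t0^2) * 2"
   using coordinate_exp_moment[OF l] by (intro mult_left_mono) auto
  also have "... = ennreal (2 * t0^2 * 2)" by (subst ennreal_mult') auto
  finally show ?thesis by simp
 qed
 show i: "integrable M (\<lambda>\<xi>. (y l \<xi> i) ^ 4)"
  by (rule integrableI_bounded) (use nn in \<open>auto simp: le_less_trans[OF _ ennreal_less_top]\<close>)
 show "(\<integral>\<xi>. (y l \<xi> i) ^ 4 \<partial>M) \<le> 4 * t0^2"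
  using nn nn_integral_eq_integral[OF i] by (simp add: ennreal_le_iff)
qed

lemma product_moment:
 assumes l: "l < N" and ij: "i < d" "j < d"
 shows "integrable M (\<lambda>\<xi>. (y l \<xi> i * y l \<xi> j)^2)" "(\<integral>\<xi>. (y l \<xi> i * y l \<xi> j)^2 \<partial>M) \<le> 4 * t0^2"
  "integrable M (\<lambda>\<xi>. y l \<xi> i * y l \<xi> j)"
proof -
 note f = fourth_moment[OF l]
 have [measurable]: "(\<lambda>\<xi>. y l \<xi> i) \<in> borel_measurable M" "(\<lambda>\<xi>. y l \<xi> j) \<in> borel_measurable M" using l ij by (auto intro: yi_meas)
 have pt: "(a * b)^2 \<le> (a ^ 4 + b ^ 4) / 2" for a b :: real
  using zero_le_power2[of "a^2 - b^2"] by (simp add: power2_eq_square power4_eq_xxxx algebra_simps)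
 show i: "integrable M (\<lambda>\<xi>. (y l \<xi> i * y l \<xi> j)^2)"
 proof (rule Bochner_Integration.integrable_bound)
  show "integrable M (\<lambda>\<xi>. ((y l \<xi> i) ^ 4 + (y l \<xi> j) ^ 4) / 2)" using f(1) ij by auto
  show "AE \<xi> in M. norm ((y l \<xi> i * y l \<xi> j)^2) \<le> norm (((y l \<xi> i) ^ 4 + (y l \<xi> j) ^ 4) / 2)"
   using pt by (auto intro!: AE_I2)
 qed measurable
 have "(\<integral>\<xi>. (y l \<xi> i * y l \<xi> j)^2 \<partial>M) \<le> (\<integral>\<xi>. ((y l \<xi> i) ^ 4 + (y l \<xi> j) ^ 4) / 2 \<partial>M)"
  using i f(1) ij pt by (intro integral_mono) auto
 also have "... = ((\<integral>\<xi>. (y l \<xi> i) ^ 4 \<partial>M) + (\<integral>\<xi>. (y l \<xi> j) ^ 4 \<partial>M)) / 2" using f(1) ij by simp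
 also have "... \<le> 4 * t0^2" using f(2)[OF ij(1)] f(2)[OF ij(2)] by simp
 finally show "(\<integral>\<xi>. (y l \<xi> i * y l \<xi> j)^2 \<partial>M) \<le> 4 * t0^2" .
 show "integrable M (\<lambda>\<xi>. y l \<xi> i * y l \<xi> j)"
  by (rule square_integrable_imp_integrable) (use i in auto)
qed

subsection \<open>Block norms\<close>

text \<open>
 For a unit vector scaled by \<open>r\<close>, this is \<open>r * x \<le> r^2 * t0 / 4 + x^2 / t0\<close>.
\<close>

lemma exp_linear_moment:
 assumes l: "l < N"
 shows "(\<integral>\<^sup>+\<xi>. ennreal (exp (\<Sum>i<d. u i * y l \<xi> i)) \<partial>M) \<le> ennreal (2 * exp ((\<Sum>i<d. (u i)^2) * t0 / 4))"
proof (cases "(\<Sum>i<d. (u i)^2) = 0")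
 case True
 then have "\<forall>i<d. u i = 0" by (subst (asm) sum_nonneg_eq_0_iff) auto
 then show ?thesis by (simp add: emeasure_space_1)
next
 case False
 have [measurable]: "\<And>i. i < d ==> (\<lambda>\<xi>. y l \<xi> i) \<in> borel_measurable M" using l by (rule yi_meas)
 define r where "r = sqrt (\<Sum>i<d. (u i)^2)"
 have r: "r > 0" "r^2 = (\<Sum>i<d. (u i)^2)"
  using False sum_nonneg[of "{..<d}" "\<lambda>i. (u i)^2"] by (auto simp: r_def less_le)
 have unit: "(\<Sum>i<d. (u i / r)^2) = 1" using r(1) by (simp add: power_divide r(2)[symmetric] flip: sum_divide_distrib)
 have "(\<integral>\<^sup>+\<xi>. ennreal (exp (\<Sum>i<d. u i * y l \<xi> i)) \<partial>M)
  \<le> (\<integral>\<^sup>+\<xi>. ennreal (exp (r^2 * t0 / 4)) * ennreal (exp ((\<Sum>i<d. u i / r * y l \<xi> i)^2 / t0)) \<partial>M)"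
 proof (rule nn_integral_mono)
  fix \<xi>
  define x where "x = (\<Sum>i<d. u i / r * y l \<xi> i)"
  have "(\<Sum>i<d. u i * y l \<xi> i) = r * x" using r(1) by (simp add: x_def sum_distrib_left)
  moreover have "r * x \<le> r^2 * t0 / 4 + x^2 / t0"
  proof -
   have "0 \<le> (r * t0 / 2 - x)^2 / t0" using t0 by simp
   also have "... = r^2 * t0 / 4 + x^2 / t0 - r * x" using t0 by (simp add: power2_eq_square field_simps)
   finally show ?thesis by simp
  qed
  ultimately show "ennreal (exp (\<Sum>i<d. u i * y l \<xi> i)) \<le> ennreal (exp (r^2 * t0 / 4)) * ennreal (exp ((\<Sum>i<d. u i / r * y l \<xi> i)^2 / t0))"
   unfolding x_def[symmetric] by (simp add: ennreal_mult[symmetric] exp_add[symmetric] ennreal_leI)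
 qed
 also have "... = ennreal (exp (r^2 * t0 / 4)) * (\<integral>\<^sup>+\<xi>. ennreal (exp ((\<Sum>i<d. u i / r * y l \<xi> i)^2 / t0)) \<partial>M)"
  by (rule nn_integral_cmult) measurable
 also have "... \<le> ennreal (exp (r^2 * t0 / 4)) * 2" by (intro mult_left_mono subgauss[OF l unit]) auto
 also have "... = ennreal (2 * exp (r^2 * t0 / 4))" by (simp add: ennreal_mult' mult.commute)
 finally show ?thesis unfolding r(2) .
qed

text \<open>
 Gaussian averaging again, now with an independent Gaussian variable for each coordinate of the block.  Each of
 them contributes the factor \<open>1 / sqrt (1 - 3 / 4) = 2\<close>.
\<close>

lemma block_exp_moment:
 assumes l: "l < N" and B: "B \<subseteq> {..<d}"
 shows "(\<integral>\<^sup>+\<xi>. ennreal (exp (3 / (4 * t0) * (\<Sum>i\<in>B. (y l \<xi> i)^2))) \<partial>M) \<le> ennreal (2 * 2 ^ card B)"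
proof -
 have fB: "finite B" using B by (rule finite_subset) simp
 have [measurable]: "\<And>i. i \<in> B ==> (\<lambda>\<xi>. y l \<xi> i) \<in> borel_measurable M" using l B by (auto intro!: yi_meas)
 interpret G: product_sigma_finite "\<lambda>_::nat. std_normal"
  by (intro product_sigma_finite.intro prob_space_imp_sigma_finite prob_space_std_normal)
 interpret PG: sigma_finite_measure "PiM B (\<lambda>_. std_normal)"
  by (rule G.sigma_finite[OF fB])
 interpret PP: pair_sigma_finite M "PiM B (\<lambda>_. std_normal)" ..
 \<comment> \<open>the scale for which \<open>exp_linear_moment\<close> yields \<open>exp (3 / 8 * g^2)\<close> for each Gaussian variable\<close>
 define s where "s = sqrt (3 / (2 * t0))"
 have s2: "s^2 = 3 / (2 * t0)" using t0 by (simp add: s_def)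
 have "(\<integral>\<^sup>+\<xi>. ennreal (exp (3 / (4 * t0) * (\<Sum>i\<in>B. (y l \<xi> i)^2))) \<partial>M)
  = (\<integral>\<^sup>+\<xi>. (\<integral>\<^sup>+g. (\<Prod>i\<in>B. ennreal (exp (s * y l \<xi> i * g i))) \<partial>PiM B (\<lambda>_. std_normal)) \<partial>M)"
 proof (rule nn_integral_cong)
  fix \<xi>
  have "(\<integral>\<^sup>+g. (\<Prod>i\<in>B. ennreal (exp (s * y l \<xi> i * g i))) \<partial>PiM B (\<lambda>_. std_normal)) = (\<Prod>i\<in>B. ennreal (exp ((s * y l \<xi> i)^2 / 2)))"
   by (subst G.product_nn_integral_prod[OF fB]) (auto simp: std_normal_exp_linear)
  also have "... = ennreal (exp (\<Sum>i\<in>B. (s * y l \<xi> i)^2 / 2))"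
   using fB by (simp add: prod_ennreal exp_sum)
  also have "(\<Sum>i\<in>B. (s * y l \<xi> i)^2 / 2) = 3 / (4 * t0) * (\<Sum>i\<in>B. (y l \<xi> i)^2)"
   by (simp add: power_mult_distrib s2 sum_distrib_left)
  finally show "ennreal (exp (3 / (4 * t0) * (\<Sum>i\<in>B. (y l \<xi> i)^2))) = (\<integral>\<^sup>+g. (\<Prod>i\<in>B. ennreal (exp (s * y l \<xi> i * g i))) \<partial>PiM B (\<lambda>_. std_normal))"
   by simp
 qed
 also have "... = (\<integral>\<^sup>+g. (\<integral>\<^sup>+\<xi>. (\<Prod>i\<in>B. ennreal (exp (s * y l \<xi> i * g i))) \<partial>M) \<partial>PiM B (\<lambda>_. std_normal))"
  by (rule PP.Fubini'[symmetric]) measurable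
 also have "... \<le> (\<integral>\<^sup>+g. ennreal 2 * (\<Prod>i\<in>B. ennreal (exp (3 / 8 * (g i)^2))) \<partial>PiM B (\<lambda>_. std_normal))"
 proof (rule nn_integral_mono)
  fix g :: "nat => real"
  define u where "u i = (if i \<in> B then s * g i else 0)" for i
  have u1: "(\<Sum>i<d. u i * z i) = (\<Sum>i\<in>B. s * z i * g i)" for z :: "nat => real"
   using B by (intro sum.mono_neutral_cong_right) (auto simp: u_def)
  have u2: "(\<Sum>i<d. (u i)^2) = (\<Sum>i\<in>B. s^2 * (g i)^2)"
   using B by (intro sum.mono_neutral_cong_right) (auto simp: u_def power_mult_distrib)
  have "(\<integral>\<^sup>+\<xi>. (\<Prod>i\<in>B. ennreal (exp (s * y l \<xi> i * g i))) \<partial>M) = (\<integral>\<^sup>+\<xi>. ennreal (exp (\<Sum>i<d. u i * y l \<xi> i)) \<partial>M)"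
   using fB by (simp add: prod_ennreal exp_sum u1)
  also have "... \<le> ennreal (2 * exp ((\<Sum>i<d. (u i)^2) * t0 / 4))" by (rule exp_linear_moment[OF l])
  also have "(\<Sum>i<d. (u i)^2) * t0 / 4 = (\<Sum>i\<in>B. 3 / 8 * (g i)^2)"
   using t0 unfolding u2 s2 by (simp add: sum_distrib_left sum_distrib_right sum_divide_distrib)
  also have "ennreal (2 * exp (\<Sum>i\<in>B. 3 / 8 * (g i)^2)) = ennreal 2 * (\<Prod>i\<in>B. ennreal (exp (3 / 8 * (g i)^2)))"
   using fB by (simp add: prod_ennreal exp_sum ennreal_mult')
  finally show "(\<integral>\<^sup>+\<xi>. (\<Prod>i\<in>B. ennreal (exp (s * y l \<xi> i * g i))) \<partial>M) \<le> ..." .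
 qed
 also have "... = ennreal 2 * (\<Prod>i\<in>B. (\<integral>\<^sup>+g. ennreal (exp (3 / 8 * g^2)) \<partial>std_normal))"
 proof -
  have "(\<lambda>g. \<Prod>i\<in>B. ennreal (exp (3 / 8 * (g i)^2))) \<in> borel_measurable (PiM B (\<lambda>_. std_normal))"
   by measurable
  then show ?thesis
   using G.product_nn_integral_prod[OF fB, of "\<lambda>_ g. ennreal (exp (3 / 8 * g^2))"]
   by (simp add: nn_integral_cmult)
 qed
 also have "... = ennreal 2 * (\<Prod>i\<in>B. ennreal 2)"
  by (subst std_normal_exp_square) (auto simp: real_sqrt_divide)
 also have "... = ennreal (2 * 2 ^ card B)"
  by (subst ennreal_mult') (simp_all flip: ennreal_power)
 finally show ?thesis .
qed

text \<open>
 A block of \<open>k\<close> coordinates has squared length of order \<open>k\<close> and not larger, up to exponentially small probability.  This is what lets the noise on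
 the band scale with \<open>k\<close>.
\<close>

lemma block_tail:
 assumes l: "l < N" and B: "B \<subseteq> {..<d}" "card B \<le> k" and \<kappa>: "\<kappa> \<ge> 0"
 shows "prob {\<xi>\<in>space M. (\<Sum>i\<in>B. (y l \<xi> i)^2) > 4 * t0 / 3 * (1 + \<kappa>) * real k} \<le> 2 * exp (- (\<kappa> * real k))"
proof -
 define \<tau> where "\<tau> = 4 * t0 / 3 * (1 + \<kappa>) * real k"
 have [measurable]: "\<And>i. i \<in> B ==> (\<lambda>\<xi>. y l \<xi> i) \<in> borel_measurable M" using l B by (auto intro!: yi_meas)
 let ?b = "\<lambda>\<xi>. \<Sum>i\<in>B. (y l \<xi> i)^2" let ?c = "3 / (4 * t0)"
 have "emeasure M {\<xi>\<in>space M. ?b \<xi> > \<tau>} = (\<integral>\<^sup>+\<xi>. indicator {\<xi>\<in>space M. ?b \<xi> > \<tau>} \<xi> \<partial>M)" by simp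
 also have "... \<le> (\<integral>\<^sup>+\<xi>. ennreal (exp (- (?c * \<tau>))) * ennreal (exp (?c * ?b \<xi>)) \<partial>M)"
 proof (rule nn_integral_mono)
  fix \<xi>
  show "indicator {\<xi>\<in>space M. ?b \<xi> > \<tau>} \<xi> \<le> ennreal (exp (- (?c * \<tau>))) * ennreal (exp (?c * ?b \<xi>))"
  proof (cases "?b \<xi> > \<tau>")
   case True
   then have "?c * \<tau> \<le> ?c * ?b \<xi>" using t0 by (intro mult_left_mono) auto
   then have "1 \<le> exp (- (?c * \<tau>)) * exp (?c * ?b \<xi>)" by (simp add: exp_add[symmetric])
   then show ?thesis by (simp add: ennreal_mult[symmetric] indicator_def ennreal_1[symmetric] del: ennreal_1)
  qed (simp add: indicator_def)
 qed
 also have "... = ennreal (exp (- (?c * \<tau>))) * (\<integral>\<^sup>+\<xi>. ennreal (exp (?c * ?b \<xi>)) \<partial>M)"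
  by (rule nn_integral_cmult) measurable
 also have "... \<le> ennreal (exp (- (?c * \<tau>))) * ennreal (2 * 2 ^ card B)"
  by (intro mult_left_mono block_exp_moment l B) auto
 also have "... = ennreal (exp (- (?c * \<tau>)) * (2 * 2 ^ card B))"
  by (simp add: ennreal_mult)
 also have "exp (- (?c * \<tau>)) * (2 * 2 ^ card B) \<le> 2 * exp (- (\<kappa> * real k))"
 proof -
  have c\<tau>: "?c * \<tau> = (1 + \<kappa>) * real k" using t0 by (simp add: \<tau>_def)
  have "(2::real) ^ card B \<le> 2 ^ k" using B by (intro power_increasing) auto
  also have "... \<le> exp 1 ^ k" using exp_ge_add_one_self[of 1] by (intro power_mono) auto
  also have "... = exp (real k)" by (simp add: exp_of_nat_mult[symmetric])
  finally have "exp (- (?c * \<tau>)) * (2 * 2 ^ card B) \<le> exp (- ((1 + \<kappa>) * real k)) * (2 * exp (real k))"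
   unfolding c\<tau> by (intro mult_left_mono) auto
  also have "... = 2 * exp (- (\<kappa> * real k))" by (simp add: exp_add[symmetric] algebra_simps)
  finally show ?thesis .
 qed
 finally have "emeasure M {\<xi>\<in>space M. ?b \<xi> > \<tau>} \<le> ennreal (2 * exp (- (\<kappa> * real k)))" by (simp add: ennreal_leI)
 then show ?thesis by (subst (asm) emeasure_eq_measure) (simp add: \<tau>_def)
qed

subsection \<open>Truncated empirical covariances\<close>

text \<open>
 The bias is the mean of the product on the exceptional event, which the Cauchy-Schwarz inequality bounds by
 the second moment \<open>4 * t0^2\<close> of the product and the probability \<open>q\<close> of the event.
\<close>

lemma truncation_bias:
 assumes l: "l < N" and ij: "i < d" "j < d" and G: "{\<xi>\<in>space M. \<not> G \<xi>} \<in> sets M"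
  and q: "prob {\<xi>\<in>space M. \<not> G \<xi>} \<le> q" "q > 0"
 defines "f \<equiv> \<lambda>\<xi>. if G \<xi> then y l \<xi> i * y l \<xi> j else 0"
 shows "integrable M f" "integrable M (\<lambda>\<xi>. (f \<xi>)^2)" "(\<integral>\<xi>. (f \<xi>)^2 \<partial>M) \<le> 4 * t0^2"
  "\<bar>(\<integral>\<xi>. f \<xi> \<partial>M) - C (i, j)\<bar> \<le> 2 * t0 * sqrt q"
proof -
 note p = product_moment[OF l ij]
 have [measurable]: "(\<lambda>\<xi>. y l \<xi> i) \<in> borel_measurable M" "(\<lambda>\<xi>. y l \<xi> j) \<in> borel_measurable M" using l ij by (auto intro: yi_meas)
 have [measurable]: "Measurable.pred M G"
  using sets.compl_sets[OF G] by (simp add: pred_def Collect_neg_eq[symmetric] set_diff_eq conj_commute) (metis (mono_tags, lifting) Collect_cong)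
 have fm[measurable]: "f \<in> borel_measurable M" unfolding f_def by measurable
 show i1: "integrable M f"
  by (rule Bochner_Integration.integrable_bound[OF p(3)]) (auto simp: f_def)
 show i2: "integrable M (\<lambda>\<xi>. (f \<xi>)^2)"
  by (rule Bochner_Integration.integrable_bound[OF p(1)]) (auto simp: f_def)
 have "(\<integral>\<xi>. (f \<xi>)^2 \<partial>M) \<le> (\<integral>\<xi>. (y l \<xi> i * y l \<xi> j)^2 \<partial>M)"
  using i2 p(1) by (intro integral_mono) (auto simp: f_def)
 then show "(\<integral>\<xi>. (f \<xi>)^2 \<partial>M) \<le> 4 * t0^2" using p(2) by simp
 \<comment> \<open>balances the two terms of \<open>x \<le> b / 2 * x^2 + 1 / (2 * b)\<close> after integration\<close>
 define b where "b = sqrt q / (2 * t0)"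
 have b: "b > 0" using q t0 by (simp add: b_def)
 have "\<bar>(\<integral>\<xi>. f \<xi> \<partial>M) - C (i, j)\<bar> = \<bar>\<integral>\<xi>. f \<xi> - y l \<xi> i * y l \<xi> j \<partial>M\<bar>"
  using i1 p(3) cov[OF l ij] by simp
 also have "... \<le> (\<integral>\<xi>. \<bar>f \<xi> - y l \<xi> i * y l \<xi> j\<bar> \<partial>M)" by (rule integral_abs_bound)
 also have "... \<le> (\<integral>\<xi>. b / 2 * (y l \<xi> i * y l \<xi> j)^2 + 1 / (2 * b) * indicator {\<xi>\<in>space M. \<not> G \<xi>} \<xi> \<partial>M)"
 proof (rule integral_mono)
  show "integrable M (\<lambda>\<xi>. \<bar>f \<xi> - y l \<xi> i * y l \<xi> j\<bar>)" using i1 p(3) by auto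
  show "integrable M (\<lambda>\<xi>. b / 2 * (y l \<xi> i * y l \<xi> j)^2 + 1 / (2 * b) * indicator {\<xi>\<in>space M. \<not> G \<xi>} \<xi>)"
   using p(1) G by (intro Bochner_Integration.integrable_add integrable_mult_right) (auto simp: emeasure_eq_measure)
  fix \<xi> assume w: "\<xi> \<in> space M"
  define x where "x = \<bar>y l \<xi> i * y l \<xi> j\<bar>"
  have "x \<le> b / 2 * x^2 + 1 / (2 * b)"
  proof -
   have "0 \<le> (b * x - 1)^2 / (2 * b)" using b by simp
   also have "... = b / 2 * x^2 + 1 / (2 * b) - x" using b by (simp add: power2_eq_square field_simps)
   finally show ?thesis by simp
  qed
  then show "\<bar>f \<xi> - y l \<xi> i * y l \<xi> j\<bar> \<le> b / 2 * (y l \<xi> i * y l \<xi> j)^2 + 1 / (2 * b) * indicator {\<xi>\<in>space M. \<not> G \<xi>} \<xi>"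
   using w b by (cases "G \<xi>") (auto simp: f_def x_def)
 qed
 also have "... = b / 2 * (\<integral>\<xi>. (y l \<xi> i * y l \<xi> j)^2 \<partial>M) + 1 / (2 * b) * prob {\<xi>\<in>space M. \<not> G \<xi>}"
  using p(1) G by (subst Bochner_Integration.integral_add) (auto simp: emeasure_eq_measure intro!: integrable_mult_right)
 also have "... \<le> b / 2 * (4 * t0^2) + 1 / (2 * b) * q"
  using b p(2) q by (intro add_mono mult_left_mono) auto
 also have "... = 2 * t0 * sqrt q"
 proof -
  have "q = sqrt q * sqrt q" using q by simp
  then have "1 / (2 * b) * q = t0 * sqrt q" using q t0 by (simp add: b_def field_simps)
  moreover have "b / 2 * (4 * t0^2) = t0 * sqrt q" using t0 by (simp add: b_def power2_eq_square)
  ultimately show ?thesis by simp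
 qed
 finally show "\<bar>(\<integral>\<xi>. f \<xi> \<partial>M) - C (i, j)\<bar> \<le> 2 * t0 * sqrt q" .
qed

lemma average_mse:
 fixes F :: "(nat => real) => real"
 assumes F: "F \<in> borel_measurable (vec_space d)"
  and int: "\<And>l. l < N ==> integrable M (\<lambda>\<xi>. (F (y l \<xi>))^2)"
  and sq: "\<And>l. l < N ==> (\<integral>\<xi>. (F (y l \<xi>))^2 \<partial>M) \<le> B"
  and bias: "\<And>l. l < N ==> \<bar>(\<integral>\<xi>. F (y l \<xi>) \<partial>M) - c\<bar> \<le> b"
 shows "(\<integral>\<^sup>+\<xi>. ennreal (((\<Sum>l<N. F (y l \<xi>)) / real N - c)^2) \<partial>M) \<le> ennreal (B / real N + b^2)"
proof -
 define \<mu> where "\<mu> l = (\<integral>\<xi>. F (y l \<xi>) \<partial>M)" for l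
 define Z where "Z l \<xi> = F (y l \<xi>) - \<mu> l" for l \<xi>
 have m: "(\<lambda>\<xi>. F (y l \<xi>)) \<in> borel_measurable M" if "l < N" for l
  using measurable_compose[OF y_meas[OF that] F] .
 have i1: "integrable M (\<lambda>\<xi>. F (y l \<xi>))" if "l < N" for l
  by (rule square_integrable_imp_integrable[OF m[OF that] int[OF that]])
 have Zi: "integrable M (Z l)" "(\<integral>\<xi>. Z l \<xi> \<partial>M) = 0" if "l < N" for l
 proof -
  have "integrable M (\<lambda>\<xi>. Z l \<xi>)" "(\<integral>\<xi>. Z l \<xi> \<partial>M) = 0"
   unfolding Z_def using i1[OF that] by (auto simp: \<mu>_def prob_space)
  then show "integrable M (Z l)" "(\<integral>\<xi>. Z l \<xi> \<partial>M) = 0" by auto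
 qed
 have Zsq: "integrable M (\<lambda>\<xi>. Z l \<xi> * Z l \<xi>)" "(\<integral>\<xi>. Z l \<xi> * Z l \<xi> \<partial>M) \<le> B" if "l < N" for l
 proof -
  have e: "Z l \<xi> * Z l \<xi> = (F (y l \<xi>))^2 - 2 * \<mu> l * F (y l \<xi>) + (\<mu> l)^2" for \<xi>
   by (simp add: Z_def power2_eq_square algebra_simps)
  show "integrable M (\<lambda>\<xi>. Z l \<xi> * Z l \<xi>)" unfolding e using int[OF that] i1[OF that] by auto
  have "(\<integral>\<xi>. Z l \<xi> * Z l \<xi> \<partial>M) = (\<integral>\<xi>. (F (y l \<xi>))^2 \<partial>M) - 2 * \<mu> l * \<mu> l + (\<mu> l)^2"
   unfolding e using int[OF that] i1[OF that] by (simp add: prob_space \<mu>_def)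
  also have "... = (\<integral>\<xi>. (F (y l \<xi>))^2 \<partial>M) - (\<mu> l)^2" by (simp add: power2_eq_square)
  also have "... \<le> B" using sq[OF that] zero_le_power2[of "\<mu> l"] by linarith
  finally show "(\<integral>\<xi>. Z l \<xi> * Z l \<xi> \<partial>M) \<le> B" .
 qed
 have indZ: "indep_vars (\<lambda>_. borel) Z {..<N}"
 proof -
  have "indep_vars (\<lambda>_. borel) (\<lambda>l \<xi>. (\<lambda>x. F x - \<mu> l) (y l \<xi>)) {..<N}"
   by (rule indep_vars_compose2[OF indep]) (use F in auto)
  then show ?thesis by (simp add: Z_def[abs_def])
 qed
 have cross: "integrable M (\<lambda>\<xi>. Z l \<xi> * Z l' \<xi>)" "(\<integral>\<xi>. Z l \<xi> * Z l' \<xi> \<partial>M) = 0" if "l < N" "l' < N" "l \<noteq> l'" for l l'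
 proof -
  have ind: "indep_vars (\<lambda>_. borel) Z {l, l'}"
   by (rule indep_vars_subset[OF indZ]) (use that in auto)
  have ints: "integrable M (Z i)" if "i \<in> {l, l'}" for i using Zi(1) \<open>l < N\<close> \<open>l' < N\<close> that by auto
  show "integrable M (\<lambda>\<xi>. Z l \<xi> * Z l' \<xi>)"
   using indep_vars_integrable[OF _ ind ints] that(3) by simp
  show "(\<integral>\<xi>. Z l \<xi> * Z l' \<xi> \<partial>M) = 0"
   using indep_vars_lebesgue_integral[OF _ ind ints] that(3) Zi(2)[OF that(1)] by simp
 qed
 define b0 where "b0 = (\<Sum>l<N. \<mu> l - c) / real N"
 have avg: "(\<Sum>l<N. F (y l \<xi>)) / real N - c = (\<Sum>l<N. Z l \<xi>) / real N + b0" for \<xi>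
  using N by (simp add: Z_def b0_def sum_subtractf diff_divide_distrib)
 have pr: "integrable M (\<lambda>\<xi>. Z l \<xi> * Z l' \<xi>)" "(\<integral>\<xi>. Z l \<xi> * Z l' \<xi> \<partial>M) \<le> (if l' = l then B else 0)" if "l < N" "l' < N" for l l'
  using cross[OF that] Zsq[OF that(1)] by (cases "l = l'"; auto)+
 have sumZ: "integrable M (\<lambda>\<xi>. \<Sum>l<N. Z l \<xi>)" using Zi by (intro Bochner_Integration.integrable_sum) auto
 have dbl: "integrable M (\<lambda>\<xi>. \<Sum>l<N. \<Sum>l'<N. Z l \<xi> * Z l' \<xi>)"
  using pr by (intro Bochner_Integration.integrable_sum) auto
 have expand: "((\<Sum>l<N. F (y l \<xi>)) / real N - c)^2
  = (\<Sum>l<N. \<Sum>l'<N. Z l \<xi> * Z l' \<xi>) / (real N)^2 + 2 * b0 / real N * (\<Sum>l<N. Z l \<xi>) + b0^2" for \<xi>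
 proof -
  have "(\<Sum>l<N. \<Sum>l'<N. Z l \<xi> * Z l' \<xi>) = (\<Sum>l<N. Z l \<xi>) * (\<Sum>l<N. Z l \<xi>)" by (simp add: sum_product)
  then show ?thesis unfolding avg by (simp add: power2_eq_square add_divide_distrib algebra_simps)
 qed
 have int_all: "integrable M (\<lambda>\<xi>. ((\<Sum>l<N. F (y l \<xi>)) / real N - c)^2)"
  unfolding expand using dbl sumZ by auto
 have "(\<integral>\<xi>. ((\<Sum>l<N. F (y l \<xi>)) / real N - c)^2 \<partial>M)
  = (\<Sum>l<N. \<Sum>l'<N. (\<integral>\<xi>. Z l \<xi> * Z l' \<xi> \<partial>M)) / (real N)^2 + 2 * b0 / real N * (\<Sum>l<N. (\<integral>\<xi>. Z l \<xi> \<partial>M)) + b0^2"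
 proof -
  have "(\<integral>\<xi>. (\<Sum>l<N. \<Sum>l'<N. Z l \<xi> * Z l' \<xi>) \<partial>M) = (\<Sum>l<N. (\<integral>\<xi>. (\<Sum>l'<N. Z l \<xi> * Z l' \<xi>) \<partial>M))"
   using pr(1) by (intro Bochner_Integration.integral_sum Bochner_Integration.integrable_sum) auto
  also have "... = (\<Sum>l<N. \<Sum>l'<N. (\<integral>\<xi>. Z l \<xi> * Z l' \<xi> \<partial>M))"
   using pr(1) by (intro sum.cong refl Bochner_Integration.integral_sum) auto
  finally have 1: "(\<integral>\<xi>. (\<Sum>l<N. \<Sum>l'<N. Z l \<xi> * Z l' \<xi>) \<partial>M) = (\<Sum>l<N. \<Sum>l'<N. (\<integral>\<xi>. Z l \<xi> * Z l' \<xi> \<partial>M))" .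
  have 2: "(\<integral>\<xi>. (\<Sum>l<N. Z l \<xi>) \<partial>M) = (\<Sum>l<N. (\<integral>\<xi>. Z l \<xi> \<partial>M))"
   using Zi(1) by (intro Bochner_Integration.integral_sum) auto
  show ?thesis unfolding expand using dbl sumZ by (simp add: prob_space 1 2)
 qed
 also have "... \<le> (\<Sum>l<N. \<Sum>l'<N. if l' = l then B else 0) / (real N)^2 + b0^2"
 proof -
  have S: "(\<Sum>l<N. \<Sum>l'<N. (\<integral>\<xi>. Z l \<xi> * Z l' \<xi> \<partial>M)) \<le> (\<Sum>l<N. \<Sum>l'<N. if l' = l then B else 0)"
   using pr(2) by (intro sum_mono) auto
  have z: "(\<Sum>l<N. (\<integral>\<xi>. Z l \<xi> \<partial>M)) = 0" using Zi(2) by simp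
  show ?thesis unfolding z using divide_right_mono[OF S, of "(real N)^2"] by simp
 qed
 also have "... = B / real N + b0^2" using N by (simp add: power2_eq_square)
 also have "b0^2 \<le> b^2"
 proof -
  have "\<bar>b0\<bar> \<le> (\<Sum>l<N. \<bar>\<mu> l - c\<bar>) / real N" unfolding b0_def using N by (simp add: divide_right_mono)
  also have "... \<le> (\<Sum>l<N. b) / real N" using bias by (intro divide_right_mono sum_mono) (auto simp: \<mu>_def)
  also have "... = b" using N by simp
  finally have "\<bar>b0\<bar> \<le> b" .
  then show ?thesis using power_mono[of "\<bar>b0\<bar>" b 2] by simp
 qed
 finally have "(\<integral>\<xi>. ((\<Sum>l<N. F (y l \<xi>)) / real N - c)^2 \<partial>M) \<le> B / real N + b^2" by simp
 then show ?thesis using nn_integral_eq_integral[OF int_all] by (simp add: ennreal_leI)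
qed

text \<open>
 Hoeffding's lemma for each of the independent summands, which have values in \<open>{-B..B}\<close>.
\<close>

lemma average_mgf:
 fixes F :: "(nat => real) => real"
 assumes F: "F \<in> borel_measurable (vec_space d)" and bd: "\<And>x. \<bar>F x\<bar> \<le> B" and s: "s > 0"
 shows "(\<integral>\<^sup>+\<xi>. ennreal (exp (s * (\<Sum>l<N. F (y l \<xi>) - (\<integral>\<xi>. F (y l \<xi>) \<partial>M)))) \<partial>M) \<le> ennreal (exp (real N * s^2 * B^2 / 2))"
proof -
 define \<mu> where "\<mu> l = (\<integral>\<xi>. F (y l \<xi>) \<partial>M)" for l
 have m: "(\<lambda>\<xi>. F (y l \<xi>)) \<in> borel_measurable M" if "l < N" for l
  using measurable_compose[OF y_meas[OF that] F] .
 have ind: "indep_vars (\<lambda>_. borel) (\<lambda>l \<xi>. (\<lambda>x. ennreal (exp (s * (F x - \<mu> l)))) (y l \<xi>)) {..<N}"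
  by (rule indep_vars_compose2[OF indep]) (use F in auto)
 have "(\<integral>\<^sup>+\<xi>. ennreal (exp (s * (\<Sum>l<N. F (y l \<xi>) - \<mu> l))) \<partial>M)
  = (\<integral>\<^sup>+\<xi>. (\<Prod>l<N. ennreal (exp (s * (F (y l \<xi>) - \<mu> l)))) \<partial>M)"
  by (simp add: prod_ennreal exp_sum[symmetric] sum_distrib_left)
 also have "... = (\<Prod>l<N. (\<integral>\<^sup>+\<xi>. ennreal (exp (s * (F (y l \<xi>) - \<mu> l))) \<partial>M))"
  by (rule indep_vars_nn_integral[OF _ ind]) auto
 also have "... \<le> (\<Prod>l<N. ennreal (exp (s^2 * B^2 / 2)))"
 proof (rule prod_mono_ennreal)
  fix l assume "l \<in> {..<N}"
  then interpret interval_bounded_random_variable M "\<lambda>\<xi>. F (y l \<xi>)" "- B" B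
   by unfold_locales (use m bd in \<open>auto simp: abs_le_iff minus_le_iff\<close>)
  have "(\<integral>\<^sup>+\<xi>. ennreal (exp (s * (F (y l \<xi>) - \<mu> l))) \<partial>M) \<le> ennreal (exp (s^2 * (B - - B)^2 / 8))"
   unfolding \<mu>_def by (rule Hoeffdings_lemma_nn_integral[OF s])
  also have "s^2 * (B - - B)^2 / 8 = s^2 * B^2 / 2" by (simp add: power2_eq_square)
  finally show "(\<integral>\<^sup>+\<xi>. ennreal (exp (s * (F (y l \<xi>) - \<mu> l))) \<partial>M) \<le> ennreal (exp (s^2 * B^2 / 2))" .
 qed
 also have "... = ennreal (exp (s^2 * B^2 / 2) ^ N)" by (simp add: ennreal_power)
 also have "exp (s^2 * B^2 / 2) ^ N = exp (real N * s^2 * B^2 / 2)" by (simp add: exp_of_nat_mult[symmetric])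
 finally show ?thesis unfolding \<mu>_def .
qed

text \<open>
 The maximum of the deviations is at most \<open>ln X / s\<close> for the sum \<open>X\<close> of their exponentials.  The logarithm is replaced by its tangent at an
 upper bound \<open>c0\<close> of the mean of \<open>X\<close>; the resulting \<open>U\<close> is affine in \<open>X\<close>, so its mean is immediate.
\<close>

lemma uniform_deviation:
 fixes F :: "'j => (nat => real) => real"
 assumes I: "finite I" "card I \<le> m" "m \<ge> 1" and F: "\<And>j. j \<in> I ==> F j \<in> borel_measurable (vec_space d)"
  and bd: "\<And>j x. \<bar>F j x\<bar> \<le> B" and B: "B > 0"
  and bias: "\<And>j l. j \<in> I ==> l < N ==> \<bar>(\<integral>\<xi>. F j (y l \<xi>) \<partial>M) - c j\<bar> \<le> b" and b: "b \<ge> 0"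
 obtains U where "U \<in> borel_measurable M" "\<And>\<xi>. \<xi> \<in> space M ==> U \<xi> \<ge> 0"
  "\<And>\<xi> j. \<xi> \<in> space M ==> j \<in> I ==> \<bar>(\<Sum>l<N. F j (y l \<xi>)) / real N - c j\<bar> \<le> U \<xi>"
  "(\<integral>\<^sup>+\<xi>. ennreal (U \<xi>) \<partial>M) \<le> ennreal (b + B * (ln (2 * real m) + 1) / sqrt (real N))"
proof -
 define Z where "Z j \<xi> = (\<Sum>l<N. F j (y l \<xi>) - (\<integral>\<xi>. F j (y l \<xi>) \<partial>M))" for j \<xi>
 define s where "s = 1 / (B * sqrt (real N))"
 have s: "s > 0" using B N by (simp add: s_def)
 define X where "X \<xi> = (\<Sum>j\<in>I. exp (s * Z j \<xi>) + exp (s * - Z j \<xi>))" for \<xi>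
 \<comment> \<open>with this \<open>s\<close> every exponential has mean at most \<open>exp (1 / 2)\<close>, and there are at most \<open>2 * m\<close> of them\<close>
 define c0 where "c0 = 2 * real m * exp (1 / 2)"
 have c0: "c0 > 0" using I by (simp add: c0_def)
 define U where "U \<xi> = b + B / sqrt (real N) * (X \<xi> / c0 + ln (2 * real m))" for \<xi>
 have m: "(\<lambda>\<xi>. F j (y l \<xi>)) \<in> borel_measurable M" if "j \<in> I" "l < N" for j l
  using measurable_compose[OF y_meas[OF that(2)] F[OF that(1)]] .
 have Zm: "Z j \<in> borel_measurable M" if "j \<in> I" for j
  unfolding Z_def using m[OF that] by (intro borel_measurable_sum borel_measurable_diff) auto
 have Xm: "X \<in> borel_measurable M" unfolding X_def using Zm by (intro borel_measurable_sum) auto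
 have X0: "0 \<le> X \<xi>" for \<xi> unfolding X_def by (intro sum_nonneg add_nonneg_nonneg) auto
 have lnm: "0 \<le> ln (2 * real m)" using I by simp
 show thesis
 proof (rule that[of U])
  show "U \<in> borel_measurable M" unfolding U_def using Xm by measurable
  show "U \<xi> \<ge> 0" for \<xi> unfolding U_def using b B X0 c0 lnm by (intro add_nonneg_nonneg mult_nonneg_nonneg) auto
  show "\<bar>(\<Sum>l<N. F j (y l \<xi>)) / real N - c j\<bar> \<le> U \<xi>" if j: "j \<in> I" for j \<xi>
  proof -
   have expX: "exp (s * \<bar>Z j \<xi>\<bar>) \<le> X \<xi>"
   proof -
    have "exp (s * \<bar>Z j \<xi>\<bar>) \<le> exp (s * Z j \<xi>) + exp (s * - Z j \<xi>)" by (cases "Z j \<xi> \<ge> 0") auto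
    also have "... \<le> X \<xi>" unfolding X_def using I j
     by (intro member_le_sum[where f = "\<lambda>j. exp (s * Z j \<xi>) + exp (s * - Z j \<xi>)"]) (auto intro: add_nonneg_nonneg)
    finally show ?thesis .
   qed
   then have Xp: "X \<xi> > 0" by (rule less_le_trans[rotated]) simp
   have "s * \<bar>Z j \<xi>\<bar> \<le> ln (X \<xi>)" using expX Xp by (simp add: ln_ge_iff)
   also have "ln (X \<xi>) = ln (X \<xi> / c0) + ln c0" using Xp c0 by (simp add: ln_div)
   also have "... \<le> (X \<xi> / c0 - 1) + ln c0" using Xp c0 by (intro add_right_mono ln_le_minus_one) auto
   also have "ln c0 = ln (2 * real m) + 1 / 2" unfolding c0_def using I by (subst ln_mult) auto
   finally have sz: "s * \<bar>Z j \<xi>\<bar> \<le> X \<xi> / c0 + ln (2 * real m)" by simp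
   have "\<bar>(\<Sum>l<N. F j (y l \<xi>)) / real N - c j\<bar> = \<bar>Z j \<xi> / real N + (\<Sum>l<N. (\<integral>\<xi>. F j (y l \<xi>) \<partial>M) - c j) / real N\<bar>"
    using N by (simp add: Z_def sum_subtractf diff_divide_distrib)
   also have "... \<le> \<bar>Z j \<xi>\<bar> / real N + (\<Sum>l<N. \<bar>(\<integral>\<xi>. F j (y l \<xi>) \<partial>M) - c j\<bar>) / real N"
    by (rule order_trans[OF abs_triangle_ineq]) (auto simp: divide_right_mono)
   also have "(\<Sum>l<N. \<bar>(\<integral>\<xi>. F j (y l \<xi>) \<partial>M) - c j\<bar>) / real N \<le> (\<Sum>l<N. b) / real N"
    using bias j by (intro divide_right_mono sum_mono) auto
   also have "(\<Sum>l<N. b) / real N = b" using N by simp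
   also have "\<bar>Z j \<xi>\<bar> / real N = B / sqrt (real N) * (s * \<bar>Z j \<xi>\<bar>)"
    using B N by (simp add: s_def field_simps)
   also have "... \<le> B / sqrt (real N) * (X \<xi> / c0 + ln (2 * real m))"
    using sz B by (intro mult_left_mono) auto
   finally show ?thesis by (simp add: U_def)
  qed
  have EX: "(\<integral>\<^sup>+\<xi>. ennreal (X \<xi>) \<partial>M) \<le> ennreal c0"
  proof -
   have "(\<integral>\<^sup>+\<xi>. ennreal (X \<xi>) \<partial>M) = (\<Sum>j\<in>I. (\<integral>\<^sup>+\<xi>. ennreal (exp (s * Z j \<xi>)) \<partial>M) + (\<integral>\<^sup>+\<xi>. ennreal (exp (s * - Z j \<xi>)) \<partial>M))"
    unfolding X_def using Zm
    by (subst sum_ennreal[symmetric]) (auto simp: nn_integral_sum nn_integral_add ennreal_plus)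
   also have "... \<le> (\<Sum>j\<in>I. ennreal (exp (1 / 2)) + ennreal (exp (1 / 2)))"
   proof (intro sum_mono add_mono)
    fix j assume j: "j \<in> I"
    have e: "real N * s^2 * B^2 / 2 = 1 / 2" using B N by (simp add: s_def power_divide power_mult_distrib)
    show "(\<integral>\<^sup>+\<xi>. ennreal (exp (s * Z j \<xi>)) \<partial>M) \<le> ennreal (exp (1 / 2))"
     using average_mgf[OF F[OF j] bd s] unfolding e Z_def .
    have n: "- Z j \<xi> = (\<Sum>l<N. - F j (y l \<xi>) - (\<integral>\<xi>. - F j (y l \<xi>) \<partial>M))" for \<xi>
     by (simp add: Z_def sum_subtractf sum_negf)
    show "(\<integral>\<^sup>+\<xi>. ennreal (exp (s * - Z j \<xi>)) \<partial>M) \<le> ennreal (exp (1 / 2))"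
     using average_mgf[of "\<lambda>x. - F j x" B s] F[OF j] bd s unfolding e n by simp
   qed
   also have "... = ennreal (real (card I) * (2 * exp (1 / 2)))"
    by (simp add: ennreal_plus[symmetric] ennreal_of_nat_eq_real_of_nat ennreal_mult' del: ennreal_plus)
   also have "... \<le> ennreal c0" unfolding c0_def using I by (intro ennreal_leI) simp
   finally show ?thesis .
  qed
  have "(\<integral>\<^sup>+\<xi>. ennreal (U \<xi>) \<partial>M) = (\<integral>\<^sup>+\<xi>. ennreal (b + B / sqrt (real N) * ln (2 * real m)) + ennreal (B / sqrt (real N) / c0) * ennreal (X \<xi>) \<partial>M)"
  proof (rule nn_integral_cong)
   fix \<xi>
   have "U \<xi> = (b + B / sqrt (real N) * ln (2 * real m)) + B / sqrt (real N) / c0 * X \<xi>"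
    by (simp add: U_def algebra_simps)
   then show "ennreal (U \<xi>) = ennreal (b + B / sqrt (real N) * ln (2 * real m)) + ennreal (B / sqrt (real N) / c0) * ennreal (X \<xi>)"
    using b B lnm c0 X0 by (simp add: ennreal_plus[symmetric] ennreal_mult[symmetric] del: ennreal_plus)
  qed
  also have "... = ennreal (b + B / sqrt (real N) * ln (2 * real m)) + ennreal (B / sqrt (real N) / c0) * (\<integral>\<^sup>+\<xi>. ennreal (X \<xi>) \<partial>M)"
   using Xm by (simp add: nn_integral_add nn_integral_cmult emeasure_space_1)
  also have "... \<le> ennreal (b + B / sqrt (real N) * ln (2 * real m)) + ennreal (B / sqrt (real N) / c0) * ennreal c0"
   using EX by (intro add_left_mono mult_left_mono) auto
  also have "... = ennreal (b + B / sqrt (real N) * ln (2 * real m) + B / sqrt (real N))"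
   using b B lnm c0 by (simp add: ennreal_plus[symmetric] ennreal_mult[symmetric] del: ennreal_plus)
  also have "b + B / sqrt (real N) * ln (2 * real m) + B / sqrt (real N) = b + B * (ln (2 * real m) + 1) / sqrt (real N)"
   by (simp add: algebra_simps add_divide_distrib)
  finally show "(\<integral>\<^sup>+\<xi>. ennreal (U \<xi>) \<partial>M) \<le> ennreal (b + B * (ln (2 * real m) + 1) / sqrt (real N))" .
 qed
qed

end

section \<open>Differences of paired observations\<close>

text \<open>
 Subtracting two observations removes the unknown mean, and the factor \<open>1 / sqrt 2\<close> keeps the covariance.
\<close>

definition pair_diff :: "nat => (nat => nat => real) => nat => nat => real" where
 "pair_diff d S l = (\<lambda>i\<in>{..<d}. (S (2 * l) i - S (2 * l + 1) i) / sqrt 2)"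

lemma indep_coordinates:
 assumes "prob_space P" and n: "n > 0"
 shows "prob_space.indep_vars (PiM {..<n} (\<lambda>_. P)) (\<lambda>_. P) (\<lambda>i S. S i) {..<n::nat}"
proof -
 interpret PM: prob_space "PiM {..<n} (\<lambda>_. P)" using assms by (intro prob_space_PiM)
 have c: "distr (PiM {..<n} (\<lambda>_. P)) P (\<lambda>S. S i) = P" if "i < n" for i
  by (rule distr_PiM_component) (use assms that in auto)
 have "distr (PiM {..<n} (\<lambda>_. P)) (PiM {..<n} (\<lambda>_. P)) (\<lambda>S. \<lambda>i\<in>{..<n}. S i)
  = distr (PiM {..<n} (\<lambda>_. P)) (PiM {..<n} (\<lambda>_. P)) (\<lambda>S. S)"
  by (intro distr_cong refl) (auto simp: space_PiM PiE_def extensional_restrict)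
 also have "... = PiM {..<n} (\<lambda>_. P)" by (rule distr_id)
 also have "... = PiM {..<n} (\<lambda>i. distr (PiM {..<n} (\<lambda>_. P)) P (\<lambda>S. S i))"
  using c by (intro PiM_cong) auto
 finally show ?thesis
  using n by (subst PM.indep_vars_iff_distr_eq_PiM') (auto intro!: measurable_component_singleton)
qed

text \<open>
 The \<open>psi_2\<close> norm is an infimum that need not be known to be attained, hence \<open>(2 * K)^2\<close> in place of \<open>K^2\<close>.
\<close>

lemma psi2_exp_moment:
 assumes psi: "psi2_norm_vec d P (\<lambda>x i. x i - \<mu> i) \<le> ennreal K" and K: "K > 0"
  and v: "(\<Sum>i<d. (v i)^2) = 1"
 shows "(\<integral>\<^sup>+x. ennreal (exp ((\<Sum>i<d. v i * (x i - \<mu> i))^2 / (4 * K^2))) \<partial>P) \<le> 2"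
proof -
 let ?\<xi> = "\<lambda>x. \<Sum>i<d. (x i - \<mu> i) * v i"
 have "L2_set v {..<d} = 1" using v by (simp add: L2_set_def)
 then have "psi2_norm P ?\<xi> \<le> psi2_norm_vec d P (\<lambda>x i. x i - \<mu> i)"
  unfolding psi2_norm_vec_def by (intro SUP_upper) auto
 also note psi
 also have "ennreal K < ennreal (2 * K)" using K by (intro ennreal_lessI) auto
 finally obtain t where t: "t > 0" "ennreal t < ennreal (2 * K)" "(\<integral>\<^sup>+x. ennreal (exp ((?\<xi> x)^2 / t^2)) \<partial>P) \<le> 2"
  unfolding psi2_norm_def by (auto simp: Inf_less_iff)
 then have "t \<le> 2 * K" using K by (simp add: ennreal_less_iff)
 then have "t^2 \<le> (2 * K)^2" using t by (intro power_mono) auto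
 then have t2: "t^2 \<le> 4 * K^2" by (simp add: power_mult_distrib)
 have "(\<integral>\<^sup>+x. ennreal (exp ((\<Sum>i<d. v i * (x i - \<mu> i))^2 / (4 * K^2))) \<partial>P) \<le> (\<integral>\<^sup>+x. ennreal (exp ((?\<xi> x)^2 / t^2)) \<partial>P)"
 proof (intro nn_integral_mono ennreal_leI)
  fix x
  have "(\<Sum>i<d. v i * (x i - \<mu> i)) = ?\<xi> x" by (simp add: mult.commute)
  then show "exp ((\<Sum>i<d. v i * (x i - \<mu> i))^2 / (4 * K^2)) \<le> exp ((?\<xi> x)^2 / t^2)"
   using t2 t by (simp add: frac_le)
 qed
 with t(3) show ?thesis by simp
qed

text \<open>
 By convexity, the exponential moment of a difference is at most the average of the exponential moments of the two observations.  The cross terms in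
 the products of two coordinates have mean zero by independence.
\<close>

lemma subgauss_sample_pair_diff:
 assumes P: "P \<in> dist_class \<J> \<alpha> K M0 M d" and K: "K > 0" and n: "n \<ge> 2"
 shows "subgauss_sample (PiM {..<n} (\<lambda>_. P)) (\<lambda>l S. pair_diff d S l) (n div 2) d (8 * K^2) (cov_mat d P)"
proof -
 define \<mu> where "\<mu> = mean_vec P"
 have prob: "prob_space P" and sP[measurable_cong]: "sets P = sets (vec_space d)"
  and sq: "\<And>i. i < d ==> integrable P (\<lambda>x. (x i)^2)"
  and psi: "psi2_norm_vec d P (\<lambda>x i. x i - \<mu> i) \<le> ennreal K"
  using P by (auto simp: dist_class_def space_prob_algebra \<mu>_def)
 interpret P: prob_space P by fact
 let ?M = "PiM {..<n} (\<lambda>_. P)"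
 interpret PM: prob_space ?M using prob by (intro prob_space_PiM)
 have ci: "(\<lambda>x. x i) \<in> borel_measurable P" if "i < d" for i
  using coord_meas[OF that] by (simp cong: measurable_cong_sets add: sP)
 have comp: "distr ?M P (\<lambda>S. S m) = P" if "m < n" for m
  by (rule distr_PiM_component) (use prob that in auto)
 have cm: "(\<lambda>S. S m) \<in> ?M \<rightarrow>\<^sub>M P" if "m < n" for m using that by (intro measurable_component_singleton) auto
 have cmi: "(\<lambda>S. S m i) \<in> borel_measurable ?M" if "m < n" "i < d" for m i
  using measurable_compose[OF cm[OF that(1)] ci[OF that(2)]] .
 have idx: "2 * l < n" "2 * l + 1 < n" if "l < n div 2" for l using that by auto
 have indep: "PM.indep_vars (\<lambda>_. P) (\<lambda>i S. S i) {..<n}" using prob n by (intro indep_coordinates) auto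
 show ?thesis
 proof
  show "0 < n div 2" using n by (simp add: div_greater_zero_iff)
  show "0 < 8 * K^2" using K by simp
  show "PM.indep_vars (\<lambda>_. vec_space d) (\<lambda>l S. pair_diff d S l) {..<n div 2}"
  proof -
   let ?K = "\<lambda>l. {2 * l, 2 * l + 1 :: nat}"
   let ?g = "\<lambda>l f. (\<lambda>i\<in>{..<d}. (f (2 * l) i - f (2 * l + 1) i) / sqrt 2) :: nat => real"
   have 1: "PM.indep_vars (\<lambda>l. PiM (?K l) (\<lambda>_. P)) (\<lambda>l S. restrict (\<lambda>i. S i) (?K l)) {..<n div 2}"
   proof (rule PM.indep_vars_restrict[OF indep])
    show "?K l \<subseteq> {..<n}" if "l \<in> {..<n div 2}" for l using idx[of l] that by auto
    have "?K l \<inter> ?K l' = {}" if "l \<noteq> l'" for l l'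
    proof -
     have "2 * l \<noteq> 2 * l' + 1" "2 * l + 1 \<noteq> 2 * l'" by presburger+
     then show ?thesis using that by auto
    qed
    then show "disjoint_family_on ?K {..<n div 2}" by (auto simp only: disjoint_family_on_def)
   qed
   have "PM.indep_vars (\<lambda>_. vec_space d) (\<lambda>l S. ?g l (restrict (\<lambda>i. S i) (?K l))) {..<n div 2}"
   proof (rule PM.indep_vars_compose2[OF 1])
    fix l
    have "(\<lambda>f. f m i) \<in> borel_measurable (PiM (?K l) (\<lambda>_. P))" if "m \<in> ?K l" "i < d" for m i
     using measurable_compose[OF measurable_component_singleton[OF that(1), of "\<lambda>_. P"] ci[OF that(2)]] .
    then show "?g l \<in> PiM (?K l) (\<lambda>_. P) \<rightarrow>\<^sub>M vec_space d"
     unfolding vec_space_def by (intro measurable_restrict borel_measurable_divide borel_measurable_diff) auto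
   qed
   then show ?thesis by (simp add: pair_diff_def[abs_def])
  qed
  fix l assume l: "l < n div 2"
  note i1 = idx(1)[OF l] and i2 = idx(2)[OF l]
  {
   fix v assume v: "(\<Sum>i<d. (v i)^2) = (1::real)"
   let ?a = "\<lambda>x. \<Sum>i<d. v i * (x i - \<mu> i)"
   have am: "(\<lambda>x. ennreal (exp ((?a x)^2 / (4 * K^2)))) \<in> borel_measurable P"
    using ci by (intro measurable_compose[OF _ measurable_ennreal] borel_measurable_exp[THEN measurable_compose[rotated]] borel_measurable_divide borel_measurable_power borel_measurable_sum borel_measurable_times borel_measurable_diff) auto
   have marg: "(\<integral>\<^sup>+S. ennreal (exp ((?a (S m))^2 / (4 * K^2))) \<partial>?M) \<le> 2" if "m < n" for m
   proof -
    have "(\<integral>\<^sup>+S. ennreal (exp ((?a (S m))^2 / (4 * K^2))) \<partial>?M) = (\<integral>\<^sup>+x. ennreal (exp ((?a x)^2 / (4 * K^2))) \<partial>distr ?M P (\<lambda>S. S m))"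
     using am by (subst nn_integral_distr[OF cm[OF that]]) auto
    also have "... \<le> 2" unfolding comp[OF that] by (rule psi2_exp_moment[OF psi K v])
    finally show ?thesis .
   qed
   have am': "(\<lambda>S. ennreal (exp ((?a (S m))^2 / (4 * K^2)))) \<in> borel_measurable ?M" if "m < n" for m
    using measurable_compose[OF cm[OF that] am] .
   have "(\<integral>\<^sup>+S. ennreal (exp ((\<Sum>i<d. v i * pair_diff d S l i)^2 / (8 * K^2))) \<partial>?M)
    \<le> (\<integral>\<^sup>+S. ennreal (1 / 2) * (ennreal (exp ((?a (S (2 * l)))^2 / (4 * K^2))) + ennreal (exp ((?a (S (2 * l + 1)))^2 / (4 * K^2)))) \<partial>?M)"
   proof (rule nn_integral_mono)
    fix S :: "nat => nat => real"
    let ?x = "?a (S (2 * l))" and ?y = "?a (S (2 * l + 1))"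
    have e: "(\<Sum>i<d. v i * pair_diff d S l i) = (?x - ?y) / sqrt 2"
     by (simp add: pair_diff_def sum_subtractf[symmetric] sum_divide_distrib algebra_simps)
    have "((?x - ?y) / sqrt 2)^2 / (8 * K^2) \<le> (?x^2 / (4 * K^2) + ?y^2 / (4 * K^2)) / 2"
    proof -
     have "(x - y)^2 / 2 \<le> x^2 + y^2" for x y :: real
      using zero_le_power2[of "x + y"] by (simp add: power2_eq_square algebra_simps)
     then have "(?x - ?y)^2 / 2 / (8 * K^2) \<le> (?x^2 + ?y^2) / (8 * K^2)" by (intro divide_right_mono) auto
     also have "... = (?x^2 / (4 * K^2) + ?y^2 / (4 * K^2)) / 2" by (simp add: add_divide_distrib)
     finally show ?thesis by (simp add: power_divide)
    qed
    then have "exp (((?x - ?y) / sqrt 2)^2 / (8 * K^2)) \<le> exp ((?x^2 / (4 * K^2) + ?y^2 / (4 * K^2)) / 2)" by simp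
    also have "... \<le> 1 / 2 * (exp (?x^2 / (4 * K^2)) + exp (?y^2 / (4 * K^2)))"
    proof -
     have "exp ((x + y) / 2) \<le> 1 / 2 * (exp x + exp y)" for x y :: real
     proof -
      have "0 \<le> (exp (x / 2) - exp (y / 2))^2" by simp
      also have "... = exp x + exp y - 2 * exp ((x + y) / 2)"
       by (simp add: power2_eq_square algebra_simps exp_add[symmetric] add_divide_distrib)
      finally show ?thesis by simp
     qed
     then show ?thesis .
    qed
    finally show "ennreal (exp ((\<Sum>i<d. v i * pair_diff d S l i)^2 / (8 * K^2))) \<le> ennreal (1 / 2) * (ennreal (exp (?x^2 / (4 * K^2))) + ennreal (exp (?y^2 / (4 * K^2))))"
     unfolding e by (simp only: ennreal_plus[symmetric] ennreal_mult'[symmetric] exp_ge_zero) (simp add: ennreal_leI ennreal_plus[symmetric] ennreal_mult'[symmetric] del: ennreal_plus)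
   qed
   also have "... = ennreal (1 / 2) * ((\<integral>\<^sup>+S. ennreal (exp ((?a (S (2 * l)))^2 / (4 * K^2))) \<partial>?M) + (\<integral>\<^sup>+S. ennreal (exp ((?a (S (2 * l + 1)))^2 / (4 * K^2))) \<partial>?M))"
    using am'[OF i1] am'[OF i2] by (subst nn_integral_cmult) (auto simp: nn_integral_add)
   also have "... \<le> ennreal (1 / 2) * (2 + 2)"
    using marg[OF i1] marg[OF i2] by (intro mult_left_mono add_mono) auto
   also have "ennreal (1 / 2) * (2 + 2) = ennreal (1 / 2 * 4)" by (subst ennreal_mult') auto
   also have "... = 2" by simp
   finally show "(\<integral>\<^sup>+S. ennreal (exp ((\<Sum>i<d. v i * pair_diff d S l i)^2 / (8 * K^2))) \<partial>?M) \<le> 2" .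
  }
  fix i j assume i: "i < d" and j: "j < d"
  have x1: "integrable P (\<lambda>x. x i)" if "i < d" for i
   by (rule P.square_integrable_imp_integrable[OF ci[OF that] sq[OF that]])
  have prod_int: "integrable P (\<lambda>x. (x i - \<mu> i) * (x j - \<mu> j))" if "i < d" "j < d" for i j
  proof (rule Bochner_Integration.integrable_bound)
   have s: "integrable P (\<lambda>x. (x i - \<mu> i)^2)" if "i < d" for i
    using sq[OF that] x1[OF that] by (simp add: power2_diff)
   show "integrable P (\<lambda>x. (x i - \<mu> i)^2 + (x j - \<mu> j)^2)" using s that by auto
   show "(\<lambda>x. (x i - \<mu> i) * (x j - \<mu> j)) \<in> borel_measurable P" using ci that by auto
   have "\<bar>a * b\<bar> \<le> a^2 + b^2" for a b :: real
   proof -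
    have "0 \<le> (\<bar>a\<bar> - \<bar>b\<bar>)^2" by simp
    also have "... = a^2 + b^2 - 2 * \<bar>a * b\<bar>" by (simp add: power2_diff abs_mult)
    finally have "2 * \<bar>a * b\<bar> \<le> a^2 + b^2" by simp
    then show ?thesis using abs_ge_zero[of "a * b"] by linarith
   qed
   then show "AE x in P. norm ((x i - \<mu> i) * (x j - \<mu> j)) \<le> norm ((x i - \<mu> i)^2 + (x j - \<mu> j)^2)"
    by (auto intro!: AE_I2 simp: abs_of_nonneg)
  qed
  have lift: "integrable ?M (\<lambda>S. f (S m))" "(\<integral>S. f (S m) \<partial>?M) = (\<integral>x. f x \<partial>P)" if "m < n" "integrable P f" for f :: "_ => real" and m
  proof -
   show "integrable ?M (\<lambda>S. f (S m))" using integrable_distr[OF cm[OF that(1)], of f] that(2) by (simp add: comp[OF that(1)])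
   show "(\<integral>S. f (S m) \<partial>?M) = (\<integral>x. f x \<partial>P)"
    using integral_distr[OF cm[OF that(1)], of f] that(2) by (simp add: comp[OF that(1)])
  qed
  have cent: "integrable P (\<lambda>x. x i - \<mu> i)" "(\<integral>x. x i - \<mu> i \<partial>P) = 0" if "i < d" for i
   using x1[OF that] by (auto simp: \<mu>_def mean_vec_def P.prob_space)
  have cross: "integrable ?M (\<lambda>S. (S m i - \<mu> i) * (S m' j - \<mu> j))" "(\<integral>S. (S m i - \<mu> i) * (S m' j - \<mu> j) \<partial>?M) = 0"
   if mm: "m < n" "m' < n" "m \<noteq> m'" and "i < d" "j < d" for m m' i j
  proof -
   define Y where "Y k S = (if k = m then S m i - \<mu> i else S m' j - \<mu> j)" for k and S :: "nat => nat => real"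
   have "PM.indep_vars (\<lambda>_. borel) (\<lambda>k S. (\<lambda>x. if k = m then x i - \<mu> i else x j - \<mu> j) (S k)) {m, m'}"
    by (rule PM.indep_vars_compose2[OF PM.indep_vars_subset[OF indep]]) (use that ci in auto)
   then have ind: "PM.indep_vars (\<lambda>_. borel) Y {m, m'}"
    by (rule PM.indep_vars_cong[THEN iffD1, rotated -1]) (auto simp: Y_def fun_eq_iff)
   have ints: "integrable ?M (Y k)" if "k \<in> {m, m'}" for k
    using that mm(3) lift(1)[OF mm(1) cent(1)[OF \<open>i < d\<close>]] lift(1)[OF mm(2) cent(1)[OF \<open>j < d\<close>]]
    by (auto simp: Y_def[abs_def])
   have pr: "(\<Prod>k\<in>{m, m'}. Y k S) = (S m i - \<mu> i) * (S m' j - \<mu> j)" for S using mm(3) by (simp add: Y_def)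
   show "integrable ?M (\<lambda>S. (S m i - \<mu> i) * (S m' j - \<mu> j))"
    using PM.indep_vars_integrable[OF _ ind ints] by (simp only: pr) simp
   have "(\<integral>S. (S m i - \<mu> i) * (S m' j - \<mu> j) \<partial>?M) = (\<Prod>k\<in>{m, m'}. (\<integral>S. Y k S \<partial>?M))"
    using PM.indep_vars_lebesgue_integral[OF _ ind ints] by (simp only: pr) simp
   also have "... = 0"
    using lift(2)[OF mm(1) cent(1)[OF \<open>i < d\<close>]] cent(2)[OF \<open>i < d\<close>] mm(3) by (simp add: Y_def[abs_def])
   finally show "(\<integral>S. (S m i - \<mu> i) * (S m' j - \<mu> j) \<partial>?M) = 0" .
  qed
  let ?b = "\<lambda>m i S. S m i - \<mu> i"
  have e: "pair_diff d S l i * pair_diff d S l j = (?b (2 * l) i S * ?b (2 * l) j S + ?b (2 * l + 1) i S * ?b (2 * l + 1) j S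
   - ?b (2 * l) i S * ?b (2 * l + 1) j S - ?b (2 * l + 1) i S * ?b (2 * l) j S) / 2" for S
   using i j by (simp add: pair_diff_def) (simp add: field_simps)
  have cv: "cov_mat d P (i, j) = (\<integral>x. (x i - \<mu> i) * (x j - \<mu> j) \<partial>P)"
   using i j by (simp add: cov_mat_def \<mu>_def)
  have ne: "2 * l \<noteq> 2 * l + 1" "2 * l + 1 \<noteq> 2 * l" by auto
  show "(\<integral>S. pair_diff d S l i * pair_diff d S l j \<partial>?M) = cov_mat d P (i, j)"
   unfolding e
   using lift(1)[OF i1 prod_int[OF i j]] lift(1)[OF i2 prod_int[OF i j]]
    cross(1)[OF i1 i2 ne(1) i j] cross(1)[OF i2 i1 ne(2) i j]
    lift(2)[OF i1 prod_int[OF i j]] lift(2)[OF i2 prod_int[OF i j]]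
    cross(2)[OF i1 i2 ne(1) i j] cross(2)[OF i2 i1 ne(2) i j]
   by (simp add: cv)
 qed
qed

section \<open>The private estimator\<close>

text \<open>
 A block of \<open>y\<close> is set to zero as a whole when its squared length exceeds \<open>\<tau>\<close>.
\<close>

definition block_trunc :: "nat => nat => real => (nat => real) => nat => real" where
 "block_trunc d k \<tau> y i = (if (\<Sum>i' | i' < d \<and> i' div k = i div k. (y i')^2) \<le> \<tau> then y i else 0)"

definition coord_trunc :: "real => (nat => real) => nat => real" where
 "coord_trunc b y i = (if \<bar>y i\<bar> \<le> b then y i else 0)"

definition emp_cov :: "((nat => real) => nat => real) => nat => nat => (nat => nat => real) => nat \<times> nat => real" where
 "emp_cov f d N S p = (\<Sum>l<N. f (pair_diff d S l) (fst p) * f (pair_diff d S l) (snd p)) / real N"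

text \<open>
 The entries whose row and column lie in the same or in neighbouring blocks of length \<open>k\<close>.  The band contains every entry at distance
 at most \<open>k\<close> from the diagonal.
\<close>

definition band :: "nat => nat => (nat \<times> nat) set" where
 "band d k = {(i, j). i < d \<and> j < d \<and> i div k \<le> j div k + 1 \<and> j div k \<le> i div k + 1}"

definition offband :: "nat => nat => nat => nat set" where
 "offband d k i = {j. j < d \<and> (i, j) \<notin> band d k}"

lemma finite_band: "finite (band d k)"
 by (rule finite_subset[of _ "{..<d} \<times> {..<d}"]) (auto simp: band_def)

lemma finite_offband: "finite (offband d k i)"
 by (simp add: offband_def)

subsection \<open>Sensitivity\<close>

text \<open>
 The second case occurs when \<open>n\<close> is odd and the last observation, which belongs to no pair, is changed.
\<close>

lemma pair_diff_adjacent: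
 assumes "adjacent n S S'" "N = n div 2"
 obtains l where "l < N" "\<And>l'. l' < N ==> l' \<noteq> l ==> pair_diff d S l' = pair_diff d S' l'"
  | "\<And>l'. l' < N ==> pair_diff d S l' = pair_diff d S' l'"
proof -
 obtain m where m: "m < n" "\<And>j. j < n ==> j \<noteq> m ==> S j = S' j" using assms(1) by (auto simp: adjacent_def)
 have eq: "pair_diff d S l' = pair_diff d S' l'" if "l' < N" "l' \<noteq> m div 2" for l'
 proof -
  have "2 * l' < n" "2 * l' + 1 < n" "2 * l' \<noteq> m" "2 * l' + 1 \<noteq> m" using that assms(2) by auto
  then show ?thesis using m(2) by (simp add: pair_diff_def)
 qed
 show thesis
 proof (cases "m div 2 < N")
  case True
  then show thesis using that(1) eq by blast
 next
  case False
  then show thesis using that(2) eq by (metis)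
 qed
qed

lemma emp_cov_diff:
 assumes adj: "adjacent n S S'" and N: "N = n div 2" "N > 0"
 obtains z z' where "\<And>p. emp_cov f d N S p - emp_cov f d N S' p = (f z (fst p) * f z (snd p) - f z' (fst p) * f z' (snd p)) / real N"
proof (rule pair_diff_adjacent[OF adj N(1), of d])
 fix l assume l: "l < N" and eq: "\<And>l'. l' < N ==> l' \<noteq> l ==> pair_diff d S l' = pair_diff d S' l'"
 let ?g = "\<lambda>S p l. f (pair_diff d S l) (fst p) * f (pair_diff d S l) (snd p)"
 have "emp_cov f d N S p - emp_cov f d N S' p = (?g S p l - ?g S' p l) / real N" for p
 proof -
  have "(\<Sum>l<N. ?g S p l) - (\<Sum>l<N. ?g S' p l) = (\<Sum>l'<N. if l' = l then ?g S p l - ?g S' p l else 0)"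
   unfolding sum_subtractf[symmetric] using eq by (intro sum.cong refl) auto
  then show ?thesis using l by (simp add: emp_cov_def diff_divide_distrib[symmetric])
 qed
 then show thesis by (rule that)
next
 assume eq: "\<And>l'. l' < N ==> pair_diff d S l' = pair_diff d S' l'"
 have "emp_cov f d N S p - emp_cov f d N S' p = (f undefined (fst p) * f undefined (snd p) - f undefined (fst p) * f undefined (snd p)) / real N" for p
  using eq by (simp add: emp_cov_def)
 then show thesis by (rule that)
qed

lemma block_trunc_block_norm:
 assumes "\<tau> \<ge> 0"
 shows "(\<Sum>i | i < d \<and> i div k = b. (block_trunc d k \<tau> y i)^2) \<le> \<tau>"
proof (cases "(\<Sum>i | i < d \<and> i div k = b. (y i)^2) \<le> \<tau>")
 case True
 then have "(\<Sum>i | i < d \<and> i div k = b. (block_trunc d k \<tau> y i)^2) = (\<Sum>i | i < d \<and> i div k = b. (y i)^2)"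
  by (intro sum.cong refl) (simp add: block_trunc_def)
 then show ?thesis using True by simp
next
 case False
 then have "(\<Sum>i | i < d \<and> i div k = b. (block_trunc d k \<tau> y i)^2) = 0"
  by (intro sum.neutral) (auto simp: block_trunc_def)
 then show ?thesis using assms by simp
qed

text \<open>
 On the band, each row block meets at most three column blocks, each of squared length at most \<open>\<tau>\<close>, and there are at most \<open>2 * d / k\<close> blocks.
 The resulting \<open>\<tau>^2 * d / k\<close> is of order \<open>k * d\<close> when \<open>\<tau>\<close> is of order \<open>k\<close>.
\<close>

lemma band_products_le:
 assumes \<tau>: "\<tau> \<ge> 0" and k: "k \<ge> 1" "k \<le> d"
 shows "(\<Sum>p\<in>band d k. (block_trunc d k \<tau> y (fst p) * block_trunc d k \<tau> y (snd p))^2) \<le> 6 * \<tau>^2 * real d / real k"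
proof -
 let ?a = "\<lambda>i. (block_trunc d k \<tau> y i)^2"
 let ?blk = "\<lambda>b. {i. i < d \<and> i div k = b}"
 have row: "(\<Sum>j | (i, j) \<in> band d k. ?a j) \<le> 3 * \<tau>" for i
 proof -
  have sub: "{j. (i, j) \<in> band d k} \<subseteq> ?blk (i div k - 1) \<union> (?blk (i div k) \<union> ?blk (i div k + 1))"
   by (auto simp: band_def)
  have "(\<Sum>j | (i, j) \<in> band d k. ?a j) \<le> (\<Sum>j\<in>?blk (i div k - 1) \<union> (?blk (i div k) \<union> ?blk (i div k + 1)). ?a j)"
   using sub by (intro sum_mono2) auto
  also have "... \<le> (\<Sum>j\<in>?blk (i div k - 1). ?a j) + ((\<Sum>j\<in>?blk (i div k). ?a j) + (\<Sum>j\<in>?blk (i div k + 1). ?a j))"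
  proof -
   have un: "sum ?a (A \<union> B) \<le> sum ?a A + sum ?a B" if "finite A" "finite B" for A B
    using sum.union_inter[OF that, of ?a] sum_nonneg[of "A \<inter> B" ?a] by simp
   show ?thesis by (rule order_trans[OF un add_left_mono[OF un]]) auto
  qed
  also have "... \<le> \<tau> + (\<tau> + \<tau>)" by (intro add_mono block_trunc_block_norm \<tau>)
  finally show ?thesis by simp
 qed
 have total: "(\<Sum>i<d. ?a i) \<le> 2 * \<tau> * real d / real k"
 proof -
  have "(\<Sum>i<d. ?a i) = (\<Sum>b\<in>(\<lambda>i. i div k) ` {..<d}. \<Sum>i | i \<in> {..<d} \<and> i div k = b. ?a i)"
   by (rule sum.image_gen) simp
  also have "... \<le> (\<Sum>b\<in>(\<lambda>i. i div k) ` {..<d}. \<tau>)"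
   using block_trunc_block_norm[OF \<tau>] by (intro sum_mono) auto
  also have "... = real (card ((\<lambda>i. i div k) ` {..<d})) * \<tau>" by simp
  also have "... \<le> (2 * real d / real k) * \<tau>"
  proof (intro mult_right_mono \<tau>)
   have "(\<lambda>i. i div k) ` {..<d} \<subseteq> {..d div k}" by (auto intro: div_le_mono)
   then have "card ((\<lambda>i. i div k) ` {..<d}) \<le> card {..d div k}" by (intro card_mono) auto
   then have "real (card ((\<lambda>i. i div k) ` {..<d})) \<le> real (d div k) + 1" by simp
   also have "... \<le> real d / real k + real d / real k"
   proof (rule add_mono)
    have "real (d div k * k) \<le> real d" by (simp only: of_nat_le_iff div_times_less_eq_dividend)
    then show "real (d div k) \<le> real d / real k" using k by (simp add: le_divide_eq)
   qed (use k in simp)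
   finally show "real (card ((\<lambda>i. i div k) ` {..<d})) \<le> 2 * real d / real k" by simp
  qed
  finally show ?thesis by (simp add: mult_ac)
 qed
 have "(\<Sum>p\<in>band d k. (block_trunc d k \<tau> y (fst p) * block_trunc d k \<tau> y (snd p))^2) = (\<Sum>i<d. \<Sum>j | (i, j) \<in> band d k. ?a i * ?a j)"
 proof -
  have "band d k = Sigma {..<d} (\<lambda>i. {j. (i, j) \<in> band d k})" by (auto simp: band_def)
  moreover have "finite {j. (i, j) \<in> band d k}" for i by (rule finite_subset[of _ "{..<d}"]) (auto simp: band_def)
  ultimately show ?thesis
   using sum.Sigma[of "{..<d}" "\<lambda>i. {j. (i, j) \<in> band d k}" "\<lambda>i j. ?a i * ?a j"]
   by (simp add: case_prod_beta power_mult_distrib)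
 qed
 also have "... \<le> (\<Sum>i<d. ?a i * (3 * \<tau>))"
  unfolding sum_distrib_left[symmetric] using row by (intro sum_mono mult_left_mono) auto
 also have "... = (\<Sum>i<d. ?a i) * (3 * \<tau>)" by (simp add: sum_distrib_right)
 also have "... \<le> (2 * \<tau> * real d / real k) * (3 * \<tau>)" using total \<tau> by (intro mult_right_mono) auto
 finally show ?thesis by (simp add: power2_eq_square mult_ac)
qed

lemma band_sensitivity:
 assumes adj: "adjacent n S S'" and N: "N = n div 2" "N > 0" and \<tau>: "\<tau> \<ge> 0" and k: "k \<ge> 1" "k \<le> d"
 shows "(\<Sum>p\<in>band d k. (emp_cov (block_trunc d k \<tau>) d N S p - emp_cov (block_trunc d k \<tau>) d N S' p)^2)
  \<le> 24 * \<tau>^2 * real d / (real k * (real N)^2)"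
proof -
 let ?f = "block_trunc d k \<tau>"
 obtain z z' where z: "\<And>p. emp_cov ?f d N S p - emp_cov ?f d N S' p = (?f z (fst p) * ?f z (snd p) - ?f z' (fst p) * ?f z' (snd p)) / real N"
  using emp_cov_diff[OF adj N, where f = ?f and d = d] by blast
 have "(\<Sum>p\<in>band d k. (emp_cov ?f d N S p - emp_cov ?f d N S' p)^2)
  \<le> (\<Sum>p\<in>band d k. (2 * (?f z (fst p) * ?f z (snd p))^2 + 2 * (?f z' (fst p) * ?f z' (snd p))^2) / (real N)^2)"
 proof (rule sum_mono)
  fix p
  have "(a - b)^2 \<le> 2 * a^2 + 2 * b^2" for a b :: real
   using zero_le_power2[of "a + b"] by (simp add: power2_eq_square algebra_simps)
  then show "(emp_cov ?f d N S p - emp_cov ?f d N S' p)^2 \<le> (2 * (?f z (fst p) * ?f z (snd p))^2 + 2 * (?f z' (fst p) * ?f z' (snd p))^2) / (real N)^2"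
   unfolding z power_divide by (intro divide_right_mono) auto
 qed
 also have "... = (2 * (\<Sum>p\<in>band d k. (?f z (fst p) * ?f z (snd p))^2) + 2 * (\<Sum>p\<in>band d k. (?f z' (fst p) * ?f z' (snd p))^2)) / (real N)^2"
  by (simp only: sum_divide_distrib[symmetric] sum.distrib sum_distrib_left)
 also have "... \<le> (2 * (6 * \<tau>^2 * real d / real k) + 2 * (6 * \<tau>^2 * real d / real k)) / (real N)^2"
  by (intro divide_right_mono add_mono mult_left_mono band_products_le \<tau> k) auto
 also have "... = 24 * \<tau>^2 * real d / (real k * (real N)^2)" by simp
 finally show ?thesis .
qed

lemma coord_sensitivity:
 assumes adj: "adjacent n S S'" and N: "N = n div 2" "N > 0" and b: "b \<ge> 0"
 shows "\<bar>emp_cov (coord_trunc b) d N S p - emp_cov (coord_trunc b) d N S' p\<bar> \<le> 2 * b^2 / real N"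
proof -
 let ?f = "coord_trunc b"
 obtain z z' where z: "\<And>p. emp_cov ?f d N S p - emp_cov ?f d N S' p = (?f z (fst p) * ?f z (snd p) - ?f z' (fst p) * ?f z' (snd p)) / real N"
  using emp_cov_diff[OF adj N, where f = ?f and d = d] by blast
 have f: "\<bar>?f y i\<bar> \<le> b" for y i using b by (simp add: coord_trunc_def)
 have prod: "\<bar>?f y i * ?f y j\<bar> \<le> b^2" for y i j
  unfolding abs_mult power2_eq_square using f b by (intro mult_mono) auto
 have "\<bar>?f z (fst p) * ?f z (snd p) - ?f z' (fst p) * ?f z' (snd p)\<bar> \<le> b^2 + b^2"
  using prod by (intro order_trans[OF abs_triangle_ineq4] add_mono)
 then have "\<bar>?f z (fst p) * ?f z (snd p) - ?f z' (fst p) * ?f z' (snd p)\<bar> / real N \<le> (2 * b^2) / real N"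
  by (intro divide_right_mono) auto
 then show ?thesis unfolding z by simp
qed

subsection \<open>The mechanism\<close>

text \<open>
 The parameters are the block length \<open>k\<close> of the band, the number \<open>s\<close> of Frank-Wolfe steps in each row, the truncation levels \<open>\<tau>\<close> of blocks and \<open>b\<close> of
 coordinates, the standard deviation \<open>v\<close> of the noise, the radius \<open>r\<close> of the \<open>l1\<close> ball and the inverse
 temperature \<open>\<eta>\<close> of the exponential mechanism.  The assumption \<open>noise\<close> gives half of the privacy budget to the band, and \<open>steps\<close> the other half to the
 \<open>d * s\<close> draws off the band.
\<close>

locale mechanism =
 fixes n d k s :: nat and \<tau> b v r \<eta> \<rho> :: real
 assumes k: "k \<ge> 1" "k \<le> d" and n: "n \<ge> 2"
  and \<tau>: "\<tau> \<ge> 0" and b: "b > 0" and v: "v > 0" and \<eta>: "\<eta> > 0" and \<rho>: "\<rho> > 0"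
  and noise: "24 * \<tau>^2 * real d / (real k * (real (n div 2))^2) \<le> \<rho> * v^2"
  and steps: "real d * real s * (4 * \<eta> * b^2 / real (n div 2))^2 \<le> \<rho>"
begin

abbreviation "N \<equiv> n div 2"

lemma N: "N > 0" using n by (simp add: div_greater_zero_iff)

text \<open>
 The average of the block-truncated products, to which the noise is added.
\<close>

definition mb :: "(nat => nat => real) => nat \<times> nat => real" where
 "mb S = emp_cov (block_trunc d k \<tau>) d N S"

text \<open>
 The averages of the coordinate-truncated products in row \<open>i\<close>, which serve as the target of the Frank-Wolfe iteration.
\<close>

definition mc :: "nat => (nat => nat => real) => nat => real" where
 "mc i S j = emp_cov (coord_trunc b) d N S (i, j)"

definition A :: "nat => (real \<times> nat) set" where "A i = atoms (offband d k i)"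

text \<open>
 A row that lies in the band entirely has no vertices to draw, and its only trace is the empty one.
\<close>

definition st :: "nat => nat" where "st i = (if offband d k i = {} then 0 else s)"

definition T :: "nat => (real \<times> nat) list set" where "T i = traces (A i) (st i)"

definition row_density :: "nat => (nat => nat => real) => (real \<times> nat) list => real" where
 "row_density i S h = trace_density (A i) (fw_score \<eta> r (mc i S)) h"

abbreviation "BG \<equiv> PiM (band d k) (\<lambda>_. lborel :: real measure)"
abbreviation "BT \<equiv> PiM {..<d} (\<lambda>i. count_space (T i))"

text \<open>
 The density of the noisy band given the data.
\<close>

definition D1 :: "(nat => nat => real) => (nat \<times> nat => real) => real" where
 "D1 S g = (\<Prod>p\<in>band d k. normal_density (mb S p) v (g p))"

text \<open>
 The density of the traces of all the rows given the data.
\<close>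

definition D2 :: "(nat => nat => real) => (nat => (real \<times> nat) list) => real" where
 "D2 S H = (\<Prod>i<d. row_density i S (H i))"

text \<open>
 The published matrix, as a function of the noisy band and of the traces.
\<close>

definition assemble :: "(nat \<times> nat => real) \<times> (nat => (real \<times> nat) list) => nat \<times> nat => real" where
 "assemble z = (\<lambda>p\<in>{..<d} \<times> {..<d}. if p \<in> band d k then fst z p else iterate r (snd z (fst p)) (snd p))"

definition mech :: "(nat => nat => real) => (nat \<times> nat => real) measure" where
 "mech S = distr (density (BG \<Otimes>\<^sub>M BT) (\<lambda>z. ennreal (D1 S (fst z) * D2 S (snd z)))) (mat_space d) assemble"

lemma finite_A: "finite (A i)" unfolding A_def by (intro finite_atoms finite_offband)

lemma A_st: "A i \<noteq> {} \<or> st i = 0" by (auto simp: A_def st_def atoms_def)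

lemma finite_T: "finite (T i)" unfolding T_def by (intro finite_traces finite_A)

lemma row_density_nonneg: "0 \<le> row_density i S h"
 by (simp add: row_density_def trace_density_nonneg)

lemma row_density_pos: "h \<in> T i ==> 0 < row_density i S h"
 unfolding row_density_def using A_st[of i]
 by (intro trace_density_pos finite_A) (auto simp: T_def traces_def)

lemma row_density_sum: "(\<Sum>h\<in>T i. row_density i S h) = 1"
 unfolding row_density_def T_def by (rule trace_density_sum[OF finite_A A_st])

lemma nn_integral_row: "(\<integral>\<^sup>+h. ennreal (row_density i S h) \<partial>count_space (T i)) = 1"
 using row_density_sum row_density_nonneg
 by (simp add: nn_integral_count_space_finite finite_T sum_ennreal)

lemma nn_integral_normal: "(\<integral>\<^sup>+x. ennreal (normal_density m v x) \<partial>lborel) = 1"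
 using prob_space.emeasure_space_1[OF prob_space_normal_density[OF v, of m]]
 by (simp add: emeasure_density)

sublocale G: product_sigma_finite "\<lambda>_::nat \<times> nat. lborel :: real measure"
 by (intro product_sigma_finite.intro lborel.sigma_finite_measure_axioms)

sublocale H: product_sigma_finite "\<lambda>i. count_space (T i)"
 by (intro product_sigma_finite.intro sigma_finite_measure_count_space_finite finite_T)

sublocale BG: sigma_finite_measure BG by (rule G.sigma_finite[OF finite_band])

sublocale BT: sigma_finite_measure BT by (rule H.sigma_finite) simp

sublocale BB: pair_sigma_finite BG BT ..

lemma D1_nonneg: "0 \<le> D1 S g" unfolding D1_def by (intro prod_nonneg) simp

lemma D2_nonneg: "0 \<le> D2 S H" unfolding D2_def by (intro prod_nonneg) (simp add: row_density_nonneg)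

lemma nm [measurable]: "normal_density m v \<in> borel_measurable lborel" by simp

lemma D1_meas [measurable]: "D1 S \<in> borel_measurable BG"
 unfolding D1_def[abs_def]
proof (intro borel_measurable_prod)
 fix p assume "p \<in> band d k"
 show "(\<lambda>g. normal_density (mb S p) v (g p)) \<in> borel_measurable BG"
  using measurable_compose[OF measurable_component_singleton[OF \<open>p \<in> band d k\<close>, of "\<lambda>_. lborel"] nm] .
qed

lemma comp_T: "i < d ==> (\<lambda>H. H i) \<in> BT \<rightarrow>\<^sub>M count_space (T i)"
 by (rule measurable_component_singleton) simp

lemma D2_meas [measurable]: "D2 S \<in> borel_measurable BT"
 unfolding D2_def[abs_def] by (intro borel_measurable_prod measurable_compose[OF comp_T]) auto

lemma nn_integral_D1: "(\<integral>\<^sup>+g. ennreal (D1 S g) \<partial>BG) = 1"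
proof -
 have "(\<integral>\<^sup>+g. ennreal (D1 S g) \<partial>BG) = (\<integral>\<^sup>+g. (\<Prod>p\<in>band d k. ennreal (normal_density (mb S p) v (g p))) \<partial>BG)"
  by (simp add: D1_def prod_ennreal)
 also have "... = (\<Prod>p\<in>band d k. (\<integral>\<^sup>+x. ennreal (normal_density (mb S p) v x) \<partial>lborel))"
  by (rule G.product_nn_integral_prod[OF finite_band]) measurable
 finally show ?thesis by (simp add: nn_integral_normal)
qed

lemma nn_integral_D2: "(\<integral>\<^sup>+H. ennreal (D2 S H) \<partial>BT) = 1"
proof -
 have "(\<integral>\<^sup>+H. ennreal (D2 S H) \<partial>BT) = (\<integral>\<^sup>+H. (\<Prod>i<d. ennreal (row_density i S (H i))) \<partial>BT)"
  by (simp add: D2_def prod_ennreal row_density_nonneg)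
 also have "... = (\<Prod>i<d. (\<integral>\<^sup>+h. ennreal (row_density i S h) \<partial>count_space (T i)))"
  by (rule H.product_nn_integral_prod) auto
 finally show ?thesis by (simp add: nn_integral_row)
qed

lemma assemble_meas [measurable]: "assemble \<in> (BG \<Otimes>\<^sub>M BT) \<rightarrow>\<^sub>M mat_space d"
 unfolding assemble_def[abs_def] mat_space_def
proof (rule measurable_restrict)
 fix p assume p: "p \<in> {..<d} \<times> {..<d}"
 show "(\<lambda>z. if p \<in> band d k then fst z p else iterate r (snd z (fst p)) (snd p)) \<in> borel_measurable (BG \<Otimes>\<^sub>M BT)"
 proof (cases "p \<in> band d k")
  case True
  have "(\<lambda>g. g p) \<in> BG \<rightarrow>\<^sub>M (lborel :: real measure)" by (rule measurable_component_singleton[OF True])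
  then have "(\<lambda>g. g p) \<in> borel_measurable BG" by simp
  from measurable_compose[OF measurable_fst this] show ?thesis using True by simp
 next
  case False
  have i: "fst p < d" using p by auto
  have "(\<lambda>h. iterate r h (snd p)) \<in> borel_measurable (count_space (T (fst p)))" by simp
  from measurable_compose[OF measurable_snd measurable_compose[OF comp_T[OF i] this]] show ?thesis using False by simp
 qed
qed

lemma nn_integral_mech:
 assumes [measurable]: "F \<in> borel_measurable (mat_space d)"
 shows "(\<integral>\<^sup>+t. F t \<partial>mech S) = (\<integral>\<^sup>+z. ennreal (D1 S (fst z)) * ennreal (D2 S (snd z)) * F (assemble z) \<partial>(BG \<Otimes>\<^sub>M BT))"
proof -
 have "(\<integral>\<^sup>+t. F t \<partial>mech S) = (\<integral>\<^sup>+z. F (assemble z) \<partial>density (BG \<Otimes>\<^sub>M BT) (\<lambda>z. ennreal (D1 S (fst z) * D2 S (snd z))))"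
  unfolding mech_def by (rule nn_integral_distr) measurable
 also have "... = (\<integral>\<^sup>+z. ennreal (D1 S (fst z) * D2 S (snd z)) * F (assemble z) \<partial>(BG \<Otimes>\<^sub>M BT))"
  by (rule nn_integral_density) measurable
 finally show ?thesis using D1_nonneg D2_nonneg by (simp add: ennreal_mult)
qed

text \<open>
 The band and the traces are independent given the data.
\<close>

lemma nn_integral_pair_density:
 assumes [measurable]: "F1 \<in> borel_measurable BG" "F2 \<in> borel_measurable BT"
 shows "(\<integral>\<^sup>+z. F1 (fst z) * F2 (snd z) \<partial>(BG \<Otimes>\<^sub>M BT)) = (\<integral>\<^sup>+g. F1 g \<partial>BG) * (\<integral>\<^sup>+H. F2 H \<partial>BT)"
 by (subst BT.nn_integral_fst[symmetric]) (auto simp: nn_integral_cmult nn_integral_multc)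

lemma prob_mech: "prob_space (mech S)"
proof (rule prob_spaceI)
 have "emeasure (mech S) (space (mech S)) = (\<integral>\<^sup>+t. 1 \<partial>mech S)" by simp
 also have "... = (\<integral>\<^sup>+z. ennreal (D1 S (fst z)) * ennreal (D2 S (snd z)) \<partial>(BG \<Otimes>\<^sub>M BT))"
  by (subst nn_integral_mech) auto
 also have "... = 1"
  by (subst nn_integral_pair_density) (auto simp: nn_integral_D1 nn_integral_D2)
 finally show "emeasure (mech S) (space (mech S)) = 1" .
qed

lemma sets_mech: "sets (mech S) = sets (mat_space d)" by (simp add: mech_def)

subsubsection \<open>Measurability\<close>

lemma data_coord: "m < n ==> i < d ==> (\<lambda>S. S m i) \<in> borel_measurable (data_space n d)"
 using measurable_compose[OF measurable_component_singleton[of m "{..<n}" "\<lambda>_. vec_space d"] coord_meas[of i d]]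
 by (simp add: data_space_def)

lemma pair_diff_meas: "l < N ==> i < d ==> (\<lambda>S. pair_diff d S l i) \<in> borel_measurable (data_space n d)"
 unfolding pair_diff_def using data_coord[of "2 * l" i] data_coord[of "2 * l + 1" i] by simp

lemma mb_meas: "p \<in> {..<d} \<times> {..<d} ==> (\<lambda>S. mb S p) \<in> borel_measurable (data_space n d)"
proof -
 assume p: "p \<in> {..<d} \<times> {..<d}"
 have "(\<lambda>S. block_trunc d k \<tau> (pair_diff d S l) i) \<in> borel_measurable (data_space n d)" if l: "l < N" "i < d" for l i
 proof -
  have [measurable]: "(\<lambda>S. pair_diff d S l j) \<in> borel_measurable (data_space n d)" if "j < d" for j using pair_diff_meas[OF l(1) that] .
  have [measurable]: "(\<lambda>S. pair_diff d S l i) \<in> borel_measurable (data_space n d)" using l by (intro pair_diff_meas)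
  have [measurable]: "(\<lambda>S. \<Sum>i' | i' < d \<and> i' div k = i div k. (pair_diff d S l i')^2) \<in> borel_measurable (data_space n d)"
   by (intro borel_measurable_sum borel_measurable_power) auto
  show ?thesis unfolding block_trunc_def by measurable
 qed
 then show ?thesis unfolding mb_def emp_cov_def using p
  by (intro borel_measurable_divide borel_measurable_sum borel_measurable_times) auto
qed

lemma mc_meas: "i < d ==> j < d ==> (\<lambda>S. mc i S j) \<in> borel_measurable (data_space n d)"
proof -
 assume ij: "i < d" "j < d"
 have "(\<lambda>S. coord_trunc b (pair_diff d S l) i) \<in> borel_measurable (data_space n d)" if l: "l < N" "i < d" for l i
 proof -
  have [measurable]: "(\<lambda>S. pair_diff d S l i) \<in> borel_measurable (data_space n d)" using l by (intro pair_diff_meas)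
  show ?thesis unfolding coord_trunc_def by measurable
 qed
 then show ?thesis unfolding mc_def emp_cov_def using ij
  by (intro borel_measurable_divide borel_measurable_sum borel_measurable_times) auto
qed

lemma row_density_meas:
 assumes i: "i < d" and h: "h \<in> T i"
 shows "(\<lambda>S. row_density i S h) \<in> borel_measurable (data_space n d)"
proof -
 have sc: "(\<lambda>S. fw_score \<eta> r (mc i S) h' a) \<in> borel_measurable (data_space n d)" if "a \<in> A i" for h' a
  unfolding fw_score_def using that i
  by (intro borel_measurable_times borel_measurable_diff mc_meas borel_measurable_const) (auto simp: A_def atoms_def offband_def)
 have ex: "(\<lambda>S. exp (fw_score \<eta> r (mc i S) h' a)) \<in> borel_measurable (data_space n d)" if "a \<in> A i" for h' a
  using measurable_compose[OF sc[OF that] borel_measurable_exp] .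
 have "h ! t \<in> A i" if "t < length h" for t using h that by (auto simp: T_def traces_def)
 then show ?thesis unfolding row_density_def trace_density_def softmax_def
  by (intro borel_measurable_prod borel_measurable_divide borel_measurable_sum ex) auto
qed

lemma joint_D1_meas: "(\<lambda>x. D1 (fst x) (fst (snd x))) \<in> borel_measurable (data_space n d \<Otimes>\<^sub>M (BG \<Otimes>\<^sub>M BT))"
 unfolding D1_def
proof (intro borel_measurable_prod)
 fix p assume p: "p \<in> band d k"
 then have p': "p \<in> {..<d} \<times> {..<d}" by (auto simp: band_def)
 have 1: "(\<lambda>x. mb (fst x) p) \<in> borel_measurable (data_space n d \<Otimes>\<^sub>M (BG \<Otimes>\<^sub>M BT))"
  using measurable_compose[OF measurable_fst mb_meas[OF p']] .
 have "(\<lambda>g. g p) \<in> BG \<rightarrow>\<^sub>M (lborel :: real measure)" by (rule measurable_component_singleton[OF p])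
 then have "(\<lambda>g. g p) \<in> borel_measurable BG" by simp
 from measurable_compose[OF measurable_snd measurable_compose[OF measurable_fst this]]
 have 2: "(\<lambda>x. fst (snd x) p) \<in> borel_measurable (data_space n d \<Otimes>\<^sub>M (BG \<Otimes>\<^sub>M BT))" .
 show "(\<lambda>x. normal_density (mb (fst x) p) v (fst (snd x) p)) \<in> borel_measurable (data_space n d \<Otimes>\<^sub>M (BG \<Otimes>\<^sub>M BT))"
  unfolding normal_density_def using 1 2 by measurable
qed

lemma joint_D2_meas: "(\<lambda>x. D2 (fst x) (snd (snd x))) \<in> borel_measurable (data_space n d \<Otimes>\<^sub>M (BG \<Otimes>\<^sub>M BT))"
 unfolding D2_def
proof (intro borel_measurable_prod)
 fix i assume "i \<in> {..<d}"
 then have i: "i < d" by simp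
 let ?X = "data_space n d \<Otimes>\<^sub>M (BG \<Otimes>\<^sub>M BT)"
 have c: "(\<lambda>x. snd (snd x) i) \<in> ?X \<rightarrow>\<^sub>M count_space (T i)"
  using measurable_compose[OF measurable_snd measurable_compose[OF measurable_snd comp_T[OF i]]] .
 have ind: "(\<lambda>x. indicator {h} (snd (snd x) i) :: real) \<in> borel_measurable ?X" for h
  using measurable_compose[OF c, of "indicator {h} :: _ => real"] by simp
 have "(\<lambda>x. \<Sum>h\<in>T i. row_density i (fst x) h * indicator {h} (snd (snd x) i)) \<in> borel_measurable ?X"
  by (intro borel_measurable_sum borel_measurable_times ind measurable_compose[OF measurable_fst row_density_meas[OF i]])
 moreover have "(\<Sum>h\<in>T i. row_density i (fst x) h * indicator {h} (snd (snd x) i)) = row_density i (fst x) (snd (snd x) i)"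
  if x: "x \<in> space ?X" for x
 proof -
  have "snd (snd x) i \<in> T i" using measurable_space[OF c x] by simp
  then have "(\<Sum>h\<in>T i. row_density i (fst x) h * indicator {h} (snd (snd x) i)) = (\<Sum>h\<in>{snd (snd x) i}. row_density i (fst x) h * indicator {h} (snd (snd x) i))"
   by (intro sum.mono_neutral_right finite_T) (auto simp: indicator_def)
  then show ?thesis by simp
 qed
 ultimately show "(\<lambda>x. row_density i (fst x) (snd (snd x) i)) \<in> borel_measurable ?X"
  by (subst measurable_cong[where g = "\<lambda>x. \<Sum>h\<in>T i. row_density i (fst x) h * indicator {h} (snd (snd x) i)"]) auto
qed

text \<open>
 The density is jointly measurable in the data and the noise, which makes the law of the estimator a measurable function of the data.
\<close>

lemma mech_kernel: "mech \<in> data_space n d \<rightarrow>\<^sub>M prob_algebra (mat_space d)"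
proof (rule measurable_prob_algebraI[OF prob_mech measurable_subprob_algebra])
 show "subprob_space (mech S)" for S using prob_mech by (rule prob_space_imp_subprob_space)
 show "sets (mech S) = sets (mat_space d)" for S by (rule sets_mech)
 fix X assume X[measurable]: "X \<in> sets (mat_space d)"
 have "emeasure (mech S) X = (\<integral>\<^sup>+z. ennreal (D1 S (fst z)) * ennreal (D2 S (snd z)) * indicator X (assemble z) \<partial>(BG \<Otimes>\<^sub>M BT))" for S
  using X by (subst nn_integral_mech[symmetric]) (auto simp: sets_mech)
 moreover have "(\<lambda>S. \<integral>\<^sup>+z. ennreal (D1 S (fst z)) * ennreal (D2 S (snd z)) * indicator X (assemble z) \<partial>(BG \<Otimes>\<^sub>M BT)) \<in> borel_measurable (data_space n d)"
 proof (rule BB.borel_measurable_nn_integral)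
  note joint_D1_meas[measurable] joint_D2_meas[measurable]
  have "(\<lambda>x. ennreal (D1 (fst x) (fst (snd x))) * ennreal (D2 (fst x) (snd (snd x))) * indicator X (assemble (snd x)))
   \<in> borel_measurable (data_space n d \<Otimes>\<^sub>M (BG \<Otimes>\<^sub>M BT))" by measurable
  then show "case_prod (\<lambda>S z. ennreal (D1 S (fst z)) * ennreal (D2 S (snd z)) * indicator X (assemble z)) \<in> borel_measurable (data_space n d \<Otimes>\<^sub>M (BG \<Otimes>\<^sub>M BT))"
   by (simp add: case_prod_beta')
 qed
 ultimately show "(\<lambda>S. emeasure (mech S) X) \<in> borel_measurable (data_space n d)" by simp
qed

subsubsection \<open>Privacy\<close>

text \<open>
 The moments of independent Gaussian variables multiply to \<open>exp\<close> of the squared distance of the means, which is the sensitivity of the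
 band.
\<close>

lemma moment_D1:
 assumes adj: "adjacent n S S'" and lam: "lam > 1"
 shows "renyi_moment BG lam (D1 S) (D1 S') \<le> ennreal (exp (lam * (lam - 1) * \<rho> / 2))"
proof -
 have "renyi_moment BG lam (D1 S) (D1 S') = (\<Prod>p\<in>band d k. renyi_moment lborel lam (normal_density (mb S p) v) (normal_density (mb S' p) v))"
  unfolding D1_def[abs_def]
  by (rule renyi_moment_PiM[OF lborel.sigma_finite_measure_axioms finite_band]) auto
 also have "... = ennreal (\<Prod>p\<in>band d k. exp (lam * (lam - 1) * (mb S p - mb S' p)^2 / (2 * v^2)))"
  by (simp add: renyi_moment_normal[OF v] prod_ennreal)
 also have "(\<Prod>p\<in>band d k. exp (lam * (lam - 1) * (mb S p - mb S' p)^2 / (2 * v^2))) = exp (lam * (lam - 1) * (\<Sum>p\<in>band d k. (mb S p - mb S' p)^2) / (2 * v^2))"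
  by (simp add: exp_sum[OF finite_band, symmetric] sum_distrib_left sum_divide_distrib)
 also have "... \<le> exp (lam * (lam - 1) * (\<rho> * v^2) / (2 * v^2))"
 proof -
  have "(\<Sum>p\<in>band d k. (mb S p - mb S' p)^2) \<le> \<rho> * v^2"
   unfolding mb_def by (rule order_trans[OF band_sensitivity[OF adj refl N \<tau> k] noise])
  then show ?thesis unfolding exp_le_cancel_iff
   using lam by (intro divide_right_mono mult_left_mono) auto
 qed
 also have "lam * (lam - 1) * (\<rho> * v^2) / (2 * v^2) = lam * (lam - 1) * \<rho> / 2" using v by simp
 finally show ?thesis by (simp add: ennreal_leI)
qed

text \<open>
 Changing one observation changes every utility by at most \<open>\<epsilon> / 2\<close> with \<open>\<epsilon> = 4 * \<eta> * b^2 / N\<close>, so that each draw costs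
 \<open>lam * (lam - 1) * \<epsilon>^2 / 2\<close>.
\<close>

lemma moment_D2:
 assumes adj: "adjacent n S S'" and lam: "lam > 1"
 shows "renyi_moment BT lam (D2 S) (D2 S') \<le> ennreal (exp (lam * (lam - 1) * \<rho> / 2))"
proof -
 define \<epsilon> where "\<epsilon> = 4 * \<eta> * b^2 / real N"
 have \<epsilon>: "\<epsilon> > 0" using \<eta> b N by (simp add: \<epsilon>_def)
 have row: "renyi_moment (count_space (T i)) lam (row_density i S) (row_density i S') \<le> ennreal (exp (real s * (lam * (lam - 1) * \<epsilon>^2 / 2)))" for i
 proof -
  have close: "\<bar>fw_score \<eta> r (mc i S) h a - fw_score \<eta> r (mc i S') h a\<bar> \<le> \<epsilon> / 2" if a: "a \<in> A i" for h a
  proof -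
   have fa: "\<bar>fst a\<bar> = 1" using a by (auto simp: A_def atoms_def)
   have "fw_score \<eta> r (mc i S) h a - fw_score \<eta> r (mc i S') h a = \<eta> * (fst a * (mc i S (snd a) - mc i S' (snd a)))"
    by (simp add: fw_score_def algebra_simps)
   then have "\<bar>fw_score \<eta> r (mc i S) h a - fw_score \<eta> r (mc i S') h a\<bar> = \<eta> * \<bar>mc i S (snd a) - mc i S' (snd a)\<bar>"
    using \<eta> fa by (simp add: abs_mult)
   also have "... \<le> \<eta> * (2 * b^2 / real N)"
    unfolding mc_def using \<eta> b by (intro mult_left_mono coord_sensitivity[OF adj refl N]) auto
   finally show ?thesis by (simp add: \<epsilon>_def mult_ac)
  qed
  have "renyi_moment (count_space (T i)) lam (row_density i S) (row_density i S') = ennreal (\<Sum>h\<in>T i. row_density i S h powr lam * row_density i S' h powr (1 - lam))"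
   unfolding renyi_moment_def by (simp add: nn_integral_count_space_finite finite_T sum_ennreal)
  also have "... \<le> ennreal (exp (real (st i) * (lam * (lam - 1) * \<epsilon>^2 / 2)))"
   unfolding row_density_def T_def
   by (intro ennreal_leI trace_renyi finite_A A_st lam \<epsilon> close)
  also have "... \<le> ennreal (exp (real s * (lam * (lam - 1) * \<epsilon>^2 / 2)))"
   using lam by (intro ennreal_leI) (auto simp: st_def)
  finally show ?thesis .
 qed
 have "renyi_moment BT lam (D2 S) (D2 S') = (\<Prod>i<d. renyi_moment (count_space (T i)) lam (row_density i S) (row_density i S'))"
  unfolding D2_def[abs_def]
  by (rule renyi_moment_PiM[OF sigma_finite_measure_count_space_finite[OF finite_T]]) (auto simp: row_density_nonneg)
 also have "... \<le> (\<Prod>i<d. ennreal (exp (real s * (lam * (lam - 1) * \<epsilon>^2 / 2))))"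
  by (intro prod_mono_ennreal row)
 also have "... = ennreal (exp (real d * (real s * (lam * (lam - 1) * \<epsilon>^2 / 2))))"
  by (simp add: ennreal_power exp_of_nat_mult[symmetric])
 also have "... \<le> ennreal (exp (lam * (lam - 1) * \<rho> / 2))"
 proof -
  have "real d * (real s * (lam * (lam - 1) * \<epsilon>^2 / 2)) = lam * (lam - 1) / 2 * (real d * real s * \<epsilon>^2)" by simp
  also have "... \<le> lam * (lam - 1) / 2 * \<rho>"
   using steps lam unfolding \<epsilon>_def by (intro mult_left_mono) auto
  finally show ?thesis by (intro ennreal_leI) simp
 qed
 finally show ?thesis .
qed

lemma mech_private: "zCDP \<rho> n d mech"
 unfolding zCDP_def
proof (intro ballI impI allI)
 fix S S' and lam :: real
 assume adj: "adjacent n S S'" and lam: "lam > 1"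
 show "renyi_divergence lam (mech S) (mech S') \<le> ereal (\<rho> * lam)"
 proof (rule renyi_divergence_le_of_moment[OF _ _ assemble_meas _ _ lam _ mech_def mech_def prob_mech prob_mech])
  show "(\<lambda>z. D1 S (fst z) * D2 S (snd z)) \<in> borel_measurable (BG \<Otimes>\<^sub>M BT)"
   "(\<lambda>z. D1 S' (fst z) * D2 S' (snd z)) \<in> borel_measurable (BG \<Otimes>\<^sub>M BT)" by measurable
  have pos: "0 < D1 S (fst z) * D2 S (snd z)" if "z \<in> space (BG \<Otimes>\<^sub>M BT)" for z S
   using that v unfolding D1_def D2_def
   by (intro mult_pos_pos prod_pos) (auto simp: normal_density_pos space_pair_measure space_PiM row_density_pos dest!: PiE_mem)
  then show "0 < D1 S (fst z) * D2 S (snd z)" "0 < D1 S' (fst z) * D2 S' (snd z)" if "z \<in> space (BG \<Otimes>\<^sub>M BT)" for z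
   using that by blast+
  show "0 \<le> \<rho> * lam" using \<rho> lam by simp
  have "renyi_moment (BG \<Otimes>\<^sub>M BT) lam (\<lambda>z. D1 S (fst z) * D2 S (snd z)) (\<lambda>z. D1 S' (fst z) * D2 S' (snd z))
   = renyi_moment BG lam (D1 S) (D1 S') * renyi_moment BT lam (D2 S) (D2 S')"
   by (rule renyi_moment_pair[OF BG.sigma_finite_measure_axioms BT.sigma_finite_measure_axioms]) (auto simp: D1_nonneg D2_nonneg)
  also have "... \<le> ennreal (exp (lam * (lam - 1) * \<rho> / 2)) * ennreal (exp (lam * (lam - 1) * \<rho> / 2))"
   by (intro mult_mono moment_D1 moment_D2 adj lam) auto
  also have "... = ennreal (exp ((lam - 1) * (\<rho> * lam)))"
   by (simp add: ennreal_mult[symmetric] exp_add[symmetric] mult_ac)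
  finally show "renyi_moment (BG \<Otimes>\<^sub>M BT) lam (\<lambda>z. D1 S (fst z) * D2 S (snd z)) (\<lambda>z. D1 S' (fst z) * D2 S' (snd z)) \<le> ennreal (exp ((lam - 1) * (\<rho> * lam)))" .
 qed
qed

lemma mech_estimator: "mech \<in> zCDP_estimators n d \<rho>"
 using mech_kernel mech_private by (simp add: zCDP_estimators_def)

end

section \<open>The risk of the private estimator\<close>

lemma normal_second_moment:
 assumes v: "v > 0"
 shows "(\<integral>\<^sup>+x. ennreal (normal_density m v x) * ennreal ((x - c)^2) \<partial>lborel) = ennreal ((m - c)^2) + ennreal (v^2)"
proof -
 have e: "normal_density m v x * (x - c)^2 = normal_density m v x * (x - m) ^ (2 * 1) + 2 * (m - c) * (normal_density m v x * (x - m) ^ (2 * 0 + 1)) + (m - c)^2 * normal_density m v x" for x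
  by (simp add: power2_eq_square algebra_simps)
 have hb: "has_bochner_integral lborel (\<lambda>x. normal_density m v x * (x - c)^2) (v^2 + 2 * (m - c) * 0 + (m - c)^2 * 1)"
  unfolding e
 proof (intro has_bochner_integral_add has_bochner_integral_mult_right)
  show "has_bochner_integral lborel (\<lambda>x. normal_density m v x * (x - m) ^ (2 * 1)) (v^2)"
   using normal_moment_even[OF v, of m 1] by (simp add: power2_eq_square fact_numeral)
  show "has_bochner_integral lborel (\<lambda>x. normal_density m v x * (x - m) ^ (2 * 0 + 1)) 0"
   by (rule normal_moment_odd[OF v])
  show "has_bochner_integral lborel (normal_density m v) 1"
   using integrable_normal_density[OF v, of m] integral_normal_density[OF v, of m] by (simp add: has_bochner_integral_iff)
 qed
 have "(\<integral>\<^sup>+x. ennreal (normal_density m v x) * ennreal ((x - c)^2) \<partial>lborel) = (\<integral>\<^sup>+x. ennreal (normal_density m v x * (x - c)^2) \<partial>lborel)"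
  by (simp add: ennreal_mult)
 also have "... = ennreal (v^2 + (m - c)^2)"
  using hb by (subst nn_integral_eq_integral) (auto simp: has_bochner_integral_iff)
 finally show ?thesis by (simp add: ennreal_plus add.commute)
qed

lemma card_block_le: "k \<ge> 1 ==> card {i. i < d \<and> i div k = c} \<le> (k::nat)"
proof -
 assume k: "k \<ge> 1"
 have "{i. i < d \<and> i div k = c} \<subseteq> {c * k..<c * k + k}"
 proof clarify
  fix i assume "i < d" "c = i div k"
  have "i = i div k * k + i mod k" by simp
  moreover have "i mod k < k" using k by simp
  ultimately show "i \<in> {i div k * k..<i div k * k + k}" by (metis atLeastLessThan_iff le_add1 nat_add_left_cancel_less)
 qed
 then have "card {i. i < d \<and> i div k = c} \<le> card {c * k..<c * k + k}" by (intro card_mono) auto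
 then show ?thesis by simp
qed

lemma card_band_le:
 assumes k: "k \<ge> 1"
 shows "real (card (band d k)) \<le> 3 * real k * real d"
proof -
 let ?blk = "\<lambda>c. {i. i < d \<and> i div k = c}"
 have row: "card {j. (i, j) \<in> band d k} \<le> 3 * k" for i
 proof -
  have "{j. (i, j) \<in> band d k} \<subseteq> ?blk (i div k - 1) \<union> (?blk (i div k) \<union> ?blk (i div k + 1))"
   by (auto simp: band_def)
  then have "card {j. (i, j) \<in> band d k} \<le> card (?blk (i div k - 1) \<union> (?blk (i div k) \<union> ?blk (i div k + 1)))"
   by (intro card_mono) auto
  also have "... \<le> card (?blk (i div k - 1)) + (card (?blk (i div k)) + card (?blk (i div k + 1)))"
   by (intro order_trans[OF card_Un_le] add_left_mono card_Un_le)
  also have "... \<le> k + (k + k)" by (intro add_mono card_block_le k)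
  finally show ?thesis by simp
 qed
 have "card (band d k) = (\<Sum>i<d. card {j. (i, j) \<in> band d k})"
 proof -
  have "band d k = Sigma {..<d} (\<lambda>i. {j. (i, j) \<in> band d k})" by (auto simp: band_def)
  moreover have "finite {j. (i, j) \<in> band d k}" for i by (rule finite_subset[of _ "{..<d}"]) (auto simp: band_def)
  ultimately show ?thesis using card_SigmaI[of "{..<d}" "\<lambda>i. {j. (i, j) \<in> band d k}"] by simp
 qed
 also have "... \<le> (\<Sum>i<d. 3 * k)" by (intro sum_mono row)
 finally have "card (band d k) \<le> 3 * k * d" by (simp add: mult_ac)
 then have "real (card (band d k)) \<le> real (3 * k * d)" by (simp only: of_nat_le_iff)
 then show ?thesis by simp
qed

lemma offband_far:
 assumes "j \<in> offband d k i" "i < d" and k: "k \<ge> 1"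
 shows "\<bar>real i - real j\<bar> > real k"
proof (rule ccontr)
 assume "\<not> ?thesis"
 then have "i \<le> j + k" "j \<le> i + k" by auto
 then have "i div k \<le> (j + k) div k" "j div k \<le> (i + k) div k" by (auto intro: div_le_mono)
 then have "i div k \<le> j div k + 1" "j div k \<le> i div k + 1" using k by auto
 then show False using assms by (auto simp: offband_def band_def)
qed

lemma nn_integral_add_sums:
 assumes f: "\<And>a. a \<in> A ==> f a \<in> borel_measurable M" and g: "\<And>b. b \<in> B ==> g b \<in> borel_measurable M"
 shows "(\<integral>\<^sup>+x. (\<Sum>a\<in>A. f a x) + (\<Sum>b\<in>B. g b x) \<partial>M) = (\<Sum>a\<in>A. \<integral>\<^sup>+x. f a x \<partial>M) + (\<Sum>b\<in>B. \<integral>\<^sup>+x. g b x \<partial>M)"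
 using nn_integral_add[of "\<lambda>x. \<Sum>a\<in>A. f a x" M "\<lambda>x. \<Sum>b\<in>B. g b x"] f g by (simp add: nn_integral_sum)

context mechanism
begin

definition row_loss :: "(nat \<times> nat => real) => nat => (real \<times> nat) list => real" where
 "row_loss C i h = (\<Sum>j\<in>offband d k i. (iterate r h j - C (i, j))^2)"

definition row_risk :: "(nat \<times> nat => real) => nat => (nat => nat => real) => real" where
 "row_risk C i S = (\<Sum>h\<in>T i. row_density i S h * row_loss C i h)"

lemma loss_split:
 "(\<Sum>p\<in>{..<d} \<times> {..<d}. (assemble z p - C p)^2) = (\<Sum>p\<in>band d k. (fst z p - C p)^2) + (\<Sum>i<d. row_loss C i (snd z i))"
proof -
 have sub: "band d k \<subseteq> {..<d} \<times> {..<d}" by (auto simp: band_def)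
 have "(\<Sum>p\<in>{..<d} \<times> {..<d}. (assemble z p - C p)^2)
  = (\<Sum>p\<in>{..<d} \<times> {..<d} - band d k. (assemble z p - C p)^2) + (\<Sum>p\<in>band d k. (assemble z p - C p)^2)"
  by (rule sum.subset_diff[OF sub]) simp
 also have "(\<Sum>p\<in>band d k. (assemble z p - C p)^2) = (\<Sum>p\<in>band d k. (fst z p - C p)^2)"
  using sub by (intro sum.cong refl) (auto simp: assemble_def)
 also have "{..<d} \<times> {..<d} - band d k = Sigma {..<d} (offband d k)" by (auto simp: offband_def)
 also have "(\<Sum>p\<in>Sigma {..<d} (offband d k). (assemble z p - C p)^2) = (\<Sum>i<d. \<Sum>j\<in>offband d k i. (assemble z (i, j) - C (i, j))^2)"
  using sum.Sigma[of "{..<d}" "offband d k" "\<lambda>i j. (assemble z (i, j) - C (i, j))^2"] finite_offband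
  by (simp add: case_prod_beta)
 also have "... = (\<Sum>i<d. row_loss C i (snd z i))"
  unfolding row_loss_def by (intro sum.cong refl) (auto simp: assemble_def offband_def)
 finally show ?thesis by simp
qed

lemma nn_integral_D1_coord:
 assumes p: "p \<in> band d k"
 shows "(\<integral>\<^sup>+g. ennreal (D1 S g) * ennreal ((g p - c)^2) \<partial>BG) = ennreal ((mb S p - c)^2) + ennreal (v^2)"
proof -
 let ?f = "\<lambda>q x. ennreal (normal_density (mb S q) v x) * (if q = p then ennreal ((x - c)^2) else 1)"
 have "(\<integral>\<^sup>+g. ennreal (D1 S g) * ennreal ((g p - c)^2) \<partial>BG) = (\<integral>\<^sup>+g. (\<Prod>q\<in>band d k. ?f q (g q)) \<partial>BG)"
 proof (rule nn_integral_cong)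
  fix g
  have "(\<Prod>q\<in>band d k. ?f q (g q)) = (\<Prod>q\<in>band d k. ennreal (normal_density (mb S q) v (g q))) * (\<Prod>q\<in>band d k. if q = p then ennreal ((g q - c)^2) else 1)"
   by (rule prod.distrib)
  also have "(\<Prod>q\<in>band d k. if q = p then ennreal ((g q - c)^2) else 1) = ennreal ((g p - c)^2)"
   using p finite_band by simp
  finally show "ennreal (D1 S g) * ennreal ((g p - c)^2) = (\<Prod>q\<in>band d k. ?f q (g q))"
   by (simp add: D1_def prod_ennreal)
 qed
 also have "... = (\<Prod>q\<in>band d k. (\<integral>\<^sup>+x. ?f q x \<partial>lborel))"
  by (rule G.product_nn_integral_prod[OF finite_band]) measurable
 also have "... = (\<Prod>q\<in>band d k. if q = p then ennreal ((mb S p - c)^2) + ennreal (v^2) else 1)"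
  by (intro prod.cong refl) (auto simp: nn_integral_normal normal_second_moment[OF v])
 also have "... = ennreal ((mb S p - c)^2) + ennreal (v^2)" using p finite_band by simp
 finally show ?thesis .
qed

lemma nn_integral_D2_coord:
 assumes i: "i < d" and F: "\<And>h. 0 \<le> F h"
 shows "(\<integral>\<^sup>+H. ennreal (D2 S H) * ennreal (F (H i)) \<partial>BT) = ennreal (\<Sum>h\<in>T i. row_density i S h * F h)"
proof -
 let ?f = "\<lambda>q h. ennreal (row_density q S h) * (if q = i then ennreal (F h) else 1)"
 have "(\<integral>\<^sup>+H. ennreal (D2 S H) * ennreal (F (H i)) \<partial>BT) = (\<integral>\<^sup>+H. (\<Prod>q<d. ?f q (H q)) \<partial>BT)"
 proof (rule nn_integral_cong)
  fix H
  have "(\<Prod>q<d. ?f q (H q)) = (\<Prod>q<d. ennreal (row_density q S (H q))) * (\<Prod>q<d. if q = i then ennreal (F (H q)) else 1)"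
   by (rule prod.distrib)
  also have "(\<Prod>q<d. if q = i then ennreal (F (H q)) else 1) = ennreal (F (H i))"
   using i by simp
  finally show "ennreal (D2 S H) * ennreal (F (H i)) = (\<Prod>q<d. ?f q (H q))"
   by (simp add: D2_def prod_ennreal row_density_nonneg)
 qed
 also have "... = (\<Prod>q<d. (\<integral>\<^sup>+h. ?f q h \<partial>count_space (T q)))"
  by (rule H.product_nn_integral_prod) auto
 also have "... = (\<Prod>q<d. if q = i then ennreal (\<Sum>h\<in>T i. row_density i S h * F h) else 1)"
 proof (intro prod.cong refl)
  fix q
  show "(\<integral>\<^sup>+h. ?f q h \<partial>count_space (T q)) = (if q = i then ennreal (\<Sum>h\<in>T i. row_density i S h * F h) else 1)"
  proof (cases "q = i")
   case True
   then show ?thesis using F row_density_nonneg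
    by (simp add: nn_integral_count_space_finite finite_T ennreal_mult[symmetric] sum_ennreal)
  qed (simp add: nn_integral_row)
 qed
 also have "... = ennreal (\<Sum>h\<in>T i. row_density i S h * F h)" using i by simp
 finally show ?thesis .
qed

lemma row_loss_nonneg: "0 \<le> row_loss C i h" unfolding row_loss_def by (intro sum_nonneg) simp

text \<open>
 The loss is a sum over the band and over the rows off the band, and each summand depends on one coordinate of the noise.
\<close>

lemma conditional_risk:
 "(\<integral>\<^sup>+t. ennreal ((frobenius_norm d (\<lambda>p. t p - C p))^2) \<partial>mech S)
  = (\<Sum>p\<in>band d k. ennreal ((mb S p - C p)^2) + ennreal (v^2)) + (\<Sum>i<d. ennreal (row_risk C i S))"
proof -
 have fr: "(frobenius_norm d (\<lambda>p. t p - C p))^2 = (\<Sum>p\<in>{..<d} \<times> {..<d}. (t p - C p)^2)" for t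
  by (simp add: frobenius_norm_def L2_set_def sum_nonneg)
 have m: "(\<lambda>t. ennreal (\<Sum>p\<in>{..<d} \<times> {..<d}. (t p - C p)^2)) \<in> borel_measurable (mat_space d)"
  unfolding mat_space_def
  by (intro measurable_compose[OF _ measurable_ennreal] borel_measurable_sum borel_measurable_power borel_measurable_diff measurable_component_singleton borel_measurable_const)
 have gp: "(\<lambda>g. g p) \<in> borel_measurable BG" if "p \<in> band d k" for p
  using measurable_component_singleton[OF that, of "\<lambda>_. lborel :: real measure"] by simp
 have m1: "(\<lambda>g. ennreal (D1 S g) * ennreal ((g p - C p)^2)) \<in> borel_measurable BG" if "p \<in> band d k" for p
  using gp[OF that] by measurable
 have m2: "(\<lambda>H. ennreal (D2 S H) * ennreal (row_loss C i (H i))) \<in> borel_measurable BT" if "i < d" for i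
 proof -
  have "(\<lambda>H. row_loss C i (H i)) \<in> borel_measurable BT"
   using measurable_compose[OF comp_T[OF that], of "row_loss C i"] by simp
  then show ?thesis by measurable
 qed
 have "(\<integral>\<^sup>+t. ennreal ((frobenius_norm d (\<lambda>p. t p - C p))^2) \<partial>mech S)
  = (\<integral>\<^sup>+z. ennreal (D1 S (fst z)) * ennreal (D2 S (snd z)) * ennreal (\<Sum>p\<in>{..<d} \<times> {..<d}. (assemble z p - C p)^2) \<partial>(BG \<Otimes>\<^sub>M BT))"
  unfolding fr by (rule nn_integral_mech[OF m])
 also have "... = (\<integral>\<^sup>+z. (\<Sum>p\<in>band d k. (ennreal (D1 S (fst z)) * ennreal ((fst z p - C p)^2)) * ennreal (D2 S (snd z)))
   + (\<Sum>i<d. ennreal (D1 S (fst z)) * (ennreal (D2 S (snd z)) * ennreal (row_loss C i (snd z i)))) \<partial>(BG \<Otimes>\<^sub>M BT))"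
 proof (rule nn_integral_cong)
  fix z
  have e: "ennreal (\<Sum>p\<in>{..<d} \<times> {..<d}. (assemble z p - C p)^2) = (\<Sum>p\<in>band d k. ennreal ((fst z p - C p)^2)) + (\<Sum>i<d. ennreal (row_loss C i (snd z i)))"
   unfolding loss_split by (subst ennreal_plus) (auto simp: sum_nonneg row_loss_nonneg sum_ennreal)
  show "ennreal (D1 S (fst z)) * ennreal (D2 S (snd z)) * ennreal (\<Sum>p\<in>{..<d} \<times> {..<d}. (assemble z p - C p)^2)
   = (\<Sum>p\<in>band d k. (ennreal (D1 S (fst z)) * ennreal ((fst z p - C p)^2)) * ennreal (D2 S (snd z)))
   + (\<Sum>i<d. ennreal (D1 S (fst z)) * (ennreal (D2 S (snd z)) * ennreal (row_loss C i (snd z i))))"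
   unfolding e distrib_left sum_distrib_left by (simp only: mult_ac)
 qed
 also have "... = (\<Sum>p\<in>band d k. \<integral>\<^sup>+z. (ennreal (D1 S (fst z)) * ennreal ((fst z p - C p)^2)) * ennreal (D2 S (snd z)) \<partial>(BG \<Otimes>\<^sub>M BT))
   + (\<Sum>i<d. \<integral>\<^sup>+z. ennreal (D1 S (fst z)) * (ennreal (D2 S (snd z)) * ennreal (row_loss C i (snd z i))) \<partial>(BG \<Otimes>\<^sub>M BT))"
 proof -
  have a: "(\<lambda>z. (ennreal (D1 S (fst z)) * ennreal ((fst z p - C p)^2)) * ennreal (D2 S (snd z))) \<in> borel_measurable (BG \<Otimes>\<^sub>M BT)" if "p \<in> band d k" for p
   using measurable_compose[OF measurable_fst m1[OF that]] by measurable
  have bb: "(\<lambda>z. ennreal (D1 S (fst z)) * (ennreal (D2 S (snd z)) * ennreal (row_loss C i (snd z i)))) \<in> borel_measurable (BG \<Otimes>\<^sub>M BT)" if "i \<in> {..<d}" for i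
  proof -
   note measurable_compose[OF measurable_snd m2, of i, measurable]
   have "i < d" using that by simp
   then show ?thesis by measurable
  qed
  show ?thesis by (intro nn_integral_add_sums a bb)
 qed
 also have "... = (\<Sum>p\<in>band d k. ennreal ((mb S p - C p)^2) + ennreal (v^2)) + (\<Sum>i<d. ennreal (row_risk C i S))"
 proof (intro arg_cong2[where f = "(+)"] sum.cong refl)
  fix p assume p: "p \<in> band d k"
  show "(\<integral>\<^sup>+z. (ennreal (D1 S (fst z)) * ennreal ((fst z p - C p)^2)) * ennreal (D2 S (snd z)) \<partial>(BG \<Otimes>\<^sub>M BT)) = ennreal ((mb S p - C p)^2) + ennreal (v^2)"
   using nn_integral_pair_density[OF m1[OF p], of "\<lambda>H. ennreal (D2 S H)"] nn_integral_D1_coord[OF p] nn_integral_D2 by simp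
 next
  fix i assume "i \<in> {..<d}"
  then have i: "i < d" by simp
  show "(\<integral>\<^sup>+z. ennreal (D1 S (fst z)) * (ennreal (D2 S (snd z)) * ennreal (row_loss C i (snd z i))) \<partial>(BG \<Otimes>\<^sub>M BT)) = ennreal (row_risk C i S)"
   using nn_integral_pair_density[OF _ m2[OF i], of "\<lambda>g. ennreal (D1 S g)"] nn_integral_D1 nn_integral_D2_coord[OF i row_loss_nonneg]
   by (simp add: row_risk_def)
 qed
 finally show ?thesis .
qed

lemma row_risk_meas: "i < d ==> (\<lambda>S. row_risk C i S) \<in> borel_measurable (data_space n d)"
 unfolding row_risk_def by (intro borel_measurable_sum borel_measurable_times row_density_meas) auto

lemma frobenius_risk_mech:
 assumes sP: "sets P = sets (vec_space d)"
 defines "C \<equiv> cov_mat d P" and "M \<equiv> PiM {..<n} (\<lambda>_. P)"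
 shows "frobenius_risk n d mech P = (\<Sum>p\<in>band d k. (\<integral>\<^sup>+S. ennreal ((mb S p - C p)^2) + ennreal (v^2) \<partial>M)) + (\<Sum>i<d. \<integral>\<^sup>+S. ennreal (row_risk C i S) \<partial>M)"
proof -
 have sM: "sets M = sets (data_space n d)"
  unfolding M_def data_space_def by (intro sets_PiM_cong) (auto simp: sP)
 have 1: "(\<lambda>S. ennreal ((mb S p - C p)^2) + ennreal (v^2)) \<in> borel_measurable M" if "p \<in> band d k" for p
 proof -
  have "p \<in> {..<d} \<times> {..<d}" using that by (auto simp: band_def)
  from mb_meas[OF this] have "(\<lambda>S. mb S p) \<in> borel_measurable M" using sM by (simp cong: measurable_cong_sets)
  then show ?thesis by measurable
 qed
 have 2: "(\<lambda>S. ennreal (row_risk C i S)) \<in> borel_measurable M" if "i \<in> {..<d}" for i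
  using row_risk_meas[of i] that sM by (simp cong: measurable_cong_sets)
 show ?thesis
  unfolding frobenius_risk_def C_def[symmetric] conditional_risk M_def[symmetric]
  by (intro nn_integral_add_sums 1 2)
qed

text \<open>
 The level \<open>\<tau>\<close> is the one in \<open>block_tail\<close>, so a block is truncated with probability at most \<open>2 * exp (- \<kappa> * k)\<close>.
\<close>

lemma band_mse:
 assumes P: "P \<in> dist_class \<J> \<alpha> K M0 M d" and K: "K > 0" and p: "p \<in> band d k"
  and \<tau>_eq: "\<tau> = 4 * (8 * K^2) / 3 * (1 + \<kappa>) * real k" and \<kappa>: "\<kappa> \<ge> 0"
 shows "(\<integral>\<^sup>+S. ennreal ((mb S p - cov_mat d P p)^2) \<partial>PiM {..<n} (\<lambda>_. P))
  \<le> ennreal (4 * (8 * K^2)^2 / real N + 16 * (8 * K^2)^2 * exp (- (\<kappa> * real k)))"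
proof -
 define t0 where "t0 = 8 * K^2"
 interpret SS: subgauss_sample "PiM {..<n} (\<lambda>_. P)" "\<lambda>l S. pair_diff d S l" N d t0 "cov_mat d P"
  unfolding t0_def by (rule subgauss_sample_pair_diff[OF P K n])
 obtain i j where pij: "p = (i, j)" and ij: "i < d" "j < d" using p by (auto simp: band_def)
 let ?f = "block_trunc d k \<tau>"
 define q where "q = 4 * exp (- (\<kappa> * real k))"
 define F where "F x = ?f x i * ?f x j" for x
 have cx: "(\<lambda>x. x m) \<in> borel_measurable (vec_space d)" if "m < d" for m using coord_meas[OF that] .
 have blk: "(\<lambda>x. \<Sum>i' | i' < d \<and> i' div k = c. (x i')^2) \<in> borel_measurable (vec_space d)" for c
  by (intro borel_measurable_sum borel_measurable_power cx) auto
 have fm: "(\<lambda>x. ?f x m) \<in> borel_measurable (vec_space d)" if "m < d" for m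
 proof -
  note cx[OF that, measurable] blk[measurable]
  show ?thesis unfolding block_trunc_def by measurable
 qed
 have Fm: "F \<in> borel_measurable (vec_space d)" unfolding F_def[abs_def] by (intro borel_measurable_times fm ij)
 let ?bad = "\<lambda>m x. (\<Sum>i' | i' < d \<and> i' div k = m div k. (x i')^2) > \<tau>"
 let ?M = "PiM {..<n} (\<lambda>_. P)"
 have facts: "integrable ?M (\<lambda>S. (F (pair_diff d S l))^2)" "(\<integral>S. (F (pair_diff d S l))^2 \<partial>?M) \<le> 4 * t0^2"
  "\<bar>(\<integral>S. F (pair_diff d S l) \<partial>?M) - cov_mat d P (i, j)\<bar> \<le> 2 * t0 * sqrt q" if l: "l < N" for l
 proof -
  let ?G = "\<lambda>S. \<not> ?bad i (pair_diff d S l) \<and> \<not> ?bad j (pair_diff d S l)"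
  have Feq: "F (pair_diff d S l) = (if ?G S then pair_diff d S l i * pair_diff d S l j else 0)" for S
   by (auto simp: F_def block_trunc_def not_less)
  have bs: "{S\<in>space ?M. ?bad m (pair_diff d S l)} \<in> sets ?M" for m
  proof -
   have "(\<lambda>S. \<Sum>i' | i' < d \<and> i' div k = m div k. (pair_diff d S l i')^2) \<in> borel_measurable ?M"
    using measurable_compose[OF SS.y_meas[OF l] blk] .
   then show ?thesis by measurable
  qed
  have tail: "SS.prob {S\<in>space ?M. ?bad m (pair_diff d S l)} \<le> 2 * exp (- (\<kappa> * real k))" for m
   using SS.block_tail[OF l _ card_block_le[OF k(1), of d "m div k"] \<kappa>] unfolding \<tau>_eq t0_def by auto
  have un: "{S\<in>space ?M. \<not> ?G S} = {S\<in>space ?M. ?bad i (pair_diff d S l)} \<union> {S\<in>space ?M. ?bad j (pair_diff d S l)}" by auto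
  have Gs: "{S\<in>space ?M. \<not> ?G S} \<in> sets ?M" unfolding un using bs by (intro sets.Un)
  have "SS.prob {S\<in>space ?M. \<not> ?G S} \<le> SS.prob {S\<in>space ?M. ?bad i (pair_diff d S l)} + SS.prob {S\<in>space ?M. ?bad j (pair_diff d S l)}"
   unfolding un by (rule measure_Un_le[OF bs bs])
  also have "... \<le> q" using tail[of i] tail[of j] by (simp add: q_def)
  finally have pq: "SS.prob {S\<in>space ?M. \<not> ?G S} \<le> q" .
  have q0: "q > 0" by (simp add: q_def)
  note SS.truncation_bias[OF l ij Gs pq q0, folded Feq]
  then show "integrable ?M (\<lambda>S. (F (pair_diff d S l))^2)" "(\<integral>S. (F (pair_diff d S l))^2 \<partial>?M) \<le> 4 * t0^2"
   "\<bar>(\<integral>S. F (pair_diff d S l) \<partial>?M) - cov_mat d P (i, j)\<bar> \<le> 2 * t0 * sqrt q" by auto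
 qed
 have mbF: "mb S (i, j) = (\<Sum>l<N. F (pair_diff d S l)) / real N" for S
  by (simp add: mb_def emp_cov_def F_def)
 have "(\<integral>\<^sup>+S. ennreal ((mb S p - cov_mat d P p)^2) \<partial>?M) \<le> ennreal (4 * t0^2 / real N + (2 * t0 * sqrt q)^2)"
  unfolding pij mbF by (rule SS.average_mse[OF Fm facts])
 also have "(2 * t0 * sqrt q)^2 = 16 * t0^2 * exp (- (\<kappa> * real k))"
  by (simp add: q_def power_mult_distrib)
 finally show ?thesis by (simp add: t0_def)
qed

lemma band_risk:
 assumes P: "P \<in> dist_class \<J> \<alpha> K M0 M d" and K: "K > 0"
  and \<tau>_eq: "\<tau> = 4 * (8 * K^2) / 3 * (1 + \<kappa>) * real k" and \<kappa>: "\<kappa> \<ge> 0"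
 shows "(\<Sum>p\<in>band d k. (\<integral>\<^sup>+S. ennreal ((mb S p - cov_mat d P p)^2) + ennreal (v^2) \<partial>PiM {..<n} (\<lambda>_. P)))
  \<le> ennreal (3 * real k * real d * (4 * (8 * K^2)^2 / real N + 16 * (8 * K^2)^2 * exp (- (\<kappa> * real k)) + v^2))"
proof -
 let ?M = "PiM {..<n} (\<lambda>_. P)"
 let ?B = "4 * (8 * K^2)^2 / real N + 16 * (8 * K^2)^2 * exp (- (\<kappa> * real k)) + v^2"
 have pP: "prob_space P" and sP: "sets P = sets (vec_space d)" using P by (auto simp: dist_class_def space_prob_algebra)
 interpret PM: prob_space ?M using pP by (intro prob_space_PiM)
 have sM: "sets ?M = sets (data_space n d)" unfolding data_space_def by (intro sets_PiM_cong) (auto simp: sP)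
 have "(\<Sum>p\<in>band d k. (\<integral>\<^sup>+S. ennreal ((mb S p - cov_mat d P p)^2) + ennreal (v^2) \<partial>?M)) \<le> (\<Sum>p\<in>band d k. ennreal ?B)"
 proof (rule sum_mono)
  fix p assume p: "p \<in> band d k"
  then have "p \<in> {..<d} \<times> {..<d}" by (auto simp: band_def)
  from mb_meas[OF this] have [measurable]: "(\<lambda>S. mb S p) \<in> borel_measurable ?M" using sM by (simp cong: measurable_cong_sets)
  have "(\<integral>\<^sup>+S. ennreal ((mb S p - cov_mat d P p)^2) + ennreal (v^2) \<partial>?M) = (\<integral>\<^sup>+S. ennreal ((mb S p - cov_mat d P p)^2) \<partial>?M) + ennreal (v^2)"
   by (subst nn_integral_add) (auto simp: PM.emeasure_space_1)
  also have "... \<le> ennreal (4 * (8 * K^2)^2 / real N + 16 * (8 * K^2)^2 * exp (- (\<kappa> * real k))) + ennreal (v^2)"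
   by (intro add_right_mono band_mse[OF P K p \<tau>_eq \<kappa>])
  also have "... = ennreal ?B" by (simp add: ennreal_plus[symmetric] del: ennreal_plus)
  finally show "(\<integral>\<^sup>+S. ennreal ((mb S p - cov_mat d P p)^2) + ennreal (v^2) \<partial>?M) \<le> ennreal ?B" .
 qed
 also have "... = ennreal (real (card (band d k)) * ?B)"
  by (simp add: ennreal_mult ennreal_of_nat_eq_real_of_nat)
 also have "... \<le> ennreal (3 * real k * real d * ?B)"
  using card_band_le[OF k(1), of d] by (intro ennreal_leI mult_right_mono add_nonneg_nonneg) auto
 finally show ?thesis .
qed

text \<open>
 Without steps the estimate is zero off the band.
\<close>

lemma row_risk_no_steps:
 assumes "s = 0"
 shows "row_risk C i S = (\<Sum>j\<in>offband d k i. (C (i, j))^2)"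
proof -
 have "T i = {[]}" unfolding T_def st_def by (simp add: assms)
 then show ?thesis by (simp add: row_risk_def row_density_def row_loss_def iterate_def)
qed

text \<open>
 For each data set \<open>frank_wolfe_risk\<close> applies with the random bound \<open>U\<close> of \<open>uniform_deviation\<close> as the error of the
 target.
\<close>

lemma row_risk_frank_wolfe:
 assumes P: "P \<in> dist_class \<J> \<alpha> K M0 M d" and K: "K > 0" and i: "i < d" and s: "s \<ge> 1"
  and r: "r \<ge> 0" "(\<Sum>j\<in>offband d k i. \<bar>cov_mat d P (i, j)\<bar>) \<le> r"
 shows "(\<integral>\<^sup>+S. ennreal (row_risk (cov_mat d P) i S) \<partial>PiM {..<n} (\<lambda>_. P))
  \<le> ennreal (4 * r^2 / real s + r * (2 * (4 * (8 * K^2) * exp (- (b^2 / (2 * (8 * K^2)))) + b^2 * (ln (2 * real d) + 1) / sqrt (real N)) + ln (2 * real d) / \<eta>))"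
proof (cases "offband d k i = {}")
 case True
 then have "row_risk (cov_mat d P) i S = 0" for S by (simp add: row_risk_def row_loss_def)
 then show ?thesis by simp
next
 case False
 define t0 where "t0 = 8 * K^2"
 have t0: "t0 > 0" using K by (simp add: t0_def)
 let ?M = "PiM {..<n} (\<lambda>_. P)" let ?C = "offband d k i" let ?\<sigma> = "\<lambda>j. cov_mat d P (i, j)"
 interpret SS: subgauss_sample ?M "\<lambda>l S. pair_diff d S l" N d t0 "cov_mat d P"
  unfolding t0_def by (rule subgauss_sample_pair_diff[OF P K n])
 define q where "q = 4 * exp (- (b^2 / t0))"
 have q0: "q > 0" by (simp add: q_def)
 let ?f = "coord_trunc b"
 define F where "F j x = ?f x i * ?f x j" for j x
 have Cd: "j < d" if "j \<in> ?C" for j using that by (auto simp: offband_def)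
 have fm: "(\<lambda>x. ?f x m) \<in> borel_measurable (vec_space d)" if "m < d" for m
 proof -
  note coord_meas[OF that, measurable]
  show ?thesis unfolding coord_trunc_def by measurable
 qed
 have Fm: "F j \<in> borel_measurable (vec_space d)" if "j \<in> ?C" for j
  unfolding F_def[abs_def] by (intro borel_measurable_times fm i Cd that)
 have fb: "\<bar>?f x m\<bar> \<le> b" for x m using b by (simp add: coord_trunc_def)
 have Fb: "\<bar>F j x\<bar> \<le> b^2" for j x
  unfolding F_def abs_mult power2_eq_square using fb b by (intro mult_mono) auto
 have bias: "\<bar>(\<integral>S. F j (pair_diff d S l) \<partial>?M) - ?\<sigma> j\<bar> \<le> 2 * t0 * sqrt q" if j: "j \<in> ?C" and l: "l < N" for j l
 proof -
  let ?bad = "\<lambda>m S. \<bar>pair_diff d S l m\<bar> > b"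
  let ?G = "\<lambda>S. \<not> ?bad i S \<and> \<not> ?bad j S"
  have Feq: "F j (pair_diff d S l) = (if ?G S then pair_diff d S l i * pair_diff d S l j else 0)" for S
   by (auto simp: F_def coord_trunc_def not_less)
  have bs: "{S\<in>space ?M. ?bad m S} \<in> sets ?M" if "m < d" for m
  proof -
   note SS.yi_meas[OF l that, measurable]
   show ?thesis by measurable
  qed
  have un: "{S\<in>space ?M. \<not> ?G S} = {S\<in>space ?M. ?bad i S} \<union> {S\<in>space ?M. ?bad j S}" by auto
  have Gs: "{S\<in>space ?M. \<not> ?G S} \<in> sets ?M" unfolding un by (intro sets.Un bs i Cd j)
  have "SS.prob {S\<in>space ?M. \<not> ?G S} \<le> SS.prob {S\<in>space ?M. ?bad i S} + SS.prob {S\<in>space ?M. ?bad j S}"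
   unfolding un by (rule measure_Un_le[OF bs[OF i] bs[OF Cd[OF j]]])
  also have "... \<le> q" using SS.coordinate_tail[OF l i, of b] SS.coordinate_tail[OF l Cd[OF j], of b] b by (simp add: q_def)
  finally show ?thesis using SS.truncation_bias(4)[OF l i Cd[OF j] Gs _ q0, folded Feq] by auto
 qed
 have card: "card ?C \<le> d"
 proof -
  have "card ?C \<le> card {..<d}" by (intro card_mono) (auto simp: offband_def)
  then show ?thesis by simp
 qed
 have d1: "d \<ge> 1" using k by simp
 have b2: "b^2 > 0" using b by simp
 have bq: "2 * t0 * sqrt q \<ge> 0" using t0 q0 by simp
 obtain U where U: "U \<in> borel_measurable ?M" "\<And>S. S \<in> space ?M ==> U S \<ge> 0"
  "\<And>S j. S \<in> space ?M ==> j \<in> ?C ==> \<bar>(\<Sum>l<N. F j (pair_diff d S l)) / real N - ?\<sigma> j\<bar> \<le> U S"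
  "(\<integral>\<^sup>+S. ennreal (U S) \<partial>?M) \<le> ennreal (2 * t0 * sqrt q + b^2 * (ln (2 * real d) + 1) / sqrt (real N))"
  by (rule SS.uniform_deviation[where F = F and c = ?\<sigma>, OF finite_offband card d1 Fm Fb b2 bias bq]) auto
 have st: "st i = Suc (s - 1)" using False s by (simp add: st_def)
 let ?L = "ln (2 * real d) / \<eta>"
 have L0: "?L \<ge> 0" using d1 \<eta> by simp
 have pos: "0 \<le> 4 * r^2 / real s + r * ?L" using r(1) L0 by (intro add_nonneg_nonneg mult_nonneg_nonneg) auto
 have dev: "0 \<le> 2 * t0 * sqrt q + b^2 * (ln (2 * real d) + 1) / sqrt (real N)"
  using b2 d1 by (intro add_nonneg_nonneg[OF bq] divide_nonneg_nonneg mult_nonneg_nonneg) auto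
 have point: "row_risk (cov_mat d P) i S \<le> 4 * r^2 / real s + r * (2 * U S + ?L)" if S: "S \<in> space ?M" for S
 proof -
  have g: "\<bar>mc i S j - ?\<sigma> j\<bar> \<le> U S" if "j \<in> ?C" for j
   using U(3)[OF S that] by (simp add: mc_def emp_cov_def F_def)
  have "row_risk (cov_mat d P) i S \<le> 4 * r^2 / real (Suc (s - 1)) + r * (2 * U S + ln (real (card (atoms ?C))) / \<eta>)"
   unfolding row_risk_def row_loss_def T_def st row_density_def A_def
   by (rule frank_wolfe_risk[OF finite_offband False \<eta> r g])
  also have "... \<le> 4 * r^2 / real s + r * (2 * U S + ?L)"
  proof -
   have "0 < card ?C" using False finite_offband by (simp add: card_gt_0_iff)
   then have "ln (real (card (atoms ?C))) \<le> ln (2 * real d)" using card by (simp add: card_atoms)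
   then have "ln (real (card (atoms ?C))) / \<eta> \<le> ?L" using \<eta> by (intro divide_right_mono) auto
   then show ?thesis using s r by (intro add_mono mult_left_mono) auto
  qed
  finally show ?thesis .
 qed
 have "(\<integral>\<^sup>+S. ennreal (row_risk (cov_mat d P) i S) \<partial>?M) \<le> (\<integral>\<^sup>+S. ennreal (4 * r^2 / real s + r * ?L) + ennreal (2 * r) * ennreal (U S) \<partial>?M)"
 proof (rule nn_integral_mono)
  fix S assume S: "S \<in> space ?M"
  have "row_risk (cov_mat d P) i S \<le> (4 * r^2 / real s + r * ?L) + 2 * r * U S"
   using point[OF S] by (simp add: algebra_simps)
  then have "ennreal (row_risk (cov_mat d P) i S) \<le> ennreal ((4 * r^2 / real s + r * ?L) + 2 * r * U S)" by (rule ennreal_leI)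
  also have "... = ennreal (4 * r^2 / real s + r * ?L) + ennreal (2 * r) * ennreal (U S)"
   using r(1) pos U(2)[OF S] by (subst ennreal_plus) (simp_all add: ennreal_mult del: times_divide_eq_right)
  finally show "ennreal (row_risk (cov_mat d P) i S) \<le> ..." .
 qed
 also have "... = ennreal (4 * r^2 / real s + r * ?L) + ennreal (2 * r) * (\<integral>\<^sup>+S. ennreal (U S) \<partial>?M)"
  using U(1) by (simp add: nn_integral_add nn_integral_cmult SS.emeasure_space_1)
 also have "... \<le> ennreal (4 * r^2 / real s + r * ?L) + ennreal (2 * r) * ennreal (2 * t0 * sqrt q + b^2 * (ln (2 * real d) + 1) / sqrt (real N))"
  using U(4) by (intro add_left_mono mult_left_mono) auto
 also have "... = ennreal ((4 * r^2 / real s + r * ?L) + 2 * r * (2 * t0 * sqrt q + b^2 * (ln (2 * real d) + 1) / sqrt (real N)))"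
  using r(1) pos dev by (subst ennreal_plus) (simp_all add: ennreal_mult del: times_divide_eq_right)
 also have "2 * t0 * sqrt q = 4 * t0 * exp (- (b^2 / (2 * t0)))"
 proof -
  have "exp (- (b^2 / t0)) = (exp (- (b^2 / (2 * t0))))^2" by (simp add: power2_eq_square exp_add[symmetric])
  then show ?thesis by (simp add: q_def real_sqrt_mult)
 qed
 also have "(4 * r^2 / real s + r * ?L) + 2 * r * (4 * t0 * exp (- (b^2 / (2 * t0))) + b^2 * (ln (2 * real d) + 1) / sqrt (real N))
  = 4 * r^2 / real s + r * (2 * (4 * t0 * exp (- (b^2 / (2 * t0))) + b^2 * (ln (2 * real d) + 1) / sqrt (real N)) + ?L)"
  by (simp add: algebra_simps)
 finally show ?thesis unfolding t0_def .
qed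

end

subsection \<open>Tails of the covariance classes\<close>

text \<open>
 Comparison of the sum with the integral, in the form of a telescoping sum.
\<close>

lemma powr_tail_telescope:
 fixes \<beta> :: real
 assumes \<beta>: "\<beta> > 0" and k: "(k::nat) \<ge> 1"
 shows "(\<Sum>m\<in>{k<..k + L}. real m powr (- (\<beta> + 1))) \<le> real k powr (- \<beta>) / \<beta>"
proof -
 have step: "real (Suc m) powr (- (\<beta> + 1)) \<le> (real m powr (- \<beta>) - real (Suc m) powr (- \<beta>)) / \<beta>" if m: "m \<ge> 1" for m :: nat
 proof -
  have "\<exists>z. real m < z \<and> z < real (Suc m) \<and> real (Suc m) powr (- \<beta>) - real m powr (- \<beta>) = (real (Suc m) - real m) * (- \<beta> * z powr (- \<beta> - 1))"
   using m by (intro MVT2) (auto intro!: derivative_eq_intros)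
  then obtain z where z: "real m < z" "z < real (Suc m)" "real (Suc m) powr (- \<beta>) - real m powr (- \<beta>) = - \<beta> * z powr (- \<beta> - 1)" by auto
  have "real (Suc m) powr (- (\<beta> + 1)) \<le> z powr (- (\<beta> + 1))"
   using z m \<beta> by (intro powr_mono2') auto
  then have "\<beta> * real (Suc m) powr (- (\<beta> + 1)) \<le> \<beta> * z powr (- \<beta> - 1)" using \<beta> by simp
  also have "... = real m powr (- \<beta>) - real (Suc m) powr (- \<beta>)" using z(3) by simp
  finally show ?thesis using \<beta> by (simp add: pos_le_divide_eq mult.commute)
 qed
 have "(\<Sum>m\<in>{k<..k + L}. real m powr (- (\<beta> + 1))) \<le> (real k powr (- \<beta>) - real (k + L) powr (- \<beta>)) / \<beta>"
 proof (induction L)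
  case (Suc L)
  have "{k<..k + Suc L} = insert (Suc (k + L)) {k<..k + L}" by auto
  then have "(\<Sum>m\<in>{k<..k + Suc L}. real m powr (- (\<beta> + 1))) = real (Suc (k + L)) powr (- (\<beta> + 1)) + (\<Sum>m\<in>{k<..k + L}. real m powr (- (\<beta> + 1)))"
   by simp
  also have "... \<le> (real (k + L) powr (- \<beta>) - real (Suc (k + L)) powr (- \<beta>)) / \<beta> + (real k powr (- \<beta>) - real (k + L) powr (- \<beta>)) / \<beta>"
   using step[of "k + L"] k Suc.IH by (intro add_mono) auto
  finally show ?case by (simp add: add_divide_distrib[symmetric])
 qed simp
 also have "... \<le> real k powr (- \<beta>) / \<beta>" using \<beta> by (intro divide_right_mono) auto
 finally show ?thesis .
qed

lemma pointwise_tail: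
 assumes C: "C \<in> pointwise_class \<alpha> M0 M d" and par: "\<alpha> > 0" "M > 0" and k: "k \<ge> 1" and i: "i < d"
 shows "(\<Sum>j\<in>offband d k i. (C (i, j))^2) \<le> 2 * M^2 * real k powr (- (2 * \<alpha> + 1))"
proof -
 let ?g = "\<lambda>m::nat. real m powr (- (2 * \<alpha> + 1 + 1))"
 have entry: "(C (i, j))^2 \<le> M^2 * ?g (nat \<bar>int i - int j\<bar>)" if j: "j \<in> offband d k i" for j
 proof -
  have far: "\<bar>real i - real j\<bar> > real k" by (rule offband_far[OF j i k])
  then have "i \<noteq> j" by auto
  moreover have "j < d" using j by (auto simp: offband_def)
  ultimately have "\<bar>C (i, j)\<bar> \<le> M * \<bar>real i - real j\<bar> powr (- (\<alpha> + 1))"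
   using C i by (auto simp: pointwise_class_def)
  then have "\<bar>C (i, j)\<bar>^2 \<le> (M * \<bar>real i - real j\<bar> powr (- (\<alpha> + 1)))^2" by (intro power_mono) auto
  also have "... = M^2 * \<bar>real i - real j\<bar> powr (- (2 * \<alpha> + 1 + 1))"
   by (simp add: power_mult_distrib power2_eq_square powr_add[symmetric] algebra_simps)
  also have "\<bar>real i - real j\<bar> = real (nat \<bar>int i - int j\<bar>)" by simp
  finally show ?thesis by simp
 qed
 have right: "(\<Sum>j\<in>{j\<in>offband d k i. i < j}. M^2 * ?g (nat \<bar>int i - int j\<bar>)) \<le> M^2 * real k powr (- (2 * \<alpha> + 1))"
  and left: "(\<Sum>j\<in>{j\<in>offband d k i. \<not> i < j}. M^2 * ?g (nat \<bar>int i - int j\<bar>)) \<le> M^2 * real k powr (- (2 * \<alpha> + 1))"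
 proof -
  have tel: "(\<Sum>m\<in>{k<..k + d}. ?g m) \<le> real k powr (- (2 * \<alpha> + 1))"
  proof -
   have "(\<Sum>m\<in>{k<..k + d}. ?g m) \<le> real k powr (- (2 * \<alpha> + 1)) / (2 * \<alpha> + 1)"
    by (rule powr_tail_telescope) (use par k in auto)
   also have "... \<le> real k powr (- (2 * \<alpha> + 1)) / 1" using par by (intro divide_left_mono) auto
   finally show ?thesis by simp
  qed
  have gen: "(\<Sum>j\<in>X. M^2 * ?g (nat \<bar>int i - int j\<bar>)) \<le> M^2 * real k powr (- (2 * \<alpha> + 1))"
   if X: "X \<subseteq> offband d k i" and inj: "inj_on (\<lambda>j. nat \<bar>int i - int j\<bar>) X" for X
  proof -
   have "(\<Sum>j\<in>X. ?g (nat \<bar>int i - int j\<bar>)) = (\<Sum>m\<in>(\<lambda>j. nat \<bar>int i - int j\<bar>) ` X. ?g m)"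
    by (simp add: sum.reindex[OF inj])
   also have "... \<le> (\<Sum>m\<in>{k<..k + d}. ?g m)"
   proof (rule sum_mono2)
    show "(\<lambda>j. nat \<bar>int i - int j\<bar>) ` X \<subseteq> {k<..k + d}"
    proof (rule image_subsetI)
     fix j assume "j \<in> X"
     then have j: "j \<in> offband d k i" using X by auto
     then have "j < d" by (auto simp: offband_def)
     with offband_far[OF j i k] i show "nat \<bar>int i - int j\<bar> \<in> {k<..k + d}" by auto
    qed
   qed auto
   also note tel
   finally have "M^2 * (\<Sum>j\<in>X. ?g (nat \<bar>int i - int j\<bar>)) \<le> M^2 * real k powr (- (2 * \<alpha> + 1))" by (intro mult_left_mono) auto
   then show ?thesis by (simp only: sum_distrib_left)
  qed
  show "(\<Sum>j\<in>{j\<in>offband d k i. i < j}. M^2 * ?g (nat \<bar>int i - int j\<bar>)) \<le> M^2 * real k powr (- (2 * \<alpha> + 1))"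
   by (rule gen) (auto simp: inj_on_def)
  show "(\<Sum>j\<in>{j\<in>offband d k i. \<not> i < j}. M^2 * ?g (nat \<bar>int i - int j\<bar>)) \<le> M^2 * real k powr (- (2 * \<alpha> + 1))"
   by (rule gen) (auto simp: inj_on_def)
 qed
 have "(\<Sum>j\<in>offband d k i. (C (i, j))^2) \<le> (\<Sum>j\<in>offband d k i. M^2 * ?g (nat \<bar>int i - int j\<bar>))"
  by (intro sum_mono entry)
 also have "... = (\<Sum>j\<in>{j\<in>offband d k i. i < j} \<union> {j\<in>offband d k i. \<not> i < j}. M^2 * ?g (nat \<bar>int i - int j\<bar>))"
  by (intro sum.cong) auto
 also have "... = (\<Sum>j\<in>{j\<in>offband d k i. i < j}. M^2 * ?g (nat \<bar>int i - int j\<bar>)) + (\<Sum>j\<in>{j\<in>offband d k i. \<not> i < j}. M^2 * ?g (nat \<bar>int i - int j\<bar>))"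
  by (rule sum.union_disjoint) (auto simp: finite_offband)
 also have "... \<le> M^2 * real k powr (- (2 * \<alpha> + 1)) + M^2 * real k powr (- (2 * \<alpha> + 1))"
  by (intro add_mono left right)
 finally show ?thesis by simp
qed

lemma row_tail_offband:
 assumes C: "C \<in> row_tail_class \<alpha> M0 M d" and k: "k \<ge> 1" and i: "i < d"
 shows "(\<Sum>j\<in>offband d k i. \<bar>C (i, j)\<bar>) \<le> M * real k powr (- \<alpha>)"
proof -
 have sym: "C (a, c) = C (c, a)" if "a < d" "c < d" for a c
  using C that by (auto simp: row_tail_class_def bounded_covariances_def loewner_le_def psd_def)
 have "(\<Sum>j\<in>offband d k i. \<bar>C (i, j)\<bar>) = (\<Sum>j\<in>offband d k i. \<bar>C (j, i)\<bar>)"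
  using i by (intro sum.cong refl) (auto simp: offband_def sym[of i])
 also have "... \<le> (\<Sum>j | j < d \<and> \<bar>real j - real i\<bar> > real k. \<bar>C (j, i)\<bar>)"
  using offband_far[OF _ i k] by (intro sum_mono2) (auto simp: offband_def abs_minus_commute)
 also have "... \<le> M * real k powr (- \<alpha>)" using C k i by (auto simp: row_tail_class_def)
 finally show ?thesis .
qed

lemma offband_full: "d \<le> k ==> offband d k i = {j. j < d \<and> \<not> i < d}"
 by (auto simp: offband_def band_def)

section \<open>Choice of the bandwidth\<close>

definition rate :: "real => nat => nat => real => real" where
 "rate \<alpha> n d \<rho> = min (real n powr (- ((2 * \<alpha> + 1) / (2 * \<alpha> + 2)))) (real d / real n) +
  min ((real d / (\<rho> * (real n)^2)) powr ((2 * \<alpha> + 1) / (2 * \<alpha> + 3))) (real d ^ 3 / (\<rho> * (real n)^2))"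

lemma minimax_rate_eq: "minimax_rate \<alpha> n d \<rho> = ennreal (rate \<alpha> n d \<rho>)"
 by (simp add: minimax_rate_def rate_def)

text \<open>
 The identities that make the variance equal to the squared bias at the balancing bandwidths, \<open>q\<close> being the exponent of the bandwidth in the
 variance.
\<close>

lemma powr_balance:
 fixes T p :: real
 assumes "T > 0" "p > 0"
 shows "(T powr (1 / p)) powr q / T = T powr (- ((p - q) / p))"
proof -
 have "(T powr (1 / p)) powr q / T = T powr (q / p - 1)" using assms by (simp add: powr_powr powr_diff)
 also have "q / p - 1 = - ((p - q) / p)" using assms by (simp add: field_simps)
 finally show ?thesis .
qed

text \<open>
 The choice is \<open>k\<close>, the integer part of the minimum of \<open>d\<close> and the two balancing bandwidths.  If the minimum is \<open>d\<close> the band is the whole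
 matrix and there is no bias; otherwise the bias \<open>k powr (- (2 * \<alpha> + 1))\<close> is dominated by the part of the rate that belongs to the smaller
 bandwidth.  The bounds on the powers of \<open>k\<close> are used for the rows off the band.
\<close>

lemma bandwidth:
 fixes n d :: nat and \<alpha> \<rho> :: real
 assumes \<alpha>: "\<alpha> > 0" and n: "n \<ge> 1" and d: "d \<ge> 1" and \<rho>: "\<rho> > 0" and T1: "1 \<le> \<rho> * (real n)^2 / real d"
 obtains k where "1 \<le> k" "k \<le> d"
  "real k powr (2 * \<alpha> + 2) \<le> real n" "real k powr (2 * \<alpha> + 3) \<le> \<rho> * (real n)^2 / real d"
  "real k / real n + (real k)^2 * real d / (\<rho> * (real n)^2) \<le> rate \<alpha> n d \<rho>"
  "k = d \<or> real k powr (- (2 * \<alpha> + 1)) \<le> 2 powr (2 * \<alpha> + 1) * rate \<alpha> n d \<rho>"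
proof -
 define T where "T = \<rho> * (real n)^2 / real d"
 define k1 where "k1 = real n powr (1 / (2 * \<alpha> + 2))"
 define k2 where "k2 = T powr (1 / (2 * \<alpha> + 3))"
 have n0: "real n > 0" and d0: "real d > 0" using n d by auto
 have T: "1 \<le> T" using T1 by (simp add: T_def)
 have k1: "1 \<le> k1" unfolding k1_def using n \<alpha> by (intro ge_one_powr_ge_zero) auto
 have k2: "1 \<le> k2" unfolding k2_def using T \<alpha> by (intro ge_one_powr_ge_zero) auto
 have b1: "k1 / real n = real n powr (- ((2 * \<alpha> + 1) / (2 * \<alpha> + 2)))"
  using powr_balance[of "real n" "2 * \<alpha> + 2" 1] n0 \<alpha> k1 by (simp add: k1_def add.commute)
 have b1': "k1 powr (- (2 * \<alpha> + 1)) = k1 / real n"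
  unfolding b1 unfolding k1_def powr_powr using \<alpha> by (intro arg_cong[where f = "\<lambda>x. real n powr x"]) (simp add: field_simps)
 have b2: "k2^2 / T = T powr (- ((2 * \<alpha> + 1) / (2 * \<alpha> + 3)))"
  using powr_balance[of T "2 * \<alpha> + 3" 2] T \<alpha> k2 by (simp add: k2_def add.commute)
 have b2': "k2 powr (- (2 * \<alpha> + 1)) = k2^2 / T"
  unfolding b2 unfolding k2_def powr_powr using \<alpha> by (intro arg_cong[where f = "\<lambda>x. T powr x"]) (simp add: field_simps)
 have inv: "real d / (\<rho> * (real n)^2) = inverse T" by (simp add: T_def)
 have e2: "(real d / (\<rho> * (real n)^2)) powr ((2 * \<alpha> + 1) / (2 * \<alpha> + 3)) = k2^2 / T"
  unfolding inv b2 using T by (simp add: powr_minus inverse_powr)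
 have rt: "rate \<alpha> n d \<rho> = min (k1 / real n) (real d / real n) + min (k2^2 / T) ((real d)^2 / T)"
  unfolding rate_def e2 b1[symmetric] by (simp add: T_def power2_eq_square power3_eq_cube)
 have r1: "min (k1 / real n) (real d / real n) \<le> rate \<alpha> n d \<rho>" and r2: "min (k2^2 / T) ((real d)^2 / T) \<le> rate \<alpha> n d \<rho>"
  unfolding rt using T k1 k2 n0 by auto
 define m where "m = min (real d) (min k1 k2)"
 define k where "k = nat \<lfloor>m\<rfloor>"
 have m1: "1 \<le> m" using d k1 k2 by (simp add: m_def)
 then have f: "1 \<le> \<lfloor>m\<rfloor>" by simp
 then have "real k = of_int \<lfloor>m\<rfloor>" "(1::real) \<le> of_int \<lfloor>m\<rfloor>" by (simp_all add: k_def)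
 then have km: "real k \<le> m" and kh: "m / 2 \<le> real k" and kk: "1 \<le> k" using f unfolding k_def by linarith+
 have kd: "real k \<le> real d" and kk1: "real k \<le> k1" and kk2: "real k \<le> k2" using km by (auto simp: m_def)
 show thesis
 proof (rule that)
  show "1 \<le> k" by fact
  show "k \<le> d" using kd by simp
  show "real k powr (2 * \<alpha> + 2) \<le> real n"
   using powr_mono2[OF _ _ kk1, of "2 * \<alpha> + 2"] \<alpha> n0 by (simp add: k1_def powr_powr)
  show "real k powr (2 * \<alpha> + 3) \<le> \<rho> * (real n)^2 / real d"
   using powr_mono2[OF _ _ kk2, of "2 * \<alpha> + 3"] \<alpha> T by (simp add: k2_def powr_powr T_def[symmetric])
  have "(real k)^2 \<le> k2^2" "(real k)^2 \<le> (real d)^2" using kk2 kd by (auto intro: power_mono)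
  then have "(real k)^2 / T \<le> min (k2^2 / T) ((real d)^2 / T)" using T by (simp add: divide_right_mono)
  moreover have "real k / real n \<le> min (k1 / real n) (real d / real n)" using kk1 kd n0 by (simp add: divide_right_mono)
  moreover have "(real k)^2 * real d / (\<rho> * (real n)^2) = (real k)^2 / T" by (simp add: T_def)
  ultimately show "real k / real n + (real k)^2 * real d / (\<rho> * (real n)^2) \<le> rate \<alpha> n d \<rho>"
   unfolding rt by linarith
  show "k = d \<or> real k powr (- (2 * \<alpha> + 1)) \<le> 2 powr (2 * \<alpha> + 1) * rate \<alpha> n d \<rho>"
  proof (cases "real d \<le> min k1 k2")
   case True
   then have "m = real d" by (simp add: m_def)
   then show ?thesis by (simp add: k_def)
  next
   case False
   then have m: "m = min k1 k2" by (auto simp: m_def min_def)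
   have "m powr (- (2 * \<alpha> + 1)) \<le> rate \<alpha> n d \<rho>"
   proof (cases "k1 \<le> k2")
    case True
    with False m have "m = k1" "k1 \<le> real d" by auto
    with r1 n0 show ?thesis unfolding \<open>m = k1\<close> b1' by (simp add: min_def divide_right_mono split: if_splits)
   next
    case F: False
    with False m have e: "m = k2" "k2 \<le> real d" by auto
    then have "k2^2 / T \<le> (real d)^2 / T" using k2 T by (intro divide_right_mono power_mono) auto
    with r2 show ?thesis unfolding e(1) b2' by (simp add: min_def split: if_splits)
   qed
   then have "2 powr (2 * \<alpha> + 1) * m powr (- (2 * \<alpha> + 1)) \<le> 2 powr (2 * \<alpha> + 1) * rate \<alpha> n d \<rho>" by (intro mult_left_mono) auto
   moreover have "real k powr (- (2 * \<alpha> + 1)) \<le> (m / 2) powr (- (2 * \<alpha> + 1))"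
    using kh m1 \<alpha> by (intro powr_mono2') auto
   moreover have gen: "(m / 2) powr (- p) = 2 powr p * m powr (- p)" for p
    using m1 by (simp add: powr_divide powr_minus field_simps)
   ultimately show ?thesis unfolding gen by linarith
  qed
 qed
qed

lemma rate_nonneg: "\<rho> > 0 ==> 0 \<le> rate \<alpha> n d \<rho>"
 by (auto simp: rate_def)

lemma powr_le_exp:
 fixes x p \<kappa> :: real
 assumes "x > 0" "p > 0" "\<kappa> > 0"
 shows "x powr p * exp (- (\<kappa> * x)) \<le> (p / \<kappa>) powr p"
proof -
 have "ln (x * \<kappa> / p) \<le> x * \<kappa> / p" using ln_le_minus_one[of "x * \<kappa> / p"] assms by simp
 then have "p * ln (x * \<kappa> / p) \<le> p * (x * \<kappa> / p)" using assms by (intro mult_left_mono) auto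
 then have le: "p * ln (x * \<kappa> / p) \<le> \<kappa> * x" using assms by (simp add: mult.commute)
 have "x powr p = (p / \<kappa>) powr p * (x * \<kappa> / p) powr p" using assms by (simp add: powr_mult[symmetric])
 also have "(x * \<kappa> / p) powr p = exp (p * ln (x * \<kappa> / p))" using assms by (simp add: powr_def)
 finally have "x powr p * exp (- (\<kappa> * x)) = (p / \<kappa>) powr p * exp (p * ln (x * \<kappa> / p) - \<kappa> * x)"
  by (simp add: exp_diff exp_minus field_simps)
 also have "... \<le> (p / \<kappa>) powr p * 1" using le by (intro mult_left_mono) auto
 finally show ?thesis by simp
qed

lemma (in mechanism) minimax_risk_le:
 assumes K: "K > 0" and \<tau>_eq: "\<tau> = 4 * (8 * K^2) / 3 * (1 + \<kappa>) * real k" and \<kappa>: "\<kappa> \<ge> 0"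
  and rows: "\<And>P i. P \<in> dist_class \<J> \<alpha> K M0 M d ==> i < d ==>
   (\<integral>\<^sup>+S. ennreal (row_risk (cov_mat d P) i S) \<partial>PiM {..<n} (\<lambda>_. P)) \<le> ennreal B" and B: "B \<ge> 0"
 shows "minimax_risk \<J> \<alpha> K M0 M n d \<rho>
  \<le> ennreal (3 * real k * (4 * (8 * K^2)^2 / real N + 16 * (8 * K^2)^2 * exp (- (\<kappa> * real k)) + v^2) + B)"
  (is "_ \<le> ennreal (3 * real k * ?E + B)")
 unfolding minimax_risk_def
proof (rule INF_lower2[OF mech_estimator], rule SUP_least)
 fix P assume P: "P \<in> dist_class \<J> \<alpha> K M0 M d"
 have sP: "sets P = sets (vec_space d)" using P by (auto simp: dist_class_def space_prob_algebra)
 have E: "0 \<le> ?E" by (intro add_nonneg_nonneg) auto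
 have d: "real d > 0" using k by simp
 have "frobenius_risk n d mech P \<le> ennreal (3 * real k * real d * ?E) + (\<Sum>i<d. ennreal B)"
  unfolding frobenius_risk_mech[OF sP] by (intro add_mono band_risk[OF P K \<tau>_eq \<kappa>] sum_mono rows[OF P]) auto
 also have "... = ennreal (real d * (3 * real k * ?E + B))"
 proof -
  have "(\<Sum>i<d. ennreal B) = ennreal (real d * B)" using B by (simp add: ennreal_mult ennreal_of_nat_eq_real_of_nat)
  then have "ennreal (3 * real k * real d * ?E) + (\<Sum>i<d. ennreal B) = ennreal (3 * real k * real d * ?E + real d * B)"
   using B E by (subst ennreal_plus) auto
  then show ?thesis by (simp only: distrib_left mult_ac)
 qed
 finally have "ennreal (1 / real d) * frobenius_risk n d mech P \<le> ennreal (1 / real d) * ennreal (real d * (3 * real k * ?E + B))"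
  by (rule mult_left_mono) simp
 also have "... = ennreal (1 / real d * (real d * (3 * real k * ?E + B)))"
  using B E by (intro ennreal_mult[symmetric]) (auto intro!: mult_nonneg_nonneg add_nonneg_nonneg)
 also have "1 / real d * (real d * (3 * real k * ?E + B)) = 3 * real k * ?E + B" using d by simp
 finally show "ennreal (1 / real d) * frobenius_risk n d mech P \<le> ennreal (3 * real k * ?E + B)" .
qed

lemma half_ge_third: "n \<ge> 2 ==> real n / 3 \<le> real (n div 2)"
proof -
 assume "n \<ge> 2"
 then have "n \<le> 3 * (n div 2)" by linarith
 then have "real n \<le> real (3 * (n div 2))" by (simp only: of_nat_le_iff)
 then show ?thesis by simp
qed

text \<open>
 The truncation bias \<open>k * exp (- k / c)\<close> is the only term not yet in the form of the rate.  If \<open>k = d\<close> the condition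
 \<open>c * ln n \<le> d\<close> of the regime makes it at most \<open>k / n\<close>, otherwise it is smaller than any power of \<open>k\<close>.
\<close>

lemma band_error_le_rate:
 fixes n d k :: nat and \<alpha> \<rho> c t0 t1 :: real
 assumes \<alpha>: "\<alpha> > 0" and n: "n \<ge> 2" and k: "k \<ge> 1" "k \<le> d" and \<rho>: "\<rho> > 0" and c: "c > 0" and dn: "c * ln (real n) \<le> real d"
  and main: "real k / real n + (real k)^2 * real d / (\<rho> * (real n)^2) \<le> L"
  and tail: "k = d \<or> real k powr (- (2 * \<alpha> + 1)) \<le> 2 powr (2 * \<alpha> + 1) * L"
  and v: "v^2 = 24 * (t1 * real k)^2 * real d / (real k * (real (n div 2))^2 * \<rho>)"
 shows "3 * real k * (4 * t0^2 / real (n div 2) + 16 * t0^2 * exp (- (1 / c * real k)) + v^2)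
  \<le> (36 * t0^2 + 48 * t0^2 * (1 + ((2 * \<alpha> + 2) * c) powr (2 * \<alpha> + 2) * 2 powr (2 * \<alpha> + 1)) + 648 * t1^2) * L"
proof -
 let ?N = "real (n div 2)" and ?Cp = "((2 * \<alpha> + 2) * c) powr (2 * \<alpha> + 2)"
 have N: "real n / 3 \<le> ?N" by (rule half_ge_third[OF n])
 have n0: "real n > 0" and k0: "real k > 0" and d0: "real d > 0" using n k by auto
 have N0: "?N > 0" using N n0 by linarith
 have kn: "real k / real n \<le> L" and kt: "(real k)^2 * real d / (\<rho> * (real n)^2) \<le> L" and L: "0 \<le> L"
 proof -
  have "0 \<le> real k / real n" "0 \<le> (real k)^2 * real d / (\<rho> * (real n)^2)" using \<rho> by auto
  with main show "real k / real n \<le> L" "(real k)^2 * real d / (\<rho> * (real n)^2) \<le> L" "0 \<le> L" by linarith+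
 qed
 have "real k / ?N \<le> real k / (real n / 3)" using N n0 k0 by (intro divide_left_mono) auto
 also have "... = 3 * (real k / real n)" by simp
 finally have 1: "real k / ?N \<le> 3 * L" using kn by linarith
 have 2: "real k * exp (- (1 / c * real k)) \<le> (1 + ?Cp * 2 powr (2 * \<alpha> + 1)) * L"
 proof (cases "k = d")
  case True
  have "ln (real n) \<le> 1 / c * real k" using dn c True by (simp add: field_simps)
  then have "exp (- (1 / c * real k)) \<le> exp (- ln (real n))" by simp
  also have "... = 1 / real n" using n0 by (simp add: exp_minus inverse_eq_divide)
  finally have "real k * exp (- (1 / c * real k)) \<le> real k * (1 / real n)" by (intro mult_left_mono) auto
  also have "... \<le> 1 * L" using kn by simp
  also have "... \<le> (1 + ?Cp * 2 powr (2 * \<alpha> + 1)) * L" using L by (intro mult_right_mono) auto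
  finally show ?thesis .
 next
  case False
  have "real k * exp (- (1 / c * real k)) = real k powr (- (2 * \<alpha> + 1)) * (real k powr (2 * \<alpha> + 2) * exp (- (1 / c * real k)))"
   using k0 by (simp add: mult.assoc[symmetric] powr_add[symmetric])
  also have "... \<le> (2 powr (2 * \<alpha> + 1) * L) * ?Cp"
   using tail False powr_le_exp[OF k0, of "2 * \<alpha> + 2" "1 / c"] \<alpha> c L by (intro mult_mono) auto
  also have "... \<le> (1 + ?Cp * 2 powr (2 * \<alpha> + 1)) * L" using L by (simp add: algebra_simps)
  finally show ?thesis .
 qed
 have 3: "real k * v^2 \<le> 216 * t1^2 * L"
 proof -
  have sq: "(real n / 3)^2 \<le> ?N^2" using N by (intro power_mono) auto
  have "real k * v^2 = 24 * t1^2 * ((real k)^2 * real d / (\<rho> * ?N^2))"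
   unfolding v using k0 N0 \<rho> by (simp add: power2_eq_square field_simps)
  also have "... \<le> 24 * t1^2 * ((real k)^2 * real d / (\<rho> * (real n / 3)^2))"
   using sq \<rho> n0 N0 by (intro mult_left_mono divide_left_mono mult_pos_pos zero_less_power) auto
  also have "(real k)^2 * real d / (\<rho> * (real n / 3)^2) = 9 * ((real k)^2 * real d / (\<rho> * (real n)^2))"
   by (simp add: power_divide)
  also have "24 * t1^2 * (9 * ((real k)^2 * real d / (\<rho> * (real n)^2))) \<le> 24 * t1^2 * (9 * L)"
   using kt by (intro mult_left_mono) auto
  finally show ?thesis by simp
 qed
 have "3 * real k * (4 * t0^2 / ?N + 16 * t0^2 * exp (- (1 / c * real k)) + v^2)
  = 12 * t0^2 * (real k / ?N) + 48 * t0^2 * (real k * exp (- (1 / c * real k))) + 3 * (real k * v^2)"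
  by (simp add: algebra_simps)
 also have "... \<le> 12 * t0^2 * (3 * L) + 48 * t0^2 * ((1 + ?Cp * 2 powr (2 * \<alpha> + 1)) * L) + 3 * (216 * t1^2 * L)"
  using 1 2 3 by (intro add_mono mult_left_mono) auto
 also have "... = (36 * t0^2 + 48 * t0^2 * (1 + ?Cp * 2 powr (2 * \<alpha> + 1)) + 648 * t1^2) * L"
  by (simp add: algebra_simps)
 finally show ?thesis .
qed

text \<open>
 The constant of \<open>band_error_le_rate\<close> with \<open>t0 = 8 * K^2\<close> and with the truncation level \<open>\<tau> = t1 * k\<close> that corresponds to
 \<open>\<kappa> = 1 / c\<close> in \<open>band_mse\<close>.
\<close>

definition upper_const :: "real => real => real => real" where
 "upper_const \<alpha> K c = 36 * (8 * K^2)^2 + 48 * (8 * K^2)^2 * (1 + ((2 * \<alpha> + 2) * c) powr (2 * \<alpha> + 2) * 2 powr (2 * \<alpha> + 1))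
  + 648 * (4 * (8 * K^2) / 3 * (1 + 1 / c))^2"

lemma upper_const_nonneg: "0 \<le> upper_const \<alpha> K c"
 unfolding upper_const_def by (intro add_nonneg_nonneg mult_nonneg_nonneg) auto

lemma upper_bound_with_rows:
 fixes n d k s :: nat and \<alpha> K M0 M c \<rho> b r \<eta> B L :: real
 assumes \<alpha>: "\<alpha> > 0" and K: "K > 0" and c: "c > 0" and n: "n \<ge> 2" and k: "k \<ge> 1" "k \<le> d" and \<rho>: "\<rho> > 0"
  and dn: "c * ln (real n) \<le> real d"
  and main: "real k / real n + (real k)^2 * real d / (\<rho> * (real n)^2) \<le> L"
  and tail: "k = d \<or> real k powr (- (2 * \<alpha> + 1)) \<le> 2 powr (2 * \<alpha> + 1) * L"
  and b: "b > 0" and \<eta>: "\<eta> > 0" and steps: "real d * real s * (4 * \<eta> * b^2 / real (n div 2))^2 \<le> \<rho>" and B: "B \<ge> 0"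
  and rows: "\<And>\<tau> v P i. mechanism n d k s \<tau> b v \<eta> \<rho> ==> P \<in> dist_class \<J> \<alpha> K M0 M d ==> i < d ==>
   (\<integral>\<^sup>+S. ennreal (mechanism.row_risk n d k s b r \<eta> (cov_mat d P) i S) \<partial>PiM {..<n} (\<lambda>_. P)) \<le> ennreal B"
 shows "minimax_risk \<J> \<alpha> K M0 M n d \<rho> \<le> ennreal (upper_const \<alpha> K c * L + B)"
proof -
 define t1 where "t1 = 4 * (8 * K^2) / 3 * (1 + 1 / c)"
 define \<tau> where "\<tau> = t1 * real k"
 have t1: "t1 > 0" unfolding t1_def using K c by (intro mult_pos_pos add_pos_pos) auto
 have N: "real (n div 2) > 0" using n by (simp add: div_greater_zero_iff)
 define w where "w = 24 * \<tau>^2 * real d / (real k * (real (n div 2))^2 * \<rho>)"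
 have w: "w > 0" unfolding w_def \<tau>_def using t1 k N \<rho> by (intro divide_pos_pos mult_pos_pos) auto
 define v where "v = sqrt w"
 have v2: "v^2 = w" using w by (simp add: v_def)
 have mech: "mechanism n d k s \<tau> b v \<eta> \<rho>"
 proof
  show "24 * \<tau>^2 * real d / (real k * (real (n div 2))^2) \<le> \<rho> * v^2"
   unfolding v2 w_def using \<rho> by simp
 qed (use k n b \<eta> \<rho> steps w t1 in \<open>auto simp: v_def \<tau>_def\<close>)
 interpret mechanism n d k s \<tau> b v r \<eta> \<rho> by (rule mech)
 have "minimax_risk \<J> \<alpha> K M0 M n d \<rho>
  \<le> ennreal (3 * real k * (4 * (8 * K^2)^2 / real (n div 2) + 16 * (8 * K^2)^2 * exp (- (1 / c * real k)) + v^2) + B)"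
  by (rule minimax_risk_le[OF K _ _ rows[OF mech] B]) (use c in \<open>auto simp: \<tau>_def t1_def\<close>)
 also have "... \<le> ennreal (upper_const \<alpha> K c * L + B)"
  unfolding upper_const_def t1_def[symmetric]
  by (intro ennreal_leI add_right_mono band_error_le_rate[OF \<alpha> n k \<rho> c dn main tail]) (simp add: v2 w_def \<tau>_def)
 finally show ?thesis .
qed

lemma pointwise_upper_bound:
 fixes n d :: nat and \<alpha> K M0 M c \<rho> :: real
 assumes par: "\<alpha> > 0" "K > 0" "M > 0" and c: "c > 0" and n: "n \<ge> 2" and d: "d \<ge> 1" and \<rho>: "\<rho> > 0"
  and dn: "c * ln (real n) \<le> real d" and T: "1 \<le> \<rho> * (real n)^2 / real d"
 shows "minimax_risk pointwise_class \<alpha> K M0 M n d \<rho>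
  \<le> ennreal (upper_const \<alpha> K c + 2 * M^2 * 2 powr (2 * \<alpha> + 1)) * minimax_rate \<alpha> n d \<rho>"
proof -
 let ?L = "rate \<alpha> n d \<rho>" let ?B = "2 * M^2 * (2 powr (2 * \<alpha> + 1) * ?L)"
 have L: "0 \<le> ?L" by (rule rate_nonneg[OF \<rho>])
 obtain k where k: "1 \<le> k" "k \<le> d"
  and main: "real k / real n + (real k)^2 * real d / (\<rho> * (real n)^2) \<le> ?L"
  and tail: "k = d \<or> real k powr (- (2 * \<alpha> + 1)) \<le> 2 powr (2 * \<alpha> + 1) * ?L"
  by (rule bandwidth[OF par(1) _ d \<rho> T]) (use n in auto)
 have "minimax_risk pointwise_class \<alpha> K M0 M n d \<rho> \<le> ennreal (upper_const \<alpha> K c * ?L + ?B)"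
 proof (rule upper_bound_with_rows[OF par(1,2) c n k \<rho> dn main tail, where b = 1 and \<eta> = 1 and s = 0 and r = 0])
  fix \<tau> v P i assume m: "mechanism n d k 0 \<tau> 1 v 1 \<rho>" and P: "P \<in> dist_class pointwise_class \<alpha> K M0 M d" and i: "i < d"
  interpret mechanism n d k 0 \<tau> 1 v 0 1 \<rho> by (rule m)
  interpret PM: prob_space "PiM {..<n} (\<lambda>_. P)"
   using P by (intro prob_space_PiM) (auto simp: dist_class_def space_prob_algebra)
  have C: "cov_mat d P \<in> pointwise_class \<alpha> M0 M d" using P by (simp add: dist_class_def)
  have "(\<Sum>j\<in>offband d k i. (cov_mat d P (i, j))^2) \<le> ?B"
  proof (cases "k = d")
   case True
   then show ?thesis using i L by (simp add: offband_full)
  next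
   case False
   then show ?thesis
    using pointwise_tail[OF C par(1,3) k(1) i] tail by (meson mult_left_mono order_trans zero_le_power2 mult_nonneg_nonneg zero_le_numeral)
  qed
  then show "(\<integral>\<^sup>+S. ennreal (row_risk (cov_mat d P) i S) \<partial>PiM {..<n} (\<lambda>_. P)) \<le> ennreal ?B"
   by (simp add: row_risk_no_steps PM.emeasure_space_1 ennreal_leI)
 qed (use \<rho> L in auto)
 also have "upper_const \<alpha> K c * ?L + ?B = (upper_const \<alpha> K c + 2 * M^2 * 2 powr (2 * \<alpha> + 1)) * ?L" by (simp add: algebra_simps)
 also have "ennreal ... = ennreal (upper_const \<alpha> K c + 2 * M^2 * 2 powr (2 * \<alpha> + 1)) * minimax_rate \<alpha> n d \<rho>"
  unfolding minimax_rate_eq using upper_const_nonneg L by (intro ennreal_mult add_nonneg_nonneg) auto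
 finally show ?thesis .
qed

text \<open>
 By the choice of \<open>k\<close>, each of \<open>n powr (- 1 / 2)\<close> and \<open>sqrt (k * d / (\<rho> * n^2))\<close> is at most \<open>k powr (- (\<alpha> + 1))\<close>.  They are the statistical
 error and the error \<open>1 / \<eta>\<close> of the exponential mechanism, up to logarithms.  The truncation level \<open>b2\<close> makes the truncation bias as small.
\<close>

lemma frank_wolfe_error:
 fixes n d k :: nat and \<alpha> M t0 \<rho> \<Lambda> b2 \<eta> :: real
 assumes \<alpha>: "\<alpha> > 0" and M: "M > 0" and t0: "t0 > 0" and n: "n \<ge> 2" and k: "k \<ge> 1" and d: "d \<ge> 1" and \<rho>: "\<rho> > 0"
  and k1: "real k powr (2 * \<alpha> + 2) \<le> real n" and k2: "real k powr (2 * \<alpha> + 3) \<le> \<rho> * (real n)^2 / real d"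
  and \<Lambda>: "1 + ln (real n) \<le> \<Lambda>" "ln (2 * real d) + 1 \<le> \<Lambda>"
 defines "b2 \<equiv> t0 * (1 + ln (real n))"
 defines "\<eta> \<equiv> real (n div 2) * sqrt (\<rho> / (real d * real k)) / (4 * b2)"
 shows "4 * (M * real k powr (- \<alpha>))^2 / real k + M * real k powr (- \<alpha>) * (2 * (4 * t0 * exp (- (b2 / (2 * t0))) + b2 * (ln (2 * real d) + 1) / sqrt (real (n div 2))) + ln (2 * real d) / \<eta>)
  \<le> (4 * M^2 + 24 * M * t0) * \<Lambda>^2 * real k powr (- (2 * \<alpha> + 1))"
proof -
 let ?N = "real (n div 2)" let ?h = "real k powr (- (\<alpha> + 1))" let ?l = "ln (2 * real d)"
 have N: "real n / 3 \<le> ?N" by (rule half_ge_third[OF n])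
 have n0: "real n > 0" and k0: "real k > 0" and d0: "real d > 0" and lnn: "0 \<le> ln (real n)" and l0: "0 \<le> ?l" using n k d by auto
 have N0: "?N > 0" using N n0 by linarith
 have \<Lambda>1: "1 \<le> \<Lambda>" using \<Lambda> lnn by linarith
 have b2: "0 < b2" "b2 \<le> t0 * \<Lambda>" unfolding b2_def using t0 lnn \<Lambda> by (auto intro!: mult_pos_pos mult_left_mono)
 have hsq: "?h^2 = 1 / real k powr (2 * \<alpha> + 2)"
 proof -
  have "?h^2 = real k powr (- (2 * \<alpha> + 2))" using k0 by (simp add: power2_eq_square powr_add[symmetric])
  then show ?thesis by (simp only: powr_minus_divide)
 qed
 have h0: "0 \<le> ?h" by simp
 have hn: "1 / real n \<le> ?h^2" unfolding hsq using k1 k0 n0 by (intro divide_left_mono mult_pos_pos) auto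
 have e1: "exp (- (b2 / (2 * t0))) \<le> ?h"
 proof (rule power2_le_imp_le[OF _ h0])
  have "(exp (- (b2 / (2 * t0))))^2 = exp (- (1 + ln (real n)))"
   using t0 by (simp add: b2_def power2_eq_square exp_add[symmetric])
  also have "... \<le> exp (- ln (real n))" by simp
  also have "... = 1 / real n" using n0 by (simp add: exp_minus inverse_eq_divide)
  finally show "(exp (- (b2 / (2 * t0))))^2 \<le> ?h^2" using hn by linarith
 qed
 have e2: "1 / sqrt ?N \<le> 2 * ?h"
 proof (rule power2_le_imp_le)
  have "(1 / sqrt ?N)^2 = 1 / ?N" using N0 by (simp add: power_divide)
  also have "... \<le> 1 / (real n / 3)" using N n0 N0 by (intro divide_left_mono) auto
  also have "... \<le> 4 * (1 / real n)" using n0 by (simp add: field_simps)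
  also have "... \<le> 4 * ?h^2" using hn by linarith
  finally show "(1 / sqrt ?N)^2 \<le> (2 * ?h)^2" by (simp add: power_mult_distrib)
 qed simp
 have e0: "0 \<le> 1 / \<eta>" using N0 \<rho> b2 by (simp add: \<eta>_def)
 have e3: "1 / \<eta> \<le> 12 * t0 * \<Lambda> * ?h"
 proof -
  have "sqrt (real d * real k / \<rho>) / ?N \<le> sqrt (real d * real k / \<rho>) / (real n / 3)"
   using N n0 N0 d0 k0 \<rho> by (intro divide_left_mono mult_pos_pos) auto
  also have "... = 3 * (sqrt (real d * real k / \<rho>) / real n)" by simp
  also have "sqrt (real d * real k / \<rho>) / real n \<le> ?h"
  proof (rule power2_le_imp_le[OF _ h0])
   have p: "real k powr (2 * \<alpha> + 3) = real k powr (2 * \<alpha> + 2) * real k"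
    using k0 powr_add[of "real k" "2 * \<alpha> + 2" 1] by (simp add: add.assoc)
   have "real k powr (2 * \<alpha> + 2) * real k * real d \<le> \<rho> * (real n)^2" using k2 d0 unfolding p by (simp add: pos_le_divide_eq)
   then have "real d * real k / (\<rho> * (real n)^2) \<le> 1 / real k powr (2 * \<alpha> + 2)"
    using k0 \<rho> n0 by (simp add: divide_le_eq le_divide_eq mult_ac)
   then show "(sqrt (real d * real k / \<rho>) / real n)^2 \<le> ?h^2"
    unfolding hsq using d0 k0 \<rho> by (simp add: power_divide mult_ac)
  qed
  finally have q: "sqrt (real d * real k / \<rho>) / ?N \<le> 3 * ?h" by simp
  have "1 / \<eta> = 4 * b2 * (sqrt (real d * real k / \<rho>) / ?N)"
   using N0 d0 k0 \<rho> b2 by (simp add: \<eta>_def real_sqrt_divide field_simps)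
  also have "... \<le> 4 * (t0 * \<Lambda>) * (3 * ?h)" using b2 q N0 d0 k0 \<rho> t0 \<Lambda>1 by (intro mult_mono) auto
  finally show ?thesis by simp
 qed
 have "2 * (4 * t0 * exp (- (b2 / (2 * t0))) + b2 * (?l + 1) / sqrt ?N) + ?l / \<eta>
  = 8 * t0 * exp (- (b2 / (2 * t0))) + 2 * (b2 * (?l + 1) * (1 / sqrt ?N)) + ?l * (1 / \<eta>)" by simp
 also have "... \<le> 8 * t0 * ?h + 2 * ((t0 * \<Lambda>) * \<Lambda> * (2 * ?h)) + \<Lambda> * (12 * t0 * \<Lambda> * ?h)"
  using e1 e2 e3 e0 b2 t0 \<Lambda> \<Lambda>1 l0 N0 by (intro add_mono mult_left_mono mult_mono) auto
 also have "... = (8 * t0 + 16 * t0 * \<Lambda>^2) * ?h" by (simp add: power2_eq_square algebra_simps)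
 also have "... \<le> (8 * t0 * \<Lambda>^2 + 16 * t0 * \<Lambda>^2) * ?h"
 proof (intro mult_right_mono add_right_mono)
  have "1 \<le> \<Lambda>^2" using \<Lambda>1 by simp
  then show "8 * t0 \<le> 8 * t0 * \<Lambda>^2" using t0 by simp
 qed simp
 finally have X: "2 * (4 * t0 * exp (- (b2 / (2 * t0))) + b2 * (?l + 1) / sqrt ?N) + ?l / \<eta> \<le> 24 * t0 * \<Lambda>^2 * ?h" by simp
 have "M * real k powr (- \<alpha>) * (2 * (4 * t0 * exp (- (b2 / (2 * t0))) + b2 * (?l + 1) / sqrt ?N) + ?l / \<eta>)
  \<le> M * real k powr (- \<alpha>) * (24 * t0 * \<Lambda>^2 * ?h)" using X M by (intro mult_left_mono) auto
 also have "... = 24 * M * t0 * \<Lambda>^2 * (real k powr (- \<alpha>) * ?h)" by simp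
 also have "real k powr (- \<alpha>) * ?h = real k powr (- (2 * \<alpha> + 1))" using k0 by (simp add: powr_add[symmetric])
 finally have Y: "M * real k powr (- \<alpha>) * (2 * (4 * t0 * exp (- (b2 / (2 * t0))) + b2 * (?l + 1) / sqrt ?N) + ?l / \<eta>)
  \<le> 24 * M * t0 * \<Lambda>^2 * real k powr (- (2 * \<alpha> + 1))" .
 have "4 * (M * real k powr (- \<alpha>))^2 / real k = 4 * M^2 * real k powr (- (2 * \<alpha> + 1))"
 proof -
  have "real k powr (- (2 * \<alpha> + 1)) = (real k powr (- \<alpha>))^2 / real k"
   using k0 powr_diff[of "real k" "- \<alpha> + - \<alpha>" 1] by (simp add: power2_eq_square powr_add[symmetric])
  then show ?thesis by (simp add: power_mult_distrib)
 qed
 also have "... \<le> 4 * M^2 * \<Lambda>^2 * real k powr (- (2 * \<alpha> + 1))"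
 proof (rule mult_right_mono)
  have "1 \<le> \<Lambda>^2" using \<Lambda>1 by simp
  then show "4 * M^2 \<le> 4 * M^2 * \<Lambda>^2" using mult_left_mono[of 1 "\<Lambda>^2" "4 * M^2"] by simp
 qed simp
 finally show ?thesis using Y by (simp add: distrib_right)
qed

text \<open>
 With \<open>s = k\<close> steps the inverse temperature \<open>\<eta>\<close> is the largest one that the privacy budget \<open>steps\<close> permits.
\<close>

lemma row_tail_upper_bound:
 fixes n d :: nat and \<alpha> K M0 M c \<rho> \<Lambda> :: real
 assumes par: "\<alpha> > 0" "K > 0" "M > 0" and c: "c > 0" and n: "n \<ge> 2" and d: "d \<ge> 1" and \<rho>: "\<rho> > 0"
  and dn: "c * ln (real n) \<le> real d" and T: "1 \<le> \<rho> * (real n)^2 / real d"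
  and \<Lambda>: "1 + ln (real n) \<le> \<Lambda>" "ln (2 * real d) + 1 \<le> \<Lambda>"
 shows "minimax_risk row_tail_class \<alpha> K M0 M n d \<rho>
  \<le> ennreal ((upper_const \<alpha> K c + (4 * M^2 + 24 * M * (8 * K^2)) * 2 powr (2 * \<alpha> + 1)) * \<Lambda>^2) * minimax_rate \<alpha> n d \<rho>"
proof -
 let ?L = "rate \<alpha> n d \<rho>" let ?D = "(4 * M^2 + 24 * M * (8 * K^2)) * \<Lambda>^2" let ?B = "?D * (2 powr (2 * \<alpha> + 1) * ?L)"
 have L: "0 \<le> ?L" by (rule rate_nonneg[OF \<rho>])
 have D: "0 \<le> ?D" using par by simp
 have "0 \<le> ln (real n)" using n by simp
 then have b2: "0 < 8 * K^2 * (1 + ln (real n))" and \<Lambda>1: "1 \<le> \<Lambda>" using par \<Lambda> by (auto intro!: mult_pos_pos)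
 obtain k where k: "1 \<le> k" "k \<le> d" and k12: "real k powr (2 * \<alpha> + 2) \<le> real n" "real k powr (2 * \<alpha> + 3) \<le> \<rho> * (real n)^2 / real d"
  and main: "real k / real n + (real k)^2 * real d / (\<rho> * (real n)^2) \<le> ?L"
  and tail: "k = d \<or> real k powr (- (2 * \<alpha> + 1)) \<le> 2 powr (2 * \<alpha> + 1) * ?L"
  by (rule bandwidth[OF par(1) _ d \<rho> T]) (use n in auto)
 define b where "b = sqrt (8 * K^2 * (1 + ln (real n)))"
 define \<eta> where "\<eta> = real (n div 2) * sqrt (\<rho> / (real d * real k)) / (4 * (8 * K^2 * (1 + ln (real n))))"
 define r where "r = M * real k powr (- \<alpha>)"
 have bb: "b > 0" "b^2 = 8 * K^2 * (1 + ln (real n))" using b2 by (auto simp: b_def)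
 have N: "real (n div 2) > 0" using n by (simp add: div_greater_zero_iff)
 have dk: "real d * real k > 0" using k by simp
 have \<eta>: "\<eta> > 0" unfolding \<eta>_def bb(2)[symmetric] using N \<rho> dk bb(1) by (intro divide_pos_pos mult_pos_pos) auto
 have "4 * \<eta> * b^2 / real (n div 2) = sqrt (\<rho> / (real d * real k))"
  unfolding \<eta>_def bb(2)[symmetric] using bb(1) N by simp
 then have "real d * real k * (4 * \<eta> * b^2 / real (n div 2))^2 = \<rho>" using dk \<rho> k by simp
 then have steps: "real d * real k * (4 * \<eta> * b^2 / real (n div 2))^2 \<le> \<rho>" by simp
 have "minimax_risk row_tail_class \<alpha> K M0 M n d \<rho> \<le> ennreal (upper_const \<alpha> K c * ?L + ?B)"
 proof (rule upper_bound_with_rows[OF par(1,2) c n k \<rho> dn main tail bb(1) \<eta> steps, where r = r])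
  fix \<tau> v P i assume m: "mechanism n d k k \<tau> b v \<eta> \<rho>" and P: "P \<in> dist_class row_tail_class \<alpha> K M0 M d" and i: "i < d"
  interpret mechanism n d k k \<tau> b v r \<eta> \<rho> by (rule m)
  have C: "cov_mat d P \<in> row_tail_class \<alpha> M0 M d" using P by (simp add: dist_class_def)
  have r: "0 \<le> r" "(\<Sum>j\<in>offband d k i. \<bar>cov_mat d P (i, j)\<bar>) \<le> r"
   using row_tail_offband[OF C k(1) i] par by (auto simp: r_def)
  show "(\<integral>\<^sup>+S. ennreal (row_risk (cov_mat d P) i S) \<partial>PiM {..<n} (\<lambda>_. P)) \<le> ennreal ?B"
  proof (cases "k = d")
   case True
   then have "offband d k i = {}" using i by (simp add: offband_full)
   then show ?thesis by (simp add: row_risk_def row_loss_def)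
  next
   case False
   have "4 * r^2 / real k + r * (2 * (4 * (8 * K^2) * exp (- (b^2 / (2 * (8 * K^2)))) + b^2 * (ln (2 * real d) + 1) / sqrt (real N)) + ln (2 * real d) / \<eta>)
    \<le> ?D * real k powr (- (2 * \<alpha> + 1))"
    using frank_wolfe_error[OF par(1,3) _ n k(1) d \<rho> k12 \<Lambda>, of "8 * K^2"] par(2) unfolding r_def bb(2) \<eta>_def by simp
   also have "... \<le> ?B" using tail False D by (intro mult_left_mono) auto
   finally show ?thesis
    by (intro order_trans[OF row_risk_frank_wolfe[OF P par(2) i k(1) r]] ennreal_leI)
  qed
 qed (use D L in auto)
 also have "upper_const \<alpha> K c * ?L + ?B \<le> ((upper_const \<alpha> K c + (4 * M^2 + 24 * M * (8 * K^2)) * 2 powr (2 * \<alpha> + 1)) * \<Lambda>^2) * ?L"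
 proof -
  have "upper_const \<alpha> K c * ?L * 1 \<le> upper_const \<alpha> K c * ?L * \<Lambda>^2"
   using upper_const_nonneg L \<Lambda>1 by (intro mult_left_mono) auto
  then show ?thesis by (simp add: algebra_simps)
 qed
 also have "ennreal (((upper_const \<alpha> K c + (4 * M^2 + 24 * M * (8 * K^2)) * 2 powr (2 * \<alpha> + 1)) * \<Lambda>^2) * ?L)
  = ennreal ((upper_const \<alpha> K c + (4 * M^2 + 24 * M * (8 * K^2)) * 2 powr (2 * \<alpha> + 1)) * \<Lambda>^2) * minimax_rate \<alpha> n d \<rho>"
  unfolding minimax_rate_eq using upper_const_nonneg L par by (intro ennreal_mult add_nonneg_nonneg mult_nonneg_nonneg) auto
 finally show ?thesis by (simp add: ennreal_leI)
qed

lemma pointwise_upper_rate: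
 assumes par: "\<alpha> > 0" "K > 0" "M > 0" and c: "c > 0"
 shows "lesssim c R (minimax_risk pointwise_class \<alpha> K M0 M) (minimax_rate \<alpha>)"
 unfolding lesssim_def
proof (intro exI conjI allI impI)
 show "0 < upper_const \<alpha> K c + 2 * M^2 * 2 powr (2 * \<alpha> + 1)"
  using upper_const_nonneg par by (intro add_nonneg_pos mult_pos_pos) auto
 fix d \<rho> assume reg: "regime c R d \<rho>"
 note L = regime_eventually_large[OF reg c]
 show "\<forall>\<^sub>F n in sequentially. minimax_risk pointwise_class \<alpha> K M0 M n (d n) (\<rho> n)
  \<le> ennreal (upper_const \<alpha> K c + 2 * M^2 * 2 powr (2 * \<alpha> + 1)) * minimax_rate \<alpha> n (d n) (\<rho> n)"
  using L(1)[of 2] L(2)[of 1] L(3,4) L(5)[of 1]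
  by eventually_elim (intro pointwise_upper_bound par c; simp)
qed

text \<open>
 The logarithms of \<open>n\<close> and \<open>d\<close> are separately bounded by the logarithmic factor, because \<open>n / \<rho>\<close> and \<open>d / \<rho>\<close> are eventually bounded below.
\<close>

lemma log_factor:
 fixes n d :: nat and \<rho> R :: real
 assumes n: "max 2 (2 * R) \<le> real n" and d: "max 1 R \<le> real d" and \<rho>: "0 < \<rho>" "\<rho> \<le> R"
 shows "1 + ln (real n) \<le> ln (exp 1 * real d * real n / \<rho>)" "ln (2 * real d) + 1 \<le> ln (exp 1 * real d * real n / \<rho>)"
proof -
 have n0: "real n > 0" and d0: "real d > 0" using n d by auto
 have "1 + ln (real n) = ln (exp 1 * real n)" using n0 by (simp add: ln_mult)
 also have "... \<le> ln (exp 1 * real d * real n / \<rho>)"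
  using n0 d d0 \<rho> by (subst ln_le_cancel_iff) (auto simp: pos_le_divide_eq)
 finally show "1 + ln (real n) \<le> ln (exp 1 * real d * real n / \<rho>)" .
 have "ln (2 * real d) + 1 = ln (exp 1 * (2 * real d))" using d0 by (simp add: ln_mult)
 also have "... \<le> ln (exp 1 * real d * real n / \<rho>)"
  using n0 n d0 \<rho> by (subst ln_le_cancel_iff) (auto simp: pos_le_divide_eq)
 finally show "ln (2 * real d) + 1 \<le> ln (exp 1 * real d * real n / \<rho>)" .
qed

lemma row_tail_upper_rate:
 assumes par: "\<alpha> > 0" "K > 0" "M > 0" and c: "c > 0"
 shows "lesssim_log c R (minimax_risk row_tail_class \<alpha> K M0 M) (minimax_rate \<alpha>)"
 unfolding lesssim_log_def
proof (intro exI conjI allI impI)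
 let ?C = "upper_const \<alpha> K c + (4 * M^2 + 24 * M * (8 * K^2)) * 2 powr (2 * \<alpha> + 1)"
 show "0 < ?C"
  using upper_const_nonneg par by (intro add_nonneg_pos mult_pos_pos add_pos_pos) auto
 show "0 < (2 :: real)" by simp
 fix d \<rho> assume reg: "regime c R d \<rho>"
 note L = regime_eventually_large[OF reg c]
 show "\<forall>\<^sub>F n in sequentially. minimax_risk row_tail_class \<alpha> K M0 M n (d n) (\<rho> n)
  \<le> ennreal (?C * ln (exp 1 * real (d n) * real n / \<rho> n) powr 2) * minimax_rate \<alpha> n (d n) (\<rho> n)"
  using L(1)[of "max 2 (2 * R)"] L(2)[of "max 1 R"] L(3,4) L(5)[of 1]
 proof eventually_elim
  case (elim n)
  note \<Lambda> = log_factor[OF elim(1,2), of "\<rho> n"]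
  have "0 < ln (exp 1 * real (d n) * real n / \<rho> n)"
   using \<Lambda>(1) elim(1,3) ln_ge_zero[of "real n"] by linarith
  then have "ln (exp 1 * real (d n) * real n / \<rho> n) powr 2 = (ln (exp 1 * real (d n) * real n / \<rho> n))^2" by simp
  then show ?case
   using row_tail_upper_bound[OF par c _ _ _ elim(4,5) \<Lambda>] elim by simp
 qed
qed

lemma lesssim_imp_lesssim_log:
 assumes ab: "lesssim c R a b" and c: "c > 0"
 shows "lesssim_log c R a b"
proof -
 obtain C where C: "C > 0"
  "\<And>d \<rho>. regime c R d \<rho> ==> \<forall>\<^sub>F n in sequentially. a n (d n) (\<rho> n) \<le> ennreal C * b n (d n) (\<rho> n)"
  using ab by (auto simp: lesssim_def)
 have "\<forall>\<^sub>F n in sequentially. a n (d n) (\<rho> n) \<le> ennreal (C * ln (exp 1 * real (d n) * real n / \<rho> n) powr 1) * b n (d n) (\<rho> n)"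
  if reg: "regime c R d \<rho>" for d \<rho>
  using C(2)[OF reg] regime_eventually_large(1)[OF reg c, of "max 2 (2 * R)"]
   regime_eventually_large(2)[OF reg c, of "max 1 R"] regime_eventually_large(3)[OF reg c]
 proof eventually_elim
  case (elim n)
  have \<Lambda>: "1 \<le> ln (exp 1 * real (d n) * real n / \<rho> n)"
   using log_factor(1)[OF elim(2,3), of "\<rho> n"] elim(2,4) ln_ge_zero[of "real n"] by linarith
  have "ennreal C \<le> ennreal (C * ln (exp 1 * real (d n) * real n / \<rho> n) powr 1)"
   using \<Lambda> C(1) by (intro ennreal_leI) simp
  then show ?case using elim(1) by (meson mult_right_mono order_trans zero_le)
 qed
 then show ?thesis unfolding lesssim_log_def using C(1) by (intro exI[of _ C] conjI exI[of _ "1::real"]) auto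
qed

section \<open>The minimax rate\<close>

theorem theorem2p7:
 fixes \<alpha> K M0 M c R :: real
 assumes "\<alpha> > 0" "K > 0" "M0 > 0" "M > 0"
  and "c > 0" "R > 0"
 shows "(\<forall>\<J>\<in>{row_tail_class, pointwise_class}.
      asymp_eq_log c R (minimax_risk \<J> \<alpha> K M0 M) (minimax_rate \<alpha>)) \<and>
    asymp_eq c R (minimax_risk pointwise_class \<alpha> K M0 M) (minimax_rate \<alpha>)"
proof -
 have lower: "lesssim c R (minimax_rate \<alpha>) (minimax_risk \<J> \<alpha> K M0 M)" if "\<J> \<in> {row_tail_class, pointwise_class}" for \<J>
  using minimax_lower_bound[OF assms that] .
 have H: "lesssim c R (minimax_risk pointwise_class \<alpha> K M0 M) (minimax_rate \<alpha>)"
  by (intro pointwise_upper_rate assms)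
 have G: "lesssim_log c R (minimax_risk row_tail_class \<alpha> K M0 M) (minimax_rate \<alpha>)"
  by (intro row_tail_upper_rate assms)
 show ?thesis
  unfolding asymp_eq_log_def asymp_eq_def
  using lower H G lesssim_imp_lesssim_log[OF _ assms(5)] by auto
qed

end
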